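(* Let $\Lambda$ be a finite, locally convex $k$-graph. Then $sr(C^*(\Lambda))=1$ if and only if $\Lambda$ has no cycle with an entrance and no initial cycle with more than one colour.
   Context: A $k$-graph ($k\ge1$) is a nonempty countable small category $\Lambda$ with a functor $d:\Lambda\to\mathbb{N}^k$ such that whenever $d(\lambda)=m+n$ there are unique $\mu,\nu\in\Lambda$ with $d(\mu)=m$, $d(\nu)=n$, $\lambda=\mu\nu$. $\Lambda^n:=d^{-1}(n)$; $\Lambda^0$ (the vertices) is identified with the objects; $r(\lambda),s(\lambda)$ are the codomain and domain of $\lambda$; $e_1,\dots,e_k$ are the generators of $\mathbb{N}^k$. For $v\in\Lambda^0$, $E\subseteq\Lambda$: $vE=\{\nu\in E: r(\nu)=v\}$. For $n\in\mathbb{N}^k$, $\Lambda^{\le n}:=\{\lambda: d(\lambda)\le n,\ s(\lambda)\Lambda^{e_i}=\emptyset \text{ whenever } d(\lambda)+e_i\le n\}$. $\Lambda$ is finite if $|\Lambda^n|<\infty$ for all $n$; locally convex if for all $i\ne j$, $\lambda\in\Lambda^{e_i}$, $\mu\in\Lambda^{e_j}$ with $r(\lambda)=r(\mu)$, the sets $s(\lambda)\Lambda^{e_j}$ and $s(\mu)\Lambda^{e_i}$ are nonempty. For $m\le n\le d(\lambda)$, $\lambda(m,n)$ is the unique element of $\Lambda^{n-m}$ with $\lambda=\lambda'\lambda(m,n)\lambda''$ where $d(\lambda')=m$, $d(\lambda'')=d(\lambda)-n$. The same notation is used for (possibly infinite) paths of degree $m\in(\mathbb{N}\cup\{\infty\})^k$,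 i.e. degree-preserving functors $x:\{(p,q)\in\mathbb{N}^k\times\mathbb{N}^k:p\le q\le m\}\to\Lambda$ (where $(p,q)$ has range $p$, source $q$, degree $q-p$). $C^*(\Lambda)$ is the universal $C^*$-algebra generated by $\{s_\lambda:\lambda\in\Lambda\}$ subject to: the $s_v$, $v\in\Lambda^0$, are mutually orthogonal projections; $s_\mu s_\nu=s_{\mu\nu}$ if $s(\mu)=r(\nu)$; $s_\lambda^*s_\lambda=s_{s(\lambda)}$; $s_v=\sum_{\lambda\in v\Lambda^{\le n}}s_\lambda s_\lambda^*$ for all $v\in\Lambda^0$, $n\in\mathbb{N}^k$. It is unital here since $\Lambda^0$ is finite. A cycle is $\lambda\in\Lambda\setminus\Lambda^0$ with $r(\lambda)=s(\lambda)$; $\lambda^\infty=\lambda\lambda\lambda\cdots$ is the path with $d(\lambda^\infty)_i=\infty$ if $d(\lambda)_i>0$, $d(\lambda^\infty)_i=0$ if $d(\lambda)_i=0$, and $\lambda^\infty(n\,d(\lambda),(n+1)d(\lambda))=\lambda$ for all $n\in\mathbb{N}$. The cycle $\lambda$ has an entrance if there is $\tau\in r(\lambda)\Lambda$ with $d(\tau)\le d(\lambda^\infty)$ and $\tau\ne\lambda^\infty(0,d(\tau))$. For $\Lambda$ with no cycle with an entrance, an initial cycle is $\mu\in\Lambda$ (possibly a vertex) with $r(\mu)=s(\mu)$ and $r(\mu)\Lambda^{e_i}=\emptyset$ whenever $d(\mu)_i=0$. The number of colours of $\mu$ is $|\{i\le k:d(\mu)_i>0\}|$. Stable rank: for unital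 $A$, $Lg_n(A)=\{(x_i)\in A^n:\exists (y_i)\in A^n,\ \sum_i y_ix_i=1\}$, and $sr(A)$ is the smallest $n\ge1$ such that $Lg_n(A)$ is dense in $A^n$, or $\infty$ if there is none; $sr(A)=1$ iff the invertible elements are dense in $A$. *)

theory Defs
  imports
    "HOL-Analysis.Analysis"
    "HOL-Library.Poly_Mapping"
    "HOL-Library.Extended_Nat"
    "HOL-Algebra.Module"
begin

section \<open>Higher-rank graphs\<close>

text \<open>
  A small category is given by its morphisms only: each object is identified with its identity
  morphism, so \<open>rng\<close> (codomain) and \<open>src\<close> (domain) take values in \<open>mor\<close>. The product \<open>cmp G \<mu> \<nu>\<close>
  is the composite \<open>\<mu>\<nu>\<close>; it is meaningful only when \<open>src G \<mu> = rng G \<nu>\<close>.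
  The rank \<open>k \<ge> 1\<close> is the cardinality of the finite index type \<open>'k\<close>.
\<close>

record ('m, 'k) kgraph =
  mor :: "'m set"
  rng :: "'m \<Rightarrow> 'm"
  src :: "'m \<Rightarrow> 'm"
  cmp :: "'m \<Rightarrow> 'm \<Rightarrow> 'm"
  deg :: "'m \<Rightarrow> nat ^ 'k"

locale k_graph =
  fixes G :: "('m, 'k::finite) kgraph"
  assumes nonempty: "mor G \<noteq> {}"
    and countable: "countable (mor G)"
    and rng_closed: "\<alpha> \<in> mor G \<Longrightarrow> rng G \<alpha> \<in> mor G"
    and src_closed: "\<alpha> \<in> mor G \<Longrightarrow> src G \<alpha> \<in> mor G"
    and rng_rng: "\<alpha> \<in> mor G \<Longrightarrow> rng G (rng G \<alpha>) = rng G \<alpha>"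
    and src_rng: "\<alpha> \<in> mor G \<Longrightarrow> src G (rng G \<alpha>) = rng G \<alpha>"
    and rng_src: "\<alpha> \<in> mor G \<Longrightarrow> rng G (src G \<alpha>) = src G \<alpha>"
    and src_src: "\<alpha> \<in> mor G \<Longrightarrow> src G (src G \<alpha>) = src G \<alpha>"
    and cmp_closed: "\<lbrakk>\<mu> \<in> mor G; \<nu> \<in> mor G; src G \<mu> = rng G \<nu>\<rbrakk> \<Longrightarrow> cmp G \<mu> \<nu> \<in> mor G"
    and rng_cmp: "\<lbrakk>\<mu> \<in> mor G; \<nu> \<in> mor G; src G \<mu> = rng G \<nu>\<rbrakk> \<Longrightarrow> rng G (cmp G \<mu> \<nu>) = rng G \<mu>"
    and src_cmp: "\<lbrakk>\<mu> \<in> mor G; \<nu> \<in> mor G; src G \<mu> = rng G \<nu>\<rbrakk> \<Longrightarrow> src G (cmp G \<mu> \<nu>) = src G \<nu>"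
    and cmp_rng: "\<alpha> \<in> mor G \<Longrightarrow> cmp G (rng G \<alpha>) \<alpha> = \<alpha>"
    and cmp_src: "\<alpha> \<in> mor G \<Longrightarrow> cmp G \<alpha> (src G \<alpha>) = \<alpha>"
    and cmp_assoc: "\<lbrakk>\<alpha> \<in> mor G; \<mu> \<in> mor G; \<nu> \<in> mor G; src G \<alpha> = rng G \<mu>; src G \<mu> = rng G \<nu>\<rbrakk>
      \<Longrightarrow> cmp G (cmp G \<alpha> \<mu>) \<nu> = cmp G \<alpha> (cmp G \<mu> \<nu>)"
    and deg_rng: "\<alpha> \<in> mor G \<Longrightarrow> deg G (rng G \<alpha>) = 0"
    and deg_src: "\<alpha> \<in> mor G \<Longrightarrow> deg G (src G \<alpha>) = 0"
    and deg_cmp: "\<lbrakk>\<mu> \<in> mor G; \<nu> \<in> mor G; src G \<mu> = rng G \<nu>\<rbrakk>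
      \<Longrightarrow> deg G (cmp G \<mu> \<nu>) = deg G \<mu> + deg G \<nu>"
    and factorisation: "\<lbrakk>\<alpha> \<in> mor G; deg G \<alpha> = m + n\<rbrakk>
      \<Longrightarrow> \<exists>!(\<mu>, \<nu>). \<mu> \<in> mor G \<and> \<nu> \<in> mor G \<and> deg G \<mu> = m \<and> deg G \<nu> = n \<and>
            src G \<mu> = rng G \<nu> \<and> \<alpha> = cmp G \<mu> \<nu>"

definition paths_of_deg :: "('m, 'k::finite) kgraph \<Rightarrow> nat ^ 'k \<Rightarrow> 'm set" where
  "paths_of_deg G n = {\<alpha> \<in> mor G. deg G \<alpha> = n}"

abbreviation verts :: "('m, 'k::finite) kgraph \<Rightarrow> 'm set" where
  "verts G \<equiv> paths_of_deg G 0"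

abbreviation unit_deg :: "'k::finite \<Rightarrow> nat ^ 'k" where
  "unit_deg i \<equiv> axis i 1"

definition paths_to :: "('m, 'k::finite) kgraph \<Rightarrow> 'm \<Rightarrow> 'm set \<Rightarrow> 'm set" where
  "paths_to G v E = {\<nu> \<in> E. rng G \<nu> = v}"

text \<open>The set \<open>\<Lambda>\<^sup>\<le>\<^sup>n\<close>.\<close>

definition paths_le :: "('m, 'k::finite) kgraph \<Rightarrow> nat ^ 'k \<Rightarrow> 'm set" where
  "paths_le G n = {\<alpha> \<in> mor G. deg G \<alpha> \<le> n \<and>
     (\<forall>i. deg G \<alpha> + unit_deg i \<le> n \<longrightarrow> paths_to G (src G \<alpha>) (paths_of_deg G (unit_deg i)) = {})}"

definition finite_kgraph :: "('m, 'k::finite) kgraph \<Rightarrow> bool" where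
  "finite_kgraph G \<longleftrightarrow> (\<forall>n. finite (paths_of_deg G n))"

definition locally_convex :: "('m, 'k::finite) kgraph \<Rightarrow> bool" where
  "locally_convex G \<longleftrightarrow>
     (\<forall>i j. \<forall>\<alpha> \<in> paths_of_deg G (unit_deg i). \<forall>\<mu> \<in> paths_of_deg G (unit_deg j).
        i \<noteq> j \<and> rng G \<alpha> = rng G \<mu> \<longrightarrow>
          paths_to G (src G \<alpha>) (paths_of_deg G (unit_deg j)) \<noteq> {} \<and>
          paths_to G (src G \<mu>) (paths_of_deg G (unit_deg i)) \<noteq> {})"


section \<open>Cycles\<close>

definition deg_le :: "nat ^ 'k \<Rightarrow> enat ^ 'k \<Rightarrow> bool" where
  "deg_le p m \<longleftrightarrow> (\<forall>i. enat (p $ i) \<le> m $ i)"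

text \<open>
  A path of degree \<open>m\<close> is a degree-preserving functor into \<open>G\<close> from the category of pairs
  \<open>p \<le> q \<le> m\<close>; its values at other pairs are irrelevant.
\<close>

definition is_path :: "('m, 'k::finite) kgraph \<Rightarrow> enat ^ 'k \<Rightarrow> (nat ^ 'k \<Rightarrow> nat ^ 'k \<Rightarrow> 'm) \<Rightarrow> bool" where
  "is_path G m x \<longleftrightarrow>
     (\<forall>p q. p \<le> q \<and> deg_le q m \<longrightarrow>
        x p q \<in> mor G \<and> deg G (x p q) = q - p \<and> rng G (x p q) = x p p \<and> src G (x p q) = x q q) \<and>
     (\<forall>p q t. p \<le> q \<and> q \<le> t \<and> deg_le t m \<longrightarrow> x p t = cmp G (x p q) (x q t))"

definition is_cycle :: "('m, 'k::finite) kgraph \<Rightarrow> 'm \<Rightarrow> bool" where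
  "is_cycle G \<alpha> \<longleftrightarrow> \<alpha> \<in> mor G - verts G \<and> rng G \<alpha> = src G \<alpha>"

definition deg_inf :: "('m, 'k::finite) kgraph \<Rightarrow> 'm \<Rightarrow> enat ^ 'k" where
  "deg_inf G \<alpha> = (\<chi> i. if deg G \<alpha> $ i > 0 then \<infinity> else 0)"

text \<open>
  The path \<open>\<alpha>\<alpha>\<alpha>\<dots>\<close>. By the factorisation property the conditions determine its values at all pairs
  \<open>p \<le> q \<le> deg_inf G \<alpha>\<close>.
\<close>

definition cycle_inf :: "('m, 'k::finite) kgraph \<Rightarrow> 'm \<Rightarrow> nat ^ 'k \<Rightarrow> nat ^ 'k \<Rightarrow> 'm" where
  "cycle_inf G \<alpha> = (SOME x. is_path G (deg_inf G \<alpha>) x \<and>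
     (\<forall>n::nat. x (n *s deg G \<alpha>) (Suc n *s deg G \<alpha>) = \<alpha>))"

definition has_entrance :: "('m, 'k::finite) kgraph \<Rightarrow> 'm \<Rightarrow> bool" where
  "has_entrance G \<alpha> \<longleftrightarrow>
     (\<exists>\<tau> \<in> paths_to G (rng G \<alpha>) (mor G).
        deg_le (deg G \<tau>) (deg_inf G \<alpha>) \<and> \<tau> \<noteq> cycle_inf G \<alpha> 0 (deg G \<tau>))"

definition is_initial_cycle :: "('m, 'k::finite) kgraph \<Rightarrow> 'm \<Rightarrow> bool" where
  "is_initial_cycle G \<mu> \<longleftrightarrow> \<mu> \<in> mor G \<and> rng G \<mu> = src G \<mu> \<and>
     (\<forall>i. deg G \<mu> $ i = 0 \<longrightarrow> paths_to G (rng G \<mu>) (paths_of_deg G (unit_deg i)) = {})"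

definition num_colours :: "('m, 'k::finite) kgraph \<Rightarrow> 'm \<Rightarrow> nat" where
  "num_colours G \<mu> = card {i. deg G \<mu> $ i > 0}"


section \<open>Unital $C^*$-algebras and stable rank\<close>

record 'a cstar_algebra = "(complex, 'a) module" +
  adj :: "'a \<Rightarrow> 'a"
  nrm :: "'a \<Rightarrow> real"

definition Lg :: "('a, 'b) cstar_algebra_scheme \<Rightarrow> nat \<Rightarrow> (nat \<Rightarrow> 'a) set" where
  "Lg A n = {x \<in> {..<n} \<rightarrow>\<^sub>E carrier A.
     \<exists>y \<in> {..<n} \<rightarrow>\<^sub>E carrier A. (\<Oplus>\<^bsub>A\<^esub>i\<in>{..<n}. y i \<otimes>\<^bsub>A\<^esub> x i) = \<one>\<^bsub>A\<^esub>}"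

definition Lg_dense :: "('a, 'b) cstar_algebra_scheme \<Rightarrow> nat \<Rightarrow> bool" where
  "Lg_dense A n \<longleftrightarrow>
     (\<forall>x \<in> {..<n} \<rightarrow>\<^sub>E carrier A. \<forall>\<epsilon>>0. \<exists>z \<in> Lg A n. \<forall>i<n. nrm A (x i \<ominus>\<^bsub>A\<^esub> z i) < \<epsilon>)"

text \<open>The infimum of the empty set of extended naturals is \<open>\<infinity>\<close>.\<close>

definition stable_rank :: "('a, 'b) cstar_algebra_scheme \<Rightarrow> enat" where
  "stable_rank A = Inf (enat ` {n. n \<ge> 1 \<and> Lg_dense A n})"


section \<open>The free $*$-algebra on a set of generators\<close>

datatype 'm letter = Gen 'm | Gen_adj 'm

fun gen_of :: "'m letter \<Rightarrow> 'm" where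
  "gen_of (Gen \<alpha>) = \<alpha>"
| "gen_of (Gen_adj \<alpha>) = \<alpha>"

fun letter_adj :: "'m letter \<Rightarrow> 'm letter" where
  "letter_adj (Gen \<alpha>) = Gen_adj \<alpha>"
| "letter_adj (Gen_adj \<alpha>) = Gen \<alpha>"

text \<open>
  Words form a monoid under concatenation, written additively so that finitely supported functions
  on words carry the convolution product of \<open>Poly_Mapping\<close>.
\<close>

datatype 'm word = Word (letters: "'m letter list")

instantiation word :: (type) monoid_add
begin

definition zero_word :: "'a word" where
  "zero_word = Word []"

definition plus_word :: "'a word \<Rightarrow> 'a word \<Rightarrow> 'a word" where
  "plus_word v w = Word (letters v @ letters w)"

instance
  by standard (simp_all add: zero_word_def plus_word_def)

end

definition word_adj :: "'m word \<Rightarrow> 'm word" where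
  "word_adj w = Word (map letter_adj (rev (letters w)))"

type_synonym 'm star_poly = "('m word, complex) poly_mapping"

text \<open>
  No constant terms are allowed: this is the free non-unital complex $*$-algebra on \<open>M\<close>.
\<close>

definition free_star_algebra :: "'m set \<Rightarrow> 'm star_poly set" where
  "free_star_algebra M =
     {f. \<forall>w \<in> Poly_Mapping.keys f. w \<noteq> 0 \<and> gen_of ` set (letters w) \<subseteq> M}"

definition poly_scale :: "complex \<Rightarrow> 'm star_poly \<Rightarrow> 'm star_poly" where
  "poly_scale c f = Poly_Mapping.single 0 c * f"

definition poly_adj :: "'m star_poly \<Rightarrow> 'm star_poly" where
  "poly_adj f = (\<Sum>w \<in> Poly_Mapping.keys f.
     Poly_Mapping.single (word_adj w) (cnj (Poly_Mapping.lookup f w)))"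

definition gen :: "'m \<Rightarrow> 'm star_poly" where
  "gen \<alpha> = Poly_Mapping.single (Word [Gen \<alpha>]) 1"


section \<open>The $C^*$-algebra of a finite higher-rank graph\<close>

text \<open>
  The defining relations; an element of this set is to be set equal to zero. The sets
  \<open>v\<Lambda>\<^sup>\<le>\<^sup>n\<close> over which the last family sums are finite when \<open>G\<close> is.
\<close>

definition ck_relations :: "('m, 'k::finite) kgraph \<Rightarrow> 'm star_poly set" where
  "ck_relations G =
     {poly_adj (gen v) - gen v | v. v \<in> verts G} \<union>
     {gen v * gen v - gen v | v. v \<in> verts G} \<union>
     {gen v * gen w | v w. v \<in> verts G \<and> w \<in> verts G \<and> v \<noteq> w} \<union>
     {gen \<mu> * gen \<nu> - gen (cmp G \<mu> \<nu>) | \<mu> \<nu>. \<mu> \<in> mor G \<and> \<nu> \<in> mor G \<and> src G \<mu> = rng G \<nu>} \<union>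
     {poly_adj (gen \<alpha>) * gen \<alpha> - gen (src G \<alpha>) | \<alpha>. \<alpha> \<in> mor G} \<union>
     {gen v - (\<Sum>\<alpha> \<in> paths_to G v (paths_le G n). gen \<alpha> * poly_adj (gen \<alpha>)) | v n. v \<in> verts G}"

text \<open>
  The $C^*$-seminorms on the free $*$-algebra that annihilate the relations are exactly the maps
  $f \mapsto \|\pi(f)\|$ for $\pi$ the $*$-homomorphism determined by a family satisfying the
  relations in some $C^*$-algebra. The universal $C^*$-algebra is the Hausdorff completion in their
  supremum, which is finite because every generator has seminorm at most 1.
\<close>

definition cstar_seminorms :: "('m, 'k::finite) kgraph \<Rightarrow> ('m star_poly \<Rightarrow> real) set" where
  "cstar_seminorms G = {p.
     (\<forall>f \<in> free_star_algebra (mor G). \<forall>g \<in> free_star_algebra (mor G).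
        p f \<ge> 0 \<and> p (f + g) \<le> p f + p g \<and> (\<forall>c. p (poly_scale c f) = cmod c * p f) \<and>
        p (f * g) \<le> p f * p g \<and> p (poly_adj f * f) = (p f)\<^sup>2) \<and>
     (\<forall>f \<in> ck_relations G. p f = 0)}"

definition univ_seminorm :: "('m, 'k::finite) kgraph \<Rightarrow> 'm star_poly \<Rightarrow> real" where
  "univ_seminorm G f = (SUP p \<in> cstar_seminorms G. p f)"

definition cauchy_seqs :: "('m, 'k::finite) kgraph \<Rightarrow> (nat \<Rightarrow> 'm star_poly) set" where
  "cauchy_seqs G = {X. (\<forall>n. X n \<in> free_star_algebra (mor G)) \<and>
     (\<forall>\<epsilon>>0. \<exists>N. \<forall>m\<ge>N. \<forall>n\<ge>N. univ_seminorm G (X m - X n) < \<epsilon>)}"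

definition seq_class :: "('m, 'k::finite) kgraph \<Rightarrow> (nat \<Rightarrow> 'm star_poly) \<Rightarrow> (nat \<Rightarrow> 'm star_poly) set" where
  "seq_class G X = {Y \<in> cauchy_seqs G. (\<lambda>n. univ_seminorm G (X n - Y n)) \<longlonglongrightarrow> 0}"

text \<open>
  The unit is the sum of the vertex projections. Finiteness of \<open>verts G\<close> is needed here.
\<close>

definition graph_cstar :: "('m, 'k::finite) kgraph \<Rightarrow> (nat \<Rightarrow> 'm star_poly) set cstar_algebra" where
  "graph_cstar G = \<lparr>
     carrier = seq_class G ` cauchy_seqs G,
     monoid.mult = (\<lambda>A B. \<Union>X\<in>A. \<Union>Y\<in>B. seq_class G (\<lambda>n. X n * Y n)),
     one = seq_class G (\<lambda>_. \<Sum>v \<in> verts G. gen v),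
     zero = seq_class G (\<lambda>_. 0),
     add = (\<lambda>A B. \<Union>X\<in>A. \<Union>Y\<in>B. seq_class G (\<lambda>n. X n + Y n)),
     smult = (\<lambda>c A. \<Union>X\<in>A. seq_class G (\<lambda>n. poly_scale c (X n))),
     adj = (\<lambda>A. \<Union>X\<in>A. seq_class G (\<lambda>n. poly_adj (X n))),
     nrm = (\<lambda>A. THE l. \<forall>X\<in>A. (\<lambda>n. univ_seminorm G (X n)) \<longlonglongrightarrow> l)
   \<rparr>"

end

theory Submission
  imports Defs "HOL-Computational_Algebra.Fundamental_Theorem_Algebra"
begin

text \<open>
  Everything takes place in the dense \<open>*\<close>-subalgebra generated by the \<open>s\<^sub>\<lambda>\<close>: stable rank one means that
  each of its elements is a limit of elements with an approximate left inverse.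

  Suppose that no cycle has an entrance and that initial cycles have at most one colour. A path in
  \<open>\<Lambda>\<^sup>\<le>\<^sup>n\<close> with \<open>n = (N, \<dots>, N)\<close> and \<open>N \<ge> |\<Lambda>\<^sup>0|\<close> ends at a vertex that supports a cycle in each colour in
  which the path has degree \<open>N\<close>, and receives no edge in the other colours. The product of these cycles is
  initial, so there is at most one such colour, and the corner at the vertex is generated by one
  unitary. Laurent polynomials in a unitary are limits of invertible ones (move the roots off the circle),
  and Gaussian elimination along the
  partition of unity \<open>\<Sum> s\<^sub>\<lambda> s\<^sub>\<lambda>\<^sup>*\<close> carries this over to the whole algebra.

  Conversely, a cycle with an entrance yields an isometry that is not unitary. An initial cycle with two colours
  yields a corner that maps onto the functions on a torus of dimension at least two, and Brouwer's theorem
  provides a function on it which is far from the invertible ones. Both arguments use that the relevant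
  elements are nonzero, which is seen in the representations on finitely supported functions on the
  set of boundary paths.
\<close>

section \<open>Quotients by star ideals\<close>

text \<open>\<open>graph_cstar\<close> comes from a supremum of seminorms on polynomials, so the
  relations hold only up to elements of seminorm zero. A type of quotients turns them into
  equations; the completion itself is entered only where the stable rank is unfolded. The price is
  that no spectral theory is at hand. Left invertibility becomes an error below 1, which a Neumann
  series improves to any accuracy. The relations give that the projections
  \<open>S \<alpha> * T \<alpha>\<close>, for \<alpha> in \<open>paths_le G n\<close> with range
  \<open>v\<close>, sum to \<open>S v\<close>; that they are orthogonal, in a complete algebra a
  matter of positivity, needs a norm argument of its own, and all computations with paths depend on
  it. In the converse direction only one boundary path starts at the vertex of the initial cycle, so
  a single representation shows a single point of the torus. The points are supplied by twisting the
  action with the phases of the gauge action.\<close>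

definition star_ideal :: "'a::ring set \<times> ('a \<Rightarrow> 'a) \<Rightarrow> bool" where
  "star_ideal i \<longleftrightarrow> 0 \<in> fst i \<and> (\<forall>x\<in>fst i. \<forall>y\<in>fst i. x - y \<in> fst i) \<and>
     (\<forall>x\<in>fst i. \<forall>y. x * y \<in> fst i \<and> y * x \<in> fst i) \<and>
     (\<forall>x\<in>fst i. snd i x \<in> fst i) \<and> (\<forall>x y. snd i (x + y) = snd i x + snd i y) \<and>
     (\<forall>x y. snd i (x * y) = snd i y * snd i x) \<and> (\<forall>x. snd i (snd i x) = x)"

lemma star_idealD:
  assumes "star_ideal i"
  shows "0 \<in> fst i" "x \<in> fst i \<Longrightarrow> y \<in> fst i \<Longrightarrow> x - y \<in> fst i"
    "x \<in> fst i \<Longrightarrow> x * y \<in> fst i" "x \<in> fst i \<Longrightarrow> y * x \<in> fst i" "x \<in> fst i \<Longrightarrow> snd i x \<in> fst i"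
    "snd i (x + y) = snd i x + snd i y" "snd i (x * y) = snd i y * snd i x" "snd i (snd i x) = x"
    "x \<in> fst i \<Longrightarrow> - x \<in> fst i" "x \<in> fst i \<Longrightarrow> y \<in> fst i \<Longrightarrow> x + y \<in> fst i"
    "snd i 0 = 0" "snd i (x - y) = snd i x - snd i y"
proof -
  show m: "x \<in> fst i \<Longrightarrow> - x \<in> fst i" for x
    using assms unfolding star_ideal_def by (metis diff_0)
  show "x \<in> fst i \<Longrightarrow> y \<in> fst i \<Longrightarrow> x + y \<in> fst i"
    using m[of y] assms unfolding star_ideal_def by (metis diff_minus_eq_add)
  have add: "snd i (x + y) = snd i x + snd i y" for x y
    using assms unfolding star_ideal_def by blast
  from add[of 0 0] show z: "snd i 0 = 0"
    by simp
  from add[of "x - y" y] show "snd i (x - y) = snd i x - snd i y"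
    by (simp add: algebra_simps)
qed (use assms in \<open>auto simp: star_ideal_def\<close>)

text \<open>
  The product of the quotients of a ring by all its \<open>*\<close>-ideals, for all involutions. It is a type
  that contains each single quotient, so that identities in a quotient become literal equations.
\<close>

quotient_type (overloaded) 'a quo = "'a::ring set \<times> ('a \<Rightarrow> 'a) \<Rightarrow> 'a" /
  "\<lambda>f g. \<forall>i. star_ideal i \<longrightarrow> f i - g i \<in> fst i"
proof (intro equivpI reflpI sympI transpI)
  show "\<forall>i. star_ideal i \<longrightarrow> f i - f i \<in> fst i" for f :: "'a set \<times> ('a \<Rightarrow> 'a) \<Rightarrow> 'a"
    by (simp add: star_idealD)
  show "\<forall>i. star_ideal i \<longrightarrow> g i - f i \<in> fst i"
    if "\<forall>i. star_ideal i \<longrightarrow> f i - g i \<in> fst i" for f g :: "'a set \<times> ('a \<Rightarrow> 'a) \<Rightarrow> 'a"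
    using that star_idealD(9) minus_diff_eq by metis
  show "\<forall>i. star_ideal i \<longrightarrow> f i - h i \<in> fst i"
    if "\<forall>i. star_ideal i \<longrightarrow> f i - g i \<in> fst i" "\<forall>i. star_ideal i \<longrightarrow> g i - h i \<in> fst i"
    for f g h :: "'a set \<times> ('a \<Rightarrow> 'a) \<Rightarrow> 'a"
  proof (intro allI impI)
    fix i :: "'a set \<times> ('a \<Rightarrow> 'a)"
    assume "star_ideal i"
    then have "(f i - g i) + (g i - h i) \<in> fst i"
      using that by (blast intro: star_idealD(10))
    then show "f i - h i \<in> fst i"
      by simp
  qed
qed

instantiation quo :: (ring) ring
begin

lift_definition zero_quo :: "'a quo" is "\<lambda>_. 0" .

lift_definition plus_quo :: "'a quo \<Rightarrow> 'a quo \<Rightarrow> 'a quo" is "\<lambda>f g i. f i + g i"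
  by (simp add: add_diff_add star_idealD(10))

lift_definition uminus_quo :: "'a quo \<Rightarrow> 'a quo" is "\<lambda>f i. - f i"
proof goal_cases
  case (1 f f' i)
  note i = 1(2)
  from 1 have "- (f i - f' i) \<in> fst i"
    by (blast intro: star_idealD(9))
  then show "- f i - - f' i \<in> fst i"
    by simp
qed

lift_definition minus_quo :: "'a quo \<Rightarrow> 'a quo \<Rightarrow> 'a quo" is "\<lambda>f g i. f i - g i"
proof goal_cases
  case (1 f f' g g' i)
  note i = 1(3)
  from 1 have "f i - f' i - (g i - g' i) \<in> fst i"
    by (blast intro: star_idealD(2))
  then show "f i - g i - (f' i - g' i) \<in> fst i"
    by (simp add: algebra_simps)
qed

lift_definition times_quo :: "'a quo \<Rightarrow> 'a quo \<Rightarrow> 'a quo" is "\<lambda>f g i. f i * g i"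
proof goal_cases
  case (1 f f' g g' i)
  note i = 1(3)
  from 1 have "(f i - f' i) * g i \<in> fst i" "f' i * (g i - g' i) \<in> fst i"
    by (simp_all add: star_idealD(3,4))
  from star_idealD(10)[OF i this] show "f i * g i - f' i * g' i \<in> fst i"
    by (simp add: algebra_simps)
qed

instance
  by standard (transfer; simp add: algebra_simps star_idealD)+

end

lift_definition quo_star :: "'a::ring quo \<Rightarrow> 'a quo" is "\<lambda>f i. snd i (f i)"
proof goal_cases
  case (1 f f' i)
  note i = 1(2)
  from 1 have "snd i (f i - f' i) \<in> fst i"
    by (blast intro: star_idealD(5))
  then show "snd i (f i) - snd i (f' i) \<in> fst i"
    using i by (simp add: star_idealD(12))
qed

lemma quo_star_add: "quo_star (x + y) = quo_star x + quo_star y"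
  by transfer (simp add: star_idealD)

lemma quo_star_mult: "quo_star (x * y) = quo_star y * quo_star x"
  by transfer (simp add: star_idealD)

lemma quo_star_star [simp]: "quo_star (quo_star x) = x"
  by transfer (simp add: star_idealD)

text \<open>The class of \<open>x\<close> in one quotient, with zero in every other factor. The
  image of 1 is therefore only an idempotent of the large ring, which is why later statements carry
  a unit such as \<open>emb i 1\<close> or \<open>sc 1\<close> explicitly.\<close>

lift_definition emb :: "'a::ring set \<times> ('a \<Rightarrow> 'a) \<Rightarrow> 'a \<Rightarrow> 'a quo" is
  "\<lambda>i x j. if j = i then x else 0" .

lemma emb_add: "emb i (x + y) = emb i x + emb i y"
  by transfer (simp add: star_idealD del: split_paired_All)

lemma emb_diff: "emb i (x - y) = emb i x - emb i y"
  by transfer (simp add: star_idealD del: split_paired_All)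

lemma emb_mult: "emb i (x * y) = emb i x * emb i y"
  by transfer (simp add: star_idealD del: split_paired_All)

lemma emb_0 [simp]: "emb i 0 = 0"
  by transfer (simp add: star_idealD del: split_paired_All)

lemma emb_uminus: "emb i (- x) = - emb i x"
  by transfer (simp add: star_idealD del: split_paired_All)

lemma emb_sum: "emb i (sum f A) = (\<Sum>a\<in>A. emb i (f a))"
  by (induction A rule: infinite_finite_induct) (simp_all add: emb_add)

lemma emb_star: "quo_star (emb i x) = emb i (snd i x)"
  by transfer (simp add: star_idealD del: split_paired_All)

lemma emb_eq_iff: "star_ideal i \<Longrightarrow> emb i x = emb i y \<longleftrightarrow> x - y \<in> fst i"
  by transfer (auto simp: star_idealD simp del: split_paired_All)

text \<open>A chosen representative, determined only modulo the ideal; hence the rules below are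
  memberships in \<open>fst i\<close> and not equations.\<close>

definition quo_comp :: "'a::ring set \<times> ('a \<Rightarrow> 'a) \<Rightarrow> 'a quo \<Rightarrow> 'a" where
  "quo_comp i F = rep_quo F i"

lemma quo_comp_abs: "star_ideal i \<Longrightarrow> quo_comp i (abs_quo f) - f i \<in> fst i"
  using Quotient3_rep_abs[OF Quotient3_quo, of f]
  by (simp add: quo_comp_def star_idealD(1) del: split_paired_All)

text \<open>Multiplication by \<open>emb i u\<close> annihilates every factor except the one at
  \<open>i\<close>, where \<open>u\<close> is a left unit modulo the ideal. An \<open>F\<close>
  fixed by it is thus determined by that factor.\<close>

lemma emb_quo_comp:
  assumes "star_ideal i" "emb i u * F = F" "\<And>x. u * x - x \<in> fst i"
  shows "emb i (quo_comp i F) = F"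
proof -
  have "emb i u * abs_quo (rep_quo F) = emb i (rep_quo F i)"
    unfolding emb.abs_eq times_quo.abs_eq quo.abs_eq_iff
    using assms(1,3) by (auto simp: star_idealD(1) simp del: split_paired_All intro: star_idealD)
  then show ?thesis
    using assms(2) by (simp add: quo_comp_def Quotient3_abs_rep[OF Quotient3_quo])
qed

lemma quo_comp_emb: "star_ideal i \<Longrightarrow> quo_comp i (emb i x) - x \<in> fst i"
  using quo_comp_abs[of i "\<lambda>j. if j = i then x else 0"] by (simp add: emb.abs_eq)

lemma quo_comp_add: "star_ideal i \<Longrightarrow> quo_comp i (F + G) - (quo_comp i F + quo_comp i G) \<in> fst i"
  using quo_comp_abs[of i "\<lambda>j. rep_quo F j + rep_quo G j"] plus_quo.abs_eq[of "rep_quo F" "rep_quo G"]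
  by (simp add: quo_comp_def Quotient3_abs_rep[OF Quotient3_quo])

lemma quo_comp_mult: "star_ideal i \<Longrightarrow> quo_comp i (F * G) - (quo_comp i F * quo_comp i G) \<in> fst i"
  using quo_comp_abs[of i "\<lambda>j. rep_quo F j * rep_quo G j"] times_quo.abs_eq[of "rep_quo F" "rep_quo G"]
  by (simp add: quo_comp_def Quotient3_abs_rep[OF Quotient3_quo])

lemma quo_comp_star: "star_ideal i \<Longrightarrow> quo_comp i (quo_star F) - snd i (quo_comp i F) \<in> fst i"
  using quo_comp_abs[of i "\<lambda>j. snd j (rep_quo F j)"] quo_star.abs_eq[of "rep_quo F"]
  by (simp add: quo_comp_def Quotient3_abs_rep[OF Quotient3_quo])

section \<open>Seminormed algebras with dense left invertible elements\<close>

text \<open>Scalars enter as central elements \<open>sc c\<close>. In the intended instance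
  \<open>sc 1\<close> is the unit of a single factor of \<open>quo\<close>, so there is no law
  \<open>sc 1 * x = x\<close>; where it matters it is a hypothesis on the elements
  concerned.\<close>

locale seminormed_algebra =
  fixes nn :: "'a::ring \<Rightarrow> real" and sc :: "complex \<Rightarrow> 'a"
  assumes nn_add: "nn (x + y) \<le> nn x + nn y"
    and nn_mult: "nn (x * y) \<le> nn x * nn y"
    and nn_sc: "nn (sc c * x) = cmod c * nn x"
    and sc_add: "sc (c + d) = sc c + sc d"
    and sc_mult: "sc (c * d) = sc c * sc d"
    and sc_comm: "sc c * x = x * sc c"
begin

lemma sc_0 [simp]: "sc 0 = 0"
  using sc_add[of 0 0] by simp

lemma sc_uminus: "sc (- c) = - sc c"
  using minus_unique[of "sc c" "sc (- c)"] sc_add[of c "- c"] by simp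

lemma nn_0 [simp]: "nn 0 = 0"
  using nn_sc[of 0 0] by simp

lemma nn_uminus [simp]: "nn (- x) = nn x"
proof -
  have "nn (- x) = nn (sc (- 1) * x)"
    using nn_sc[of 1 "- x"] by (simp add: sc_uminus)
  then show ?thesis
    by (simp add: nn_sc)
qed

lemma nn_nonneg [simp]: "0 \<le> nn x"
  using nn_add[of x "- x"] by simp

lemma nn_diff_commute: "nn (x - y) = nn (y - x)"
  by (metis minus_diff_eq nn_uminus)

lemma nn_diff: "nn (x - y) \<le> nn x + nn y"
  using nn_add[of x "- y"] by simp

lemma nn_diff_trans: "nn (x - z) \<le> nn (x - y) + nn (y - z)"
  using nn_add[of "x - y" "y - z"] by simp

lemma nn_sum: "nn (sum f A) \<le> (\<Sum>a\<in>A. nn (f a))"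
  by (induction A rule: infinite_finite_induct) (auto intro: order_trans[OF nn_add])

lemma nn_mult_le: "nn x \<le> a \<Longrightarrow> nn y \<le> b \<Longrightarrow> nn (x * y) \<le> a * b"
  using nn_mult[of x y] mult_mono[of "nn x" a "nn y" b] nn_nonneg[of x] by (smt (verit) nn_nonneg)

section \<open>Corners, approximate left inverses and stable rank one of a corner\<close>

definition cor :: "'a \<Rightarrow> 'a \<Rightarrow> bool" where
  "cor p x \<longleftrightarrow> p * x = x \<and> x * p = x"

text \<open>An error below 1 amounts to a left inverse in the completion, by the Neumann series. The
  condition survives small perturbations of \<open>x\<close> and can be stated without
  limits.\<close>

definition linv :: "'a \<Rightarrow> 'a \<Rightarrow> bool" where
  "linv p x \<longleftrightarrow> (\<exists>y. cor p y \<and> nn (y * x - p) < 1)"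

definition approx :: "'a \<Rightarrow> 'a \<Rightarrow> bool" where
  "approx p x \<longleftrightarrow> (\<forall>\<epsilon>>0. \<exists>x'. cor p x' \<and> linv p x' \<and> nn (x - x') < \<epsilon>)"

text \<open>Stable rank one of the corner at an idempotent \<open>p\<close>, phrased inside the
  dense subalgebra.\<close>

definition full :: "'a \<Rightarrow> bool" where
  "full p \<longleftrightarrow> p * p = p \<and> (\<forall>x. cor p x \<longrightarrow> approx p x)"

lemma corD: "cor p x \<Longrightarrow> p * x = x" "cor p x \<Longrightarrow> x * p = x"
    "cor p x \<Longrightarrow> p * (x * y) = x * y" "cor p x \<Longrightarrow> x * (p * y) = x * y"
  by (auto simp: cor_def mult.assoc[symmetric])

lemma cor_mult [intro]:
  assumes "cor p x" "cor p y"
  shows "cor p (x * y)"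
  unfolding cor_def using corD[OF assms(1)] corD[OF assms(2)] by (simp add: mult.assoc)

lemma cor_add [intro]: "cor p x \<Longrightarrow> cor p y \<Longrightarrow> cor p (x + y)"
  by (simp add: cor_def distrib_left distrib_right)

lemma cor_diff [intro]: "cor p x \<Longrightarrow> cor p y \<Longrightarrow> cor p (x - y)"
  by (simp add: cor_def left_diff_distrib right_diff_distrib)

lemma cor_sc [intro]:
  assumes "cor p x"
  shows "cor p (sc c * x)"
proof -
  have "p * (sc c * x) = sc c * (p * x)"
    by (metis mult.assoc sc_comm)
  then show ?thesis
    using assms by (simp add: cor_def mult.assoc)
qed

lemma cor_0 [intro]: "cor p 0"
  by (simp add: cor_def)

lemma cor_self [intro]: "p * p = p \<Longrightarrow> cor p p"
  by (simp add: cor_def)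

lemma cor_sandwich: "p * p = p \<Longrightarrow> cor p (p * x * p)"
  by (simp add: cor_def mult.assoc) (simp add: mult.assoc[symmetric])

text \<open>Neumann series: with \<open>r = p - y * x\<close> the partial sum \<open>Y n\<close> is
  \<open>y\<close> multiplied from the left by the sum of the powers of \<open>r\<close> up to
  \<open>n\<close>, and the defect \<open>p - Y n * x\<close> is \<open>r\<close> to the power
  \<open>n + 1\<close>.\<close>

lemma linv_refine:
  assumes p: "p * p = p" and x: "cor p x" "linv p x" and "\<delta> > 0"
  shows "\<exists>y. cor p y \<and> nn (y * x - p) < \<delta>"
proof -
  obtain y where y: "cor p y" "nn (y * x - p) < 1"
    using x(2) by (auto simp: linv_def)
  define r where "r = p - y * x"
  have r: "cor p r" "nn r < 1"
    using y p x by (auto simp: r_def nn_diff_commute)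
  define Y where "Y = rec_nat y (\<lambda>_ z. y + r * z)"
  have Y: "Y 0 = y" "Y (Suc n) = y + r * Y n" for n
    by (simp_all add: Y_def)
  have cY: "cor p (Y n)" for n
    by (induction n) (use y r in \<open>auto simp: Y\<close>)
  have bound: "nn (p - Y n * x) \<le> nn r ^ Suc n" for n
  proof (induction n)
    case 0
    show ?case by (simp add: Y r_def)
  next
    case (Suc n)
    have "p - Y (Suc n) * x = r * (p - Y n * x)"
      using corD(2)[OF r(1)] by (simp add: Y r_def algebra_simps)
    then have "nn (p - Y (Suc n) * x) \<le> nn r * nn r ^ Suc n"
      using nn_mult_le[OF order_refl Suc] by metis
    then show ?case by simp
  qed
  obtain n where "nn r ^ n < \<delta>"
    using real_arch_pow_inv[OF \<open>\<delta> > 0\<close> r(2)] by auto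
  moreover have "nn r ^ Suc n \<le> nn r ^ n"
    using r(2) by (intro power_decreasing) auto
  ultimately show ?thesis
    using bound[of n] cY[of n] nn_diff_commute[of p "Y n * x"] by (intro exI[of _ "Y n"]) auto
qed

lemma linv_mult:
  assumes p: "p * p = p" and x: "cor p x" "linv p x" and y: "cor p y" "linv p y"
  shows "linv p (x * y)"
proof -
  obtain y' where y': "cor p y'" "nn (y' * y - p) < 1/2"
    using linv_refine[OF p y, of "1/2"] by auto
  \<comment> \<open>The error of the left inverse of \<open>x\<close> is multiplied by
    \<open>y'\<close> and \<open>y\<close> below; with this \<delta> it stays under 1/2 and adds to
    the error 1/2 of \<open>y'\<close>.\<close>
  define \<delta> where "\<delta> = 1 / (2 * (nn y' * nn y + 1))"
  have pos: "nn y' * nn y + 1 > 0"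
    by (simp add: add_nonneg_pos)
  then have "\<delta> > 0"
    by (simp add: \<delta>_def)
  then obtain x' where x': "cor p x'" "nn (x' * x - p) < \<delta>"
    using linv_refine[OF p x, of \<delta>] by blast
  have "y' * x' * (x * y) - p = y' * ((x' * x - p) * y) + (y' * y - p)"
    using corD[OF y(1)] by (simp add: algebra_simps)
  then have "nn (y' * x' * (x * y) - p) \<le> nn (y' * ((x' * x - p) * y)) + nn (y' * y - p)"
    by (metis nn_add)
  moreover have "nn (y' * ((x' * x - p) * y)) \<le> nn y' * (\<delta> * nn y)"
    using x'(2) by (intro nn_mult_le) auto
  moreover have "nn y' * (\<delta> * nn y) < 1/2"
    using pos by (simp add: \<delta>_def field_simps)
  ultimately have "nn (y' * x' * (x * y) - p) < 1"
    using y'(2) by simp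
  then show ?thesis
    using x' y' by (auto simp: linv_def)
qed

lemma approx_linv: "cor p x \<Longrightarrow> linv p x \<Longrightarrow> approx p x"
  by (force simp: approx_def)

lemma approx_lim:
  assumes "\<And>\<epsilon>. \<epsilon> > 0 \<Longrightarrow> \<exists>x'. approx p x' \<and> nn (x - x') < \<epsilon>"
  shows "approx p x"
  unfolding approx_def
proof (intro allI impI)
  fix \<epsilon> :: real assume "\<epsilon> > 0"
  then obtain x' where x': "approx p x'" "nn (x - x') < \<epsilon> / 2"
    using assms[of "\<epsilon> / 2"] by auto
  then obtain z where "cor p z" "linv p z" "nn (x' - z) < \<epsilon> / 2"
    using \<open>\<epsilon> > 0\<close> by (metis approx_def half_gt_zero)
  then show "\<exists>x'. cor p x' \<and> linv p x' \<and> nn (x - x') < \<epsilon>"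
    using x' nn_diff_trans[of x z x'] by (intro exI[of _ z]) auto
qed

lemma approx_mult:
  assumes p: "p * p = p" and x: "approx p x" and y: "approx p y"
  shows "approx p (x * y)"
proof (rule approx_lim)
  fix \<epsilon> :: real assume e: "\<epsilon> > 0"
  have "\<epsilon> / (2 * (nn y + 1)) > 0"
    using e by (simp add: add_nonneg_pos)
  then obtain x' where x': "cor p x'" "linv p x'" "nn (x - x') < \<epsilon> / (2 * (nn y + 1))"
    using x unfolding approx_def by blast
  \<comment> \<open>The tolerance for \<open>y\<close> refers to the \<open>x'\<close> already
    chosen, since the difference of the products is split as
    \<open>(x - x') * y + x' * (y - y')\<close>.\<close>
  have "\<epsilon> / (2 * (nn x' + 1)) > 0"
    using e by (simp add: add_nonneg_pos)
  then obtain y' where y': "cor p y'" "linv p y'" "nn (y - y') < \<epsilon> / (2 * (nn x' + 1))"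
    using y unfolding approx_def by blast
  have *: "\<epsilon> / (2 * (a + 1)) * a < \<epsilon> / 2" if "a \<ge> 0" for a :: real
    using that e by (simp add: field_simps)
  have "x * y - x' * y' = (x - x') * y + x' * (y - y')"
    by (simp add: algebra_simps)
  then have "nn (x * y - x' * y') \<le> nn ((x - x') * y) + nn (x' * (y - y'))"
    by (metis nn_add)
  also have "nn ((x - x') * y) \<le> \<epsilon> / (2 * (nn y + 1)) * nn y"
    using x'(3) by (intro nn_mult_le) auto
  also have "nn (x' * (y - y')) \<le> nn x' * (\<epsilon> / (2 * (nn x' + 1)))"
    using y'(3) by (intro nn_mult_le) auto
  also have "\<epsilon> / (2 * (nn y + 1)) * nn y + nn x' * (\<epsilon> / (2 * (nn x' + 1))) < \<epsilon>"
    using *[of "nn y"] *[of "nn x'"] by (simp add: mult.commute)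
  finally show "\<exists>z. approx p z \<and> nn (x * y - z) < \<epsilon>"
    using approx_linv[OF cor_mult[OF x'(1) y'(1)] linv_mult[OF p x'(1,2) y'(1,2)]]
    by (intro exI[of _ "x' * y'"]) auto
qed

text \<open>
  Gaussian elimination: an element of the corner at \<open>p + q\<close> with entries \<open>a, b, c, d\<close>, where \<open>a\<close> has
  an approximate left inverse \<open>a'\<close>, is close to the product of the elementary matrix with entry \<open>c a'\<close>,
  the diagonal matrices of \<open>(1, d - c a' b)\<close> and \<open>(a, 1)\<close>, and the elementary matrix with entry \<open>b\<close>.
\<close>

lemma full_add:
  assumes p: "full p" and q: "full q" and pq: "p * q = 0" "q * p = 0"
  shows "full (p + q)"
proof -
  define e where "e = p + q"
  have pp: "p * p = p" and qq: "q * q = q"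
    using p q by (simp_all add: full_def)
  have ee: "e * e = e"
    by (simp add: e_def algebra_simps pp qq pq)
  have pq': "p * (q * x) = 0" "q * (p * x) = 0" "p * (p * x) = p * x" "q * (q * x) = q * x" for x
    by (simp_all add: mult.assoc[symmetric] pq pp qq)
  note S = pp qq pq pq' algebra_simps
  have diag1: "approx e (x + q)" if x: "approx p x" for x
    unfolding approx_def
  proof (intro allI impI)
    fix \<epsilon> :: real assume "\<epsilon> > 0"
    then obtain z where z: "cor p z" "linv p z" "nn (x - z) < \<epsilon>"
      using x unfolding approx_def by blast
    obtain y where y: "cor p y" "nn (y * z - p) < 1"
      using z(2) by (auto simp: linv_def)
    have 0: "z * q = 0" "q * z = 0" "y * q = 0" "q * y = 0"
      using z(1) y(1) by (metis corD mult.assoc mult_zero_left mult_zero_right pq)+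
    have "cor e (z + q)" "cor e (y + q)"
      using corD[OF z(1)] corD[OF y(1)] by (simp_all add: cor_def e_def S 0)
    moreover have "(y + q) * (z + q) - e = y * z - p"
      by (simp add: e_def S 0)
    ultimately show "\<exists>x'. cor e x' \<and> linv e x' \<and> nn (x + q - x') < \<epsilon>"
      using z y by (intro exI[of _ "z + q"]) (auto simp: linv_def intro!: exI[of _ "y + q"])
  qed
  have diag2: "approx e (p + x)" if x: "approx q x" for x
    unfolding approx_def
  proof (intro allI impI)
    fix \<epsilon> :: real assume "\<epsilon> > 0"
    then obtain z where z: "cor q z" "linv q z" "nn (x - z) < \<epsilon>"
      using x unfolding approx_def by blast
    obtain y where y: "cor q y" "nn (y * z - q) < 1"
      using z(2) by (auto simp: linv_def)
    have 0: "z * p = 0" "p * z = 0" "y * p = 0" "p * y = 0"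
      using z(1) y(1) by (metis corD mult.assoc mult_zero_left mult_zero_right pq)+
    have "cor e (p + z)" "cor e (p + y)"
      using corD[OF z(1)] corD[OF y(1)] by (simp_all add: cor_def e_def S 0)
    moreover have "(p + y) * (p + z) - e = y * z - q"
      by (simp add: e_def S 0)
    ultimately show "\<exists>x'. cor e x' \<and> linv e x' \<and> nn (p + x - x') < \<epsilon>"
      using z y by (intro exI[of _ "p + z"]) (auto simp: linv_def intro!: exI[of _ "p + y"])
  qed
  have unip: "approx e (e + x)" if "cor e x" "x * x = 0" for x
  proof -
    have "(e - x) * (e + x) - e = 0"
      using that ee corD[OF that(1)] by (simp add: algebra_simps)
    then have "linv e (e + x)"
      unfolding linv_def using that ee by (intro exI[of _ "e - x"]) (auto)
    then show ?thesis
      using that ee by (intro approx_linv) auto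
  qed
  have "approx e z" if z: "cor e z" for z
  proof (rule approx_lim)
    fix \<epsilon> :: real assume \<epsilon>: "\<epsilon> > 0"
    define a0 b c d where a0_b_c_d_def: "a0 = p * z * p" "b = p * z * q" "c = q * z * p" "d = q * z * q"
    have zz: "z = a0 + b + c + d"
      using z unfolding cor_def e_def a0_b_c_d_def
      by (metis (no_types, lifting) add.assoc distrib_left distrib_right)
    have bcd: "p * b = b" "b * q = b" "q * b = 0" "b * p = 0" "q * c = c" "c * p = c" "p * c = 0" "c * q = 0"
        "q * d = d" "d * q = d" "p * d = 0" "d * p = 0"
      unfolding a0_b_c_d_def by (simp_all add: S)
    have "approx p a0"
      using p cor_sandwich[OF pp] by (simp add: full_def a0_b_c_d_def)
    then obtain a where a: "cor p a" "linv p a" "nn (a0 - a) < \<epsilon> / 2"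
      using \<epsilon> unfolding approx_def by (meson half_gt_zero)
    have "\<epsilon> / (2 * (nn c + 1)) > 0"
      using \<epsilon> by (simp add: add_nonneg_pos)
    then obtain a' where a': "cor p a'" "nn (a' * a - p) < \<epsilon> / (2 * (nn c + 1))"
      using linv_refine[OF pp a(1,2)] by blast
    note aa = corD[OF a(1)] corD[OF a'(1)]
    have aq: "a * q = 0" "q * a = 0" "a' * q = 0" "q * a' = 0"
      using a(1) a'(1) by (metis corD mult.assoc mult_zero_left mult_zero_right pq)+
    define D where "D = d - c * a' * b"
    have D: "cor q D"
      using bcd unfolding D_def cor_def by (simp add: algebra_simps) (simp add: mult.assoc[symmetric])
    have Dp: "D * p = 0" "p * D = 0"
      using D by (metis corD mult.assoc mult_zero_left mult_zero_right pq)+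
    have cab: "c * a' * p = c * a'" "p * (c * a') = 0" "c * a' * q = 0" "q * (c * a') = c * a'"
      using bcd aa aq by (simp_all add: mult.assoc) (simp_all add: mult.assoc[symmetric] bcd)
    have zero: "b * b = 0" "c * a' * (c * a') = 0" "a' * D = 0" "b * a = 0" "D * a = 0"
      using bcd aa aq Dp by (metis mult.assoc mult_zero_left mult_zero_right)+
    define w where "w = (e + c * a') * ((p + D) * ((e + b) * (a + q)))"
    have "approx e w"
      unfolding w_def
    proof (intro approx_mult ee unip diag1 diag2)
      show "cor e (c * a')" "cor e b"
        using cab bcd by (simp_all add: cor_def e_def algebra_simps)
      show "approx q D"
        using q D by (simp add: full_def)
      show "approx p a"
        using a by (intro approx_linv)
    qed (use zero in auto)
    moreover have "nn (z - w) < \<epsilon>"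
    proof -
      have 1: "(e + b) * (a + q) = a + q + b"
        using aa bcd aq zero by (simp add: e_def S)
      have 2: "(p + D) * (a + q + b) = a + b + D"
        using aa bcd aq zero Dp D by (simp add: e_def S corD)
           (metis mult.assoc mult_zero_left bcd(1) Dp(1))
      have 3: "(e + c * a') * (a + b + D) = a + b + c * (a' * a) + d"
      proof -
        have "e * (a + b + D) = a + b + D"
          using aa bcd aq D Dp by (simp add: e_def distrib_left distrib_right corD)
        moreover have "c * a' * (a + b + D) = c * (a' * a) + c * a' * b"
          using zero(3) by (simp add: algebra_simps)
        ultimately show ?thesis
          by (simp add: D_def distrib_right)
      qed
      \<comment> \<open>That \<open>a'\<close> inverts \<open>a\<close> only approximately spoils a
        single entry, the one at \<open>c\<close>; the entry at \<open>d\<close> is exact because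
        \<open>D\<close> subtracts precisely \<open>c * a' * b\<close>. This is why the tolerance of
        \<open>a'\<close> is scaled by \<open>nn c\<close>.\<close>
      have "z - w = (a0 - a) - c * (a' * a - p)"
        using bcd unfolding zz w_def 1 2 3 by (simp add: algebra_simps)
      then have "nn (z - w) \<le> nn (a0 - a) + nn (c * (a' * a - p))"
        by (metis nn_diff)
      moreover have "nn (c * (a' * a - p)) \<le> nn c * (\<epsilon> / (2 * (nn c + 1)))"
        using a'(2) by (intro nn_mult_le) auto
      moreover have "nn c * (\<epsilon> / (2 * (nn c + 1))) \<le> \<epsilon> / 2"
      proof -
        have "a * (\<epsilon> / (2 * (a + 1))) \<le> \<epsilon> / 2" if "a \<ge> 0" for a :: real
          using that \<epsilon> by (simp add: field_simps)
        then show ?thesis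
          by simp
      qed
      ultimately show ?thesis
        using a(3) by linarith
    qed
    ultimately show "\<exists>x'. approx e x' \<and> nn (z - x') < \<epsilon>"
      by blast
  qed
  with ee show ?thesis
    by (simp add: full_def e_def)
qed

lemma full_0: "full 0"
  by (auto simp: full_def cor_def approx_def linv_def)

lemma full_sum:
  assumes "finite A" "\<And>i. i \<in> A \<Longrightarrow> full (f i)"
    "\<And>i j. i \<in> A \<Longrightarrow> j \<in> A \<Longrightarrow> i \<noteq> j \<Longrightarrow> f i * f j = 0"
  shows "full (sum f A)"
  using assms
proof (induction A rule: finite_induct)
  case (insert i A)
  have "f i * sum f A = 0" "sum f A * f i = 0"
    unfolding sum_distrib_left sum_distrib_right using insert by (auto intro!: sum.neutral)
  then show ?case
    using insert by (simp add: full_add)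
qed (simp add: full_0)

text \<open>Equivalent idempotents have isomorphic corners: \<open>s * x * t\<close> carries the
  corner at \<open>q\<close> onto the one at \<open>p\<close>, with inverse
  \<open>t * x * s\<close>. As \<open>s\<close> and \<open>t\<close> are contractions, errors do not
  grow on the way.\<close>

lemma full_transport:
  assumes q: "full q" and s: "t * s = q" "s * t = p" "s * q = s" "q * t = t"
    and nst: "nn s \<le> 1" "nn t \<le> 1"
  shows "full p"
proof -
  have pp: "p * p = p"
    using s by (metis mult.assoc)
  have r: "p * (s * x) = s * x" "x * s * q = x * s" "x * t * p = x * t" "q * (t * x) = t * x"
      "t * (s * x) = q * x" "s * (q * x) = s * x" "t * p = t" "p * s = s" for x
    using s by (metis mult.assoc)+
  have c: "cor p (s * x * t)" if "cor q x" for x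
    using that s r by (simp add: cor_def mult.assoc)
  have n: "nn (s * x * t) \<le> nn x" for x
    using nn_mult_le[OF nn_mult_le[OF nst(1) order_refl] nst(2), of x] by simp
  have "approx p x" if x: "cor p x" for x
    unfolding approx_def
  proof (intro allI impI)
    fix \<epsilon> :: real assume "\<epsilon> > 0"
    have "cor q (t * x * s)"
      using s(3,4) by (simp add: cor_def mult.assoc r)
    then obtain z y where z: "cor q z" "nn (t * x * s - z) < \<epsilon>" "cor q y" "nn (y * z - q) < 1"
      using q \<open>\<epsilon> > 0\<close> by (metis full_def approx_def linv_def)
    have "(s * y * t) * (s * z * t) - p = s * (y * z - q) * t"
      using z s r by (simp add: algebra_simps corD)
    then have "linv p (s * z * t)"
      using n[of "y * z - q"] z c unfolding linv_def by (intro exI[of _ "s * y * t"]) auto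
    moreover have "x - s * z * t = s * (t * x * s - z) * t"
    proof -
      have "s * (t * x * s) * t = p * x * p"
        using s(2) by (simp add: mult.assoc[symmetric]) (simp add: mult.assoc s(2))
      then show ?thesis
        using x by (simp add: algebra_simps cor_def)
    qed
    ultimately show "\<exists>x'. cor p x' \<and> linv p x' \<and> nn (x - x') < \<epsilon>"
      using n[of "t * x * s - z"] z c by (intro exI[of _ "s * z * t"]) auto
  qed
  with pp show ?thesis
    by (simp add: full_def)
qed

end

section \<open>Polynomials and Laurent polynomials in a unitary of a corner\<close>

context seminormed_algebra
begin

text \<open>Powers within the corner at \<open>q\<close>: the power with exponent 0 is
  \<open>q\<close>, as the ambient ring has no unit.\<close>

primrec upow :: "'a \<Rightarrow> 'a \<Rightarrow> nat \<Rightarrow> 'a" where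
  "upow q u 0 = q"
| "upow q u (Suc n) = u * upow q u n"

lemma cor_upow: "q * q = q \<Longrightarrow> cor q u \<Longrightarrow> cor q (upow q u n)"
  by (induction n) auto

lemma upow_add: "q * q = q \<Longrightarrow> cor q u \<Longrightarrow> upow q u (m + n) = upow q u m * upow q u n"
  by (induction m) (simp_all add: corD(1)[OF cor_upow] mult.assoc)

lemma nn_upow: "nn q \<le> 1 \<Longrightarrow> nn u \<le> 1 \<Longrightarrow> nn (upow q u n) \<le> 1"
  by (induction n) (use nn_mult_le in \<open>fastforce simp: mult_le_one\<close>)+

definition peval :: "'a \<Rightarrow> 'a \<Rightarrow> complex poly \<Rightarrow> 'a" where
  "peval q u P = fold_coeffs (\<lambda>a r. sc a * q + u * r) P 0"

lemma peval_0 [simp]: "peval q u 0 = 0"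
  by (simp add: peval_def)

lemma peval_pCons: "peval q u (pCons a P) = sc a * q + u * peval q u P"
  by (cases "P = 0 \<and> a = 0") (auto simp: peval_def)

lemma cor_peval: "q * q = q \<Longrightarrow> cor q u \<Longrightarrow> cor q (peval q u P)"
  by (induction P) (auto simp: peval_pCons)

lemma peval_add: "peval q u (P + Q) = peval q u P + peval q u Q"
proof (induction P arbitrary: Q)
  case (pCons a P)
  obtain b R where "Q = pCons b R"
    by (cases Q)
  then show ?case
    using pCons.IH[of R] by (simp add: peval_pCons sc_add algebra_simps)
qed simp

lemma sc_left_commute: "x * (sc c * y) = sc c * (x * y)"
  by (simp only: mult.assoc[symmetric] sc_comm[of c x])

lemma peval_smult: "peval q u (Polynomial.smult c P) = sc c * peval q u P"
  by (induction P) (simp_all add: peval_pCons sc_mult sc_left_commute[of u] distrib_left mult.assoc)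

lemma peval_mult:
  assumes "q * q = q" "cor q u"
  shows "peval q u (P * Q) = peval q u P * peval q u Q"
proof (induction P)
  case (pCons a P)
  have "q * peval q u Q = peval q u Q"
    using corD[OF cor_peval[OF assms]] by simp
  then show ?case
    using pCons.IH by (simp add: peval_pCons peval_add peval_smult distrib_right mult.assoc)
qed simp

lemma peval_monom:
  assumes "sc 1 * q = q" "q * q = q" "cor q u"
  shows "peval q u (monom 1 n) = upow q u n"
proof (induction n)
  case 0
  then show ?case by (simp add: monom_0 peval_pCons assms)
qed (simp add: monom_Suc peval_pCons)

text \<open>
  By the fundamental theorem of algebra a polynomial in \<open>u\<close> is a product of factors \<open>u - a\<close>, each of
  which is invertible unless \<open>a\<close> lies on the unit circle.
\<close>

lemma approx_peval:
  assumes q: "q * q = q" "sc 1 * q = q" "nn q \<le> 1" and u: "cor q u" "cor q u'" "u' * u = q"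
    and n: "nn u \<le> 1" "nn u' \<le> 1"
  shows "approx q (peval q u P)"
proof -
  have nnsc: "nn (sc c * q) \<le> cmod c" "nn (sc c * u) \<le> cmod c" "nn (sc c * u') \<le> cmod c" for c
    using q(3) n by (simp_all add: nn_sc mult_left_le)
  have qs: "cor q (sc c * q)" for c
    using q by auto
  have const_linv: "linv q (sc c * q)" if "c \<noteq> 0" for c
  proof -
    have "sc (1 / c) * q * (sc c * q) = q"
    proof -
      have "sc (1 / c) * q * (sc c * q) = sc (1 / c) * sc c * (q * q)"
        by (simp only: mult.assoc sc_left_commute[of q])
      then show ?thesis
        using that q by (simp add: sc_mult[symmetric])
    qed
    then show ?thesis
      unfolding linv_def using qs by (intro exI[of _ "sc (1 / c) * q"]) simp
  qed
  have const: "approx q (sc c * q)" for c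
  proof (cases "c = 0")
    case True
    show ?thesis
      unfolding approx_def
    proof (intro allI impI)
      fix \<epsilon> :: real assume "\<epsilon> > 0"
      then have "nn (sc c * q - sc (of_real (\<epsilon> / 2)) * q) < \<epsilon>"
        using nnsc(1)[of "of_real (\<epsilon> / 2)"] True by simp
      then show "\<exists>x'. cor q x' \<and> linv q x' \<and> nn (sc c * q - x') < \<epsilon>"
        using const_linv[of "of_real (\<epsilon> / 2)"] qs \<open>\<epsilon> > 0\<close> by (intro exI[of _ "sc (of_real (\<epsilon> / 2)) * q"]) simp
    qed
  qed (use const_linv qs approx_linv in auto)
  have cu: "cor q (u - sc a * q)" for a
    using u qs by auto
  \<comment> \<open>For \<open>a\<close> inside the unit circle \<open>u'\<close> is a left inverse
    with error of size \<open>cmod a\<close>; outside it the scalar \<open>- 1 / a\<close> is one,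
    with error at most \<open>1 / cmod a\<close>.\<close>
  have lin_linv: "linv q (u - sc a * q)" if "cmod a \<noteq> 1" for a
  proof (cases "cmod a < 1")
    case True
    have "u' * (u - sc a * q) - q = - (sc a * u')"
      using u by (simp add: right_diff_distrib sc_left_commute[of u'] corD)
    then show ?thesis
      unfolding linv_def using True nnsc(3)[of a] u by (intro exI[of _ u']) auto
  next
    case False
    then have a: "cmod a > 1" using that by simp
    then have "a \<noteq> 0" by auto
    then have "sc (- 1 / a) * sc a = - sc 1"
      by (simp add: sc_mult[symmetric] sc_uminus)
    then have *: "sc (- 1 / a) * (sc a * q) = - q"
      using q by (simp add: mult.assoc[symmetric])
    have "sc (- 1 / a) * q * (u - sc a * q) - q = sc (- 1 / a) * u"
      using u q * by (simp add: right_diff_distrib mult.assoc sc_left_commute[of q] corD)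
    moreover have "cmod (- 1 / a) < 1"
      using a by (simp add: norm_divide divide_less_eq)
    ultimately show ?thesis
      unfolding linv_def using nnsc(2)[of "- 1 / a"] qs by (intro exI[of _ "sc (- 1 / a) * q"]) auto
  qed
  have lin: "approx q (u - sc a * q)" for a
  proof (rule approx_lim)
    fix \<epsilon> :: real assume \<epsilon>: "\<epsilon> > 0"
    show "\<exists>x'. approx q x' \<and> nn (u - sc a * q - x') < \<epsilon>"
    proof (cases "cmod a = 1")
      case True
      define b where "b = a * of_real (1 + \<epsilon> / 2)"
      have "cmod b = 1 + \<epsilon> / 2"
        unfolding b_def norm_mult norm_of_real using True \<epsilon> by simp
      moreover have "u - sc a * q - (u - sc b * q) = sc (b - a) * q"
        using sc_add[of b "- a"] by (simp add: sc_uminus left_diff_distrib)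
      moreover have "cmod (b - a) = \<epsilon> / 2"
      proof -
        have "b - a = a * of_real (\<epsilon> / 2)"
          by (simp add: b_def algebra_simps)
        then have "cmod (b - a) = cmod a * \<bar>\<epsilon> / 2\<bar>"
          by (simp only: norm_mult norm_of_real)
        then show ?thesis
          using True \<epsilon> by simp
      qed
      ultimately show ?thesis
        using approx_linv[OF cu lin_linv[of b]] nnsc(1)[of "b - a"] \<epsilon>
        by (intro exI[of _ "u - sc b * q"]) auto
    qed (use approx_linv[OF cu lin_linv[of a]] \<epsilon> in \<open>auto intro!: exI[of _ "u - sc a * q"]\<close>)
  qed
  show ?thesis
  proof (induction "degree P" arbitrary: P rule: less_induct)
    case less
    show ?case
    proof (cases "degree P = 0")
      case True
      then obtain c where "P = [:c:]"
        by (auto elim: degree_eq_zeroE)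
      then show ?thesis
        using const[of c] by (simp add: peval_pCons)
    next
      case False
      then have "\<not> constant (poly P)"
        by (simp add: constant_degree)
      then obtain a where "poly P a = 0"
        using fundamental_theorem_of_algebra by blast
      then obtain R where R: "P = [:- a, 1:] * R"
        by (metis dvdE poly_eq_0_iff_dvd)
      then have "degree P = Suc (degree R)"
        using False by (subst R, subst degree_mult_eq) auto
      then have "approx q (peval q u R)"
        using less by simp
      moreover have "peval q u [:- a, 1:] = u - sc a * q"
        using q corD[OF u(1)] by (simp add: peval_pCons sc_uminus)
      ultimately show ?thesis
        using lin[of a] peval_mult[OF q(1) u(1), of "[:- a, 1:]" R] R approx_mult[OF q(1)] by metis
    qed
  qed
qed

text \<open>A Laurent polynomial is a negative power of \<open>u\<close>, which is left invertible,
  times a polynomial in \<open>u\<close>; limits of left invertible elements are closed under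
  products.\<close>

lemma full_unitary:
  assumes q: "q * q = q" "sc 1 * q = q" "nn q \<le> 1" and u: "cor q u" "cor q u'" "u' * u = q" "u * u' = q"
    and n: "nn u \<le> 1" "nn u' \<le> 1"
    and gen: "\<And>x. cor q x \<Longrightarrow> \<exists>N P. x = upow q u' N * peval q u P"
  shows "full q"
proof -
  have "approx q (upow q u' N)" for N
  proof (induction N)
    case 0
    then show ?case
      using q by (auto simp: linv_def intro!: approx_linv exI[of _ q])
  next
    case (Suc N)
    have "linv q u'"
      using u by (auto simp: linv_def intro!: exI[of _ u])
    then show ?case
      using Suc approx_mult[OF q(1)] approx_linv[OF u(2)] by simp
  qed
  then show ?thesis
    unfolding full_def using q gen approx_mult[OF q(1)] approx_peval[OF q u(1-3) n] by metis
qed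

definition laurent :: "'a \<Rightarrow> 'a \<Rightarrow> 'a \<Rightarrow> 'a set" where
  "laurent q u u' = {upow q u' N * peval q u P | N P. True}"

lemma upow_inverse:
  assumes "q * q = q" "cor q u" "cor q u'" "u' * u = q"
  shows "upow q u' n * upow q u n = q"
proof (induction n)
  case (Suc n)
  have "upow q u' (Suc n) = upow q u' n * u'"
    using upow_add[of q u' n 1] assms by (simp add: corD)
  then have "upow q u' (Suc n) * upow q u (Suc n) = upow q u' n * ((u' * u) * upow q u n)"
    by (simp only: upow.simps mult.assoc)
  also have "\<dots> = q"
    using Suc assms corD[OF cor_upow[OF assms(1,2)]] by simp
  finally show ?case .
qed (use assms in simp)

text \<open>Common denominators: raising the negative exponent by \<open>k\<close> is compensated by
  multiplying the polynomial with the monomial of degree \<open>k\<close>, so both summands can be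
  given the exponent \<open>M + N\<close>.\<close>

lemma laurent_add:
  assumes q: "q * q = q" "sc 1 * q = q" and u: "cor q u" "cor q u'" "u' * u = q"
    and x: "x \<in> laurent q u u'" and y: "y \<in> laurent q u u'"
  shows "x + y \<in> laurent q u u'"
proof -
  obtain M P N Q where xy: "x = upow q u' M * peval q u P" "y = upow q u' N * peval q u Q"
    using x y by (auto simp: laurent_def)
  have shift: "upow q u' M * peval q u P = upow q u' (M + k) * peval q u (monom 1 k * P)" for M k P
  proof -
    have "upow q u' (M + k) * peval q u (monom 1 k * P)
        = upow q u' M * ((upow q u' k * upow q u k) * peval q u P)"
      using u q by (simp add: peval_mult peval_monom upow_add mult.assoc)
    then show ?thesis
      using upow_inverse[OF q(1) u] corD[OF cor_peval[OF q(1) u(1)]] by simp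
  qed
  have "x + y = upow q u' (M + N) * peval q u (monom 1 N * P + monom 1 M * Q)"
    using shift[of M P N] shift[of N Q M] by (simp add: xy peval_add distrib_left add.commute)
  then show ?thesis
    by (auto simp: laurent_def)
qed

lemma laurent_sc: "x \<in> laurent q u u' \<Longrightarrow> sc c * x \<in> laurent q u u'"
  unfolding laurent_def by (clarsimp simp: sc_left_commute[symmetric] peval_smult[symmetric]) blast

lemma laurent_0: "0 \<in> laurent q u u'"
  by (auto simp: laurent_def intro!: exI[of _ 0])

lemma upow_commute:
  assumes "q * q = q" "cor q u" "cor q u'" "u' * u = q" "u * u' = q"
  shows "upow q u m * upow q u' n = upow q u' n * upow q u m"
proof -
  have 1: "u * upow q u' n = upow q u' n * u" for n
  proof (induction n)
    case (Suc n)
    have "u * (u' * upow q u' n) = u' * (u * upow q u' n)"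
      using assms by (metis mult.assoc)
    then show ?case
      using Suc by (simp add: mult.assoc)
  qed (use assms in \<open>simp add: cor_def\<close>)
  show ?thesis
  proof (induction m)
    case 0
    then show ?case
      using corD[OF cor_upow[OF assms(1,3)]] by simp
  next
    case (Suc m)
    then show ?case
      using 1[of n] by (simp add: mult.assoc) (simp add: mult.assoc[symmetric])
  qed
qed

lemma laurent_upow:
  assumes "q * q = q" "sc 1 * q = q" "cor q u" "cor q u'" "u' * u = q" "u * u' = q"
  shows "upow q u m * upow q u' n \<in> laurent q u u'"
  unfolding laurent_def upow_commute[OF assms(1,3-6)]
  by (rule CollectI, intro exI[of _ n] exI[of _ "monom 1 m"])
     (simp only: peval_monom[OF assms(2,1,3)])

end

section \<open>Projections with sum a projection\<close>

text \<open>A null element is required to vanish only after multiplication by \<open>sc 1\<close>: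
  the seminorm used on \<open>quo\<close> sees a single factor, and an element living in the other
  factors is null without being 0.\<close>

locale cstar_seminormed = seminormed_algebra nn sc
  for nn :: "'a::ring \<Rightarrow> real" and sc :: "complex \<Rightarrow> 'a" +
  fixes star :: "'a \<Rightarrow> 'a"
  assumes star_add: "star (x + y) = star x + star y"
    and star_mult: "star (x * y) = star y * star x"
    and star_star [simp]: "star (star x) = x"
    and star_sc: "star (sc c) = sc (cnj c)"
    and cstar: "nn (star x * x) = (nn x)\<^sup>2"
    and nn_eq_0: "nn x = 0 \<Longrightarrow> sc 1 * x = 0"
begin

lemma star_0 [simp]: "star 0 = 0"
  using star_add[of 0 0] by simp

lemma star_uminus: "star (- x) = - star x"
  using star_add[of x "- x"] minus_unique[of "star x" "star (- x)"] by simp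

lemma star_diff: "star (x - y) = star x - star y"
  using star_add[of x "- y"] by (simp add: star_uminus)

lemma nn_star: "nn (star x) = nn x"
proof -
  have "nn x \<le> nn (star x)" for x
    using nn_mult[of "star x" x] nn_nonneg[of x] nn_nonneg[of "star x"]
    unfolding cstar power2_eq_square by (cases "nn x = 0") auto
  from this[of x] this[of "star x"] show ?thesis
    by simp
qed

definition proj :: "'a \<Rightarrow> bool" where
  "proj p \<longleftrightarrow> star p = p \<and> p * p = p"

lemma nn_proj: "proj p \<Longrightarrow> nn p \<le> 1"
  using cstar[of p] nn_nonneg[of p] by (auto simp: proj_def power2_eq_square)

lemma nn_partial_isometry: "proj (star s * s) \<Longrightarrow> nn s \<le> 1"
  using nn_proj[of "star s * s"] nn_nonneg[of s] by (simp add: cstar abs_square_le_1)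

text \<open>The binomial expansion, with coefficients independent of \<open>s\<close>. The higher
  ones remain unspecified, since the averaging that follows removes all but the linear one.\<close>

lemma upow_expansion:
  assumes p: "p * p = p" "sc 1 * p = p" and x: "cor p x"
  shows "\<exists>B. (\<forall>s. upow p (p + sc s * x) n = (\<Sum>k\<le>n. sc (s ^ k) * B k)) \<and>
    (\<forall>k. cor p (B k)) \<and> B 0 = p \<and> B (Suc 0) = sc (of_nat n) * x \<and> (\<forall>k>n. B k = 0)"
proof (induction n)
  case 0
  show ?case
    using p by (intro exI[of _ "\<lambda>k. if k = 0 then p else 0"]) auto
next
  case (Suc n)
  then obtain B where B: "\<And>s. upow p (p + sc s * x) n = (\<Sum>k\<le>n. sc (s ^ k) * B k)"
    "\<And>k. cor p (B k)" "B 0 = p" "B (Suc 0) = sc (of_nat n) * x" "\<And>k. k > n \<Longrightarrow> B k = 0"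
    by auto
  have 1: "sc 1 * x = x"
    using p x by (metis cor_def mult.assoc)
  define B' where "B' k = (case k of 0 \<Rightarrow> p | Suc j \<Rightarrow> B (Suc j) + x * B j)" for k
  have "upow p (p + sc s * x) (Suc n) = (\<Sum>k\<le>Suc n. sc (s ^ k) * B' k)" for s
  proof -
    have "(\<Sum>k\<le>Suc n. sc (s ^ k) * B' k)
        = p + (\<Sum>k\<le>n. sc (s ^ Suc k) * B (Suc k)) + (\<Sum>k\<le>n. sc (s ^ Suc k) * (x * B k))"
      by (subst sum.atMost_Suc_shift) (simp add: B'_def p distrib_left sum.distrib)
    also have "(\<Sum>k\<le>n. sc (s ^ Suc k) * (x * B k)) = sc s * x * (\<Sum>k\<le>n. sc (s ^ k) * B k)"
      unfolding sum_distrib_left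
      by (intro sum.cong) (auto simp: sc_mult sc_left_commute[of x] mult.assoc)
    also have "p + (\<Sum>k\<le>n. sc (s ^ Suc k) * B (Suc k)) = (\<Sum>k\<le>Suc n. sc (s ^ k) * B k)"
      by (subst sum.atMost_Suc_shift) (simp add: B p)
    also have "\<dots> = p * (\<Sum>k\<le>n. sc (s ^ k) * B k)"
      using B(2,5) by (simp add: sum_distrib_left sc_left_commute[of p] corD)
    finally show ?thesis
      by (simp add: B(1) distrib_right)
  qed
  moreover have "B' (Suc 0) = sc (of_nat (Suc n)) * x"
    using B(3,4) corD[OF x] by (simp add: B'_def sc_add distrib_right 1)
  moreover have "\<forall>k. cor p (B' k)"
    using B(2) p x by (auto simp: B'_def split: nat.splits)
  moreover have "\<forall>k>Suc n. B' k = 0"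
    using B(5) by (auto simp: B'_def split: nat.splits)
  ultimately show ?case
    by (intro exI[of _ B']) (simp add: B'_def)
qed

text \<open>
  In a \<open>C\<^sup>*\<close>-algebra this is clear from the spectrum. Without completeness: the assumption
  passes to \<open>\<parallel>1 + s x\<parallel> \<le> 1\<close> for all small complex \<open>s\<close>, and averaging \<open>(1 + s x)^n\<close> over roots of unity
  extracts its linear coefficient \<open>n x\<close>, which is therefore bounded independently of \<open>n\<close>.
\<close>

lemma selfadjoint_extreme:
  assumes p: "proj p" "sc 1 * p = p" and x: "cor p x" "star x = x"
    and b: "nn (p + x) \<le> 1" "nn (p - x) \<le> 1"
  shows "nn x = 0"
proof -
  have pp: "p * p = p" "star p = p"
    using p by (simp_all add: proj_def)
  have e1: "sc 1 * x = x"
    using p x(1) by (metis cor_def mult.assoc)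
  \<comment> \<open>\<open>p + x * x\<close> is the mean of the squares of \<open>p + x\<close> and
    \<open>p - x\<close>.\<close>
  have sq: "nn (p + x * x) \<le> 1"
  proof -
    have "sc 2 * (p + x * x) = (p + x) * (p + x) + (p - x) * (p - x)"
      using sc_add[of 1 1] p corD[OF x(1)] pp e1 by (simp add: algebra_simps) (metis e1 mult.assoc)
    then have "2 * nn (p + x * x) \<le> nn ((p + x) * (p + x)) + nn ((p - x) * (p - x))"
      using nn_sc[of 2 "p + x * x"] nn_add[of "(p + x) * (p + x)" "(p - x) * (p - x)"] by simp
    then show ?thesis
      using nn_mult_le[OF b(1) b(1)] nn_mult_le[OF b(2) b(2)] by simp
  qed
  \<comment> \<open>For \<open>c\<close> equal to plus or minus the imaginary unit the product of
    \<open>p + sc c * x\<close> with its adjoint is \<open>p + x * x\<close>, so the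
    \<open>C*\<close>-identity reduces this to the bound just shown.\<close>
  have im: "nn (p + sc c * x) \<le> 1" if "c = \<i> \<or> c = - \<i>" for c
  proof -
    have cc: "cnj c = - c" "c * c = - 1"
      using that by auto
    have "star (p + sc c * x) * (p + sc c * x) = (p - sc c * x) * (p + sc c * x)"
      using x pp cc by (simp add: star_add star_mult star_sc sc_uminus sc_comm)
    also have "\<dots> = p - sc (c * c) * (x * x)"
      using corD[OF x(1)] pp
      by (simp add: algebra_simps sc_left_commute[of p] sc_left_commute[of x] sc_mult)
    also have "\<dots> = p + x * x"
      using e1 unfolding cc by (simp add: sc_uminus mult.assoc[symmetric])
    finally have "(nn (p + sc c * x))\<^sup>2 \<le> 1"
      using sq cstar[of "p + sc c * x"] by simp
    then show ?thesis
      by (simp add: abs_square_le_1)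
  qed
  have re: "nn (p + sc c * x) \<le> 1" if "c = 1 \<or> c = - 1" for c
    using that b e1 by (auto simp: sc_uminus)
  \<comment> \<open>\<open>p + sc s * x\<close> is a convex combination of \<open>p\<close>, of one
    of \<open>p + x\<close> and \<open>p - x\<close>, and of one of their analogues with an
    imaginary factor. The radius 1/2 ensures that the absolute values of the real and imaginary
    parts of \<open>s\<close> add up to at most 1.\<close>
  have cx: "nn (p + sc s * x) \<le> 1" if s: "cmod s \<le> 1 / 2" for s
  proof -
    define a c where "a = Re s" and "c = Im s"
    have ac: "\<bar>a\<bar> + \<bar>c\<bar> \<le> 1"
      using abs_Re_le_cmod[of s] abs_Im_le_cmod[of s] s by (simp add: a_def c_def)
    define t where "t = 1 - \<bar>a\<bar> - \<bar>c\<bar>"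
    define A C where "A = (if a < 0 then - 1 else 1 :: complex)" and "C = (if c < 0 then - \<i> else \<i>)"
    have s_eq: "s = of_real \<bar>a\<bar> * A + of_real \<bar>c\<bar> * C"
      by (auto simp: complex_eq_iff A_def C_def a_def c_def)
    have "p + sc s * x = sc (of_real \<bar>a\<bar>) * (p + sc A * x) + sc (of_real \<bar>c\<bar>) * (p + sc C * x) + sc (of_real t) * p"
    proof -
      have "sc (of_real \<bar>a\<bar>) * p + sc (of_real \<bar>c\<bar>) * p + sc (of_real t) * p = p"
        using p(2) by (simp add: distrib_right[symmetric] sc_add[symmetric] t_def)
      moreover have "sc s * x = sc (of_real \<bar>a\<bar>) * (sc A * x) + sc (of_real \<bar>c\<bar>) * (sc C * x)"
        by (subst s_eq) (simp add: sc_add sc_mult distrib_right mult.assoc)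
      ultimately show ?thesis
        by (simp add: distrib_left add_ac)
    qed
    then have "nn (p + sc s * x) \<le> nn (sc (of_real \<bar>a\<bar>) * (p + sc A * x))
        + nn (sc (of_real \<bar>c\<bar>) * (p + sc C * x)) + nn (sc (of_real t) * p)"
      by (metis nn_add add_right_mono order_trans)
    also have "\<dots> \<le> \<bar>a\<bar> * 1 + \<bar>c\<bar> * 1 + \<bar>t\<bar> * 1"
      unfolding nn_sc norm_of_real abs_idempotent
      using re[of A] im[of C] nn_proj[OF p(1)]
      by (intro add_mono mult_left_mono) (auto simp: A_def C_def)
    finally show ?thesis
      using ac by (simp add: t_def)
  qed
  have main: "real n * nn x \<le> 2" if n: "n > 0" for n
  proof -
    obtain B where B: "\<And>s. upow p (p + sc s * x) n = (\<Sum>k\<le>n. sc (s ^ k) * B k)"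
      "\<And>k. cor p (B k)" "B (Suc 0) = sc (of_nat n) * x"
      using upow_expansion[OF pp(1) p(2) x(1), of n] by blast
    \<comment> \<open>With \<open>n + 1\<close> roots of unity the weight \<open>w j ^ n\<close> is
      the inverse of \<open>w j\<close>. The sum of \<open>w j ^ (k + n)\<close> over
      \<open>j\<close> vanishes unless \<open>N\<close> divides \<open>k + n\<close>, which for
      \<open>k \<le> n\<close> happens only at \<open>k = 1\<close>. The points
      \<open>w j / 2\<close> lie on the radius where \<open>cx\<close> applies; this is the origin
      of the bound 2.\<close>
    define N where "N = Suc n"
    define w where "w j = exp (2 * of_real pi * \<i> * of_nat j / of_nat N)" for j
    have w_pow: "w j = w 1 ^ j" for j
      by (simp add: w_def exp_of_nat_mult[symmetric] algebra_simps)
    have w_norm: "cmod (w j) = 1" for j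
      by (simp add: w_def norm_exp_eq_Re)
    have orth: "(\<Sum>j<N. w j ^ (k + n)) = (if k = 1 then of_nat N else 0)" if k: "k \<le> n" for k
    proof -
      define r where "r = w (k + n)"
      have r: "w j ^ (k + n) = r ^ j" for j
        unfolding r_def by (subst w_pow, subst (2) w_pow) (simp add: power_mult[symmetric] mult.commute)
      have "r = 1 \<longleftrightarrow> N dvd k + n"
        unfolding r_def w_def using complex_root_unity_eq_1[of N "k + n"] by (simp add: N_def)
      also have "\<dots> \<longleftrightarrow> k = 1"
      proof
        assume "N dvd k + n"
        then obtain d where d: "k + n = N * d" by auto
        then have "d > 0" using n by (cases d) auto
        moreover have "d < 2"
        proof (rule ccontr)
          assume "\<not> d < 2"
          then have "N * 2 \<le> N * d" by (intro mult_le_mono) auto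
          then show False using d k by (simp add: N_def)
        qed
        ultimately have "d = 1" by simp
        then show "k = 1" using d by (simp add: N_def)
      qed (simp add: N_def)
      finally have r1: "r = 1 \<longleftrightarrow> k = 1" .
      have rN: "r ^ N = 1"
        unfolding r_def w_def using complex_root_unity[of N "k + n"] by (simp add: N_def)
      show ?thesis
      proof (cases "k = 1")
        case True
        then have "w j ^ (k + n) = 1" for j
          unfolding r using True r1 by simp
        then show ?thesis using True by (simp only:) simp
      next
        case False
        then have "r \<noteq> 1" using r1 by simp
        then show ?thesis
          using False rN by (simp add: r geometric_sum)
      qed
    qed
    have "(\<Sum>j<N. sc (w j ^ n) * upow p (p + sc (w j / 2) * x) n)
        = (\<Sum>j<N. \<Sum>k\<le>n. sc (w j ^ (k + n)) * (sc (1 / 2 ^ k) * B k))"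
      unfolding B(1) sum_distrib_left
      by (intro sum.cong refl)
         (simp add: mult.assoc[symmetric] sc_mult[symmetric] power_divide power_add mult.commute)
    also have "\<dots> = (\<Sum>k\<le>n. sc (\<Sum>j<N. w j ^ (k + n)) * (sc (1 / 2 ^ k) * B k))"
    proof -
      have scs: "sc (sum f J) = (\<Sum>j\<in>J. sc (f j))" for f :: "nat \<Rightarrow> complex" and J
        by (induction J rule: infinite_finite_induct) (simp_all add: sc_add)
      show ?thesis
        by (subst sum.swap) (simp add: scs sum_distrib_right)
    qed
    also have "\<dots> = (\<Sum>k\<le>n. if k = 1 then sc (of_nat N) * (sc (1 / 2) * B 1) else 0)"
      by (intro sum.cong refl) (simp add: orth)
    also have "\<dots> = sc (of_nat N) * (sc (1 / 2) * B 1)"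
      using n by (simp add: sum.delta)
    also have "\<dots> = sc (of_nat N * (1 / 2) * of_nat n) * x"
      by (simp only: One_nat_def B(3) sc_mult mult.assoc)
    finally have "nn (sc (of_nat N * (1 / 2) * of_nat n) * x)
        \<le> (\<Sum>j<N. nn (sc (w j ^ n) * upow p (p + sc (w j / 2) * x) n))"
      using nn_sum[of "\<lambda>j. sc (w j ^ n) * upow p (p + sc (w j / 2) * x) n" "{..<N}"] by (simp only:)
    also have "\<dots> \<le> (\<Sum>j<N. 1)"
    proof (intro sum_mono)
      fix j
      have "nn (p + sc (w j / 2) * x) \<le> 1"
        by (rule cx) (simp add: norm_divide w_norm)
      then show "nn (sc (w j ^ n) * upow p (p + sc (w j / 2) * x) n) \<le> 1"
        using nn_upow[OF nn_proj[OF p(1)]] by (simp add: nn_sc norm_power w_norm)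
    qed
    finally have "real N * (1/2) * real n * nn x \<le> real N"
      by (simp add: nn_sc norm_mult norm_divide)
    then have "real N * (real n * nn x) \<le> real N * 2"
      by simp
    then show ?thesis
      by (subst (asm) mult_le_cancel_left_pos) (simp_all add: N_def)
  qed
  show ?thesis
  proof (rule ccontr)
    assume "nn x \<noteq> 0"
    then have "nn x > 0" using nn_nonneg[of x] by linarith
    then obtain n :: nat where "real n * nn x > 2"
      using reals_Archimedean3 by blast
    moreover have "n > 0"
      using calculation by (cases n) auto
    ultimately show False
      using main[of n] by simp
  qed
qed

text \<open>Compress to the corner at \<open>p i\<close>: the elements
  \<open>h l = p i * p l * p i\<close> with \<open>l \<noteq> i\<close> sum to zero, and each
  \<open>p i - h l\<close> is a compression of the projection \<open>f - p l\<close>, hence a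
  contraction. If there are \<open>m\<close> such indices, then \<open>- h j\<close> is the sum of
  the other \<open>h l\<close>, so \<open>m\<close> times \<open>p i\<close> plus \<open>h j\<close>
  is a sum of \<open>m\<close> contractions; the same holds for the difference. Thus
  \<open>h j\<close> divided by \<open>m\<close> satisfies \<open>selfadjoint_extreme\<close> and is
  null, and \<open>h j\<close> is the product of \<open>p j * p i\<close> with its adjoint.\<close>

lemma proj_sum_orthogonal:
  assumes A: "finite A" and p: "\<And>i. i \<in> A \<Longrightarrow> proj (p i)" "\<And>i. i \<in> A \<Longrightarrow> cor f (p i)"
    and f: "proj f" "sc 1 * f = f" "(\<Sum>i\<in>A. p i) = f"
    and ij: "i \<in> A" "j \<in> A" "i \<noteq> j"
  shows "p i * p j = 0"
proof -
  define h where "h l = p i * p l * p i" for l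
  define B where "B = A - {i}"
  define m where "m = card B"
  have B: "finite B" "j \<in> B"
    using A ij by (auto simp: B_def)
  then have m: "m > 0"
    by (auto simp: m_def card_gt_0_iff)
  have pi: "p i * p i = p i" "star (p i) = p i" "p i * (p i * z) = p i * z" for z
    using p(1)[OF ij(1)] by (simp_all add: proj_def mult.assoc[symmetric])
  have unit: "sc 1 * p i = p i"
    using p(2)[OF ij(1)] f(2) by (metis cor_def mult.assoc)
  have sum0: "(\<Sum>l\<in>B. h l) = 0"
  proof -
    have "(\<Sum>l\<in>A. h l) = p i * f * p i"
      by (simp add: h_def f(3)[symmetric] sum_distrib_left sum_distrib_right)
    also have "\<dots> = h i"
      using p(2)[OF ij(1)] pi by (simp add: h_def cor_def mult.assoc)
    finally show ?thesis
      using A ij(1) by (simp add: B_def sum_diff1)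
  qed
  have le1: "nn (p i - h l) \<le> 1" if "l \<in> B" for l
  proof -
    have l: "proj (p l)" "cor f (p l)"
      using that p by (auto simp: B_def)
    then have "proj (f - p l)"
      using f(1) by (auto simp: proj_def cor_def algebra_simps star_diff)
    moreover have "p i - h l = p i * (f - p l) * p i"
      using p(2)[OF ij(1)] pi by (simp add: h_def cor_def algebra_simps)
    ultimately show ?thesis
      using nn_mult_le[OF nn_mult_le[OF nn_proj[OF p(1)[OF ij(1)]] nn_proj] nn_proj[OF p(1)[OF ij(1)]]]
      by simp
  qed
  define x where "x = sc (1 / of_nat m) * h j"
  have hj: "cor (p i) (h j)" "star (h j) = h j"
    using pi p(1)[of j] ij by (simp_all add: h_def cor_def star_mult proj_def mult.assoc)
  have of_nat_sc: "sc (of_nat n) * p i = (\<Sum>l<n. p i)" for n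
    by (induction n) (simp_all add: sc_add distrib_right unit add.commute)
  have scm: "sc (1 / of_nat m) * (sc (of_nat m) * z) = sc 1 * z" for z
    using m by (simp add: mult.assoc[symmetric] sc_mult[symmetric])
  have "nn x = 0"
  proof (rule selfadjoint_extreme[OF p(1)[OF ij(1)] unit])
    show "cor (p i) x"
      using hj by (auto simp: x_def)
    show "star x = x"
      using hj by (simp add: x_def star_mult star_sc sc_comm)
    have "sc (of_nat m) * p i + h j = (\<Sum>l\<in>B - {j}. p i - h l) + p i"
    proof -
      have "(\<Sum>l\<in>B - {j}. p i) + p i = (\<Sum>l\<in>B. p i)"
        using B by (simp add: sum.remove[of B j] add.commute)
      also have "\<dots> = sc (of_nat m) * p i"
        using sum.reindex_bij_betw[OF bij_betw_from_nat_into_finite[OF B(1)], of "\<lambda>_. p i"]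
        by (simp add: of_nat_sc m_def)
      finally have "(\<Sum>l\<in>B - {j}. p i) + p i = sc (of_nat m) * p i" .
      moreover have "(\<Sum>l\<in>B - {j}. h l) = - h j"
        using sum0 sum.remove[OF B, of h] by (simp add: eq_neg_iff_add_eq_0 add.commute)
      ultimately show ?thesis
        by (simp add: sum_subtractf algebra_simps)
    qed
    then have "nn (sc (of_nat m) * p i + h j) \<le> (\<Sum>l\<in>B - {j}. nn (p i - h l)) + nn (p i)"
      using nn_add[of "\<Sum>l\<in>B - {j}. p i - h l" "p i"] nn_sum[of "\<lambda>l. p i - h l" "B - {j}"] by simp
    also have "\<dots> \<le> (\<Sum>l\<in>B - {j}. 1) + 1"
      using le1 nn_proj[OF p(1)[OF ij(1)]] by (intro add_mono sum_mono) auto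
    also have "\<dots> = real m"
      using B m by (simp add: m_def)
    finally have 1: "nn (sc (of_nat m) * p i + h j) \<le> real m" .
    have "p i + x = sc (1 / of_nat m) * (sc (of_nat m) * p i + h j)"
      by (simp add: x_def distrib_left scm unit)
    then have "nn (p i + x) = nn (sc (of_nat m) * p i + h j) / real m"
      by (simp add: nn_sc norm_divide)
    then show "nn (p i + x) \<le> 1"
      using 1 m by (simp add: divide_le_eq)
    have "sc (of_nat m) * p i - h j = sc (of_nat (m - 1)) * p i + (p i - h j)"
    proof -
      have "sc (of_nat m) * p i = sc (of_nat (m - 1)) * p i + p i"
        using m by (cases m) (simp_all add: sc_add distrib_right unit add.commute)
      then show ?thesis by simp
    qed
    then have "nn (sc (of_nat m) * p i - h j) \<le> nn (sc (of_nat (m - 1)) * p i) + nn (p i - h j)"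
      by (metis nn_add)
    also have "\<dots> \<le> real (m - 1) * 1 + 1"
      unfolding nn_sc norm_of_nat using le1[OF B(2)] nn_proj[OF p(1)[OF ij(1)]]
      by (intro add_mono mult_left_mono) auto
    finally have 2: "nn (sc (of_nat m) * p i - h j) \<le> real m"
      using m by (simp add: of_nat_diff)
    have "p i - x = sc (1 / of_nat m) * (sc (of_nat m) * p i - h j)"
      by (simp add: x_def right_diff_distrib scm unit)
    then have "nn (p i - x) = nn (sc (of_nat m) * p i - h j) / real m"
      by (simp add: nn_sc norm_divide)
    then show "nn (p i - x) \<le> 1"
      using 2 m by (simp add: divide_le_eq)
  qed
  then have "nn (h j) = 0"
    using m by (simp add: x_def nn_sc)
  moreover have "h j = star (p j * p i) * (p j * p i)"
    using pi p(1)[of j] ij by (simp add: h_def star_mult proj_def mult.assoc)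
      (simp add: mult.assoc[symmetric])
  ultimately have "nn (p j * p i) = 0"
    using cstar[of "p j * p i"] by simp
  then have "nn (p i * p j) = 0"
    using nn_star[of "p j * p i"] pi p(1)[of j] ij by (simp add: star_mult proj_def)
  then show ?thesis
    using nn_eq_0 unit by (metis mult.assoc)
qed

end

text \<open>The null elements of a \<open>C*\<close>-seminorm form a \<open>*\<close>-ideal, and the
  seminorm is constant on its cosets, so it descends to the factor of \<open>quo\<close> at this
  ideal. Multiplication by \<open>emb i 1\<close> is the projection onto that factor.\<close>

lemma quo_cstar_seminormed:
  fixes nn :: "'a::ring_1 \<Rightarrow> real" and sc :: "complex \<Rightarrow> 'a" and star :: "'a \<Rightarrow> 'a"
  assumes "seminormed_algebra nn sc" and sc1: "sc 1 = 1"
    and star: "\<And>x y. star (x + y) = star x + star y" "\<And>x y. star (x * y) = star y * star x"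
      "\<And>x. star (star x) = x" "\<And>c. star (sc c) = sc (cnj c)"
    and cstar: "\<And>x. nn (star x * x) = (nn x)\<^sup>2" and nn_star: "\<And>x. nn (star x) = nn x"
  defines "i \<equiv> ({x. nn x = 0}, star)"
  shows "cstar_seminormed (\<lambda>F. nn (quo_comp i F)) (\<lambda>c. emb i (sc c)) quo_star"
    and "star_ideal i"
    and "\<And>x. nn (quo_comp i (emb i x)) = nn x"
    and "\<And>x y. emb i x = emb i y \<longleftrightarrow> nn (x - y) = 0"
    and "\<And>F. emb i 1 * F = emb i (quo_comp i F)"
proof -
  interpret seminormed_algebra nn sc by fact
  have null: "nn x = 0" if "nn x \<le> 0" for x
    using that nn_nonneg[of x] by simp
  have nullm: "nn (x * y) = 0 \<and> nn (y * x) = 0" if "nn x = 0" for x y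
    using nn_mult[of x y] nn_mult[of y x] that by (auto intro!: null)
  have nulld: "nn (x - y) = 0" if "nn x = 0" "nn y = 0" for x y
    using nn_diff[of x y] that by (auto intro!: null)
  show i: "star_ideal i"
    unfolding star_ideal_def i_def using nullm nulld star nn_star by simp
  have cong: "nn x = nn y" if "x - y \<in> fst i" for x y
    using that nn_add[of "x - y" y] nn_add[of "y - x" x] nn_diff_commute[of x y] by (simp add: i_def)
  show "nn (quo_comp i (emb i x)) = nn x" for x
    by (rule cong[OF quo_comp_emb[OF i]])
  show emb_eq: "emb i x = emb i y \<longleftrightarrow> nn (x - y) = 0" for x y
    using emb_eq_iff[OF i] by (simp add: i_def)
  have e: "emb i 1 * F = emb i (quo_comp i (emb i 1 * F))" for F
    by (rule emb_quo_comp[OF i, of 1, symmetric]) (simp_all add: mult.assoc[symmetric] emb_mult[symmetric] i_def)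
  show unit: "emb i 1 * F = emb i (quo_comp i F)" for F
  proof -
    have 1: "quo_comp i (emb i 1 * F) - quo_comp i (emb i 1) * quo_comp i F \<in> fst i"
      by (rule quo_comp_mult[OF i])
    have "(quo_comp i (emb i 1) - 1) * quo_comp i F \<in> fst i"
      using quo_comp_emb[OF i, of 1] i by (simp add: star_idealD)
    from star_idealD(10)[OF i 1 this] have "emb i (quo_comp i (emb i 1 * F)) = emb i (quo_comp i F)"
      using emb_eq_iff[OF i] by (simp add: algebra_simps)
    then show ?thesis
      using e by simp
  qed
  show "cstar_seminormed (\<lambda>F. nn (quo_comp i F)) (\<lambda>c. emb i (sc c)) quo_star"
  proof
    fix F G c d
    show "nn (quo_comp i (F + G)) \<le> nn (quo_comp i F) + nn (quo_comp i G)"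
      using cong[OF quo_comp_add[OF i, of F G]] nn_add by metis
    show "nn (quo_comp i (F * G)) \<le> nn (quo_comp i F) * nn (quo_comp i G)"
      using cong[OF quo_comp_mult[OF i, of F G]] nn_mult by metis
    show "nn (quo_comp i (emb i (sc c) * F)) = cmod c * nn (quo_comp i F)"
    proof -
      have 1: "quo_comp i (emb i (sc c) * F) - quo_comp i (emb i (sc c)) * quo_comp i F \<in> fst i"
        by (rule quo_comp_mult[OF i])
      have "(quo_comp i (emb i (sc c)) - sc c) * quo_comp i F \<in> fst i"
        using quo_comp_emb[OF i, of "sc c"] i by (simp add: star_idealD)
      from star_idealD(10)[OF i 1 this] have "quo_comp i (emb i (sc c) * F) - sc c * quo_comp i F \<in> fst i"
        by (simp add: algebra_simps)
      then show ?thesis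
        using cong nn_sc by metis
    qed
    show "emb i (sc (c + d)) = emb i (sc c) + emb i (sc d)" "emb i (sc (c * d)) = emb i (sc c) * emb i (sc d)"
      by (simp_all add: sc_add sc_mult emb_add emb_mult)
    have "\<forall>x. sc c * x = x * sc c"
      using sc_comm by blast
    then show "emb i (sc c) * F = F * emb i (sc c)"
      by transfer (simp add: star_idealD del: split_paired_All)
    show "quo_star (F + G) = quo_star F + quo_star G" "quo_star (F * G) = quo_star G * quo_star F"
      by (fact quo_star_add quo_star_mult)+
    show "quo_star (emb i (sc c)) = emb i (sc (cnj c))"
      by (simp add: emb_star) (simp add: i_def star)
    show "nn (quo_comp i (quo_star F * F)) = (nn (quo_comp i F))\<^sup>2"
    proof -
      have 1: "quo_comp i (quo_star F * F) - quo_comp i (quo_star F) * quo_comp i F \<in> fst i"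
        by (rule quo_comp_mult[OF i])
      have "(quo_comp i (quo_star F) - star (quo_comp i F)) * quo_comp i F \<in> fst i"
        using quo_comp_star[OF i, of F] star_idealD(3)[OF i] by (simp add: i_def)
      from star_idealD(10)[OF i 1 this]
      have "quo_comp i (quo_star F * F) - star (quo_comp i F) * quo_comp i F \<in> fst i"
        by (simp add: algebra_simps)
      then show ?thesis
        using cong cstar by metis
    qed
    show "emb i (sc 1) * F = 0" if "nn (quo_comp i F) = 0"
      using that emb_eq[of "quo_comp i F" 0] by (simp add: sc1 unit)
  qed simp
qed

section \<open>The free algebra\<close>

lemma star_poly_sum: "f = (\<Sum>w\<in>Poly_Mapping.keys f. Poly_Mapping.single w (Poly_Mapping.lookup f w))"
  by (rule poly_mapping_eqI)
     (auto simp: lookup_sum lookup_single when_def sum.delta in_keys_iff)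

lemma star_poly_induct [case_names single add]:
  fixes f :: "'m star_poly"
  assumes "\<And>w c. P (Poly_Mapping.single w c)" "\<And>f g. P f \<Longrightarrow> P g \<Longrightarrow> P (f + g)"
  shows "P f"
proof -
  have "P (\<Sum>w\<in>A. Poly_Mapping.single w (Poly_Mapping.lookup f w))" for A
    by (induction A rule: infinite_finite_induct) (use assms assms(1)[of 0 0] in auto)
  then show ?thesis
    by (subst star_poly_sum)
qed

lemma word_adj_adj [simp]: "word_adj (word_adj w) = (w :: 'm word)"
proof -
  have "letter_adj \<circ> letter_adj = (id :: 'm letter \<Rightarrow> 'm letter)"
    by (rule ext, rename_tac l, case_tac l) auto
  then show ?thesis
    by (cases w) (simp add: word_adj_def rev_map)
qed

lemma word_adj_plus: "word_adj (v + w) = word_adj w + word_adj v"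
  by (simp add: word_adj_def plus_word_def)

lemma word_adj_0 [simp]: "word_adj 0 = 0"
  by (simp add: word_adj_def zero_word_def)

lemma word_eq_0_iff: "w = 0 \<longleftrightarrow> letters w = []"
  by (cases w) (simp add: zero_word_def)

lemma letters_plus [simp]: "letters (v + w) = letters v @ letters w"
  by (simp add: plus_word_def)

lemma word_plus_eq_0_iff: "0 = v + w \<longleftrightarrow> v = 0 \<and> w = 0" for v w :: "'m word"
  by (simp only: eq_commute[of 0] word_eq_0_iff) simp

lemma lookup_poly_adj: "Poly_Mapping.lookup (poly_adj f) w = cnj (Poly_Mapping.lookup f (word_adj w))"
proof -
  have "word_adj v = w \<longleftrightarrow> v = word_adj w" for v
    by auto
  then show ?thesis
    by (auto simp: poly_adj_def lookup_sum lookup_single when_def sum.delta in_keys_iff)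
qed

lemma poly_adj_add: "poly_adj (f + g) = poly_adj f + poly_adj g"
  by (rule poly_mapping_eqI) (simp add: lookup_poly_adj lookup_add)

lemma poly_adj_single [simp]: "poly_adj (Poly_Mapping.single w c) = Poly_Mapping.single (word_adj w) (cnj c)"
  by (rule poly_mapping_eqI) (auto simp: lookup_poly_adj lookup_single when_def)

lemma poly_adj_adj [simp]: "poly_adj (poly_adj f) = f"
  by (rule poly_mapping_eqI) (simp add: lookup_poly_adj)

lemma poly_adj_mult: "poly_adj (f * g) = poly_adj g * poly_adj f"
proof (induction f rule: star_poly_induct)
  case (single w c)
  show ?case
    by (induction g rule: star_poly_induct)
       (simp_all add: mult_single word_adj_plus distrib_left distrib_right poly_adj_add mult.commute)
qed (simp add: distrib_left distrib_right poly_adj_add)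

lemma poly_adj_0 [simp]: "poly_adj 0 = 0"
  by (simp add: poly_adj_def)

lemma poly_adj_diff: "poly_adj (f - g) = poly_adj f - poly_adj g"
  by (rule poly_mapping_eqI) (simp add: lookup_poly_adj lookup_minus)

lemma poly_adj_sum: "poly_adj (sum f A) = (\<Sum>a\<in>A. poly_adj (f a))"
  by (induction A rule: infinite_finite_induct) (simp_all add: poly_adj_add)

lemma scalar_commute: "Poly_Mapping.single 0 c * f = f * Poly_Mapping.single (0 :: 'm word) (c :: complex)"
  by (induction f rule: star_poly_induct) (simp_all add: mult_single distrib_left distrib_right mult.commute)

lemma poly_scale_minus_one: "poly_scale (- 1) f = - f"
  by (simp add: poly_scale_def single_uminus)

lemma poly_scale_scale: "poly_scale c (poly_scale d f) = poly_scale (c * d) f"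
  by (simp add: poly_scale_def mult.assoc[symmetric] mult_single)

lemma poly_scale_1 [simp]: "poly_scale 1 f = f"
  by (simp add: poly_scale_def)

lemma single_Cons: "Poly_Mapping.single (Word (l # ls)) (1::complex)
    = Poly_Mapping.single (Word [l]) 1 * Poly_Mapping.single (Word ls) 1"
  by (simp add: mult_single plus_word_def)

lemma single_scale: "Poly_Mapping.single w c = poly_scale c (Poly_Mapping.single w 1)"
  by (simp add: poly_scale_def mult_single)

lemma keys_poly_adj: "Poly_Mapping.keys (poly_adj f) = word_adj ` Poly_Mapping.keys f"
  by (force simp: in_keys_iff lookup_poly_adj image_iff)

definition word_in :: "'m set \<Rightarrow> 'm word \<Rightarrow> bool" where
  "word_in M w \<longleftrightarrow> gen_of ` set (letters w) \<subseteq> M"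

lemma word_in_plus [simp]: "word_in M (v + w) \<longleftrightarrow> word_in M v \<and> word_in M w"
  by (auto simp: word_in_def)

lemma word_in_0 [simp]: "word_in M 0"
  by (simp add: word_in_def zero_word_def)

lemma word_in_adj [simp]: "word_in M (word_adj w) \<longleftrightarrow> word_in M w"
proof -
  have "gen_of (letter_adj l) = gen_of l" for l :: "'a letter"
    by (cases l) auto
  then show ?thesis
    by (simp add: word_in_def word_adj_def image_image)
qed

text \<open>In contrast to \<open>free_star_algebra M\<close> the empty word is allowed; the lemmas
  below show that the latter is an ideal in this set.\<close>

definition words_in :: "'m set \<Rightarrow> 'm star_poly set" where
  "words_in M = {f. \<forall>w\<in>Poly_Mapping.keys f. word_in M w}"

lemma free_star_algebra_iff:
  "f \<in> free_star_algebra M \<longleftrightarrow> f \<in> words_in M \<and> 0 \<notin> Poly_Mapping.keys f"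
  by (auto simp: free_star_algebra_def words_in_def word_in_def)

lemma words_in_add: "f \<in> words_in M \<Longrightarrow> g \<in> words_in M \<Longrightarrow> f + g \<in> words_in M"
  using Poly_Mapping.keys_add[of f g] by (auto simp: words_in_def)

lemma words_in_mult: "f \<in> words_in M \<Longrightarrow> g \<in> words_in M \<Longrightarrow> f * g \<in> words_in M"
  using Poly_Mapping.keys_mult[of f g] by (force simp: words_in_def)

lemma free_mult_left: "f \<in> free_star_algebra M \<Longrightarrow> g \<in> words_in M \<Longrightarrow> f * g \<in> free_star_algebra M"
  unfolding free_star_algebra_iff using words_in_mult[of f M g] Poly_Mapping.keys_mult[of f g]
  by (auto simp: word_plus_eq_0_iff)

lemma free_mult_right: "f \<in> words_in M \<Longrightarrow> g \<in> free_star_algebra M \<Longrightarrow> f * g \<in> free_star_algebra M"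
  unfolding free_star_algebra_iff using words_in_mult[of f M g] Poly_Mapping.keys_mult[of f g]
  by (auto simp: word_plus_eq_0_iff)

lemma free_words_in: "f \<in> free_star_algebra M \<Longrightarrow> f \<in> words_in M"
  by (simp add: free_star_algebra_iff)

lemma free_mult: "f \<in> free_star_algebra M \<Longrightarrow> g \<in> free_star_algebra M \<Longrightarrow> f * g \<in> free_star_algebra M"
  by (intro free_mult_left free_words_in)

lemma free_add: "f \<in> free_star_algebra M \<Longrightarrow> g \<in> free_star_algebra M \<Longrightarrow> f + g \<in> free_star_algebra M"
  using words_in_add[of f M g] by (auto simp: free_star_algebra_iff in_keys_iff lookup_add)

lemma free_0 [simp]: "0 \<in> free_star_algebra M"
  by (simp add: free_star_algebra_def)

lemma free_uminus: "f \<in> free_star_algebra M \<Longrightarrow> - f \<in> free_star_algebra M"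
  by (simp add: free_star_algebra_def)

lemma free_diff: "f \<in> free_star_algebra M \<Longrightarrow> g \<in> free_star_algebra M \<Longrightarrow> f - g \<in> free_star_algebra M"
  using free_add[of f M "- g"] free_uminus[of g M] by simp

lemma free_sum: "(\<And>a. a \<in> A \<Longrightarrow> f a \<in> free_star_algebra M) \<Longrightarrow> sum f A \<in> free_star_algebra M"
  by (induction A rule: infinite_finite_induct) (auto intro: free_add)

lemma single_0_words_in: "Poly_Mapping.single 0 c \<in> words_in M"
  by (simp add: words_in_def)

lemma free_scale: "f \<in> free_star_algebra M \<Longrightarrow> poly_scale c f \<in> free_star_algebra M"
  unfolding poly_scale_def by (intro free_mult_right single_0_words_in)

lemma free_adj: "f \<in> free_star_algebra M \<Longrightarrow> poly_adj f \<in> free_star_algebra M" for f :: "'m star_poly"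
proof -
  have "word_adj w = 0 \<Longrightarrow> w = 0" for w :: "'m word"
    by (metis word_adj_0 word_adj_adj)
  then show "f \<in> free_star_algebra M \<Longrightarrow> poly_adj f \<in> free_star_algebra M" for f :: "'m star_poly"
    by (force simp: free_star_algebra_iff words_in_def keys_poly_adj)
qed

lemma free_gen: "\<alpha> \<in> M \<Longrightarrow> gen \<alpha> \<in> free_star_algebra M"
  by (simp add: gen_def free_star_algebra_def zero_word_def)

text \<open>The type of polynomials has a generator for every element of \<open>'m\<close>, also
  outside \<open>M\<close>. Discarding the words with foreign letters is multiplicative, because a
  concatenation lies over \<open>M\<close> only if both parts do.\<close>

definition restrict_words :: "'m set \<Rightarrow> 'm star_poly \<Rightarrow> 'm star_poly" where
  "restrict_words M f =
     (\<Sum>w\<in>Poly_Mapping.keys f. Poly_Mapping.single w (if word_in M w then Poly_Mapping.lookup f w else 0))"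

lemma lookup_restrict_words:
  "Poly_Mapping.lookup (restrict_words M f) w = (if word_in M w then Poly_Mapping.lookup f w else 0)"
  by (auto simp: restrict_words_def lookup_sum lookup_single when_def sum.delta in_keys_iff)

lemma restrict_words_add: "restrict_words M (f + g) = restrict_words M f + restrict_words M g"
  by (rule poly_mapping_eqI) (simp add: lookup_restrict_words lookup_add)

lemma restrict_words_single:
  "restrict_words M (Poly_Mapping.single w c) = (if word_in M w then Poly_Mapping.single w c else 0)"
  by (rule poly_mapping_eqI) (auto simp: lookup_restrict_words lookup_single when_def)

lemma restrict_words_mult: "restrict_words M (f * g) = restrict_words M f * restrict_words M g"
proof (induction f rule: star_poly_induct)
  case (single w c)
  show ?case
    by (induction g rule: star_poly_induct)
       (simp_all add: mult_single restrict_words_single distrib_left restrict_words_add)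
qed (simp add: distrib_right restrict_words_add)

lemma restrict_words_adj: "restrict_words M (poly_adj f) = poly_adj (restrict_words M f)"
  by (rule poly_mapping_eqI) (simp add: lookup_restrict_words lookup_poly_adj)

lemma restrict_words_in: "restrict_words M f \<in> words_in M"
  by (auto simp: words_in_def in_keys_iff lookup_restrict_words split: if_splits)

lemma restrict_words_id: "f \<in> words_in M \<Longrightarrow> restrict_words M f = f"
  by (rule poly_mapping_eqI) (auto simp: lookup_restrict_words words_in_def in_keys_iff)

section \<open>The universal seminorm\<close>

locale finite_k_graph = k_graph G for G :: "('m, 'k::finite) kgraph" +
  assumes fin: "finite_kgraph G"
begin

abbreviation A0 :: "'m star_poly set" where
  "A0 \<equiv> free_star_algebra (mor G)"

lemma finite_verts: "finite (verts G)"
  using fin by (auto simp: finite_kgraph_def)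

lemma verts_mor: "v \<in> verts G \<Longrightarrow> v \<in> mor G"
  by (simp add: paths_of_deg_def)

lemma rng_verts: "\<alpha> \<in> mor G \<Longrightarrow> rng G \<alpha> \<in> verts G"
  by (simp add: paths_of_deg_def rng_closed deg_rng)

lemma src_verts: "\<alpha> \<in> mor G \<Longrightarrow> src G \<alpha> \<in> verts G"
  by (simp add: paths_of_deg_def src_closed deg_src)

lemma gen_A0 [intro]: "\<alpha> \<in> mor G \<Longrightarrow> gen \<alpha> \<in> A0"
  by (rule free_gen)

lemmas A0_closed = free_add free_diff free_mult free_scale free_adj free_sum free_uminus

lemma ck_A0: "f \<in> ck_relations G \<Longrightarrow> f \<in> A0"
proof -
  have p: "\<alpha> \<in> paths_to G v (paths_le G n) \<Longrightarrow> \<alpha> \<in> mor G" for \<alpha> v n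
    by (simp add: paths_to_def paths_le_def)
  assume "f \<in> ck_relations G"
  then show ?thesis
    unfolding ck_relations_def
    by (auto intro!: A0_closed gen_A0 intro: verts_mor rng_closed src_closed cmp_closed p)
qed

context
  fixes p assumes p: "p \<in> cstar_seminorms G"
begin

lemma p_ax:
  assumes "f \<in> A0" "g \<in> A0"
  shows "p f \<ge> 0" "p (f + g) \<le> p f + p g" "p (poly_scale c f) = cmod c * p f"
    "p (f * g) \<le> p f * p g" "p (poly_adj f * f) = (p f)\<^sup>2"
  using p assms by (auto simp: cstar_seminorms_def)

lemma p_ck: "f \<in> ck_relations G \<Longrightarrow> p f = 0"
  using p by (simp add: cstar_seminorms_def)

lemma p_0 [simp]: "p 0 = 0"
  using p_ax(3)[of 0 0 0] by (simp add: poly_scale_def)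

lemma p_uminus: "f \<in> A0 \<Longrightarrow> p (- f) = p f"
  using p_ax(3)[of f f "- 1"] by (simp add: poly_scale_minus_one)

lemma p_diff: "f \<in> A0 \<Longrightarrow> g \<in> A0 \<Longrightarrow> p (f - g) \<le> p f + p g"
  using p_ax(2)[of f "- g"] by (simp add: p_uminus free_uminus)

lemma p_sum: "(\<And>a. a \<in> A \<Longrightarrow> f a \<in> A0) \<Longrightarrow> p (sum f A) \<le> (\<Sum>a\<in>A. p (f a))"
  by (induction A rule: infinite_finite_induct) (auto intro!: order_trans[OF p_ax(2)] free_sum)

lemma p_adj: "f \<in> A0 \<Longrightarrow> p (poly_adj f) = p f"
proof -
  have le: "p f \<le> p (poly_adj f)" if f: "f \<in> A0" for f
  proof -
    have "(p f)\<^sup>2 \<le> p (poly_adj f) * p f"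
      using p_ax(4)[OF free_adj[OF f] f] p_ax(5)[OF f f] by simp
    then show ?thesis
      using p_ax(1)[OF f f] p_ax(1)[OF free_adj[OF f] f] unfolding power2_eq_square
      by (cases "p f = 0") auto
  qed
  show "p (poly_adj f) = p f" if "f \<in> A0"
    using le[OF that] le[OF free_adj[OF that]] by simp
qed

lemma p_null_mult:
  assumes "p f = 0" "f \<in> A0" "g \<in> A0"
  shows "p (f * g) = 0" "p (g * f) = 0"
  using p_ax(1,4)[of f g] p_ax(1,4)[of g f] p_ax(1)[of "f * g" g] p_ax(1)[of "g * f" g] assms
  by (auto simp: free_mult intro: antisym)

lemma p_null_add:
  assumes "p f = 0" "p g = 0" "f \<in> A0" "g \<in> A0"
  shows "p (f + g) = 0" "p (f - g) = 0"
  using p_ax(1,2)[of f g] p_diff[of f g] p_ax(1)[of "f + g" g] p_ax(1)[of "f - g" g] assms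
  by (auto simp: free_add free_diff intro: antisym)

lemma p_cong: "p (f - g) = 0 \<Longrightarrow> f \<in> A0 \<Longrightarrow> g \<in> A0 \<Longrightarrow> p f = p g"
  using p_ax(2)[of "f - g" g] p_ax(2)[of "g - f" f] p_uminus[of "f - g"] by (simp add: free_diff)

text \<open>Up to null elements \<open>gen v\<close> is a selfadjoint idempotent, so the
  \<open>C*\<close>-identity says that its seminorm equals its own square.\<close>

lemma p_vert: "v \<in> verts G \<Longrightarrow> p (gen v) \<le> 1"
proof -
  assume v: "v \<in> verts G"
  have g: "gen v \<in> A0"
    using v verts_mor by blast
  have 1: "p (poly_adj (gen v) - gen v) = 0" "p (gen v * gen v - gen v) = 0"
    using v by (intro p_ck; force simp: ck_relations_def)+
  have "p (poly_adj (gen v) * gen v - gen v) = 0"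
  proof -
    have eq: "poly_adj (gen v) * gen v - gen v
        = (poly_adj (gen v) - gen v) * gen v + (gen v * gen v - gen v)"
      by (simp add: algebra_simps)
    show ?thesis
      unfolding eq using 1 g by (simp add: p_null_add p_null_mult p_uminus A0_closed)
  qed
  then have "(p (gen v))\<^sup>2 = p (gen v)"
    using p_cong g p_ax(5)[OF g g] by (simp add: A0_closed)
  then show ?thesis
    using p_ax(1)[OF g g] by (auto simp: power2_eq_square)
qed

lemma p_gen: "\<alpha> \<in> mor G \<Longrightarrow> p (gen \<alpha>) \<le> 1"
proof -
  assume a: "\<alpha> \<in> mor G"
  have g: "gen \<alpha> \<in> A0" "gen (src G \<alpha>) \<in> A0"
    using a src_closed by blast+
  have "p (poly_adj (gen \<alpha>) * gen \<alpha> - gen (src G \<alpha>)) = 0"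
    using a by (intro p_ck; force simp: ck_relations_def)
  then have "(p (gen \<alpha>))\<^sup>2 \<le> 1"
    using p_cong g p_ax(5)[OF g(1) g(1)] p_vert[OF src_verts[OF a]] by (simp add: A0_closed)
  then show ?thesis
    using p_ax(1)[OF g(1) g(1)] by (simp add: abs_square_le_1)
qed

lemma p_letter:
  assumes "gen_of l \<in> mor G"
  shows "Poly_Mapping.single (Word [l]) 1 \<in> A0" "p (Poly_Mapping.single (Word [l]) 1) \<le> 1"
proof -
  have "p (Poly_Mapping.single (Word [l]) 1) \<le> 1 \<and> Poly_Mapping.single (Word [l]) 1 \<in> A0"
  proof (cases l)
    case (Gen x1)
    then show ?thesis
      using assms p_gen[of x1] gen_A0[of x1] by (simp add: gen_def)
  next
    case (Gen_adj x2)
    then have "Poly_Mapping.single (Word [l]) 1 = poly_adj (gen x2)"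
      by (simp add: gen_def word_adj_def)
    then show ?thesis
      using assms p_gen[of x2] gen_A0[of x2] p_adj[of "gen x2"] Gen_adj by (simp add: free_adj)
  qed
  then show "Poly_Mapping.single (Word [l]) 1 \<in> A0" "p (Poly_Mapping.single (Word [l]) 1) \<le> 1"
    by auto
qed

lemma p_word:
  assumes "w \<noteq> 0" "word_in (mor G) w"
  shows "Poly_Mapping.single w 1 \<in> A0" "p (Poly_Mapping.single w 1) \<le> 1"
proof -
  have "Poly_Mapping.single (Word ls) 1 \<in> A0 \<and> p (Poly_Mapping.single (Word ls) 1) \<le> 1"
    if "ls \<noteq> []" "gen_of ` set ls \<subseteq> mor G" for ls
    using that
  proof (induction ls rule: list_nonempty_induct)
    case (single l)
    then show ?case
      using p_letter[of l] by simp
  next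
    case (cons l ls)
    then have l: "Poly_Mapping.single (Word [l]) 1 \<in> A0" "p (Poly_Mapping.single (Word [l]) 1) \<le> 1"
      using p_letter[of l] by auto
    have ls: "Poly_Mapping.single (Word ls) 1 \<in> A0" "p (Poly_Mapping.single (Word ls) 1) \<le> 1"
      using cons by auto
    have "p (Poly_Mapping.single (Word [l]) 1 * Poly_Mapping.single (Word ls) 1) \<le> 1 * 1"
      using p_ax(1,4)[OF l(1) ls(1)] p_ax(1)[OF ls(1) ls(1)] l(2) ls(2)
      by (intro order_trans[OF p_ax(4)[OF l(1) ls(1)]] mult_mono) auto
    then show ?case
      unfolding single_Cons[of l ls] using l ls by (simp add: free_mult)
  qed
  then show "Poly_Mapping.single w 1 \<in> A0" "p (Poly_Mapping.single w 1) \<le> 1"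
    using assms by (cases w; auto simp: word_in_def word_eq_0_iff)+
qed

lemma A0_sum:
  assumes "f \<in> A0"
  shows "f = (\<Sum>w\<in>Poly_Mapping.keys f. poly_scale (Poly_Mapping.lookup f w) (Poly_Mapping.single w 1))"
    "\<And>w. w \<in> Poly_Mapping.keys f \<Longrightarrow> Poly_Mapping.single w 1 \<in> A0 \<and> p (Poly_Mapping.single w 1) \<le> 1"
proof -
  show "f = (\<Sum>w\<in>Poly_Mapping.keys f. poly_scale (Poly_Mapping.lookup f w) (Poly_Mapping.single w 1))"
    using star_poly_sum[of f] by (simp add: single_scale[symmetric])
  show "Poly_Mapping.single w 1 \<in> A0 \<and> p (Poly_Mapping.single w 1) \<le> 1"
    if "w \<in> Poly_Mapping.keys f" for w
    using p_word[of w] assms that by (auto simp: free_star_algebra_def word_in_def)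
qed

lemma p_bound:
  assumes f: "f \<in> A0"
  shows "p f \<le> (\<Sum>w\<in>Poly_Mapping.keys f. cmod (Poly_Mapping.lookup f w))"
proof -
  have "p f = p (\<Sum>w\<in>Poly_Mapping.keys f. poly_scale (Poly_Mapping.lookup f w) (Poly_Mapping.single w 1))"
    using A0_sum(1)[OF f] by simp
  also have "\<dots> \<le> (\<Sum>w\<in>Poly_Mapping.keys f. p (poly_scale (Poly_Mapping.lookup f w) (Poly_Mapping.single w 1)))"
    using A0_sum(2)[OF f] by (intro p_sum free_scale) auto
  also have "\<dots> \<le> (\<Sum>w\<in>Poly_Mapping.keys f. cmod (Poly_Mapping.lookup f w))"
  proof (intro sum_mono)
    fix w assume "w \<in> Poly_Mapping.keys f"
    note w = A0_sum(2)[OF f this]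
    have "cmod (Poly_Mapping.lookup f w) * p (Poly_Mapping.single w 1) \<le> cmod (Poly_Mapping.lookup f w) * 1"
      using w by (intro mult_left_mono) auto
    then show "p (poly_scale (Poly_Mapping.lookup f w) (Poly_Mapping.single w 1)) \<le> cmod (Poly_Mapping.lookup f w)"
      using w p_ax(3)[of "Poly_Mapping.single w 1" "Poly_Mapping.single w 1"] by simp
  qed
  finally show ?thesis .
qed

end

lemma zero_cstar_seminorm: "(\<lambda>_. 0) \<in> cstar_seminorms G"
  by (simp add: cstar_seminorms_def)

abbreviation N :: "'m star_poly \<Rightarrow> real" where
  "N \<equiv> univ_seminorm G"

lemma bdd_seminorms: "f \<in> A0 \<Longrightarrow> bdd_above ((\<lambda>p. p f) ` cstar_seminorms G)"
  by (rule bdd_aboveI2[OF p_bound])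

lemma le_univ_seminorm: "p \<in> cstar_seminorms G \<Longrightarrow> f \<in> A0 \<Longrightarrow> p f \<le> N f"
  unfolding univ_seminorm_def by (rule cSUP_upper[OF _ bdd_seminorms])

lemma univ_seminorm_le: "(\<And>p. p \<in> cstar_seminorms G \<Longrightarrow> p f \<le> b) \<Longrightarrow> N f \<le> b"
  unfolding univ_seminorm_def using zero_cstar_seminorm by (intro cSUP_least) auto

text \<open>Inequalities pass to the supremum directly. Equality in the scaling rule comes from
  applying the inequality with the inverse scalar, and the lower bound in the
  \<open>C*\<close>-identity from square roots taken before the supremum.\<close>

lemma univ_cstar_seminorm: "N \<in> cstar_seminorms G"
proof -
  have pos: "N f \<ge> 0" if "f \<in> A0" for f
    using le_univ_seminorm[OF zero_cstar_seminorm that] by simp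
  have add: "N (f + g) \<le> N f + N g" if fg: "f \<in> A0" "g \<in> A0" for f g
  proof (rule univ_seminorm_le)
    fix p assume p: "p \<in> cstar_seminorms G"
    show "p (f + g) \<le> N f + N g"
      using p_ax(2)[OF p fg] le_univ_seminorm[OF p fg(1)] le_univ_seminorm[OF p fg(2)] by linarith
  qed
  have scale_le: "N (poly_scale c f) \<le> cmod c * N f" if f: "f \<in> A0" for f c
  proof (rule univ_seminorm_le)
    fix p assume p: "p \<in> cstar_seminorms G"
    show "p (poly_scale c f) \<le> cmod c * N f"
      using p_ax(3)[OF p f f, of c] le_univ_seminorm[OF p f] by (simp add: mult_left_mono)
  qed
  have scale: "N (poly_scale c f) = cmod c * N f" if f: "f \<in> A0" for f c
  proof (cases "c = 0")
    case True
    then show ?thesis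
      using scale_le[OF f, of c] pos[OF free_scale[OF f, of c]] by simp
  next
    case False
    have "N f \<le> cmod (1 / c) * N (poly_scale c f)"
      using scale_le[OF free_scale[OF f, of c], of "1 / c"] False by (simp add: poly_scale_scale)
    then have "cmod c * N f \<le> N (poly_scale c f)"
      using False by (simp add: norm_divide field_simps)
    then show ?thesis
      using scale_le[OF f, of c] by simp
  qed
  have mult: "N (f * g) \<le> N f * N g" if fg: "f \<in> A0" "g \<in> A0" for f g
  proof (rule univ_seminorm_le)
    fix p assume p: "p \<in> cstar_seminorms G"
    have "p f * p g \<le> N f * N g"
      using le_univ_seminorm[OF p fg(1)] le_univ_seminorm[OF p fg(2)] p_ax(1)[OF p fg(2) fg(2)] pos[OF fg(1)]
      by (intro mult_mono) auto
    then show "p (f * g) \<le> N f * N g"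
      using p_ax(4)[OF p fg] by linarith
  qed
  have cstar: "N (poly_adj f * f) = (N f)\<^sup>2" if f: "f \<in> A0" for f
  proof (rule antisym)
    show "N (poly_adj f * f) \<le> (N f)\<^sup>2"
    proof (rule univ_seminorm_le)
      fix p assume p: "p \<in> cstar_seminorms G"
      show "p (poly_adj f * f) \<le> (N f)\<^sup>2"
        using p_ax(1,5)[OF p f f] le_univ_seminorm[OF p f] by (simp add: power_mono)
    qed
    have "p f \<le> sqrt (N (poly_adj f * f))" if p: "p \<in> cstar_seminorms G" for p
    proof -
      have "(p f)\<^sup>2 \<le> N (poly_adj f * f)"
        using le_univ_seminorm[OF p, of "poly_adj f * f"] p_ax(5)[OF p f f] f by (simp add: A0_closed)
      then show ?thesis
        by (rule real_le_rsqrt)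
    qed
    then have "N f \<le> sqrt (N (poly_adj f * f))"
      by (rule univ_seminorm_le)
    then have "(N f)\<^sup>2 \<le> (sqrt (N (poly_adj f * f)))\<^sup>2"
      using pos[OF f] by (intro power_mono)
    then show "(N f)\<^sup>2 \<le> N (poly_adj f * f)"
      using pos[of "poly_adj f * f"] f by (simp add: A0_closed)
  qed
  have ck: "N f = 0" if "f \<in> ck_relations G" for f
  proof (rule antisym[OF univ_seminorm_le pos[OF ck_A0[OF that]]])
    show "p f \<le> 0" if "p \<in> cstar_seminorms G" for p
      using p_ck[OF that \<open>f \<in> ck_relations G\<close>] by simp
  qed
  show ?thesis
    unfolding cstar_seminorms_def using pos add scale mult cstar ck by auto
qed

lemmas N_ax = p_ax[OF univ_cstar_seminorm]
lemmas N_ck = p_ck[OF univ_cstar_seminorm]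
lemmas N_0 = p_0[OF univ_cstar_seminorm]
lemmas N_uminus = p_uminus[OF univ_cstar_seminorm]
lemmas N_sum = p_sum[OF univ_cstar_seminorm]
lemmas N_adj = p_adj[OF univ_cstar_seminorm]
lemmas N_null_mult = p_null_mult[OF univ_cstar_seminorm]
lemmas N_null_add = p_null_add[OF univ_cstar_seminorm]
lemmas N_cong = p_cong[OF univ_cstar_seminorm]

definition unit_sum :: "'m star_poly" where
  "unit_sum = (\<Sum>v\<in>verts G. gen v)"

lemma unit_sum_A0 [intro]: "unit_sum \<in> A0"
  unfolding unit_sum_def using verts_mor by (intro free_sum) blast

lemma unit_sum_vert: "v \<in> verts G \<Longrightarrow> N (unit_sum * gen v - gen v) = 0"
proof -
  assume v: "v \<in> verts G"
  have "unit_sum * gen v - gen v = (\<Sum>w\<in>verts G. if w = v then gen v * gen v - gen v else gen w * gen v)"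
    using v finite_verts
    by (simp add: unit_sum_def sum_distrib_right sum.remove[of "verts G" v] algebra_simps)
  moreover have "N (\<Sum>w\<in>verts G. if w = v then gen v * gen v - gen v else gen w * gen v) \<le> 0"
  proof (rule order_trans[OF N_sum])
    show "(\<Sum>w\<in>verts G. N (if w = v then gen v * gen v - gen v else gen w * gen v)) \<le> 0"
    proof (rule sum_nonpos)
      fix w assume "w \<in> verts G"
      then have "(if w = v then gen v * gen v - gen v else gen w * gen v) \<in> ck_relations G"
        using v by (auto simp: ck_relations_def)
      then show "N (if w = v then gen v * gen v - gen v else gen w * gen v) \<le> 0"
        using N_ck by simp
    qed
  qed (use v verts_mor in \<open>auto intro!: A0_closed gen_A0\<close>)
  ultimately show ?thesis
    using N_ax(1)[of "unit_sum * gen v - gen v" 0] v verts_mor by (auto simp: A0_closed gen_A0 unit_sum_A0)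
qed

text \<open>Only the first letter of a word matters. It absorbs on its left the vertex at its range,
  for a generator, or at its source, for an adjoint, and \<open>unit_sum\<close> absorbs every
  vertex because distinct vertices are orthogonal.\<close>

lemma unit_sum_left: "f \<in> A0 \<Longrightarrow> N (unit_sum * f - f) = 0"
proof -
  have comb: "N (unit_sum * f - f) = 0"
    if "v \<in> verts G" "N (gen v * f - f) = 0" "f \<in> A0" for v f
  proof -
    have v: "gen v \<in> A0"
      using that(1) verts_mor by blast
    have eq: "unit_sum * f - f = (gen v * f - f) - unit_sum * (gen v * f - f) + (unit_sum * gen v - gen v) * f"
      by (simp add: algebra_simps)
    show ?thesis
      unfolding eq using that v unit_sum_vert[OF that(1)]
      by (simp add: N_null_add N_null_mult N_uminus A0_closed unit_sum_A0)
  qed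
  have letter: "N (unit_sum * Poly_Mapping.single (Word [l]) 1 - Poly_Mapping.single (Word [l]) 1) = 0"
    if "gen_of l \<in> mor G" for l
  proof (cases l)
    case (Gen \<alpha>)
    then have \<alpha>: "\<alpha> \<in> mor G" using that by simp
    have "gen (rng G \<alpha>) * gen \<alpha> - gen (cmp G (rng G \<alpha>) \<alpha>) \<in> ck_relations G"
      using \<alpha> rng_closed src_rng by (fastforce simp: ck_relations_def)
    then have "N (gen (rng G \<alpha>) * gen \<alpha> - gen \<alpha>) = 0"
      using N_ck \<alpha> by (simp add: cmp_rng)
    then have "N (unit_sum * gen \<alpha> - gen \<alpha>) = 0"
      using comb[OF rng_verts[OF \<alpha>]] \<alpha> by blast
    then show ?thesis
      using Gen by (simp add: gen_def)
  next
    case (Gen_adj \<alpha>)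
    then have \<alpha>: "\<alpha> \<in> mor G" using that by simp
    let ?v = "src G \<alpha>"
    have A: "gen \<alpha> \<in> A0" "gen ?v \<in> A0"
      using \<alpha> src_closed by auto
    have "gen \<alpha> * gen ?v - gen (cmp G \<alpha> ?v) \<in> ck_relations G"
      using \<alpha> src_closed rng_src by (fastforce simp: ck_relations_def)
    then have "N (gen \<alpha> * gen ?v - gen \<alpha>) = 0"
      using N_ck \<alpha> by (simp add: cmp_src)
    then have 1: "N (poly_adj (gen ?v) * poly_adj (gen \<alpha>) - poly_adj (gen \<alpha>)) = 0"
      using N_adj[of "gen \<alpha> * gen ?v - gen \<alpha>"] A by (simp add: A0_closed poly_adj_diff poly_adj_mult)
    have "poly_adj (gen ?v) - gen ?v \<in> ck_relations G"
      using src_verts[OF \<alpha>] by (auto simp: ck_relations_def)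
    then have "N (poly_adj (gen ?v) - gen ?v) = 0"
      using N_ck by blast
    then have 2: "N ((poly_adj (gen ?v) - gen ?v) * poly_adj (gen \<alpha>)) = 0"
      using A by (simp add: N_null_mult A0_closed)
    have eq: "gen ?v * poly_adj (gen \<alpha>) - poly_adj (gen \<alpha>)
        = (poly_adj (gen ?v) * poly_adj (gen \<alpha>) - poly_adj (gen \<alpha>))
          - (poly_adj (gen ?v) - gen ?v) * poly_adj (gen \<alpha>)"
      by (simp add: algebra_simps)
    have "N (gen ?v * poly_adj (gen \<alpha>) - poly_adj (gen \<alpha>)) = 0"
      unfolding eq using 1 2 A by (simp add: N_null_add A0_closed)
    then have "N (unit_sum * poly_adj (gen \<alpha>) - poly_adj (gen \<alpha>)) = 0"
      using comb[OF src_verts[OF \<alpha>]] A by (simp add: free_adj)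
    then show ?thesis
      using Gen_adj by (simp add: gen_def word_adj_def)
  qed
  have word: "N (unit_sum * Poly_Mapping.single w 1 - Poly_Mapping.single w 1) = 0"
    if w: "w \<noteq> 0" "word_in (mor G) w" for w
  proof -
    obtain l ls where w': "w = Word (l # ls)"
      using w by (cases w; cases "letters w") (auto simp: word_eq_0_iff)
    have l: "gen_of l \<in> mor G"
      using w w' by (simp add: word_in_def)
    show ?thesis
    proof (cases "ls = []")
      case True
      then show ?thesis
        using letter[OF l] w' by simp
    next
      case False
      then have ls: "Poly_Mapping.single (Word ls) 1 \<in> A0"
        using w w' p_word[OF univ_cstar_seminorm, of "Word ls"] by (simp add: word_in_def word_eq_0_iff)
      have "unit_sum * Poly_Mapping.single w 1 - Poly_Mapping.single w 1
          = (unit_sum * Poly_Mapping.single (Word [l]) 1 - Poly_Mapping.single (Word [l]) 1) * Poly_Mapping.single (Word ls) 1"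
        unfolding w' single_Cons[of l ls] by (simp add: algebra_simps)
      then show ?thesis
        using N_null_mult(1)[OF letter[OF l] _ ls] p_letter(1)[OF univ_cstar_seminorm l]
        by (simp add: A0_closed unit_sum_A0)
    qed
  qed
  assume f: "f \<in> A0"
  let ?d = "\<lambda>w. poly_scale (Poly_Mapping.lookup f w)
     (unit_sum * Poly_Mapping.single w 1 - Poly_Mapping.single w 1)"
  have A: "Poly_Mapping.single w 1 \<in> A0" if "w \<in> Poly_Mapping.keys f" for w
    using A0_sum(2)[OF univ_cstar_seminorm f that] by simp
  have "unit_sum * f - f = (\<Sum>w\<in>Poly_Mapping.keys f. ?d w)"
  proof -
    have "?d w = unit_sum * poly_scale (Poly_Mapping.lookup f w) (Poly_Mapping.single w 1)
        - poly_scale (Poly_Mapping.lookup f w) (Poly_Mapping.single w 1)" for w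
      unfolding poly_scale_def right_diff_distrib mult.assoc[symmetric] scalar_commute[of _ unit_sum] ..
    then show ?thesis
      using A0_sum(1)[OF univ_cstar_seminorm f] by (simp add: sum_subtractf sum_distrib_left[symmetric])
  qed
  moreover have "N (\<Sum>w\<in>Poly_Mapping.keys f. ?d w) \<le> (\<Sum>w\<in>Poly_Mapping.keys f. N (?d w))"
    using A by (intro N_sum) (simp add: A0_closed unit_sum_A0)
  moreover have "N (?d w) = 0" if "w \<in> Poly_Mapping.keys f" for w
  proof -
    have "N (unit_sum * Poly_Mapping.single w 1 - Poly_Mapping.single w 1) = 0"
      using f that by (intro word) (auto simp: free_star_algebra_def word_in_def)
    then show ?thesis
      using N_ax(3)[of "unit_sum * Poly_Mapping.single w 1 - Poly_Mapping.single w 1"] A[OF that]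
      by (simp add: A0_closed unit_sum_A0)
  qed
  ultimately show "N (unit_sum * f - f) = 0"
    using N_ax(1)[OF free_diff[OF free_mult[OF unit_sum_A0 f] f] free_0] by simp
qed

lemma unit_sum_adj: "N (poly_adj unit_sum - unit_sum) = 0"
proof -
  have "poly_adj unit_sum - unit_sum = (\<Sum>v\<in>verts G. poly_adj (gen v) - gen v)"
    by (simp add: unit_sum_def poly_adj_sum sum_subtractf)
  moreover have "N (\<Sum>v\<in>verts G. poly_adj (gen v) - gen v) \<le> (\<Sum>v\<in>verts G. N (poly_adj (gen v) - gen v))"
    using verts_mor by (intro N_sum A0_closed gen_A0) auto
  moreover have "N (poly_adj (gen v) - gen v) = 0" if "v \<in> verts G" for v
    using that by (intro N_ck) (auto simp: ck_relations_def)
  ultimately show ?thesis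
    using N_ax(1)[OF free_diff[OF free_adj[OF unit_sum_A0] unit_sum_A0] free_0] by simp
qed

lemma unit_sum_right: "f \<in> A0 \<Longrightarrow> N (f * unit_sum - f) = 0"
proof -
  assume f: "f \<in> A0"
  have eq: "poly_adj (f * unit_sum - f)
      = (poly_adj unit_sum - unit_sum) * poly_adj f + (unit_sum * poly_adj f - poly_adj f)"
    by (simp add: poly_adj_diff poly_adj_mult algebra_simps)
  have "N (poly_adj (f * unit_sum - f)) = 0"
    unfolding eq using f unit_sum_adj unit_sum_left[of "poly_adj f"]
    by (simp add: N_null_add N_null_mult N_uminus A0_closed unit_sum_A0)
  then show ?thesis
    using f by (simp add: N_adj A0_closed unit_sum_A0)
qed

text \<open>
  The unit of the \<open>C\<^sup>*\<close>-algebra is the class of \<open>unit_sum\<close>, whereas the ring of all polynomials has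
  the empty word as its unit. The seminorm is extended by identifying the two.
\<close>

definition corner_poly :: "'m star_poly \<Rightarrow> 'm star_poly" where
  "corner_poly f = unit_sum * restrict_words (mor G) f * unit_sum"

lemma corner_poly_A0 [intro, simp]: "corner_poly f \<in> A0"
  unfolding corner_poly_def
  by (intro free_mult_left restrict_words_in free_words_in[OF unit_sum_A0] unit_sum_A0)

definition nrm1 :: "'m star_poly \<Rightarrow> real" where
  "nrm1 f = N (corner_poly f)"

lemma corner_poly_add: "corner_poly (f + g) = corner_poly f + corner_poly g"
  by (simp add: corner_poly_def restrict_words_add algebra_simps)

lemma corner_poly_A0_eq: "f \<in> A0 \<Longrightarrow> N (corner_poly f - f) = 0"
proof -
  assume f: "f \<in> A0"
  have eq: "corner_poly f - f = (unit_sum * f - f) * unit_sum + (f * unit_sum - f)"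
    using f by (simp add: corner_poly_def restrict_words_id free_words_in algebra_simps)
  show ?thesis
    unfolding eq using f unit_sum_left unit_sum_right
    by (simp add: N_null_add N_null_mult N_uminus A0_closed unit_sum_A0)
qed

lemma nrm1_A0: "f \<in> A0 \<Longrightarrow> nrm1 f = N f"
  unfolding nrm1_def by (rule N_cong[OF corner_poly_A0_eq]) auto

text \<open>The product on the right has two copies of \<open>unit_sum\<close> in the middle; both
  act as identities up to seminorm zero, so the map is multiplicative only in this sense.\<close>

lemma corner_poly_mult: "N (corner_poly (f * g) - corner_poly f * corner_poly g) = 0"
proof -
  let ?a = "unit_sum * restrict_words (mor G) f" and ?b = "restrict_words (mor G) g * unit_sum"
  have ab: "?a \<in> A0" "?b \<in> A0"
    by (intro free_mult_left free_mult_right restrict_words_in unit_sum_A0)+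
  have eq: "corner_poly (f * g) - corner_poly f * corner_poly g
      = 0 - (?a * unit_sum - ?a) * ?b - ?a * unit_sum * (unit_sum * ?b - ?b)"
    by (simp add: corner_poly_def restrict_words_mult algebra_simps)
  show ?thesis
    unfolding eq using ab unit_sum_left[OF ab(2)] unit_sum_right[OF ab(1)]
    by (simp add: N_null_add N_null_mult N_uminus A0_closed unit_sum_A0)
qed

lemma corner_poly_adj: "N (corner_poly (poly_adj f) - poly_adj (corner_poly f)) = 0"
proof -
  let ?r = "poly_adj (restrict_words (mor G) f)"
  have r: "unit_sum * ?r \<in> A0" "?r * poly_adj unit_sum \<in> A0"
    using restrict_words_in[of "mor G" "poly_adj f"]
    by (auto simp: restrict_words_adj intro: free_mult_left[OF unit_sum_A0]
        free_mult_right[OF _ free_adj[OF unit_sum_A0]])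
  have eq: "corner_poly (poly_adj f) - poly_adj (corner_poly f)
      = 0 - ((poly_adj unit_sum - unit_sum) * (?r * poly_adj unit_sum)) - (unit_sum * ?r) * (poly_adj unit_sum - unit_sum)"
    by (simp add: corner_poly_def restrict_words_adj poly_adj_mult algebra_simps)
  show ?thesis
    unfolding eq using r unit_sum_adj by (simp add: N_null_add N_null_mult N_uminus A0_closed unit_sum_A0)
qed

lemma nrm1_seminormed: "seminormed_algebra nrm1 (Poly_Mapping.single 0)"
proof
  fix f g :: "'m star_poly" and c d :: complex
  show "nrm1 (f + g) \<le> nrm1 f + nrm1 g"
    unfolding nrm1_def corner_poly_add by (rule N_ax(2)) auto
  have "nrm1 (f * g) = N (corner_poly f * corner_poly g)"
    unfolding nrm1_def by (rule N_cong[OF corner_poly_mult]) (auto intro: free_mult)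
  then show "nrm1 (f * g) \<le> nrm1 f * nrm1 g"
    unfolding nrm1_def using N_ax(4) by simp
  have "corner_poly (Poly_Mapping.single 0 c * f) = poly_scale c (corner_poly f)"
    by (simp add: corner_poly_def poly_scale_def restrict_words_mult restrict_words_single
        mult.assoc[symmetric] scalar_commute[of c unit_sum])
  then show "nrm1 (Poly_Mapping.single 0 c * f) = cmod c * nrm1 f"
    unfolding nrm1_def using N_ax(3)[of "corner_poly f" "corner_poly f"] by simp
qed (simp_all add: single_add mult_single scalar_commute)

lemma nrm1_adj: "nrm1 (poly_adj f) = nrm1 f"
  unfolding nrm1_def using N_cong[OF corner_poly_adj, of f] N_adj[of "corner_poly f"] by (simp add: free_adj)

lemma nrm1_cstar: "nrm1 (poly_adj f * f) = (nrm1 f)\<^sup>2"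
proof -
  have "nrm1 (poly_adj f * f) = N (corner_poly (poly_adj f) * corner_poly f)"
    unfolding nrm1_def by (rule N_cong[OF corner_poly_mult]) (auto intro: free_mult)
  also have "\<dots> = N (poly_adj (corner_poly f) * corner_poly f)"
  proof (rule N_cong)
    have "corner_poly (poly_adj f) * corner_poly f - poly_adj (corner_poly f) * corner_poly f
        = (corner_poly (poly_adj f) - poly_adj (corner_poly f)) * corner_poly f"
      by (simp add: algebra_simps)
    then show "N (corner_poly (poly_adj f) * corner_poly f - poly_adj (corner_poly f) * corner_poly f) = 0"
      using N_null_mult(1)[OF corner_poly_adj] by (simp add: A0_closed)
  qed (auto intro!: A0_closed)
  also have "\<dots> = (nrm1 f)\<^sup>2"
    unfolding nrm1_def by (rule N_ax(5)) auto
  finally show ?thesis .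
qed

section \<open>The ring of classes modulo elements of seminorm zero\<close>

definition idx :: "'m star_poly set \<times> ('m star_poly \<Rightarrow> 'm star_poly)" where
  "idx = ({f. nrm1 f = 0}, poly_adj)"

definition cls :: "'m star_poly \<Rightarrow> 'm star_poly quo" where
  "cls = emb idx"

definition nn :: "'m star_poly quo \<Rightarrow> real" where
  "nn F = nrm1 (quo_comp idx F)"

definition sc :: "complex \<Rightarrow> 'm star_poly quo" where
  "sc c = cls (Poly_Mapping.single 0 c)"

lemmas quo_props = quo_cstar_seminormed[OF nrm1_seminormed _ poly_adj_add poly_adj_mult poly_adj_adj _ nrm1_cstar nrm1_adj,
    folded idx_def]

sublocale cs: cstar_seminormed nn sc quo_star
  using quo_props(1) unfolding nn_def sc_def cls_def by simp

lemma cls_nn: "nn (cls f) = nrm1 f"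
  using quo_props(3) by (simp add: nn_def cls_def)

lemma cls_eq_iff: "cls f = cls g \<longleftrightarrow> nrm1 (f - g) = 0"
  using quo_props(4) by (simp add: cls_def)

lemma cls_eqI: "f \<in> A0 \<Longrightarrow> g \<in> A0 \<Longrightarrow> N (f - g) = 0 \<Longrightarrow> cls f = cls g"
  by (simp add: cls_eq_iff nrm1_A0 free_diff)

lemma cls_hom: "cls (f + g) = cls f + cls g" "cls (f * g) = cls f * cls g" "cls (f - g) = cls f - cls g"
    "cls (- f) = - cls f" "cls 0 = 0" "cls (sum h A) = (\<Sum>a\<in>A. cls (h a))"
    "cls (poly_adj f) = quo_star (cls f)" "cls (poly_scale c f) = sc c * cls f"
  by (simp_all add: cls_def sc_def emb_add emb_mult emb_diff emb_uminus emb_sum emb_star poly_scale_def)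
     (simp add: idx_def)

definition un :: "'m star_poly quo" where
  "un = cls 1"

lemma un_sc: "un = sc 1"
  by (simp add: un_def sc_def)

lemma un_cls: "un * cls f = cls f" "cls f * un = cls f" "un * (cls f * F) = cls f * F"
  by (simp_all add: un_def cls_hom(2)[symmetric] mult.assoc[symmetric])

lemma un_un: "un * un = un"
  using un_cls[of 1] by (simp add: un_def)

lemma cls_unit_sum: "cls unit_sum = un"
proof -
  have "restrict_words (mor G) (unit_sum - 1) = unit_sum - 1"
    using restrict_words_add[of "mor G" "unit_sum - 1" 1] restrict_words_single[of "mor G" 0 1]
      restrict_words_id[OF free_words_in[OF unit_sum_A0]] by (simp add: eq_diff_eq)
  then have "corner_poly (unit_sum - 1) = unit_sum * (unit_sum * unit_sum - unit_sum)"
    by (simp only: corner_poly_def) (simp add: algebra_simps)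
  then have "nrm1 (unit_sum - 1) = 0"
    unfolding nrm1_def using unit_sum_left[OF unit_sum_A0] by (simp add: N_null_mult A0_closed unit_sum_A0)
  then show ?thesis
    by (simp add: cls_eq_iff un_def)
qed

text \<open>A representative of \<open>F\<close> may contain constants and letters that are not
  morphisms. Compressing it by \<open>corner_poly\<close> moves it into \<open>A0\<close> without
  changing the class, since \<open>unit_sum\<close> represents \<open>un\<close> and the foreign
  words are null.\<close>

lemma cls_surj: "cs.cor un F \<Longrightarrow> \<exists>f\<in>A0. F = cls f"
proof -
  assume F: "cs.cor un F"
  let ?f = "quo_comp idx F"
  have "F = cls ?f"
    using quo_props(5)[of F] cs.corD(1)[OF F] by (simp add: un_def cls_def)
  moreover have "cls (corner_poly ?f) = cls ?f"
  proof -
    have "cls (corner_poly ?f) = un * cls (restrict_words (mor G) ?f) * un"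
      by (simp add: corner_poly_def cls_hom cls_unit_sum)
    also have "\<dots> = cls (restrict_words (mor G) ?f)"
      by (simp add: un_cls)
    also have "\<dots> = cls ?f"
    proof -
      have "restrict_words (mor G) (restrict_words (mor G) ?f - ?f) = 0"
        by (rule poly_mapping_eqI) (simp add: lookup_restrict_words lookup_minus)
      then have "nrm1 (restrict_words (mor G) ?f - ?f) = 0"
        by (simp add: nrm1_def corner_poly_def N_0)
      then show ?thesis
        by (simp add: cls_eq_iff)
    qed
    finally show ?thesis .
  qed
  ultimately show ?thesis
    by (metis corner_poly_A0)
qed

lemma cor_un: "cs.cor un (cls f)"
  by (simp add: cs.cor_def un_cls)

end

section \<open>Stable rank one\<close>

lemma stable_rank_eq_1: "stable_rank A = 1 \<longleftrightarrow> Lg_dense A 1"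
proof
  assume *: "stable_rank A = 1"
  let ?S = "enat ` {n. n \<ge> 1 \<and> Lg_dense A n}"
  have "?S \<noteq> {}"
    using * by (auto simp: stable_rank_def Inf_enat_def one_enat_def split: if_splits)
  then have "Inf ?S \<in> ?S"
    unfolding Inf_enat_def by (auto intro: LeastI)
  then show "Lg_dense A 1"
    using * by (auto simp: stable_rank_def one_enat_def)
next
  assume "Lg_dense A 1"
  then have "Inf (enat ` {n. n \<ge> 1 \<and> Lg_dense A n}) \<le> enat 1"
    by (intro Inf_lower) auto
  moreover have "enat 1 \<le> Inf (enat ` {n. n \<ge> 1 \<and> Lg_dense A n})"
    by (intro Inf_greatest) auto
  ultimately show "stable_rank A = 1"
    by (simp add: stable_rank_def one_enat_def)
qed

lemma null_seq_le:
  fixes a b :: "nat \<Rightarrow> real"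
  assumes "b \<longlonglongrightarrow> 0" "\<And>n. 0 \<le> a n" "\<And>n. a n \<le> b n"
  shows "a \<longlonglongrightarrow> 0"
  by (rule tendsto_sandwich[OF _ _ tendsto_const assms(1)]) (use assms in auto)

text \<open>The operations of \<open>graph_cstar\<close> are unions over all representatives. Once
  every choice leads to the same class, the union is that class.\<close>

lemma UN_UN_const:
  "a \<in> A \<Longrightarrow> b \<in> B \<Longrightarrow> (\<And>x y. x \<in> A \<Longrightarrow> y \<in> B \<Longrightarrow> f x y = C) \<Longrightarrow> (\<Union>x\<in>A. \<Union>y\<in>B. f x y) = C"
  by blast

section \<open>Cauchy classes and the operations of the completion\<close>

context finite_k_graph
begin

abbreviation CS :: "(nat \<Rightarrow> 'm star_poly) set" where
  "CS \<equiv> cauchy_seqs G"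

abbreviation K :: "(nat \<Rightarrow> 'm star_poly) set cstar_algebra" where
  "K \<equiv> graph_cstar G"

lemma N_nonneg: "f \<in> A0 \<Longrightarrow> 0 \<le> N f"
  using N_ax(1) by blast

lemma CS_A0: "X \<in> CS \<Longrightarrow> X n \<in> A0"
  by (simp add: cauchy_seqs_def)

lemma CS_D: "X \<in> CS \<Longrightarrow> \<epsilon> > 0 \<Longrightarrow> \<exists>M. \<forall>m\<ge>M. \<forall>n\<ge>M. N (X m - X n) < \<epsilon>"
  by (simp add: cauchy_seqs_def)

lemma CS_const: "f \<in> A0 \<Longrightarrow> (\<lambda>_. f) \<in> CS"
  by (simp add: cauchy_seqs_def N_0)

lemma CS_bounded:
  assumes X: "X \<in> CS"
  shows "\<exists>B>0. \<forall>n. N (X n) \<le> B"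
proof -
  obtain M where M: "\<And>m n. m \<ge> M \<Longrightarrow> n \<ge> M \<Longrightarrow> N (X m - X n) < 1"
    using CS_D[OF X, of 1] by auto
  define B where "B = Max ((\<lambda>n. N (X n)) ` {..M}) + 1"
  have le: "N (X n) \<le> B" for n
  proof (cases "n \<le> M")
    case True
    then have "N (X n) \<le> Max ((\<lambda>n. N (X n)) ` {..M})"
      by (intro Max_ge) auto
    then show ?thesis by (simp add: B_def)
  next
    case False
    have "N (X n) \<le> N (X n - X M) + N (X M)"
      using N_ax(2)[OF free_diff[OF CS_A0[OF X, of n] CS_A0[OF X, of M]] CS_A0[OF X, of M]] by simp
    moreover have "N (X M) \<le> Max ((\<lambda>n. N (X n)) ` {..M})"
      by (intro Max_ge) auto
    ultimately show ?thesis
      using M[of n M] False unfolding B_def by linarith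
  qed
  moreover have "0 \<le> Max ((\<lambda>n. N (X n)) ` {..M})"
    using N_nonneg[OF CS_A0[OF X]] by (intro order_trans[OF _ Max_ge[of _ "N (X 0)"]]) auto
  then have "B > 0" by (simp add: B_def)
  ultimately show ?thesis by blast
qed

lemma CS_add:
  assumes "X \<in> CS" "Y \<in> CS"
  shows "(\<lambda>n. X n + Y n) \<in> CS"
  unfolding cauchy_seqs_def
proof (intro CollectI conjI allI impI)
  show "X n + Y n \<in> A0" for n
    using assms by (intro free_add CS_A0)
  fix \<epsilon> :: real assume "\<epsilon> > 0"
  then obtain M1 M2 where M: "\<And>m n. m \<ge> M1 \<Longrightarrow> n \<ge> M1 \<Longrightarrow> N (X m - X n) < \<epsilon> / 2"
    "\<And>m n. m \<ge> M2 \<Longrightarrow> n \<ge> M2 \<Longrightarrow> N (Y m - Y n) < \<epsilon> / 2"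
    using CS_D[OF assms(1), of "\<epsilon> / 2"] CS_D[OF assms(2), of "\<epsilon> / 2"] half_gt_zero by metis
  have "N (X m + Y m - (X n + Y n)) < \<epsilon>" if "m \<ge> max M1 M2" "n \<ge> max M1 M2" for m n
  proof -
    have "X m + Y m - (X n + Y n) = (X m - X n) + (Y m - Y n)"
      by simp
    then have "N (X m + Y m - (X n + Y n)) \<le> N (X m - X n) + N (Y m - Y n)"
      using assms N_ax(2) by (metis CS_A0 free_diff)
    then show ?thesis
      using M(1)[of m n] M(2)[of m n] that by simp
  qed
  then show "\<exists>M. \<forall>m\<ge>M. \<forall>n\<ge>M. N (X m + Y m - (X n + Y n)) < \<epsilon>"
    by blast
qed

lemma CS_uminus:
  assumes "X \<in> CS"
  shows "(\<lambda>n. - X n) \<in> CS"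
proof -
  have "N (- X m - - X n) = N (X m - X n)" for m n
    using N_uminus[OF free_diff[OF CS_A0[OF assms, of m] CS_A0[OF assms, of n]]] by simp
  then show ?thesis
    using assms by (simp add: cauchy_seqs_def free_uminus)
qed

lemma CS_mult:
  assumes X: "X \<in> CS" and Y: "Y \<in> CS"
  shows "(\<lambda>n. X n * Y n) \<in> CS"
  unfolding cauchy_seqs_def
proof (intro CollectI conjI allI impI)
  show "X n * Y n \<in> A0" for n
    using assms by (intro free_mult CS_A0)
  fix \<epsilon> :: real assume \<epsilon>: "\<epsilon> > 0"
  obtain B C where B: "B > 0" "\<And>n. N (X n) \<le> B" and C: "C > 0" "\<And>n. N (Y n) \<le> C"
    using CS_bounded[OF X] CS_bounded[OF Y] by auto
  obtain M1 M2 where M: "\<And>m n. m \<ge> M1 \<Longrightarrow> n \<ge> M1 \<Longrightarrow> N (X m - X n) < \<epsilon> / (2 * C)"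
    "\<And>m n. m \<ge> M2 \<Longrightarrow> n \<ge> M2 \<Longrightarrow> N (Y m - Y n) < \<epsilon> / (2 * B)"
  proof -
    have "\<epsilon> / (2 * C) > 0" "\<epsilon> / (2 * B) > 0"
      using \<epsilon> B(1) C(1) by auto
    then show ?thesis
      using CS_D[OF X, of "\<epsilon> / (2 * C)"] CS_D[OF Y, of "\<epsilon> / (2 * B)"] that by metis
  qed
  have "N (X m * Y m - X n * Y n) < \<epsilon>" if "m \<ge> max M1 M2" "n \<ge> max M1 M2" for m n
  proof -
    note A = CS_A0[OF X] CS_A0[OF Y]
    have "X m * Y m - X n * Y n = (X m - X n) * Y m + X n * (Y m - Y n)"
      by (simp add: algebra_simps)
    then have "N (X m * Y m - X n * Y n) \<le> N ((X m - X n) * Y m) + N (X n * (Y m - Y n))"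
      using N_ax(2)[OF free_mult[OF free_diff[OF A(1) A(1)] A(2)] free_mult[OF A(1) free_diff[OF A(2) A(2)]], of m n m n m n]
      by simp
    also have "\<dots> \<le> N (X m - X n) * N (Y m) + N (X n) * N (Y m - Y n)"
      by (intro add_mono N_ax(4) free_diff A)
    also have "\<dots> \<le> N (X m - X n) * C + B * N (Y m - Y n)"
      by (intro add_mono mult_left_mono mult_right_mono B C N_nonneg free_diff A)
    also have "\<dots> < \<epsilon> / (2 * C) * C + B * (\<epsilon> / (2 * B))"
      using M(1)[of m n] M(2)[of m n] that B(1) C(1) by (intro add_strict_mono mult_strict_left_mono mult_strict_right_mono) auto
    also have "\<dots> = \<epsilon>"
      using B(1) C(1) by simp
    finally show ?thesis .
  qed
  then show "\<exists>M. \<forall>m\<ge>M. \<forall>n\<ge>M. N (X m * Y m - X n * Y n) < \<epsilon>"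
    by blast
qed

lemma seq_class_self: "X \<in> CS \<Longrightarrow> X \<in> seq_class G X"
  by (simp add: seq_class_def N_0)

lemma seq_classD: "Y \<in> seq_class G X \<Longrightarrow> Y \<in> CS" "Y \<in> seq_class G X \<Longrightarrow> (\<lambda>n. N (X n - Y n)) \<longlonglongrightarrow> 0"
  by (simp_all add: seq_class_def)

lemma N_triangle: "f \<in> A0 \<Longrightarrow> g \<in> A0 \<Longrightarrow> h \<in> A0 \<Longrightarrow> N (f - h) \<le> N (f - g) + N (g - h)"
  using N_ax(2)[of "f - g" "g - h"] by (simp add: free_diff)

lemma N_sym: "f \<in> A0 \<Longrightarrow> g \<in> A0 \<Longrightarrow> N (f - g) = N (g - f)"
  using N_uminus[of "f - g"] by (simp add: free_diff)

lemma seq_class_eqI: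
  assumes X: "X \<in> CS" and Y: "Y \<in> CS" and lim: "(\<lambda>n. N (X n - Y n)) \<longlonglongrightarrow> 0"
  shows "seq_class G X = seq_class G Y"
proof -
  have "seq_class G X \<subseteq> seq_class G Y"
    if X: "X \<in> CS" and Y: "Y \<in> CS" and lim: "(\<lambda>n. N (Y n - X n)) \<longlonglongrightarrow> 0" for X Y
  proof
    fix Z assume Z: "Z \<in> seq_class G X"
    have "(\<lambda>n. N (Y n - X n) + N (X n - Z n)) \<longlonglongrightarrow> 0 + 0"
      using lim seq_classD(2)[OF Z] by (intro tendsto_add)
    then have lim0: "(\<lambda>n. N (Y n - X n) + N (X n - Z n)) \<longlonglongrightarrow> 0"
      by simp
    have "(\<lambda>n. N (Y n - Z n)) \<longlonglongrightarrow> 0"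
    proof (rule null_seq_le[OF lim0])
      fix n
      note C = CS_A0[OF X, of n] CS_A0[OF Y, of n] CS_A0[OF seq_classD(1)[OF Z], of n]
      show "0 \<le> N (Y n - Z n)"
        by (intro N_nonneg free_diff C)
      show "N (Y n - Z n) \<le> N (Y n - X n) + N (X n - Z n)"
        by (rule N_triangle[OF C(2,1,3)])
    qed
    then show "Z \<in> seq_class G Y"
      using seq_classD(1)[OF Z] by (simp add: seq_class_def)
  qed
  moreover have "(\<lambda>n. N (Y n - X n)) = (\<lambda>n. N (X n - Y n))"
    using X Y by (intro ext N_sym CS_A0)
  ultimately show ?thesis
    using assms by (metis subset_antisym)
qed

lemma carrier_K: "carrier K = seq_class G ` CS"
  by (simp add: graph_cstar_def)

lemma zero_K: "\<zero>\<^bsub>K\<^esub> = seq_class G (\<lambda>_. 0)"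
  by (simp add: graph_cstar_def)

lemma one_K: "\<one>\<^bsub>K\<^esub> = seq_class G (\<lambda>_. unit_sum)"
  by (simp add: graph_cstar_def unit_sum_def)

lemma add_K:
  assumes X: "X \<in> CS" and Y: "Y \<in> CS"
  shows "seq_class G X \<oplus>\<^bsub>K\<^esub> seq_class G Y = seq_class G (\<lambda>n. X n + Y n)"
proof -
  have "seq_class G (\<lambda>n. X' n + Y' n) = seq_class G (\<lambda>n. X n + Y n)"
    if X': "X' \<in> seq_class G X" and Y': "Y' \<in> seq_class G Y" for X' Y'
  proof (rule seq_class_eqI[symmetric])
    note C = CS_A0[OF X] CS_A0[OF Y] CS_A0[OF seq_classD(1)[OF X']] CS_A0[OF seq_classD(1)[OF Y']]
    show "(\<lambda>n. N (X n + Y n - (X' n + Y' n))) \<longlonglongrightarrow> 0"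
    proof (rule null_seq_le)
      show "(\<lambda>n. N (X n - X' n) + N (Y n - Y' n)) \<longlonglongrightarrow> 0"
        using tendsto_add[OF seq_classD(2)[OF X'] seq_classD(2)[OF Y']] by simp
      show "N (X n + Y n - (X' n + Y' n)) \<le> N (X n - X' n) + N (Y n - Y' n)" for n
        using N_ax(2)[OF free_diff[OF C(1,3)[of n]] free_diff[OF C(2,4)[of n]]] by (simp add: algebra_simps)
    qed (intro N_nonneg free_diff free_add C)
  qed (intro CS_add X Y seq_classD(1)[OF X'] seq_classD(1)[OF Y'])+
  then have "(\<Union>X'\<in>seq_class G X. \<Union>Y'\<in>seq_class G Y. seq_class G (\<lambda>n. X' n + Y' n))
      = seq_class G (\<lambda>n. X n + Y n)"
    by (intro UN_UN_const[OF seq_class_self[OF X] seq_class_self[OF Y]])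
  then show ?thesis
    by (simp add: graph_cstar_def)
qed

lemma mult_K:
  assumes X: "X \<in> CS" and Y: "Y \<in> CS"
  shows "seq_class G X \<otimes>\<^bsub>K\<^esub> seq_class G Y = seq_class G (\<lambda>n. X n * Y n)"
proof -
  have "seq_class G (\<lambda>n. X' n * Y' n) = seq_class G (\<lambda>n. X n * Y n)"
    if X': "X' \<in> seq_class G X" and Y': "Y' \<in> seq_class G Y" for X' Y'
  proof (rule seq_class_eqI[symmetric])
    note C = CS_A0[OF X] CS_A0[OF Y] CS_A0[OF seq_classD(1)[OF X']] CS_A0[OF seq_classD(1)[OF Y']]
    obtain B D where B: "\<And>n. N (X n) \<le> B" and D: "\<And>n. N (Y' n) \<le> D"
      using CS_bounded[OF X] CS_bounded[OF seq_classD(1)[OF Y']] by auto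
    show "(\<lambda>n. N (X n * Y n - X' n * Y' n)) \<longlonglongrightarrow> 0"
    proof (rule null_seq_le)
      show "(\<lambda>n. B * N (Y n - Y' n) + N (X n - X' n) * D) \<longlonglongrightarrow> 0"
        using tendsto_add[OF tendsto_mult_right_zero[OF seq_classD(2)[OF Y'], of B]
            tendsto_mult_left_zero[OF seq_classD(2)[OF X'], of D]] by simp
      fix n
      have "X n * Y n - X' n * Y' n = X n * (Y n - Y' n) + (X n - X' n) * Y' n"
        by (simp add: algebra_simps)
      then have "N (X n * Y n - X' n * Y' n) \<le> N (X n * (Y n - Y' n)) + N ((X n - X' n) * Y' n)"
        using N_ax(2)[OF free_mult[OF C(1) free_diff[OF C(2,4)]] free_mult[OF free_diff[OF C(1,3)] C(4)], of n n n n n n]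
        by simp
      also have "\<dots> \<le> N (X n) * N (Y n - Y' n) + N (X n - X' n) * N (Y' n)"
        by (intro add_mono N_ax(4) free_diff C)
      also have "\<dots> \<le> B * N (Y n - Y' n) + N (X n - X' n) * D"
        by (intro add_mono mult_left_mono mult_right_mono B D N_nonneg free_diff C)
      finally show "N (X n * Y n - X' n * Y' n) \<le> B * N (Y n - Y' n) + N (X n - X' n) * D" .
    qed (intro N_nonneg free_diff free_mult C)
  qed (intro CS_mult X Y seq_classD(1)[OF X'] seq_classD(1)[OF Y'])+
  then have "(\<Union>X'\<in>seq_class G X. \<Union>Y'\<in>seq_class G Y. seq_class G (\<lambda>n. X' n * Y' n))
      = seq_class G (\<lambda>n. X n * Y n)"
    by (intro UN_UN_const[OF seq_class_self[OF X] seq_class_self[OF Y]])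
  then show ?thesis
    by (simp add: graph_cstar_def)
qed

lemma abelian_group_K: "abelian_group K"
proof (rule abelian_groupI)
  fix x y z :: "(nat \<Rightarrow> 'm star_poly) set"
  assume "x \<in> carrier K" "y \<in> carrier K"
  then obtain X Y where X: "X \<in> CS" "x = seq_class G X" and Y: "Y \<in> CS" "y = seq_class G Y"
    by (auto simp: carrier_K)
  show "x \<oplus>\<^bsub>K\<^esub> y \<in> carrier K"
    using X Y by (auto simp: add_K carrier_K CS_add)
  show "x \<oplus>\<^bsub>K\<^esub> y = y \<oplus>\<^bsub>K\<^esub> x"
    using X Y by (simp add: add_K add.commute)
  show "x \<oplus>\<^bsub>K\<^esub> y \<oplus>\<^bsub>K\<^esub> z = x \<oplus>\<^bsub>K\<^esub> (y \<oplus>\<^bsub>K\<^esub> z)" if z: "z \<in> carrier K"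
  proof -
    obtain Z where "Z \<in> CS" "z = seq_class G Z"
      using z by (auto simp: carrier_K)
    then show ?thesis
      using X Y by (simp add: add_K CS_add add.assoc)
  qed
next
  show "\<zero>\<^bsub>K\<^esub> \<in> carrier K"
    by (simp add: zero_K carrier_K CS_const)
next
  fix x assume "x \<in> carrier K"
  then obtain X where X: "X \<in> CS" "x = seq_class G X"
    by (auto simp: carrier_K)
  show "\<zero>\<^bsub>K\<^esub> \<oplus>\<^bsub>K\<^esub> x = x"
    using X by (simp add: zero_K add_K CS_const)
  show "\<exists>y\<in>carrier K. y \<oplus>\<^bsub>K\<^esub> x = \<zero>\<^bsub>K\<^esub>"
    using X CS_uminus[OF X(1)] by (auto simp: carrier_K zero_K add_K intro!: bexI[of _ "\<lambda>n. - X n"])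
qed

lemma minus_K:
  assumes X: "X \<in> CS" and Y: "Y \<in> CS"
  shows "seq_class G X \<ominus>\<^bsub>K\<^esub> seq_class G Y = seq_class G (\<lambda>n. X n - Y n)"
proof -
  interpret K: abelian_group K
    by (rule abelian_group_K)
  have "\<ominus>\<^bsub>K\<^esub> seq_class G Y = seq_class G (\<lambda>n. - Y n)"
    using Y CS_uminus[OF Y] by (intro K.minus_equality) (auto simp: add_K zero_K carrier_K)
  then show ?thesis
    using X CS_uminus[OF Y] by (simp add: a_minus_def add_K)
qed

lemma nrm_K:
  assumes X: "X \<in> CS"
  shows "(\<lambda>n. N (X n)) \<longlonglongrightarrow> nrm K (seq_class G X)"
proof -
  have diff: "\<bar>N f - N g\<bar> \<le> N (f - g)" if "f \<in> A0" "g \<in> A0" for f g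
    using N_ax(2)[of "f - g" g] N_ax(2)[of "g - f" f] N_sym[of f g] that by (simp add: free_diff)
  have "Cauchy (\<lambda>n. N (X n))"
  proof (rule metric_CauchyI)
    fix \<epsilon> :: real assume "\<epsilon> > 0"
    then obtain M where M: "\<And>m n. m \<ge> M \<Longrightarrow> n \<ge> M \<Longrightarrow> N (X m - X n) < \<epsilon>"
      using CS_D[OF X] by blast
    have "dist (N (X m)) (N (X n)) < \<epsilon>" if "m \<ge> M" "n \<ge> M" for m n
      using M[OF that] diff[OF CS_A0[OF X, of m] CS_A0[OF X, of n]] by (simp add: dist_real_def)
    then show "\<exists>M. \<forall>m\<ge>M. \<forall>n\<ge>M. dist (N (X m)) (N (X n)) < \<epsilon>"
      by blast
  qed
  then obtain l where l: "(\<lambda>n. N (X n)) \<longlonglongrightarrow> l"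
    using Cauchy_convergent_iff convergent_def by blast
  have l': "(\<lambda>n. N (Y n)) \<longlonglongrightarrow> l" if Y: "Y \<in> seq_class G X" for Y
  proof -
    have "(\<lambda>n. N (X n) - N (Y n)) \<longlonglongrightarrow> 0"
    proof (rule tendsto_rabs_zero_cancel, rule null_seq_le[OF seq_classD(2)[OF Y]])
      show "\<bar>N (X n) - N (Y n)\<bar> \<le> N (X n - Y n)" for n
        by (intro diff CS_A0 X seq_classD(1)[OF Y])
    qed simp
    from tendsto_diff[OF l this] show ?thesis by simp
  qed
  have "nrm K (seq_class G X) = (THE l. \<forall>Y\<in>seq_class G X. (\<lambda>n. N (Y n)) \<longlonglongrightarrow> l)"
    by (simp add: graph_cstar_def)
  also have "\<dots> = l"
  proof (rule the_equality)
    show "\<forall>Y\<in>seq_class G X. (\<lambda>n. N (Y n)) \<longlonglongrightarrow> l"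
      using l' by blast
    show "l' = l" if "\<forall>Y\<in>seq_class G X. (\<lambda>n. N (Y n)) \<longlonglongrightarrow> l'" for l'
      using that l seq_class_self[OF X] LIMSEQ_unique by blast
  qed
  finally show ?thesis
    using l by simp
qed

lemma Lg_dense_1:
  "Lg_dense K 1 \<longleftrightarrow> (\<forall>x\<in>carrier K. \<forall>\<epsilon>>0. \<exists>z\<in>carrier K. (\<exists>y\<in>carrier K. y \<otimes>\<^bsub>K\<^esub> z = \<one>\<^bsub>K\<^esub>) \<and>
     nrm K (x \<ominus>\<^bsub>K\<^esub> z) < \<epsilon>)"
proof -
  interpret K: abelian_group K
    by (rule abelian_group_K)
  have mult_closed: "y \<otimes>\<^bsub>K\<^esub> z \<in> carrier K" if "y \<in> carrier K" "z \<in> carrier K" for y z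
    using that by (auto simp: carrier_K mult_K CS_mult)
  have dom: "{..<1::nat} = {0}" by auto
  have fin1: "(\<Oplus>\<^bsub>K\<^esub>i\<in>{..<1::nat}. y i \<otimes>\<^bsub>K\<^esub> x i) = y 0 \<otimes>\<^bsub>K\<^esub> x 0"
    if "y 0 \<in> carrier K" "x 0 \<in> carrier K" for x y
    unfolding dom using that by (subst K.finsum_insert) (auto simp: mult_closed)
  define c where "c = (\<lambda>x (i::nat). if i = 0 then x else undefined :: (nat \<Rightarrow> 'm star_poly) set)"
  have c: "c x \<in> {..<1} \<rightarrow>\<^sub>E carrier K" if "x \<in> carrier K" for x
    using that by (auto simp: c_def PiE_iff extensional_def)
  have ext: "x = c (x 0)" "x 0 \<in> carrier K" if "x \<in> {..<1} \<rightarrow>\<^sub>E carrier K"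
    for x :: "nat \<Rightarrow> (nat \<Rightarrow> 'm star_poly) set"
    using that by (auto simp: c_def PiE_iff extensional_def fun_eq_iff)
  have Lg: "x \<in> Lg K 1 \<longleftrightarrow> (x \<in> {..<1} \<rightarrow>\<^sub>E carrier K \<and> (\<exists>y\<in>carrier K. y \<otimes>\<^bsub>K\<^esub> x 0 = \<one>\<^bsub>K\<^esub>))" for x
  proof
    assume "x \<in> Lg K 1"
    then obtain y where y: "x \<in> {..<1} \<rightarrow>\<^sub>E carrier K" "y \<in> {..<1} \<rightarrow>\<^sub>E carrier K"
      "(\<Oplus>\<^bsub>K\<^esub>i\<in>{..<1::nat}. y i \<otimes>\<^bsub>K\<^esub> x i) = \<one>\<^bsub>K\<^esub>"
      by (auto simp: Lg_def)
    then show "x \<in> {..<1} \<rightarrow>\<^sub>E carrier K \<and> (\<exists>y\<in>carrier K. y \<otimes>\<^bsub>K\<^esub> x 0 = \<one>\<^bsub>K\<^esub>)"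
      using fin1[of y x] ext(2)[OF y(1)] ext(2)[OF y(2)] by auto
  next
    assume *: "x \<in> {..<1} \<rightarrow>\<^sub>E carrier K \<and> (\<exists>y\<in>carrier K. y \<otimes>\<^bsub>K\<^esub> x 0 = \<one>\<^bsub>K\<^esub>)"
    then obtain y where y: "y \<in> carrier K" "y \<otimes>\<^bsub>K\<^esub> x 0 = \<one>\<^bsub>K\<^esub>" by auto
    have "(\<Oplus>\<^bsub>K\<^esub>i\<in>{..<1::nat}. c y i \<otimes>\<^bsub>K\<^esub> x i) = \<one>\<^bsub>K\<^esub>"
      using fin1[of "c y" x] * y ext(2)[of x] by (simp add: c_def)
    then show "x \<in> Lg K 1"
      using * c[OF y(1)] unfolding Lg_def by blast
  qed
  show ?thesis
  proof
    assume d: "Lg_dense K 1"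
    show "\<forall>x\<in>carrier K. \<forall>\<epsilon>>0. \<exists>z\<in>carrier K. (\<exists>y\<in>carrier K. y \<otimes>\<^bsub>K\<^esub> z = \<one>\<^bsub>K\<^esub>) \<and>
       nrm K (x \<ominus>\<^bsub>K\<^esub> z) < \<epsilon>"
    proof (intro ballI allI impI)
      fix x and \<epsilon> :: real assume "x \<in> carrier K" "\<epsilon> > 0"
      then obtain z where z: "z \<in> Lg K 1" "\<forall>i<1. nrm K (c x i \<ominus>\<^bsub>K\<^esub> z i) < \<epsilon>"
        using d c unfolding Lg_dense_def by blast
      have "nrm K (x \<ominus>\<^bsub>K\<^esub> z 0) < \<epsilon>"
        using z(2) by (simp add: c_def)
      then show "\<exists>z\<in>carrier K. (\<exists>y\<in>carrier K. y \<otimes>\<^bsub>K\<^esub> z = \<one>\<^bsub>K\<^esub>) \<and> nrm K (x \<ominus>\<^bsub>K\<^esub> z) < \<epsilon>"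
        using ext(2)[of z] z(1) unfolding Lg by blast
    qed
  next
    assume d: "\<forall>x\<in>carrier K. \<forall>\<epsilon>>0. \<exists>z\<in>carrier K. (\<exists>y\<in>carrier K. y \<otimes>\<^bsub>K\<^esub> z = \<one>\<^bsub>K\<^esub>) \<and>
       nrm K (x \<ominus>\<^bsub>K\<^esub> z) < \<epsilon>"
    show "Lg_dense K 1"
      unfolding Lg_dense_def
    proof (intro ballI allI impI)
      fix x :: "nat \<Rightarrow> (nat \<Rightarrow> 'm star_poly) set" and \<epsilon> :: real
      assume x: "x \<in> {..<1} \<rightarrow>\<^sub>E carrier K" "\<epsilon> > 0"
      from bspec[OF d ext(2)[OF x(1)]] x(2) obtain z where
        z: "z \<in> carrier K" "\<exists>y\<in>carrier K. y \<otimes>\<^bsub>K\<^esub> z = \<one>\<^bsub>K\<^esub>" "nrm K (x 0 \<ominus>\<^bsub>K\<^esub> z) < \<epsilon>"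
        by blast
      have cz: "c z 0 = z"
        by (simp add: c_def)
      have "c z \<in> Lg K 1"
        unfolding Lg cz using z(2) c[OF z(1)] by (intro conjI)
      moreover have "\<forall>i<1. nrm K (x i \<ominus>\<^bsub>K\<^esub> c z i) < \<epsilon>"
        using z(3) cz by simp
      ultimately show "\<exists>z\<in>Lg K 1. \<forall>i<1. nrm K (x i \<ominus>\<^bsub>K\<^esub> z i) < \<epsilon>"
        by (intro bexI)
    qed
  qed
qed

lemma full_iff:
  "cs.full un \<longleftrightarrow> (\<forall>x\<in>A0. \<forall>\<epsilon>>0. \<exists>z\<in>A0. \<exists>y\<in>A0. N (x - z) < \<epsilon> \<and> N (y * z - unit_sum) < 1)"
proof -
  have nn: "nn (cls f - cls g) = N (f - g)" if "f \<in> A0" "g \<in> A0" for f g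
    using cls_nn[of "f - g"] nrm1_A0[OF free_diff[OF that]] by (simp add: cls_hom)
  have nnm: "nn (cls f * cls g - un) = N (f * g - unit_sum)" if "f \<in> A0" "g \<in> A0" for f g
    using nn[OF free_mult[OF that] unit_sum_A0] by (simp add: cls_hom cls_unit_sum)
  show ?thesis
  proof
    assume f: "cs.full un"
    show "\<forall>x\<in>A0. \<forall>\<epsilon>>0. \<exists>z\<in>A0. \<exists>y\<in>A0. N (x - z) < \<epsilon> \<and> N (y * z - unit_sum) < 1"
    proof (intro ballI allI impI)
      fix x and \<epsilon> :: real assume x: "x \<in> A0" "\<epsilon> > 0"
      then obtain z y where zy: "cs.cor un z" "cs.cor un y" "nn (cls x - z) < \<epsilon>" "nn (y * z - un) < 1"
        using f cor_un[of x] unfolding cs.full_def cs.approx_def cs.linv_def by metis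
      then obtain z' y' where "z' \<in> A0" "z = cls z'" "y' \<in> A0" "y = cls y'"
        using cls_surj by metis
      then show "\<exists>z\<in>A0. \<exists>y\<in>A0. N (x - z) < \<epsilon> \<and> N (y * z - unit_sum) < 1"
        using zy x nn nnm by auto
    qed
  next
    assume d: "\<forall>x\<in>A0. \<forall>\<epsilon>>0. \<exists>z\<in>A0. \<exists>y\<in>A0. N (x - z) < \<epsilon> \<and> N (y * z - unit_sum) < 1"
    have "cs.approx un F" if F: "cs.cor un F" for F
      unfolding cs.approx_def
    proof (intro allI impI)
      fix \<epsilon> :: real assume "\<epsilon> > 0"
      obtain x where x: "x \<in> A0" "F = cls x"
        using cls_surj[OF F] by blast
      then obtain z y where "z \<in> A0" "y \<in> A0" "N (x - z) < \<epsilon>" "N (y * z - unit_sum) < 1"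
        using d \<open>\<epsilon> > 0\<close> by blast
      then show "\<exists>x'. cs.cor un x' \<and> cs.linv un x' \<and> nn (F - x') < \<epsilon>"
        using cor_un[of z] cor_un[of y] nn[of x z] nnm[of y z] x
        by (intro exI[of _ "cls z"]) (auto simp: cs.linv_def)
    qed
    then show "cs.full un"
      by (simp add: cs.full_def un_un)
  qed
qed

text \<open>From the completion to polynomials one takes late terms of the sequences for
  \<open>z\<close> and \<open>y\<close>. In the other direction a left invertible element near
  \<open>x\<close> can be sought among the constant sequences, and an approximate left inverse of it
  becomes exact as the limit of a Neumann series.\<close>

theorem stable_rank_1_iff_full: "stable_rank K = 1 \<longleftrightarrow> cs.full un"
  unfolding stable_rank_eq_1 Lg_dense_1 full_iff
proof
  assume d: "\<forall>x\<in>carrier K. \<forall>\<epsilon>>0. \<exists>z\<in>carrier K. (\<exists>y\<in>carrier K. y \<otimes>\<^bsub>K\<^esub> z = \<one>\<^bsub>K\<^esub>) \<and>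
     nrm K (x \<ominus>\<^bsub>K\<^esub> z) < \<epsilon>"
  show "\<forall>x\<in>A0. \<forall>\<epsilon>>0. \<exists>z\<in>A0. \<exists>y\<in>A0. N (x - z) < \<epsilon> \<and> N (y * z - unit_sum) < 1"
  proof (intro ballI allI impI)
    fix x and \<epsilon> :: real assume x: "x \<in> A0" and \<epsilon>: "\<epsilon> > 0"
    have x': "(\<lambda>_. x) \<in> CS" by (rule CS_const[OF x])
    then have "seq_class G (\<lambda>_. x) \<in> carrier K"
      by (simp add: carrier_K)
    with d \<epsilon> obtain z y where zy: "z \<in> carrier K" "y \<in> carrier K" "y \<otimes>\<^bsub>K\<^esub> z = \<one>\<^bsub>K\<^esub>"
      "nrm K (seq_class G (\<lambda>_. x) \<ominus>\<^bsub>K\<^esub> z) < \<epsilon>" by blast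
    then obtain Z Y where Z: "Z \<in> CS" "z = seq_class G Z" and Y: "Y \<in> CS" "y = seq_class G Y"
      by (auto simp: carrier_K)
    have "(\<lambda>n. Y n * Z n) \<in> seq_class G (\<lambda>_. unit_sum)"
      using zy(3) seq_class_self[OF CS_mult[OF Y(1) Z(1)]] unfolding Z Y one_K mult_K[OF Y(1) Z(1)] by simp
    then have "(\<lambda>n. N (unit_sum - Y n * Z n)) \<longlonglongrightarrow> 0"
      by (rule seq_classD)
    then have 1: "\<forall>\<^sub>F n in sequentially. N (unit_sum - Y n * Z n) < 1"
      by (rule order_tendstoD) simp
    have "(\<lambda>n. x - Z n) \<in> CS"
      using CS_add[OF x' CS_uminus[OF Z(1)]] by simp
    from nrm_K[OF this] have "(\<lambda>n. N (x - Z n)) \<longlonglongrightarrow> nrm K (seq_class G (\<lambda>_. x) \<ominus>\<^bsub>K\<^esub> z)"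
      by (simp add: Z minus_K[OF x' Z(1)])
    then have "\<forall>\<^sub>F n in sequentially. N (x - Z n) < \<epsilon>"
      by (rule order_tendstoD) (rule zy(4))
    with 1 obtain n where "N (unit_sum - Y n * Z n) < 1" "N (x - Z n) < \<epsilon>"
      using eventually_happens'[OF sequentially_bot eventually_conj] by blast
    moreover have "Z n \<in> A0" "Y n \<in> A0"
      using Z Y CS_A0 by auto
    ultimately show "\<exists>z\<in>A0. \<exists>y\<in>A0. N (x - z) < \<epsilon> \<and> N (y * z - unit_sum) < 1"
      using N_sym[OF unit_sum_A0 free_mult] by metis
  qed
next
  assume d: "\<forall>x\<in>A0. \<forall>\<epsilon>>0. \<exists>z\<in>A0. \<exists>y\<in>A0. N (x - z) < \<epsilon> \<and> N (y * z - unit_sum) < 1"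
  show "\<forall>x\<in>carrier K. \<forall>\<epsilon>>0. \<exists>z\<in>carrier K. (\<exists>y\<in>carrier K. y \<otimes>\<^bsub>K\<^esub> z = \<one>\<^bsub>K\<^esub>) \<and>
     nrm K (x \<ominus>\<^bsub>K\<^esub> z) < \<epsilon>"
  proof (intro ballI allI impI)
    fix x and \<epsilon> :: real assume "x \<in> carrier K" and \<epsilon>: "\<epsilon> > 0"
    then obtain X where X: "X \<in> CS" "x = seq_class G X"
      by (auto simp: carrier_K)
    \<comment> \<open>Thirds and not halves: the norm of a class is a limit, and a bound by two
      thirds of \<epsilon> stays below \<epsilon> in the limit.\<close>
    obtain M where M: "\<And>m n. m \<ge> M \<Longrightarrow> n \<ge> M \<Longrightarrow> N (X m - X n) < \<epsilon> / 3"
      using CS_D[OF X(1), of "\<epsilon> / 3"] \<epsilon> by auto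
    obtain z y where z: "z \<in> A0" and y: "y \<in> A0" and zy: "N (X M - z) < \<epsilon> / 3" "N (y * z - unit_sum) < 1"
      using d CS_A0[OF X(1), of M] \<epsilon> by (meson divide_pos_pos zero_less_numeral)
    have z': "(\<lambda>_. z) \<in> CS" by (rule CS_const[OF z])
    define r where "r = unit_sum - y * z"
    have r: "r \<in> A0" "N r < 1"
      using zy(2) N_sym[OF unit_sum_A0 free_mult[OF y z]] y z by (auto simp: r_def A0_closed unit_sum_A0)
    \<comment> \<open>The partial sums of the Neumann series. They form a Cauchy sequence, whose
      class is the left inverse of the constant sequence \<open>z\<close>.\<close>
    define Y where "Y = rec_nat y (\<lambda>_ v. y + r * v)"
    have Y: "Y 0 = y" "Y (Suc n) = y + r * Y n" for n
      by (simp_all add: Y_def)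
    have YA: "Y n \<in> A0" for n
      by (induction n) (simp_all add: Y y r A0_closed)
    have step: "N (Y (Suc n) - Y n) \<le> N r ^ n * N (r * y)" for n
    proof (induction n)
      case 0
      then show ?case by (simp add: Y)
    next
      case (Suc n)
      have "Y (Suc (Suc n)) - Y (Suc n) = r * (Y (Suc n) - Y n)"
        unfolding Y(2)[of "Suc n"] Y(2)[of n] by (simp add: algebra_simps)
      then have "N (Y (Suc (Suc n)) - Y (Suc n)) \<le> N r * N (Y (Suc n) - Y n)"
        using N_ax(4)[OF r(1) free_diff[OF YA YA]] by simp
      also have "\<dots> \<le> N r * (N r ^ n * N (r * y))"
        using Suc N_nonneg[OF r(1)] by (intro mult_left_mono)
      finally show ?case by simp
    qed
    have tail: "N (Y (n + k) - Y n) \<le> (\<Sum>j<k. N r ^ (n + j) * N (r * y))" for n k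
    proof (induction k)
      case 0
      then show ?case by (simp add: N_0)
    next
      case (Suc k)
      then show ?case
        using N_triangle[OF YA[of "n + Suc k"] YA[of "n + k"] YA[of n]] step[of "n + k"] by simp
    qed
    have tail2: "N (Y (n + k) - Y n) \<le> N r ^ n * (N (r * y) / (1 - N r))" for n k
    proof -
      have "(\<Sum>j<k. N r ^ (n + j) * N (r * y)) = N r ^ n * N (r * y) * (\<Sum>j<k. N r ^ j)"
        by (simp add: power_add sum_distrib_left mult_ac)
      also have "(\<Sum>j<k. N r ^ j) \<le> 1 / (1 - N r)"
        using sum_le_suminf[OF summable_geometric, of "N r" "{..<k}"] suminf_geometric[of "N r"]
          r(2) N_nonneg[OF r(1)] by simp
      then have "N r ^ n * N (r * y) * (\<Sum>j<k. N r ^ j) \<le> N r ^ n * N (r * y) * (1 / (1 - N r))"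
        using N_nonneg[OF r(1)] N_nonneg[OF free_mult[OF r(1) y]] by (intro mult_left_mono) auto
      finally show ?thesis
        using tail[of n k] by simp
    qed
    have null: "(\<lambda>n. N r ^ n * c) \<longlonglongrightarrow> 0" for c
      using r(2) N_nonneg[OF r(1)] by (intro tendsto_mult_left_zero LIMSEQ_power_zero) simp
    have "Y \<in> CS"
      unfolding cauchy_seqs_def
    proof (intro CollectI conjI allI impI YA)
      fix \<delta> :: real assume "\<delta> > 0"
      then obtain n0 where n0: "\<And>n. n \<ge> n0 \<Longrightarrow> N r ^ n * (N (r * y) / (1 - N r)) < \<delta>"
        using order_tendstoD(2)[OF null[of "N (r * y) / (1 - N r)"], of \<delta>] by (auto simp: eventually_sequentially)
      have le: "N (Y m - Y n) < \<delta>" if "m \<ge> n" "n \<ge> n0" for m n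
        using tail2[of n "m - n"] n0[of n] that by simp
      then have "N (Y m - Y n) < \<delta>" if "m \<ge> n0" "n \<ge> n0" for m n
        using that N_sym[OF YA YA, of m n] le[of n m] le[of m n] by (cases "m \<ge> n") auto
      then show "\<exists>M. \<forall>m\<ge>M. \<forall>n\<ge>M. N (Y m - Y n) < \<delta>"
        by blast
    qed
    have inv: "N (unit_sum - Y n * z) \<le> N r ^ Suc n" for n
    proof (induction n)
      case 0
      then show ?case by (simp add: Y r_def)
    next
      case (Suc n)
      have "N (unit_sum - Y (Suc n) * z) = N (r * (unit_sum - Y n * z))"
      proof (rule N_cong)
        have "unit_sum - Y (Suc n) * z - r * (unit_sum - Y n * z) = 0 - (r * unit_sum - r)"
          by (simp add: Y r_def algebra_simps)
        then show "N (unit_sum - Y (Suc n) * z - r * (unit_sum - Y n * z)) = 0"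
          using unit_sum_right[OF r(1)] N_uminus[of "r * unit_sum - r"] r
          by (simp add: A0_closed unit_sum_A0)
      qed (intro A0_closed unit_sum_A0 YA z r)+
      also have "\<dots> \<le> N r * N (unit_sum - Y n * z)"
        by (intro N_ax(4) A0_closed unit_sum_A0 YA z r)
      also have "\<dots> \<le> N r * N r ^ Suc n"
        using Suc N_nonneg[OF r(1)] by (intro mult_left_mono)
      finally show ?case by simp
    qed
    have "(\<lambda>n. N (unit_sum - Y n * z)) \<longlonglongrightarrow> 0"
    proof (rule null_seq_le[OF null[of "N r"]])
      show "N (unit_sum - Y n * z) \<le> N r ^ n * N r" for n
        using inv[of n] by (simp add: mult.commute)
    qed (intro N_nonneg A0_closed unit_sum_A0 YA z)
    then have "seq_class G Y \<otimes>\<^bsub>K\<^esub> seq_class G (\<lambda>_. z) = \<one>\<^bsub>K\<^esub>"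
      unfolding mult_K[OF \<open>Y \<in> CS\<close> z'] one_K
      by (intro seq_class_eqI[symmetric] CS_const CS_mult[OF \<open>Y \<in> CS\<close> z'] unit_sum_A0)
    moreover have "nrm K (x \<ominus>\<^bsub>K\<^esub> seq_class G (\<lambda>_. z)) < \<epsilon>"
    proof -
      have C: "(\<lambda>n. X n - z) \<in> CS"
        using CS_add[OF X(1) CS_uminus[OF z']] by simp
      have "N (X n - z) \<le> 2 * \<epsilon> / 3" if "n \<ge> M" for n
        using N_triangle[OF CS_A0[OF X(1), of n] CS_A0[OF X(1), of M] z] M[of n M] that zy(1) by simp
      then have "nrm K (seq_class G (\<lambda>n. X n - z)) \<le> 2 * \<epsilon> / 3"
        using nrm_K[OF C] by (intro LIMSEQ_le_const2) auto
      then show ?thesis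
        using \<epsilon> by (simp add: X minus_K[OF X(1) z'])
    qed
    ultimately show "\<exists>z\<in>carrier K. (\<exists>y\<in>carrier K. y \<otimes>\<^bsub>K\<^esub> z = \<one>\<^bsub>K\<^esub>) \<and> nrm K (x \<ominus>\<^bsub>K\<^esub> z) < \<epsilon>"
      using z' \<open>Y \<in> CS\<close> unfolding carrier_K by blast
  qed
qed

end

section \<open>Paths\<close>

lemma vec_le_iff: "m \<le> n \<longleftrightarrow> (\<forall>i. m $ i \<le> n $ i)" for m n :: "nat ^ 'k"
  by (simp add: less_eq_vec_def)

lemma vec_diff_add: "m \<le> n \<Longrightarrow> m + (n - m) = n" for m n :: "nat ^ 'k"
  by (simp add: vec_le_iff vec_eq_iff)

lemma vec_le_add: "m \<le> m + n" for m n :: "nat ^ 'k"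
  by (simp add: vec_le_iff)

lemma axis_nth_nat: "axis i (t :: nat) $ j = (if j = i then t else 0)"
  by (simp add: axis_def)

lemma finite_vec_atMost: "finite {m. m \<le> n}" for n :: "nat ^ 'k::finite"
proof -
  have "{m. m \<le> n} \<subseteq> vec_lambda ` (PiE UNIV (\<lambda>i. {..n $ i}))"
  proof
    fix m assume "m \<in> {m. m \<le> n}"
    then have "vec_nth m \<in> PiE UNIV (\<lambda>i. {..n $ i})"
      by (auto simp: vec_le_iff)
    moreover have "m = vec_lambda (vec_nth m)"
      by (simp add: vec_eq_iff)
    ultimately show "m \<in> vec_lambda ` (PiE UNIV (\<lambda>i. {..n $ i}))"
      by blast
  qed
  then show ?thesis
    by (rule finite_subset) (intro finite_imageI finite_PiE; simp)
qed

context k_graph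
begin

abbreviation M where "M \<equiv> mor G"
abbreviation r where "r \<equiv> rng G"
abbreviation s where "s \<equiv> src G"
abbreviation d where "d \<equiv> deg G"

lemma factorE:
  assumes "\<alpha> \<in> M" "m \<le> d \<alpha>"
  obtains \<mu> \<nu> where "\<mu> \<in> M" "\<nu> \<in> M" "d \<mu> = m" "d \<nu> = d \<alpha> - m" "s \<mu> = r \<nu>" "\<alpha> = cmp G \<mu> \<nu>"
    "r \<mu> = r \<alpha>" "s \<nu> = s \<alpha>"
proof -
  obtain \<mu> \<nu> where *: "\<mu> \<in> M" "\<nu> \<in> M" "d \<mu> = m" "d \<nu> = d \<alpha> - m" "s \<mu> = r \<nu>" "\<alpha> = cmp G \<mu> \<nu>"
    using factorisation[OF assms(1), of m "d \<alpha> - m"] vec_diff_add[OF assms(2)] by auto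
  then show ?thesis
    using rng_cmp src_cmp by (intro that[of \<mu> \<nu>]) auto
qed

lemma factor_unique:
  assumes "\<mu> \<in> M" "\<nu> \<in> M" "s \<mu> = r \<nu>" "\<mu>' \<in> M" "\<nu>' \<in> M" "s \<mu>' = r \<nu>'"
    "cmp G \<mu> \<nu> = cmp G \<mu>' \<nu>'" "d \<mu> = d \<mu>'"
  shows "\<mu> = \<mu>'" "\<nu> = \<nu>'"
proof -
  let ?\<alpha> = "cmp G \<mu> \<nu>"
  have "d \<mu> + d \<nu> = d \<mu>' + d \<nu>'"
    using assms deg_cmp by metis
  then have "d \<nu>' = d \<nu>"
    using assms(8) by simp
  define Q where "Q = (\<lambda>(a, b). a \<in> M \<and> b \<in> M \<and> d a = d \<mu> \<and> d b = d \<nu> \<and> s a = r b \<and> ?\<alpha> = cmp G a b)"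
  have "\<exists>!p. Q p"
    unfolding Q_def using assms(1-3) by (intro factorisation cmp_closed deg_cmp)
  then obtain p where p: "\<And>q. Q q \<Longrightarrow> q = p"
    by (metis)
  have "Q (\<mu>, \<nu>)" "Q (\<mu>', \<nu>')"
    unfolding Q_def using assms \<open>d \<nu>' = d \<nu>\<close> by simp_all
  then have "(\<mu>, \<nu>) = (\<mu>', \<nu>')"
    using p by metis
  then show "\<mu> = \<mu>'" "\<nu> = \<nu>'"
    by auto
qed

lemma deg_0_rng: "\<alpha> \<in> M \<Longrightarrow> d \<alpha> = 0 \<Longrightarrow> r \<alpha> = \<alpha>"
  using factor_unique(1)[of "r \<alpha>" \<alpha> \<alpha> "s \<alpha>"]
  by (simp add: rng_closed src_closed src_rng rng_src cmp_rng cmp_src deg_rng)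

lemma deg_0_src: "\<alpha> \<in> M \<Longrightarrow> d \<alpha> = 0 \<Longrightarrow> s \<alpha> = \<alpha>"
  using deg_0_rng src_rng by metis

lemma vertsD: "v \<in> verts G \<Longrightarrow> v \<in> M \<and> d v = 0 \<and> r v = v \<and> s v = v"
  using deg_0_rng[of v] deg_0_src[of v] by (simp add: paths_of_deg_def)

definition edges_at :: "'m \<Rightarrow> 'k \<Rightarrow> 'm set" where
  "edges_at v i = paths_to G v (paths_of_deg G (unit_deg i))"

lemma edges_at_iff: "f \<in> edges_at v i \<longleftrightarrow> f \<in> M \<and> d f = unit_deg i \<and> r f = v"
  by (auto simp: edges_at_def paths_to_def paths_of_deg_def)

lemma edges_at_path:
  assumes "\<beta> \<in> M" "d \<beta> $ i > 0"
  shows "edges_at (r \<beta>) i \<noteq> {}"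
proof -
  have "unit_deg i \<le> d \<beta>"
    using assms by (auto simp: vec_le_iff axis_nth_nat)
  then obtain \<mu> where "\<mu> \<in> M" "d \<mu> = unit_deg i" "r \<mu> = r \<beta>"
    using factorE[OF assms(1)] by metis
  then show ?thesis
    using edges_at_iff by blast
qed

lemma paths_le_iff: "\<alpha> \<in> paths_le G n \<longleftrightarrow> \<alpha> \<in> M \<and> d \<alpha> \<le> n \<and> (\<forall>i. d \<alpha> + unit_deg i \<le> n \<longrightarrow> edges_at (s \<alpha>) i = {})"
  by (simp add: paths_le_def edges_at_def)

lemma paths_le_self: "\<alpha> \<in> M \<Longrightarrow> \<alpha> \<in> paths_le G (d \<alpha>)"
  by (auto simp: paths_le_iff vec_le_iff axis_nth_nat)

lemma paths_le_cmp:
  assumes "\<alpha> \<in> M" "\<eta> \<in> paths_le G m" "s \<alpha> = r \<eta>"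
  shows "cmp G \<alpha> \<eta> \<in> paths_le G (d \<alpha> + m)"
proof -
  have \<eta>: "\<eta> \<in> M" "d \<eta> \<le> m"
    using assms(2) by (simp_all add: paths_le_iff)
  then show ?thesis
    using assms by (auto simp: paths_le_iff cmp_closed deg_cmp src_cmp vec_le_iff add.assoc)
qed

text \<open>Greedy extension: a path of degree at most \<open>n\<close> outside
  \<open>paths_le G n\<close> can be prolonged by an edge within \<open>n\<close>, and the total
  degree still missing drops.\<close>

lemma paths_le_exists:
  assumes v: "v \<in> verts G"
  shows "\<exists>\<eta>\<in>paths_le G n. r \<eta> = v"
proof -
  have "\<exists>\<eta>\<in>paths_le G n. r \<eta> = v" if "\<alpha> \<in> M" "r \<alpha> = v" "d \<alpha> \<le> n" for \<alpha>
    using that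
  proof (induction "\<Sum>i\<in>UNIV. n $ i - d \<alpha> $ i" arbitrary: \<alpha> rule: less_induct)
    case less
    show ?case
    proof (cases "\<alpha> \<in> paths_le G n")
      case False
      then obtain i f where f: "d \<alpha> + unit_deg i \<le> n" "f \<in> edges_at (s \<alpha>) i"
        using less.prems by (auto simp: paths_le_iff)
      then have f': "f \<in> M" "d f = unit_deg i" "r f = s \<alpha>"
        by (simp_all add: edges_at_iff)
      have dc: "d (cmp G \<alpha> f) = d \<alpha> + unit_deg i"
        using f' less.prems by (simp add: deg_cmp)
      have "(\<Sum>j\<in>UNIV. n $ j - d (cmp G \<alpha> f) $ j) < (\<Sum>j\<in>UNIV. n $ j - d \<alpha> $ j)"
      proof (rule sum_strict_mono_ex1)
        show "\<forall>j\<in>UNIV. n $ j - d (cmp G \<alpha> f) $ j \<le> n $ j - d \<alpha> $ j"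
          by (auto simp: dc intro: diff_le_mono2)
        have "d \<alpha> $ i + 1 \<le> n $ i"
          using f(1) by (auto simp: vec_le_iff axis_nth_nat dest: spec[of _ i])
        then show "\<exists>j\<in>UNIV. n $ j - d (cmp G \<alpha> f) $ j < n $ j - d \<alpha> $ j"
          by (intro bexI[of _ i]) (auto simp: dc axis_nth_nat)
      qed simp
      then show ?thesis
        using less.hyps[of "cmp G \<alpha> f"] f f' less.prems dc by (simp add: cmp_closed rng_cmp)
    qed (use less in blast)
  qed
  from this[of v] show ?thesis
    using vertsD[OF v] by (simp add: vec_le_iff)
qed

primrec cpow :: "'m \<Rightarrow> 'm \<Rightarrow> nat \<Rightarrow> 'm" where
  "cpow w \<alpha> 0 = w"
| "cpow w \<alpha> (Suc l) = cmp G \<alpha> (cpow w \<alpha> l)"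

lemma cpow_props:
  assumes "w \<in> verts G" "\<alpha> \<in> M" "r \<alpha> = w" "s \<alpha> = w"
  shows "cpow w \<alpha> l \<in> M \<and> r (cpow w \<alpha> l) = w \<and> s (cpow w \<alpha> l) = w \<and> d (cpow w \<alpha> l) = l *s d \<alpha>"
  using assms
  by (induction l) (auto simp: vertsD cmp_closed rng_cmp src_cmp deg_cmp vec_eq_iff)

end

context finite_k_graph
begin

lemma finite_paths_le: "finite (paths_le G n)"
proof -
  have "paths_le G n \<subseteq> (\<Union>m\<in>{m. m \<le> n}. paths_of_deg G m)"
    by (auto simp: paths_le_def paths_of_deg_def)
  then show ?thesis
    using fin finite_vec_atMost[of n] by (auto simp: finite_kgraph_def intro: finite_subset)
qed

section \<open>Cuntz--Krieger relations\<close>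

definition S :: "'m \<Rightarrow> 'm star_poly quo" where
  "S \<alpha> = cls (gen \<alpha>)"

definition T :: "'m \<Rightarrow> 'm star_poly quo" where
  "T \<alpha> = quo_star (S \<alpha>)"

lemma cls_ck: "f \<in> ck_relations G \<Longrightarrow> cls f = 0"
  using cls_eqI[of f 0] ck_A0[of f] N_ck[of f] by (simp add: cls_hom)

lemma star_vert: "v \<in> verts G \<Longrightarrow> T v = S v"
  using cls_ck[of "poly_adj (gen v) - gen v"]
  by (force simp: ck_relations_def cls_hom T_def S_def)

lemma vert_idem: "v \<in> verts G \<Longrightarrow> S v * S v = S v"
  using cls_ck[of "gen v * gen v - gen v"] by (force simp: ck_relations_def cls_hom S_def)

lemma vert_orth: "v \<in> verts G \<Longrightarrow> w \<in> verts G \<Longrightarrow> v \<noteq> w \<Longrightarrow> S v * S w = 0"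
  using cls_ck[of "gen v * gen w"] by (force simp: ck_relations_def cls_hom S_def)

lemma S_mult: "\<mu> \<in> M \<Longrightarrow> \<nu> \<in> M \<Longrightarrow> s \<mu> = r \<nu> \<Longrightarrow> S \<mu> * S \<nu> = S (cmp G \<mu> \<nu>)"
  using cls_ck[of "gen \<mu> * gen \<nu> - gen (cmp G \<mu> \<nu>)"] by (force simp: ck_relations_def cls_hom S_def)

lemma T_mult: "\<mu> \<in> M \<Longrightarrow> \<nu> \<in> M \<Longrightarrow> s \<mu> = r \<nu> \<Longrightarrow> T \<nu> * T \<mu> = T (cmp G \<mu> \<nu>)"
  unfolding T_def by (simp add: quo_star_mult[symmetric] S_mult)

lemma T_S: "\<alpha> \<in> M \<Longrightarrow> T \<alpha> * S \<alpha> = S (s \<alpha>)"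
  using cls_ck[of "poly_adj (gen \<alpha>) * gen \<alpha> - gen (src G \<alpha>)"]
  by (force simp: ck_relations_def cls_hom S_def T_def)

lemma S_sum: "v \<in> verts G \<Longrightarrow> S v = (\<Sum>\<alpha>\<in>paths_to G v (paths_le G n). S \<alpha> * T \<alpha>)"
  using cls_ck[of "gen v - (\<Sum>\<alpha>\<in>paths_to G v (paths_le G n). gen \<alpha> * poly_adj (gen \<alpha>))"]
  by (force simp: ck_relations_def cls_hom S_def T_def)

lemma S_rng: "\<alpha> \<in> M \<Longrightarrow> S (r \<alpha>) * S \<alpha> = S \<alpha>"
  by (simp add: S_mult rng_closed src_rng cmp_rng)

lemma S_src: "\<alpha> \<in> M \<Longrightarrow> S \<alpha> * S (s \<alpha>) = S \<alpha>"
  by (simp add: S_mult src_closed rng_src cmp_src)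

lemma T_rng: "\<alpha> \<in> M \<Longrightarrow> T \<alpha> * S (r \<alpha>) = T \<alpha>"
  using S_rng[of \<alpha>] star_vert[OF rng_verts, of \<alpha>] unfolding T_def by (metis quo_star_mult)

lemma T_src: "\<alpha> \<in> M \<Longrightarrow> S (s \<alpha>) * T \<alpha> = T \<alpha>"
  using S_src[of \<alpha>] star_vert[OF src_verts, of \<alpha>] unfolding T_def by (metis quo_star_mult)

lemma un_S [simp]: "un * S \<alpha> = S \<alpha>" "un * (S \<alpha> * F) = S \<alpha> * F"
  by (simp_all add: S_def un_cls)

lemma proj_vert: "v \<in> verts G \<Longrightarrow> cs.proj (S v)"
  using vert_idem[of v] star_vert[of v] by (simp add: cs.proj_def T_def)

lemma proj_path: "\<alpha> \<in> M \<Longrightarrow> cs.proj (S \<alpha> * T \<alpha>)"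
proof -
  assume \<alpha>: "\<alpha> \<in> M"
  have "S \<alpha> * T \<alpha> * (S \<alpha> * T \<alpha>) = S \<alpha> * (T \<alpha> * S \<alpha>) * T \<alpha>"
    by (simp add: mult.assoc)
  also have "\<dots> = S \<alpha> * T \<alpha>"
    using \<alpha> by (simp add: T_S S_src)
  finally show ?thesis
    by (simp add: cs.proj_def quo_star_mult T_def)
qed

lemma nn_S: "\<alpha> \<in> M \<Longrightarrow> nn (S \<alpha>) \<le> 1"
  using cs.nn_partial_isometry[of "S \<alpha>"] proj_vert[OF src_verts] T_S[of \<alpha>] by (simp add: T_def)

lemma nn_T: "\<alpha> \<in> M \<Longrightarrow> nn (T \<alpha>) \<le> 1"
  using nn_S[of \<alpha>] by (simp add: T_def cs.nn_star)

text \<open>For different ranges this is orthogonality of the vertices. For a common range the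
  projections \<open>S \<gamma> * T \<gamma>\<close> sum to the vertex projection and are therefore
  orthogonal; multiplying by \<open>T \<alpha>\<close> on the left and \<open>S \<beta>\<close> on
  the right strips the outer factors.\<close>

lemma path_orth:
  assumes \<alpha>: "\<alpha> \<in> paths_le G n" and \<beta>: "\<beta> \<in> paths_le G n" and ne: "\<alpha> \<noteq> \<beta>"
  shows "T \<alpha> * S \<beta> = 0"
proof -
  have M: "\<alpha> \<in> M" "\<beta> \<in> M"
    using \<alpha> \<beta> by (simp_all add: paths_le_iff)
  show ?thesis
  proof (cases "r \<alpha> = r \<beta>")
    case False
    have "T \<alpha> * S \<beta> = T \<alpha> * (S (r \<alpha>) * S (r \<beta>)) * S \<beta>"
      using M by (simp add: mult.assoc S_rng) (simp add: mult.assoc[symmetric] T_rng)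
    then show ?thesis
      using vert_orth[OF rng_verts rng_verts False] M by simp
  next
    case True
    define A where "A = paths_to G (r \<alpha>) (paths_le G n)"
    have rv: "r \<alpha> \<in> verts G"
      using M rng_verts by blast
    have A: "\<gamma> \<in> M \<and> r \<gamma> = r \<alpha>" if "\<gamma> \<in> A" for \<gamma>
      using that by (simp add: A_def paths_to_def paths_le_iff)
    have "S \<alpha> * T \<alpha> * (S \<beta> * T \<beta>) = 0"
    proof (rule cs.proj_sum_orthogonal[of A "\<lambda>\<gamma>. S \<gamma> * T \<gamma>" "S (r \<alpha>)"])
      show "finite A"
        using finite_paths_le[of n] by (auto simp: A_def paths_to_def)
      show "cs.proj (S \<gamma> * T \<gamma>)" if "\<gamma> \<in> A" for \<gamma>
        using A[OF that] proj_path by blast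
      show "cs.cor (S (r \<alpha>)) (S \<gamma> * T \<gamma>)" if "\<gamma> \<in> A" for \<gamma>
        using A[OF that] S_rng[of \<gamma>] T_rng[of \<gamma>] by (simp add: cs.cor_def mult.assoc) (simp add: mult.assoc[symmetric])
      show "cs.proj (S (r \<alpha>))"
        by (rule proj_vert[OF rv])
      show "sc 1 * S (r \<alpha>) = S (r \<alpha>)"
        by (simp add: un_sc[symmetric])
      show "(\<Sum>\<gamma>\<in>A. S \<gamma> * T \<gamma>) = S (r \<alpha>)"
        unfolding A_def by (rule S_sum[OF rv, symmetric])
      show "\<alpha> \<in> A" "\<beta> \<in> A" "\<alpha> \<noteq> \<beta>"
        using \<alpha> \<beta> ne True by (simp_all add: A_def paths_to_def)
    qed
    then have "T \<alpha> * (S \<alpha> * T \<alpha> * (S \<beta> * T \<beta>)) * S \<beta> = 0"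
      by simp
    moreover have "T \<alpha> * (S \<alpha> * T \<alpha> * (S \<beta> * T \<beta>)) * S \<beta> = (T \<alpha> * S \<alpha>) * (T \<alpha> * S \<beta>) * (T \<beta> * S \<beta>)"
      by (simp add: mult.assoc)
    moreover have "\<dots> = T \<alpha> * S \<beta>"
      using M by (simp add: T_S mult.assoc S_src) (simp add: mult.assoc[symmetric] T_src)
    ultimately show ?thesis by simp
  qed
qed

lemma un_sum: "un = (\<Sum>\<alpha>\<in>paths_le G n. S \<alpha> * T \<alpha>)"
proof -
  have "(\<Sum>\<alpha>\<in>paths_le G n. S \<alpha> * T \<alpha>) = (\<Sum>v\<in>verts G. \<Sum>\<alpha>\<in>paths_to G v (paths_le G n). S \<alpha> * T \<alpha>)"
    unfolding paths_to_def
    by (rule sum.group[symmetric]) (auto simp: finite_paths_le finite_verts paths_le_iff rng_verts)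
  also have "\<dots> = (\<Sum>v\<in>verts G. S v)"
    by (intro sum.cong refl S_sum[symmetric])
  also have "\<dots> = un"
    by (simp add: cls_unit_sum[symmetric] unit_sum_def cls_hom S_def)
  finally show ?thesis ..
qed

section \<open>Vertices with circle corners\<close>

definition good :: "'m \<Rightarrow> 'm \<Rightarrow> bool" where
  "good w \<alpha> \<longleftrightarrow> w \<in> verts G \<and> \<alpha> \<in> M \<and> r \<alpha> = w \<and> s \<alpha> = w \<and>
     (\<forall>n. \<forall>\<beta>\<in>paths_le G n. \<forall>\<gamma>\<in>paths_le G n. r \<beta> = w \<and> r \<gamma> = w \<longrightarrow> \<beta> = \<gamma>) \<and>
     (\<forall>\<beta>\<in>M. r \<beta> = w \<longrightarrow> (\<exists>\<kappa>\<in>M. \<exists>l. s \<beta> = r \<kappa> \<and> cmp G \<beta> \<kappa> = cpow w \<alpha> l)) \<and>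
     (\<forall>\<beta>\<in>M. r \<beta> = w \<and> s \<beta> = w \<longrightarrow> (\<exists>l. \<beta> = cpow w \<alpha> l))"

context
  fixes w \<alpha> assumes good: "good w \<alpha>"
begin

lemma goodD:
  "w \<in> verts G" "\<alpha> \<in> M" "r \<alpha> = w" "s \<alpha> = w"
  "\<beta> \<in> paths_le G n \<Longrightarrow> \<gamma> \<in> paths_le G n \<Longrightarrow> r \<beta> = w \<Longrightarrow> r \<gamma> = w \<Longrightarrow> \<beta> = \<gamma>"
  using good unfolding good_def by blast+

text \<open>Prolonging \<beta> by two members of \<open>paths_le G n\<close> gives two members of
  \<open>paths_le G (d \<beta> + n)\<close> with range \<open>w\<close>. These coincide, so the sum
  that expands \<open>S (s \<beta>)\<close> has one term.\<close>

lemma good_full_range: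
  assumes \<beta>: "\<beta> \<in> M" "r \<beta> = w" and \<eta>: "\<eta> \<in> paths_le G n" "s \<beta> = r \<eta>"
  shows "S \<eta> * T \<eta> = S (s \<beta>)"
proof -
  have "paths_to G (s \<beta>) (paths_le G n) = {\<eta>}"
  proof -
    have "\<eta>' = \<eta>" if "\<eta>' \<in> paths_le G n" "r \<eta>' = s \<beta>" for \<eta>'
    proof -
      have M: "\<eta> \<in> M" "\<eta>' \<in> M"
        using \<eta> that by (simp_all add: paths_le_iff)
      have "cmp G \<beta> \<eta> = cmp G \<beta> \<eta>'"
        using goodD(5)[OF paths_le_cmp[OF \<beta>(1) \<eta>] paths_le_cmp[OF \<beta>(1) that(1) that(2)[symmetric]]]
          rng_cmp[OF \<beta>(1)] M \<beta>(2) \<eta>(2) that(2) by simp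
      then show ?thesis
        using factor_unique(2)[of \<beta> \<eta> \<beta> \<eta>'] \<beta> \<eta> that M by simp
    qed
    then show ?thesis
      using \<eta> by (auto simp: paths_to_def)
  qed
  then show ?thesis
    using S_sum[OF src_verts[OF \<beta>(1)], of n] by simp
qed

text \<open>Single products suffice, without linear combinations: wherever a projection has to be
  expanded on the left of the product, the expansion has one term at a good vertex. Multiplying
  \<open>S w\<close> by letters from the right thus never leaves this set.\<close>

definition spanning :: "'m star_poly quo set" where
  "spanning = insert 0 {S \<beta> * T \<nu> | \<beta> \<nu>. \<beta> \<in> M \<and> \<nu> \<in> M \<and> r \<beta> = w \<and> s \<beta> = s \<nu>}"

lemma spanningI: "\<beta> \<in> M \<Longrightarrow> \<nu> \<in> M \<Longrightarrow> r \<beta> = w \<Longrightarrow> s \<beta> = s \<nu> \<Longrightarrow> S \<beta> * T \<nu> \<in> spanning"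
  by (auto simp: spanning_def)

lemma spanning_T:
  assumes "x \<in> spanning" "\<kappa> \<in> M"
  shows "x * T \<kappa> \<in> spanning"
proof (cases "x = 0")
  case False
  then obtain \<beta> \<nu> where x: "x = S \<beta> * T \<nu>" "\<beta> \<in> M" "\<nu> \<in> M" "r \<beta> = w" "s \<beta> = s \<nu>"
    using assms(1) by (auto simp: spanning_def)
  show ?thesis
  proof (cases "s \<kappa> = r \<nu>")
    case True
    then have "x * T \<kappa> = S \<beta> * T (cmp G \<kappa> \<nu>)"
      using x assms(2) by (simp add: mult.assoc T_mult)
    then show ?thesis
      using x assms(2) True spanningI[of \<beta> "cmp G \<kappa> \<nu>"] by (simp add: cmp_closed src_cmp)
  next
    case False
    have "T \<nu> * T \<kappa> = T \<nu> * (S (r \<nu>) * S (s \<kappa>)) * T \<kappa>"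
      using x assms(2) by (simp add: mult.assoc T_src) (simp add: mult.assoc[symmetric] T_rng)
    then have "T \<nu> * T \<kappa> = 0"
      using vert_orth[OF rng_verts src_verts] x assms(2) False by auto
    then show ?thesis
      by (simp add: x mult.assoc spanning_def)
  qed
qed (simp add: spanning_def)

text \<open>Both \<nu> and \<kappa> are prolonged into \<open>paths_le G n\<close>, with
  \<open>n\<close> the join of their degrees. On the side of \<nu> a single \<eta> is inserted; on
  the side of \<kappa> the sum over all \<zeta> appears. By orthogonality only a \<zeta> with
  \<open>cmp G \<kappa> \<zeta> = cmp G \<nu> \<eta>\<close> contributes, and unique factorisation
  admits at most one.\<close>

lemma spanning_S:
  assumes "x \<in> spanning" and \<kappa>: "\<kappa> \<in> M"
  shows "x * S \<kappa> \<in> spanning"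
proof (cases "x = 0")
  case False
  then obtain \<beta> \<nu> where x: "x = S \<beta> * T \<nu>" and \<beta>: "\<beta> \<in> M" "r \<beta> = w" and \<nu>: "\<nu> \<in> M" and \<beta>\<nu>: "s \<beta> = s \<nu>"
    using assms(1) by (auto simp: spanning_def)
  define n where "n = (\<chi> i. max (d \<nu> $ i) (d \<kappa> $ i))"
  have n: "d \<nu> \<le> n" "d \<kappa> \<le> n"
    by (simp_all add: n_def vec_le_iff)
  obtain \<eta> where \<eta>: "\<eta> \<in> paths_le G (n - d \<nu>)" "r \<eta> = s \<nu>"
    using paths_le_exists[OF src_verts[OF \<nu>]] by blast
  have \<eta>M: "\<eta> \<in> M" "s \<nu> = r \<eta>" "s \<beta> = r \<eta>"
    using \<eta> \<beta>\<nu> by (simp_all add: paths_le_iff)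
  have \<nu>\<eta>: "cmp G \<nu> \<eta> \<in> paths_le G n"
    using paths_le_cmp[OF \<nu> \<eta>(1)] \<eta> vec_diff_add[OF n(1)] by simp
  have x': "x = S (cmp G \<beta> \<eta>) * T (cmp G \<nu> \<eta>)"
  proof -
    have "x = S \<beta> * (S \<eta> * T \<eta>) * T \<nu>"
      using good_full_range[OF \<beta> \<eta>(1) \<eta>M(3)] \<nu> \<beta>\<nu> by (simp add: x mult.assoc T_src)
    also have "\<dots> = (S \<beta> * S \<eta>) * (T \<eta> * T \<nu>)"
      by (simp add: mult.assoc)
    finally show ?thesis
      using \<beta> \<nu> \<eta>M by (simp add: S_mult T_mult)
  qed
  define Z where "Z = paths_to G (s \<kappa>) (paths_le G (n - d \<kappa>))"
  have Z: "\<zeta> \<in> M \<and> s \<kappa> = r \<zeta> \<and> cmp G \<kappa> \<zeta> \<in> paths_le G n" if "\<zeta> \<in> Z" for \<zeta>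
    using that paths_le_cmp[OF \<kappa>, of \<zeta> "n - d \<kappa>"] vec_diff_add[OF n(2)]
    by (auto simp: Z_def paths_to_def paths_le_iff[of \<zeta>])
  have finZ: "finite Z"
    using finite_paths_le by (simp add: Z_def paths_to_def)
  have "S \<kappa> = (\<Sum>\<zeta>\<in>Z. S (cmp G \<kappa> \<zeta>) * T \<zeta>)"
  proof -
    have "S \<kappa> = S \<kappa> * (\<Sum>\<zeta>\<in>Z. S \<zeta> * T \<zeta>)"
      using S_src[OF \<kappa>] S_sum[OF src_verts[OF \<kappa>], of "n - d \<kappa>"] by (simp add: Z_def)
    also have "\<dots> = (\<Sum>\<zeta>\<in>Z. S (cmp G \<kappa> \<zeta>) * T \<zeta>)"
      unfolding sum_distrib_left using Z \<kappa> by (intro sum.cong) (auto simp: mult.assoc[symmetric] S_mult)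
    finally show ?thesis .
  qed
  then have "x * S \<kappa> = (\<Sum>\<zeta>\<in>Z. S (cmp G \<beta> \<eta>) * (T (cmp G \<nu> \<eta>) * S (cmp G \<kappa> \<zeta>)) * T \<zeta>)"
    by (simp add: x' sum_distrib_left mult.assoc)
  also have "\<dots> = (\<Sum>\<zeta>\<in>Z. if cmp G \<kappa> \<zeta> = cmp G \<nu> \<eta> then S (cmp G \<beta> \<eta>) * T \<zeta> else 0)"
  proof (intro sum.cong refl)
    fix \<zeta> assume \<zeta>: "\<zeta> \<in> Z"
    show "S (cmp G \<beta> \<eta>) * (T (cmp G \<nu> \<eta>) * S (cmp G \<kappa> \<zeta>)) * T \<zeta>
        = (if cmp G \<kappa> \<zeta> = cmp G \<nu> \<eta> then S (cmp G \<beta> \<eta>) * T \<zeta> else 0)"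
    proof (cases "cmp G \<kappa> \<zeta> = cmp G \<nu> \<eta>")
      case True
      have "s (cmp G \<nu> \<eta>) = s (cmp G \<beta> \<eta>)" "cmp G \<nu> \<eta> \<in> M" "cmp G \<beta> \<eta> \<in> M"
        using \<beta> \<nu> \<eta>M by (simp_all add: src_cmp cmp_closed)
      then show ?thesis
        using True T_S[of "cmp G \<nu> \<eta>"] S_src[of "cmp G \<beta> \<eta>"] by simp
    next
      case False
      then show ?thesis
        using path_orth[OF \<nu>\<eta>, of "cmp G \<kappa> \<zeta>"] Z[OF \<zeta>] by auto
    qed
  qed
  also have "\<dots> \<in> spanning"
  proof (cases "\<exists>\<zeta>\<in>Z. cmp G \<kappa> \<zeta> = cmp G \<nu> \<eta>")
    case True
    then obtain \<zeta> where \<zeta>: "\<zeta> \<in> Z" "cmp G \<kappa> \<zeta> = cmp G \<nu> \<eta>" by blast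
    have "\<zeta>' = \<zeta>" if "\<zeta>' \<in> Z" "cmp G \<kappa> \<zeta>' = cmp G \<nu> \<eta>" for \<zeta>'
      using factor_unique(2)[of \<kappa> \<zeta>' \<kappa> \<zeta>] that \<zeta> Z[OF that(1)] Z[OF \<zeta>(1)] \<kappa> by simp
    then have eq: "cmp G \<kappa> \<zeta>' = cmp G \<nu> \<eta> \<longleftrightarrow> \<zeta>' = \<zeta>" if "\<zeta>' \<in> Z" for \<zeta>'
      using that \<zeta>(2) by blast
    have "(\<Sum>\<zeta>\<in>Z. if cmp G \<kappa> \<zeta> = cmp G \<nu> \<eta> then S (cmp G \<beta> \<eta>) * T \<zeta> else 0)
        = (\<Sum>\<zeta>'\<in>Z. if \<zeta>' = \<zeta> then S (cmp G \<beta> \<eta>) * T \<zeta>' else 0)"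
      by (intro sum.cong refl) (simp add: eq)
    also have "\<dots> = S (cmp G \<beta> \<eta>) * T \<zeta>"
      using finZ \<zeta> by (simp add: sum.delta')
    moreover have "s (cmp G \<beta> \<eta>) = s \<zeta>"
      using \<zeta>(2) Z[OF \<zeta>(1)] \<kappa> \<nu> \<beta> \<eta>M src_cmp[of \<kappa> \<zeta>] src_cmp[of \<nu> \<eta>] src_cmp[of \<beta> \<eta>] by simp
    ultimately show ?thesis
      using \<beta> \<eta>M Z[OF \<zeta>(1)] spanningI[of "cmp G \<beta> \<eta>" \<zeta>] by (simp add: cmp_closed rng_cmp)
  next
    case False
    then have "(\<Sum>\<zeta>\<in>Z. if cmp G \<kappa> \<zeta> = cmp G \<nu> \<eta> then S (cmp G \<beta> \<eta>) * T \<zeta> else 0) = 0"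
      by (intro sum.neutral) auto
    then show ?thesis
      by (simp add: spanning_def)
  qed
  finally show ?thesis .
qed (simp add: spanning_def)

lemma spanning_word:
  "gen_of ` set ls \<subseteq> M \<Longrightarrow> S w * cls (Poly_Mapping.single (Word ls) 1) \<in> spanning"
proof (induction ls rule: rev_induct)
  case Nil
  have "S w * cls (Poly_Mapping.single (Word []) 1) = S w * T w"
    using vert_idem[OF goodD(1)] star_vert[OF goodD(1)] un_cls(2)[of "gen w"]
    by (simp add: zero_word_def[symmetric] un_def S_def)
  then show ?case
    using vertsD[OF goodD(1)] spanningI[of w w] by simp
next
  case (snoc l ls)
  have "cls (Poly_Mapping.single (Word (ls @ [l])) 1)
      = cls (Poly_Mapping.single (Word ls) 1) * cls (Poly_Mapping.single (Word [l]) 1)"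
    by (simp add: cls_hom(2)[symmetric] mult_single plus_word_def)
  moreover have "cls (Poly_Mapping.single (Word [l]) 1) = (case l of Gen \<kappa> \<Rightarrow> S \<kappa> | Gen_adj \<kappa> \<Rightarrow> T \<kappa>)"
    by (cases l) (simp_all add: S_def T_def gen_def cls_hom(7)[symmetric] word_adj_def)
  ultimately have "S w * cls (Poly_Mapping.single (Word (ls @ [l])) 1)
      = S w * cls (Poly_Mapping.single (Word ls) 1) * (case l of Gen \<kappa> \<Rightarrow> S \<kappa> | Gen_adj \<kappa> \<Rightarrow> T \<kappa>)"
    by (simp only: mult.assoc)
  moreover have "S w * cls (Poly_Mapping.single (Word ls) 1) \<in> spanning" "gen_of l \<in> M"
    using snoc by auto
  ultimately show ?case
    using spanning_S spanning_T by (cases l) auto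
qed

lemma good_unitary: "T \<alpha> * S \<alpha> = S w" "S \<alpha> * T \<alpha> = S w"
  using T_S[of \<alpha>] good_full_range[of w \<alpha> "d \<alpha>"] paths_le_self[of \<alpha>] goodD vertsD[of w] by auto

lemma good_cor: "cs.cor (S w) (S \<alpha>)" "cs.cor (S w) (T \<alpha>)"
  using S_rng[of \<alpha>] S_src[of \<alpha>] T_rng[of \<alpha>] T_src[of \<alpha>] goodD by (simp_all add: cs.cor_def)

lemma S_cpow: "S (cpow w \<alpha> l) = cs.upow (S w) (S \<alpha>) l" "T (cpow w \<alpha> l) = cs.upow (S w) (T \<alpha>) l"
proof -
  note c = cpow_props[OF goodD(1-4)]
  show "S (cpow w \<alpha> l) = cs.upow (S w) (S \<alpha>) l"
    by (induction l) (use c goodD in \<open>auto simp: S_mult[symmetric]\<close>)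
  show "T (cpow w \<alpha> l) = cs.upow (S w) (T \<alpha>) l"
  proof (induction l)
    case 0
    then show ?case by (simp add: star_vert goodD)
  next
    case (Suc l)
    have "cs.upow (S w) (T \<alpha>) (Suc l) = cs.upow (S w) (T \<alpha>) l * T \<alpha>"
      using cs.upow_add[OF vert_idem[OF goodD(1)] good_cor(2), of l 1] good_cor(2) by (simp add: cs.corD)
    then show ?case
      using Suc c[of l] goodD by (simp add: T_mult[symmetric] del: cs.upow.simps)
  qed
qed

text \<open>If \<nu> has range \<open>w\<close>, it is prolonged by some \<kappa> to a power of
  \<alpha>. Inserting \<open>S \<kappa> * T \<kappa>\<close>, which equals
  \<open>S (s \<beta>)\<close>, turns \<beta> into a path from \<open>w\<close> to \<open>w\<close>,
  which is a power of \<alpha> as well. For any other range of \<nu> the product with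
  \<open>S w\<close> vanishes.\<close>

lemma spanning_corner:
  assumes "x \<in> spanning"
  shows "x * S w \<in> cs.laurent (S w) (S \<alpha>) (T \<alpha>)"
proof (cases "x = 0")
  case False
  then obtain \<beta> \<nu> where x: "x = S \<beta> * T \<nu>" and \<beta>: "\<beta> \<in> M" "r \<beta> = w" and \<nu>: "\<nu> \<in> M" and \<beta>\<nu>: "s \<beta> = s \<nu>"
    using assms by (auto simp: spanning_def)
  show ?thesis
  proof (cases "r \<nu> = w")
    case True
    then obtain \<kappa> l where \<kappa>: "\<kappa> \<in> M" "s \<nu> = r \<kappa>" "cmp G \<nu> \<kappa> = cpow w \<alpha> l"
      using good \<nu> unfolding good_def by blast
    have sk: "s \<kappa> = w"
      using \<kappa> \<nu> cpow_props[OF goodD(1-4), of l] src_cmp[of \<nu> \<kappa>] by simp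
    then have "cmp G \<beta> \<kappa> \<in> M" "r (cmp G \<beta> \<kappa>) = w" "s (cmp G \<beta> \<kappa>) = w"
      using \<beta> \<kappa> \<beta>\<nu> by (simp_all add: cmp_closed rng_cmp src_cmp)
    then obtain l' where l': "cmp G \<beta> \<kappa> = cpow w \<alpha> l'"
      using good unfolding good_def by blast
    have "x * S w = x"
      using T_rng[OF \<nu>] True by (simp add: x mult.assoc)
    also have "\<dots> = S \<beta> * (S \<kappa> * T \<kappa>) * T \<nu>"
      using good_full_range[OF \<beta>, of \<kappa> "d \<kappa>"] paths_le_self[OF \<kappa>(1)] T_src[OF \<nu>] \<kappa>(2) \<beta>\<nu>
      by (simp add: x mult.assoc)
    also have "\<dots> = (S \<beta> * S \<kappa>) * (T \<kappa> * T \<nu>)"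
      by (simp add: mult.assoc)
    also have "\<dots> = cs.upow (S w) (S \<alpha>) l' * cs.upow (S w) (T \<alpha>) l"
      using \<beta> \<nu> \<kappa> \<beta>\<nu> l' by (simp add: S_mult T_mult S_cpow)
    also have "\<dots> \<in> cs.laurent (S w) (S \<alpha>) (T \<alpha>)"
      using vert_idem[OF goodD(1)] good_cor good_unitary by (intro cs.laurent_upow) (simp_all add: un_sc[symmetric])
    finally show ?thesis .
  next
    case False
    have "T \<nu> * S w = T \<nu> * (S (r \<nu>) * S w)"
      using T_rng[OF \<nu>] by (simp add: mult.assoc[symmetric])
    then have "x * S w = 0"
      using vert_orth[OF rng_verts[OF \<nu>] goodD(1) False] by (simp add: x mult.assoc)
    then show ?thesis
      by (simp add: cs.laurent_0)
  qed
qed (simp add: cs.laurent_0)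

lemma full_good: "cs.full (S w)"
proof (rule cs.full_unitary)
  show "S w * S w = S w" "sc 1 * S w = S w" "nn (S w) \<le> 1"
    using vert_idem[OF goodD(1)] nn_S vertsD[OF goodD(1)] by (simp_all add: un_sc[symmetric])
  show "cs.cor (S w) (S \<alpha>)" "cs.cor (S w) (T \<alpha>)" "T \<alpha> * S \<alpha> = S w" "S \<alpha> * T \<alpha> = S w"
    by (fact good_cor good_unitary)+
  show "nn (S \<alpha>) \<le> 1" "nn (T \<alpha>) \<le> 1"
    by (intro nn_S nn_T goodD)+
  fix x assume x: "cs.cor (S w) x"
  have "cs.cor un x"
    using x un_cls[of "gen w"] unfolding cs.cor_def S_def by (metis mult.assoc)
  then obtain f where f: "f \<in> A0" "x = cls f"
    using cls_surj by blast
  have "x = S w * x * S w"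
    using x by (simp add: cs.cor_def)
  also have "\<dots> = (\<Sum>u\<in>Poly_Mapping.keys f. sc (Poly_Mapping.lookup f u) * (S w * cls (Poly_Mapping.single u 1) * S w))"
    by (subst f(2), subst A0_sum(1)[OF univ_cstar_seminorm f(1)])
       (simp add: cls_hom sum_distrib_left sum_distrib_right mult.assoc cs.sc_left_commute[of "S w"])
  also have "\<dots> \<in> cs.laurent (S w) (S \<alpha>) (T \<alpha>)"
  proof -
    have "(\<Sum>u\<in>A. sc (Poly_Mapping.lookup f u) * (S w * cls (Poly_Mapping.single u 1) * S w)) \<in> cs.laurent (S w) (S \<alpha>) (T \<alpha>)"
      if "A \<subseteq> Poly_Mapping.keys f" for A
      using finite_subset[OF that finite_keys] that
    proof (induction A rule: finite_induct)
      case (insert u A)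
      have "gen_of ` set (letters u) \<subseteq> M"
        using insert f(1) by (auto simp: free_star_algebra_def)
      then have "S w * cls (Poly_Mapping.single u 1) * S w \<in> cs.laurent (S w) (S \<alpha>) (T \<alpha>)"
        using spanning_word[of "letters u"] spanning_corner by simp
      then show ?case
        using insert vert_idem[OF goodD(1)] good_cor good_unitary
        by (auto intro!: cs.laurent_add cs.laurent_sc simp: un_sc[symmetric])
    qed (simp add: cs.laurent_0)
    then show ?thesis by blast
  qed
  finally show "\<exists>N P. x = cs.upow (S w) (T \<alpha>) N * cs.peval (S w) (S \<alpha>) P"
    by (simp add: cs.laurent_def)
qed

end

lemma full_un:
  assumes "\<And>\<alpha>. \<alpha> \<in> paths_le G n \<Longrightarrow> \<exists>\<beta>. good (s \<alpha>) \<beta>"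
  shows "cs.full un"
proof -
  have "cs.full (\<Sum>\<alpha>\<in>paths_le G n. S \<alpha> * T \<alpha>)"
  proof (rule cs.full_sum[OF finite_paths_le])
    fix \<alpha> assume \<alpha>: "\<alpha> \<in> paths_le G n"
    then have M: "\<alpha> \<in> M"
      by (simp add: paths_le_iff)
    show "cs.full (S \<alpha> * T \<alpha>)"
    proof (rule cs.full_transport)
      show "cs.full (S (s \<alpha>))"
        using assms[OF \<alpha>] full_good by blast
    qed (use M in \<open>auto simp: T_S S_src T_src nn_S nn_T\<close>)
    fix \<beta> assume \<beta>: "\<beta> \<in> paths_le G n" "\<alpha> \<noteq> \<beta>"
    have "S \<alpha> * T \<alpha> * (S \<beta> * T \<beta>) = S \<alpha> * (T \<alpha> * S \<beta>) * T \<beta>"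
      by (simp add: mult.assoc)
    then show "S \<alpha> * T \<alpha> * (S \<beta> * T \<beta>) = 0"
      using path_orth[OF \<alpha> \<beta>] by simp
  qed
  then show ?thesis
    using un_sum by simp
qed

end

section \<open>Graphs without entrances\<close>

context k_graph
begin

text \<open>The degree is admissible for the infinite path of \<alpha>, so in the absence of an
  entrance both paths are its initial segment of that degree.\<close>

lemma no_entrance_unique:
  assumes "\<not> has_entrance G \<alpha>" "\<beta> \<in> M" "\<gamma> \<in> M" "r \<beta> = r \<alpha>" "r \<gamma> = r \<alpha>" "d \<beta> = d \<gamma>"
    "\<And>i. d \<alpha> $ i = 0 \<Longrightarrow> d \<beta> $ i = 0"
  shows "\<beta> = \<gamma>"
proof -
  have "deg_le (d \<beta>) (deg_inf G \<alpha>)"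
    using assms(7) by (auto simp: deg_le_def deg_inf_def zero_enat_def)
  then have "\<beta> = cycle_inf G \<alpha> 0 (d \<beta>)" "\<gamma> = cycle_inf G \<alpha> 0 (d \<gamma>)"
    using assms(1-6) unfolding has_entrance_def paths_to_def by (metis (mono_tags, lifting) mem_Collect_eq)+
  then show ?thesis
    using assms(6) by simp
qed

lemma deg_axis_0: "\<beta> \<in> M \<Longrightarrow> d \<beta> = axis i 0 \<Longrightarrow> \<beta> = r \<beta>"
  using deg_0_rng[of \<beta>] by (simp add: axis_def vec_eq_iff)

text \<open>
  A long path in a single colour repeats a vertex. The cycle \<open>\<alpha>\<close> found in this way has no entrance,
  so it carries the rest \<open>\<kappa>\<close> of the path to itself: \<open>\<alpha>\<kappa> = \<kappa>\<alpha>'\<close>, where \<open>\<alpha>'\<close> is a cycle at the source.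
\<close>

lemma cycle_at_source:
  assumes fin: "finite (verts G)" and ne: "\<And>\<alpha>. is_cycle G \<alpha> \<Longrightarrow> \<not> has_entrance G \<alpha>"
    and \<rho>: "\<rho> \<in> M" "card (verts G) \<le> d \<rho> $ i"
  shows "\<exists>\<alpha>\<in>M. \<exists>m>0. d \<alpha> = axis i m \<and> r \<alpha> = s \<rho> \<and> s \<alpha> = s \<rho>"
proof -
  define N where "N = d \<rho> $ i"
  have sub: "d \<rho> - axis i N \<le> d \<rho>"
    by (simp add: vec_le_iff)
  obtain \<nu> where \<nu>: "\<nu> \<in> M" "d \<nu> = axis i N" "s \<nu> = s \<rho>"
  proof -
    obtain \<nu> where \<nu>: "\<nu> \<in> M" "d \<nu> = d \<rho> - (d \<rho> - axis i N)" "s \<nu> = s \<rho>"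
      using factorE[OF \<rho>(1) sub] by metis
    moreover have "d \<rho> - (d \<rho> - axis i N) = axis i N"
      by (simp add: vec_eq_iff axis_nth_nat N_def)
    ultimately show ?thesis
      using that by simp
  qed
  have "\<exists>\<phi> \<psi>. \<phi> \<in> M \<and> \<psi> \<in> M \<and> d \<phi> = axis i t \<and> d \<psi> = axis i (N - t) \<and> s \<phi> = r \<psi> \<and> cmp G \<phi> \<psi> = \<nu> \<and> s \<psi> = s \<rho>"
    if "t \<le> N" for t
  proof -
    have "axis i t \<le> d \<nu>"
      using that by (simp add: \<nu> vec_le_iff axis_nth_nat)
    from factorE[OF \<nu>(1) this] obtain \<phi> \<psi> where
      "\<phi> \<in> M" "\<psi> \<in> M" "d \<phi> = axis i t" "d \<psi> = d \<nu> - axis i t" "s \<phi> = r \<psi>" "\<nu> = cmp G \<phi> \<psi>" "s \<psi> = s \<nu>"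
      by metis
    moreover have "d \<nu> - axis i t = axis i (N - t)"
      by (simp add: \<nu> vec_eq_iff axis_nth_nat)
    ultimately show ?thesis
      using \<nu> by metis
  qed
  then obtain \<phi> \<psi> where \<phi>: "\<And>t. t \<le> N \<Longrightarrow> \<phi> t \<in> M \<and> \<psi> t \<in> M \<and> d (\<phi> t) = axis i t \<and> d (\<psi> t) = axis i (N - t) \<and>
      s (\<phi> t) = r (\<psi> t) \<and> cmp G (\<phi> t) (\<psi> t) = \<nu> \<and> s (\<psi> t) = s \<rho>"
    by metis
  \<comment> \<open>Cutting at \<open>t = 0, ..., N\<close> gives \<open>N + 1\<close> vertices,
    while there are at most \<open>N\<close> in the graph.\<close>
  have "\<not> inj_on (\<lambda>t. s (\<phi> t)) {..N}"
  proof
    assume "inj_on (\<lambda>t. s (\<phi> t)) {..N}"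
    then have "card {..N} = card ((\<lambda>t. s (\<phi> t)) ` {..N})"
      by (simp add: card_image)
    also have "\<dots> \<le> card (verts G)"
    proof (intro card_mono fin subsetI, elim imageE)
      fix v t assume "v = s (\<phi> t)" "t \<in> {..N}"
      then show "v \<in> verts G"
        using conjunct1[OF \<phi>[of t]] by (simp add: paths_of_deg_def src_closed deg_src)
    qed
    finally show False
      using \<rho>(2) by (simp add: N_def)
  qed
  then obtain a b where ab: "a < b" "b \<le> N" "s (\<phi> a) = s (\<phi> b)"
    unfolding inj_on_def by (metis atMost_iff linorder_neqE_nat)
  have "axis i a \<le> d (\<phi> b)"
    using ab \<phi>[of b] by (simp add: vec_le_iff axis_nth_nat)
  with \<phi>[of b] ab obtain \<mu> \<alpha> where \<mu>: "\<mu> \<in> M" "\<alpha> \<in> M" "d \<mu> = axis i a" "d \<alpha> = d (\<phi> b) - axis i a"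
    "s \<mu> = r \<alpha>" "\<phi> b = cmp G \<mu> \<alpha>" "s \<alpha> = s (\<phi> b)"
    using factorE[of "\<phi> b" "axis i a"] by metis
  have d\<alpha>: "d \<alpha> = axis i (b - a)"
    using \<mu>(4) \<phi>[of b] ab by (simp add: vec_eq_iff axis_nth_nat)
  \<comment> \<open>Both are the initial segment of \<nu> in degree \<open>a\<close>. Hence \<alpha>
    runs between two cutting points with the same vertex, and is a cycle.\<close>
  have "\<mu> = \<phi> a"
  proof (rule factor_unique(1)[of \<mu> "cmp G \<alpha> (\<psi> b)" "\<phi> a" "\<psi> a"])
    have "cmp G (cmp G \<mu> \<alpha>) (\<psi> b) = cmp G \<mu> (cmp G \<alpha> (\<psi> b))"
      using \<mu> \<phi>[of b] ab by (intro cmp_assoc) auto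
    then show "cmp G \<mu> (cmp G \<alpha> (\<psi> b)) = cmp G (\<phi> a) (\<psi> a)"
      using \<phi>[of a] \<phi>[of b] \<mu>(6) ab by simp
  qed (use \<mu> \<phi>[of a] \<phi>[of b] ab in \<open>auto simp: cmp_closed rng_cmp\<close>)
  define \<kappa> where "\<kappa> = \<psi> a"
  have \<kappa>: "\<kappa> \<in> M" "d \<kappa> = axis i (N - a)" "r \<kappa> = s \<alpha>" "s \<kappa> = s \<rho>" "r \<alpha> = s \<alpha>"
    using \<phi>[of a] \<phi>[of b] ab \<mu> \<open>\<mu> = \<phi> a\<close> by (auto simp: \<kappa>_def)
  have "\<alpha> \<notin> verts G"
    using d\<alpha> ab by (auto simp: paths_of_deg_def vec_eq_iff axis_nth_nat)
  then have cyc: "\<not> has_entrance G \<alpha>"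
    using \<mu> \<kappa> by (intro ne) (simp add: is_cycle_def)
  have \<alpha>\<kappa>: "cmp G \<alpha> \<kappa> \<in> M" "d (cmp G \<alpha> \<kappa>) = d \<alpha> + d \<kappa>" "r (cmp G \<alpha> \<kappa>) = r \<alpha>" "s (cmp G \<alpha> \<kappa>) = s \<rho>"
    using \<mu>(2) \<kappa> by (simp_all add: cmp_closed deg_cmp rng_cmp src_cmp)
  have "d \<kappa> \<le> d (cmp G \<alpha> \<kappa>)"
    by (simp add: \<alpha>\<kappa> vec_le_iff)
  then obtain \<kappa>' \<alpha>' where *: "\<kappa>' \<in> M" "\<alpha>' \<in> M" "d \<kappa>' = d \<kappa>"
    "d \<alpha>' = d (cmp G \<alpha> \<kappa>) - d \<kappa>" "s \<kappa>' = r \<alpha>'" "cmp G \<alpha> \<kappa> = cmp G \<kappa>' \<alpha>'"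
    "r \<kappa>' = r (cmp G \<alpha> \<kappa>)" "s \<alpha>' = s (cmp G \<alpha> \<kappa>)"
    by (rule factorE[OF \<alpha>\<kappa>(1)])
  have "\<kappa> = \<kappa>'"
  proof (rule no_entrance_unique[OF cyc \<kappa>(1) *(1)])
    show "d \<kappa> $ j = 0" if "d \<alpha> $ j = 0" for j
      using that ab by (auto simp: d\<alpha> \<kappa>(2) axis_nth_nat split: if_splits)
  qed (use *(3,7) \<kappa>(3,5) \<alpha>\<kappa>(3) in simp_all)
  then have "r \<alpha>' = s \<rho>" "s \<alpha>' = s \<rho>" "d \<alpha>' = axis i (b - a)"
    using *(4,5,7) *(8) \<kappa>(4) \<alpha>\<kappa>(2,4) d\<alpha> by simp_all
  then show ?thesis
    using *(2) ab by (intro bexI[of _ \<alpha>'] exI[of _ "b - a"]) auto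
qed

lemma cycle_product:
  assumes w: "w \<in> verts G" and "finite C"
    and "\<And>i. i \<in> C \<Longrightarrow> \<exists>\<alpha>\<in>M. \<exists>m>0. d \<alpha> = axis i m \<and> r \<alpha> = w \<and> s \<alpha> = w"
  shows "\<exists>\<mu>\<in>M. r \<mu> = w \<and> s \<mu> = w \<and> {i. d \<mu> $ i > 0} = C"
  using assms(2,3)
proof (induction C rule: finite_induct)
  case empty
  then show ?case
    using vertsD[OF w] by (intro bexI[of _ w]) auto
next
  case (insert i C)
  then obtain \<mu> where \<mu>: "\<mu> \<in> M" "r \<mu> = w" "s \<mu> = w" "{i. d \<mu> $ i > 0} = C"
    by auto
  obtain \<alpha> m where \<alpha>: "\<alpha> \<in> M" "m > 0" "d \<alpha> = axis i m" "r \<alpha> = w" "s \<alpha> = w"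
    using insert.prems[of i] by auto
  have "{j. d (cmp G \<alpha> \<mu>) $ j > 0} = insert i {j. d \<mu> $ j > 0}"
    using \<alpha> \<mu>(1-3) by (auto simp: deg_cmp axis_nth_nat)
  then show ?case
    using \<alpha> \<mu> by (intro bexI[of _ "cmp G \<alpha> \<mu>"]) (auto simp: cmp_closed rng_cmp src_cmp)
qed

end

context finite_k_graph
begin

lemma good_vertex:
  assumes w: "w \<in> verts G" "\<And>\<beta>. \<beta> \<in> M \<Longrightarrow> r \<beta> = w \<Longrightarrow> d \<beta> = 0"
  shows "good w w"
proof -
  have 1: "\<beta> = w" if "\<beta> \<in> M" "r \<beta> = w" for \<beta>
    using deg_0_rng[OF that(1) w(2)[OF that]] that by simp
  have pw: "cpow w w 0 = w" by simp
  show ?thesis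
    unfolding good_def
  proof (intro conjI allI ballI impI)
    show "\<beta> = \<gamma>" if "\<beta> \<in> paths_le G n" "\<gamma> \<in> paths_le G n" "r \<beta> = w \<and> r \<gamma> = w" for n \<beta> \<gamma>
      using that 1[of \<beta>] 1[of \<gamma>] by (simp add: paths_le_iff)
    show "\<exists>\<kappa>\<in>M. \<exists>l. s \<beta> = r \<kappa> \<and> cmp G \<beta> \<kappa> = cpow w w l" if "\<beta> \<in> M" "r \<beta> = w" for \<beta>
    proof (intro bexI[of _ w] exI[of _ 0])
      show "s \<beta> = r w \<and> cmp G \<beta> w = cpow w w 0"
        using 1[OF that] vertsD[OF w(1)] cmp_src[of w] by simp
    qed (use vertsD[OF w(1)] in simp)
    show "\<exists>l. \<beta> = cpow w w l" if "\<beta> \<in> M" "r \<beta> = w \<and> s \<beta> = w" for \<beta>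
      using 1[of \<beta>] that pw by metis
  qed (use vertsD[OF w(1)] w(1) in auto)
qed

text \<open>Take \<alpha> of least positive length \<open>m\<close>. It has no entrance, so a path
  with range \<open>w\<close> is determined by its length, and one of length \<open>b\<close> is an
  initial segment of the power of \<alpha> with exponent \<open>b\<close>. A path from
  \<open>w\<close> to \<open>w\<close> of length \<open>b\<close> leaves, after
  \<open>b div m\<close> copies of \<alpha>, a closed path of length less than \<open>m\<close>,
  which must be a vertex.\<close>

lemma good_cycle:
  assumes ne: "\<And>\<alpha>. is_cycle G \<alpha> \<Longrightarrow> \<not> has_entrance G \<alpha>"
    and w: "w \<in> verts G" "\<And>\<beta>. \<beta> \<in> M \<Longrightarrow> r \<beta> = w \<Longrightarrow> \<exists>t. d \<beta> = axis i t"
    and cyc: "\<exists>\<alpha>\<in>M. \<exists>m>0. d \<alpha> = axis i m \<and> r \<alpha> = w \<and> s \<alpha> = w"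
  shows "\<exists>\<alpha>. good w \<alpha>"
proof -
  define P where "P m \<longleftrightarrow> m > 0 \<and> (\<exists>\<alpha>\<in>M. d \<alpha> = axis i m \<and> r \<alpha> = w \<and> s \<alpha> = w)" for m
  define m where "m = (LEAST m. P m)"
  have "P m"
  proof -
    have "\<exists>m. P m"
      unfolding P_def using cyc by blast
    then show ?thesis
      unfolding m_def by (rule LeastI_ex)
  qed
  then obtain \<alpha> where \<alpha>: "\<alpha> \<in> M" "d \<alpha> = axis i m" "r \<alpha> = w" "s \<alpha> = w" and m: "m > 0"
    unfolding P_def by blast
  have least: "m \<le> l" if "P l" for l
    unfolding m_def using that by (rule Least_le)
  have cyc\<alpha>: "\<not> has_entrance G \<alpha>"
    using \<alpha> m by (intro ne) (auto simp: is_cycle_def paths_of_deg_def vec_eq_iff axis_nth_nat)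
  have uniq: "\<beta> = \<gamma>" if "\<beta> \<in> M" "\<gamma> \<in> M" "r \<beta> = w" "r \<gamma> = w" "d \<beta> = d \<gamma>" for \<beta> \<gamma>
  proof -
    have *: "\<exists>t. d \<beta> = axis i t"
      using w(2) that by blast
    show ?thesis
    proof (rule no_entrance_unique[OF cyc\<alpha> that(1,2) _ _ that(5)])
      show "r \<beta> = r \<alpha>" "r \<gamma> = r \<alpha>"
        by (simp_all only: that \<alpha>)
      show "d \<beta> $ j = 0" if "d \<alpha> $ j = 0" for j
        using * that m by (auto simp: \<alpha>(2) axis_nth_nat split: if_splits)
    qed
  qed
  note cp = cpow_props[OF w(1) \<alpha>(1,3,4)]
  have cpd: "d (cpow w \<alpha> l) = axis i (l * m)" for l
    using cp[of l] \<alpha>(2) by (simp add: vec_eq_iff axis_nth_nat)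
  have split: "\<exists>\<kappa>. \<kappa> \<in> M \<and> s \<beta> = r \<kappa> \<and> \<gamma> = cmp G \<beta> \<kappa> \<and> d \<kappa> = axis i (c - b) \<and> s \<kappa> = s \<gamma>"
    if \<beta>: "\<beta> \<in> M" "r \<beta> = w" "d \<beta> = axis i b" and \<gamma>: "\<gamma> \<in> M" "r \<gamma> = w" "d \<gamma> = axis i c" and "b \<le> c" for \<beta> \<gamma> b c
  proof -
    have "axis i b \<le> d \<gamma>"
      using \<gamma> \<open>b \<le> c\<close> by (simp add: vec_le_iff axis_nth_nat)
    then obtain \<beta>' \<kappa> where *: "\<beta>' \<in> M" "\<kappa> \<in> M" "d \<beta>' = axis i b" "d \<kappa> = d \<gamma> - axis i b"
      "s \<beta>' = r \<kappa>" "\<gamma> = cmp G \<beta>' \<kappa>" "r \<beta>' = r \<gamma>" "s \<kappa> = s \<gamma>"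
      by (rule factorE[OF \<gamma>(1)])
    have "\<beta>' = \<beta>"
      by (rule uniq[OF *(1) \<beta>(1)]) (simp_all only: *(3,7) \<beta> \<gamma>)
    moreover have "d \<gamma> - axis i b = axis i (c - b)"
      using \<gamma> by (simp add: vec_eq_iff axis_nth_nat)
    ultimately show ?thesis
      using * by (intro exI[of _ \<kappa>]) simp
  qed
  have "good w \<alpha>"
    unfolding good_def
  proof (intro conjI allI ballI impI)
    have le: "b \<ge> c"
      if \<beta>: "\<beta> \<in> paths_le G n" "r \<beta> = w" "d \<beta> = axis i b" and \<gamma>: "\<gamma> \<in> paths_le G n" "r \<gamma> = w" "d \<gamma> = axis i c"
      for n \<beta> \<gamma> b c
    proof (rule ccontr)
      assume "\<not> b \<ge> c"
      then obtain \<kappa> where \<kappa>: "\<kappa> \<in> M" "s \<beta> = r \<kappa>" "d \<kappa> = axis i (c - b)"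
        using split[of \<beta> b \<gamma> c] \<beta> \<gamma> by (auto simp: paths_le_iff)
      then have "edges_at (s \<beta>) i \<noteq> {}"
        using edges_at_path[of \<kappa> i] \<open>\<not> b \<ge> c\<close> by (simp add: axis_nth_nat)
      moreover have "d \<beta> + unit_deg i \<le> d \<gamma>"
        using \<beta> \<gamma> \<open>\<not> b \<ge> c\<close> by (simp add: vec_le_iff axis_nth_nat)
      then have "d \<beta> + unit_deg i \<le> n"
        using \<gamma>(1) unfolding paths_le_iff by (meson order_trans)
      ultimately show False
        using \<beta>(1) by (simp add: paths_le_iff)
    qed
    fix n \<beta> \<gamma> assume *: "\<beta> \<in> paths_le G n" "\<gamma> \<in> paths_le G n" "r \<beta> = w \<and> r \<gamma> = w"
    then have M: "\<beta> \<in> M" "\<gamma> \<in> M"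
      by (simp_all add: paths_le_iff)
    obtain b c where bc: "d \<beta> = axis i b" "d \<gamma> = axis i c"
      using w(2)[OF M(1)] w(2)[OF M(2)] * by auto
    then have "b = c"
      using le[of \<beta> n b \<gamma> c] le[of \<gamma> n c \<beta> b] * by simp
    then show "\<beta> = \<gamma>"
      using uniq[OF M] bc *(3) by simp
  next
    fix \<beta> assume \<beta>: "\<beta> \<in> M" "r \<beta> = w"
    obtain b where b: "d \<beta> = axis i b"
      using w(2)[OF \<beta>] by blast
    have "b \<le> b * m"
      using m by simp
    then obtain \<kappa> where "\<kappa> \<in> M" "s \<beta> = r \<kappa>" "cpow w \<alpha> b = cmp G \<beta> \<kappa>"
      using split[OF \<beta> b, of "cpow w \<alpha> b" "b * m"] cp[of b] cpd[of b] by auto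
    then show "\<exists>\<kappa>\<in>M. \<exists>l. s \<beta> = r \<kappa> \<and> cmp G \<beta> \<kappa> = cpow w \<alpha> l"
      by metis
  next
    fix \<beta> assume \<beta>: "\<beta> \<in> M" "r \<beta> = w \<and> s \<beta> = w"
    obtain b where b: "d \<beta> = axis i b"
      using w(2)[OF \<beta>(1)] \<beta> by blast
    define l where "l = b div m"
    have "l * m \<le> b"
      by (simp add: l_def)
    then obtain \<kappa> where \<kappa>: "\<kappa> \<in> M" "s (cpow w \<alpha> l) = r \<kappa>" "\<beta> = cmp G (cpow w \<alpha> l) \<kappa>" "d \<kappa> = axis i (b - l * m)" "s \<kappa> = s \<beta>"
      using split[of "cpow w \<alpha> l" "l * m" \<beta> b] cp[of l] cpd[of l] \<beta> b by auto
    have rem: "b - l * m < m"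
      using m by (simp add: l_def minus_div_mult_eq_mod)
    have "b - l * m = 0"
    proof (rule ccontr)
      assume "b - l * m \<noteq> 0"
      then have "P (b - l * m)"
        using \<kappa> \<beta> cp[of l] by (auto simp: P_def)
      then show False
        using least rem by fastforce
    qed
    then have "\<kappa> = r \<kappa>"
      using \<kappa>(1,4) deg_axis_0[of \<kappa> i] by simp
    then show "\<exists>l. \<beta> = cpow w \<alpha> l"
      using \<kappa> cmp_src[of "cpow w \<alpha> l"] cp[of l] by metis
  qed (use \<alpha> w in auto)
  then show ?thesis by blast
qed

theorem full_if_no_entrance:
  assumes ne: "\<not> (\<exists>\<alpha>. is_cycle G \<alpha> \<and> has_entrance G \<alpha>)"
    and col: "\<not> (\<exists>\<mu>. is_initial_cycle G \<mu> \<and> num_colours G \<mu> > 1)"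
  shows "cs.full un"
proof (rule full_un)
  define N where "N = card (verts G)"
  define n :: "nat ^ 'k" where "n = (\<chi> i. N)"
  have nei: "n $ i = N" for i
    by (simp add: n_def)
  fix \<rho> assume \<rho>: "\<rho> \<in> paths_le G n"
  then have \<rho>M: "\<rho> \<in> M" and dle: "d \<rho> $ i \<le> N" for i
    using nei by (auto simp: paths_le_iff vec_le_iff)
  define w where "w = s \<rho>"
  have w: "w \<in> verts G"
    using \<rho>M by (simp add: w_def src_verts)
  define C where "C = {i. d \<rho> $ i = N}"
  have empty: "edges_at w j = {}" if "j \<notin> C" for j
  proof -
    have "d \<rho> $ j < N"
      using that dle[of j] by (auto simp: C_def)
    then have "d \<rho> + unit_deg j \<le> n"
      using dle by (auto simp: vec_le_iff axis_nth_nat nei)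
    then show ?thesis
      using \<rho> by (simp add: paths_le_iff w_def)
  qed
  have cyc: "\<exists>\<alpha>\<in>M. \<exists>m>0. d \<alpha> = axis i m \<and> r \<alpha> = w \<and> s \<alpha> = w" if "i \<in> C" for i
    unfolding w_def using that \<rho>M finite_verts ne by (intro cycle_at_source) (auto simp: C_def N_def)
  have deg0: "d \<beta> $ j = 0" if "\<beta> \<in> M" "r \<beta> = w" "j \<notin> C" for \<beta> j
    using edges_at_path[of \<beta> j] empty[of j] that by auto
  obtain \<mu> where \<mu>: "\<mu> \<in> M" "r \<mu> = w" "s \<mu> = w" "{i. d \<mu> $ i > 0} = C"
    using cycle_product[OF w _ cyc, of C] by auto
  have "is_initial_cycle G \<mu>"
    using \<mu> empty unfolding is_initial_cycle_def edges_at_def by auto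
  then have "card C \<le> 1"
    using col \<mu>(4) by (auto simp: num_colours_def)
  then consider "C = {}" | i where "C = {i}"
    by (auto simp: le_Suc_eq card_1_singleton_iff)
  then show "\<exists>\<beta>. good (s \<rho>) \<beta>"
  proof cases
    case 1
    then have "good w w"
      using deg0 by (intro good_vertex w) (auto simp: vec_eq_iff)
    then show ?thesis
      unfolding w_def by blast
  next
    case 2
    have "\<exists>t. d \<beta> = axis i t" if "\<beta> \<in> M" "r \<beta> = w" for \<beta>
      using deg0[OF that] 2 by (intro exI[of _ "d \<beta> $ i"]) (auto simp: vec_eq_iff axis_nth_nat)
    then show ?thesis
      using good_cycle[of w i] ne w cyc[of i] 2 unfolding w_def by blast
  qed
qed

end

section \<open>Representations by weighted partial bijections\<close>

definition fsupp :: "('b \<Rightarrow> complex) \<Rightarrow> bool" where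
  "fsupp \<xi> \<longleftrightarrow> finite {y. \<xi> y \<noteq> 0}"

definition ip :: "('b \<Rightarrow> complex) \<Rightarrow> ('b \<Rightarrow> complex) \<Rightarrow> complex" where
  "ip \<xi> \<eta> = (\<Sum>y | \<xi> y \<noteq> 0. \<xi> y * cnj (\<eta> y))"

definition nr :: "('b \<Rightarrow> complex) \<Rightarrow> real" where
  "nr \<xi> = L2_set (\<lambda>y. cmod (\<xi> y)) {y. \<xi> y \<noteq> 0}"

lemma fsupp_add: "fsupp \<xi> \<Longrightarrow> fsupp \<eta> \<Longrightarrow> fsupp (\<lambda>y. \<xi> y + \<eta> y)"
  unfolding fsupp_def by (rule finite_subset[of _ "{y. \<xi> y \<noteq> 0} \<union> {y. \<eta> y \<noteq> 0}"]) auto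

lemma fsupp_scale: "fsupp \<xi> \<Longrightarrow> fsupp (\<lambda>y. a * \<xi> y)"
  unfolding fsupp_def by (rule finite_subset[of _ "{y. \<xi> y \<noteq> 0}"]) auto

lemma fsupp_sum: "(\<And>a. a \<in> A \<Longrightarrow> fsupp (f a)) \<Longrightarrow> fsupp (\<lambda>y. \<Sum>a\<in>A. f a y)"
  by (induction A rule: infinite_finite_induct) (auto intro: fsupp_add simp: fsupp_def[of "\<lambda>_. 0"])

lemma ip_eq: "finite A \<Longrightarrow> {y. \<xi> y \<noteq> 0} \<subseteq> A \<Longrightarrow> ip \<xi> \<eta> = (\<Sum>y\<in>A. \<xi> y * cnj (\<eta> y))"
  unfolding ip_def by (rule sum.mono_neutral_left) auto

lemma nr_eq: "finite A \<Longrightarrow> {y. \<xi> y \<noteq> 0} \<subseteq> A \<Longrightarrow> nr \<xi> = L2_set (\<lambda>y. cmod (\<xi> y)) A"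
  unfolding nr_def L2_set_def by (subst sum.mono_neutral_left[of A]) auto

lemma nr_nonneg [simp]: "0 \<le> nr \<xi>"
  by (simp add: nr_def)

lemma nr_square: "complex_of_real ((nr \<xi>)\<^sup>2) = ip \<xi> \<xi>"
  by (simp add: nr_def ip_def L2_set_def sum_nonneg complex_norm_square[symmetric])

lemma nr_triangle: "fsupp \<xi> \<Longrightarrow> fsupp \<eta> \<Longrightarrow> nr (\<lambda>y. \<xi> y + \<eta> y) \<le> nr \<xi> + nr \<eta>"
proof -
  assume *: "fsupp \<xi>" "fsupp \<eta>"
  define A where "A = {y. \<xi> y \<noteq> 0} \<union> {y. \<eta> y \<noteq> 0}"
  have A: "finite A"
    using * by (simp add: A_def fsupp_def)
  have "nr (\<lambda>y. \<xi> y + \<eta> y) = L2_set (\<lambda>y. cmod (\<xi> y + \<eta> y)) A"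
    using A by (intro nr_eq) (auto simp: A_def)
  also have "\<dots> \<le> L2_set (\<lambda>y. cmod (\<xi> y) + cmod (\<eta> y)) A"
    by (intro L2_set_mono norm_triangle_ineq norm_ge_zero)
  also have "\<dots> \<le> L2_set (\<lambda>y. cmod (\<xi> y)) A + L2_set (\<lambda>y. cmod (\<eta> y)) A"
    by (rule L2_set_triangle_ineq)
  also have "\<dots> = nr \<xi> + nr \<eta>"
    using nr_eq[OF A, of \<xi>] nr_eq[OF A, of \<eta>] by (auto simp: A_def)
  finally show ?thesis .
qed

lemma nr_scale: "nr (\<lambda>y. a * \<xi> y) = cmod a * nr \<xi>"
proof (cases "a = 0")
  case False
  then show ?thesis
    by (simp add: nr_def norm_mult L2_set_right_distrib)
qed (simp add: nr_def)

lemma nr_0 [simp]: "nr (\<lambda>_. 0) = 0"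
  by (simp add: nr_def)

lemma nr_eq_0: "fsupp \<xi> \<Longrightarrow> nr \<xi> = 0 \<Longrightarrow> \<xi> = (\<lambda>_. 0)"
  unfolding fsupp_def nr_def by (subst (asm) L2_set_eq_0_iff) auto

lemma cauchy_schwarz: "fsupp \<xi> \<Longrightarrow> fsupp \<eta> \<Longrightarrow> cmod (ip \<xi> \<eta>) \<le> nr \<xi> * nr \<eta>"
proof -
  assume *: "fsupp \<xi>" "fsupp \<eta>"
  define A where "A = {y. \<xi> y \<noteq> 0} \<union> {y. \<eta> y \<noteq> 0}"
  have A: "finite A"
    using * by (simp add: A_def fsupp_def)
  have "ip \<xi> \<eta> = (\<Sum>y\<in>A. \<xi> y * cnj (\<eta> y))"
    using A by (intro ip_eq) (auto simp: A_def)
  then have "cmod (ip \<xi> \<eta>) \<le> (\<Sum>y\<in>A. \<bar>cmod (\<xi> y)\<bar> * \<bar>cmod (\<eta> y)\<bar>)"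
    using norm_sum[of "\<lambda>y. \<xi> y * cnj (\<eta> y)" A] by (simp add: norm_mult)
  also have "\<dots> \<le> L2_set (\<lambda>y. cmod (\<xi> y)) A * L2_set (\<lambda>y. cmod (\<eta> y)) A"
    by (rule L2_set_mult_ineq)
  also have "\<dots> = nr \<xi> * nr \<eta>"
    using nr_eq[OF A, of \<xi>] nr_eq[OF A, of \<eta>] by (auto simp: A_def)
  finally show ?thesis .
qed

lemma ip_add_left: "fsupp \<xi> \<Longrightarrow> fsupp \<xi>' \<Longrightarrow> ip (\<lambda>y. \<xi> y + \<xi>' y) \<eta> = ip \<xi> \<eta> + ip \<xi>' \<eta>"
proof -
  assume *: "fsupp \<xi>" "fsupp \<xi>'"
  define A where "A = {y. \<xi> y \<noteq> 0} \<union> {y. \<xi>' y \<noteq> 0}"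
  have A: "finite A"
    using * by (simp add: A_def fsupp_def)
  have "ip (\<lambda>y. \<xi> y + \<xi>' y) \<eta> = (\<Sum>y\<in>A. (\<xi> y + \<xi>' y) * cnj (\<eta> y))"
    using A by (intro ip_eq) (auto simp: A_def)
  then show ?thesis
    using ip_eq[OF A, of \<xi>] ip_eq[OF A, of \<xi>'] by (simp add: A_def algebra_simps sum.distrib)
qed

lemma ip_scale_left: "ip (\<lambda>y. a * \<xi> y) \<eta> = a * ip \<xi> \<eta>"
  by (cases "a = 0") (simp_all add: ip_def sum_distrib_left mult.assoc)

lemma ip_add_right: "ip \<xi> (\<lambda>y. \<eta> y + \<eta>' y) = ip \<xi> \<eta> + ip \<xi> \<eta>'"
  by (simp add: ip_def algebra_simps sum.distrib)

lemma ip_scale_right: "ip \<xi> (\<lambda>y. a * \<eta> y) = cnj a * ip \<xi> \<eta>"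
  by (simp add: ip_def sum_distrib_left mult.left_commute)

text \<open>Each letter acts as a partial isometry between the finitely supported functions on
  \<open>D (letter_adj l)\<close> and those on \<open>D l\<close>. Phases of modulus 1 preserve
  this, and the compatibility of \<open>h\<close> and \<open>c\<close> with
  \<open>letter_adj\<close> makes the operator of the adjoint letter the adjoint operator.\<close>

locale partial_bijections =
  fixes D :: "'m letter \<Rightarrow> 'b set" and h :: "'m letter \<Rightarrow> 'b \<Rightarrow> 'b" and c :: "'m letter \<Rightarrow> complex"
  assumes h_D: "y \<in> D l \<Longrightarrow> h l y \<in> D (letter_adj l)"
    and h_h: "y \<in> D l \<Longrightarrow> h (letter_adj l) (h l y) = y"
    and c_adj: "c (letter_adj l) = cnj (c l)"
    and c_norm: "cmod (c l) = 1"
begin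

definition op :: "'m letter \<Rightarrow> ('b \<Rightarrow> complex) \<Rightarrow> 'b \<Rightarrow> complex" where
  "op l \<xi> y = (if y \<in> D l then c l * \<xi> (h l y) else 0)"

definition wop :: "'m word \<Rightarrow> ('b \<Rightarrow> complex) \<Rightarrow> 'b \<Rightarrow> complex" where
  "wop w = foldr op (letters w)"

definition rep :: "'m star_poly \<Rightarrow> ('b \<Rightarrow> complex) \<Rightarrow> 'b \<Rightarrow> complex" where
  "rep f \<xi> y = (\<Sum>w\<in>Poly_Mapping.keys f. Poly_Mapping.lookup f w * wop w \<xi> y)"

lemma letter_adj_adj [simp]: "letter_adj (letter_adj l) = (l :: 'm letter)"
  by (cases l) auto

lemma bij_h: "bij_betw (h l) {y \<in> D l. \<xi> (h l y) \<noteq> 0} {z \<in> D (letter_adj l). \<xi> z \<noteq> 0}"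
proof (rule bij_betw_byWitness[where f' = "h (letter_adj l)"])
  show "\<forall>z\<in>{z \<in> D (letter_adj l). \<xi> z \<noteq> 0}. h l (h (letter_adj l) z) = z"
    using h_h[of _ "letter_adj l"] by simp
  then show "h (letter_adj l) ` {z \<in> D (letter_adj l). \<xi> z \<noteq> 0} \<subseteq> {y \<in> D l. \<xi> (h l y) \<noteq> 0}"
    using h_D[of _ "letter_adj l"] by auto
qed (use h_h h_D in auto)

lemma supp_op: "{y. op l \<xi> y \<noteq> 0} = {y \<in> D l. \<xi> (h l y) \<noteq> 0}"
  using c_norm[of l] by (auto simp: op_def)

lemma fsupp_op: "fsupp \<xi> \<Longrightarrow> fsupp (op l \<xi>)"
  unfolding fsupp_def supp_op bij_betw_finite[OF bij_h] by (rule finite_subset[of _ "{y. \<xi> y \<noteq> 0}"]) auto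

lemma op_adj: "fsupp \<xi> \<Longrightarrow> ip (op l \<xi>) \<eta> = ip \<xi> (op (letter_adj l) \<eta>)"
proof -
  assume \<xi>: "fsupp \<xi>"
  let ?A = "{y \<in> D l. \<xi> (h l y) \<noteq> 0}" and ?B = "{z \<in> D (letter_adj l). \<xi> z \<noteq> 0}"
  have "ip (op l \<xi>) \<eta> = (\<Sum>y\<in>?A. c l * \<xi> (h l y) * cnj (\<eta> y))"
    unfolding ip_def supp_op by (intro sum.cong) (auto simp: op_def)
  also have "\<dots> = (\<Sum>y\<in>?A. c l * \<xi> (h l y) * cnj (\<eta> (h (letter_adj l) (h l y))))"
    using h_h by (intro sum.cong) auto
  also have "\<dots> = (\<Sum>z\<in>?B. c l * \<xi> z * cnj (\<eta> (h (letter_adj l) z)))"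
    by (rule sum.reindex_bij_betw[OF bij_h])
  also have "\<dots> = (\<Sum>z\<in>?B. \<xi> z * cnj (op (letter_adj l) \<eta> z))"
    by (intro sum.cong) (auto simp: op_def c_adj)
  also have "\<dots> = ip \<xi> (op (letter_adj l) \<eta>)"
    unfolding ip_def using \<xi> by (intro sum.mono_neutral_left) (auto simp: fsupp_def op_def)
  finally show ?thesis .
qed

lemma nr_op: "fsupp \<xi> \<Longrightarrow> nr (op l \<xi>) \<le> nr \<xi>"
proof -
  assume \<xi>: "fsupp \<xi>"
  let ?A = "{y \<in> D l. \<xi> (h l y) \<noteq> 0}" and ?B = "{z \<in> D (letter_adj l). \<xi> z \<noteq> 0}"
  have "(\<Sum>y\<in>?A. (cmod (op l \<xi> y))\<^sup>2) = (\<Sum>y\<in>?A. (cmod (\<xi> (h l y)))\<^sup>2)"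
    by (intro sum.cong) (auto simp: op_def norm_mult c_norm)
  also have "\<dots> = (\<Sum>z\<in>?B. (cmod (\<xi> z))\<^sup>2)"
    by (rule sum.reindex_bij_betw[OF bij_h])
  also have "\<dots> \<le> (\<Sum>z | \<xi> z \<noteq> 0. (cmod (\<xi> z))\<^sup>2)"
    using \<xi> by (intro sum_mono2) (auto simp: fsupp_def)
  finally show ?thesis
    by (simp add: nr_def supp_op L2_set_def)
qed

lemma op_linear: "op l (\<lambda>y. \<xi> y + \<eta> y) = (\<lambda>y. op l \<xi> y + op l \<eta> y)" "op l (\<lambda>y. a * \<xi> y) = (\<lambda>y. a * op l \<xi> y)"
  by (auto simp: op_def fun_eq_iff algebra_simps)

lemma wop_simps [simp]: "wop 0 \<xi> = \<xi>" "wop (v + w) \<xi> = wop v (wop w \<xi>)" "wop (Word [l]) \<xi> = op l \<xi>"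
  by (simp_all add: wop_def zero_word_def)

lemma wop_Cons: "wop (Word (l # ls)) \<xi> = op l (wop (Word ls) \<xi>)"
  by (simp add: wop_def)

lemma wop_linear: "wop w (\<lambda>y. \<xi> y + \<eta> y) = (\<lambda>y. wop w \<xi> y + wop w \<eta> y)" "wop w (\<lambda>y. a * \<xi> y) = (\<lambda>y. a * wop w \<xi> y)"
proof -
  have "foldr op ls (\<lambda>y. \<xi> y + \<eta> y) = (\<lambda>y. foldr op ls \<xi> y + foldr op ls \<eta> y)"
    "foldr op ls (\<lambda>y. a * \<xi> y) = (\<lambda>y. a * foldr op ls \<xi> y)" for ls
    by (induction ls) (simp_all add: op_linear)
  then show "wop w (\<lambda>y. \<xi> y + \<eta> y) = (\<lambda>y. wop w \<xi> y + wop w \<eta> y)"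
    "wop w (\<lambda>y. a * \<xi> y) = (\<lambda>y. a * wop w \<xi> y)"
    by (simp_all add: wop_def)
qed

lemma wop_0 [simp]: "wop w (\<lambda>_. 0) = (\<lambda>_. 0)"
  using wop_linear(2)[of w 0 "\<lambda>_. 0"] by simp

lemma fsupp_wop: "fsupp \<xi> \<Longrightarrow> fsupp (wop w \<xi>)" and nr_wop: "fsupp \<xi> \<Longrightarrow> nr (wop w \<xi>) \<le> nr \<xi>"
proof -
  have "fsupp (foldr op ls \<xi>) \<and> nr (foldr op ls \<xi>) \<le> nr \<xi>" if "fsupp \<xi>" for ls
    using that by (induction ls) (auto intro: fsupp_op order_trans[OF nr_op])
  then show "fsupp \<xi> \<Longrightarrow> fsupp (wop w \<xi>)" "fsupp \<xi> \<Longrightarrow> nr (wop w \<xi>) \<le> nr \<xi>"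
    by (simp_all add: wop_def)
qed

lemma wop_adj: "fsupp \<xi> \<Longrightarrow> ip (wop w \<xi>) \<eta> = ip \<xi> (wop (word_adj w) \<eta>)"
proof -
  have "ip (foldr op ls \<xi>) \<eta> = ip \<xi> (foldr op (map letter_adj (rev ls)) \<eta>)" if "fsupp \<xi>" for ls
    using that
  proof (induction ls arbitrary: \<eta>)
    case (Cons l ls)
    have "fsupp (foldr op ls \<xi>)"
      using fsupp_wop[OF Cons.prems, of "Word ls"] by (simp add: wop_def)
    then show ?case
      using Cons by (simp add: op_adj)
  qed simp
  then show "fsupp \<xi> \<Longrightarrow> ip (wop w \<xi>) \<eta> = ip \<xi> (wop (word_adj w) \<eta>)"
    by (simp add: wop_def word_adj_def)
qed

lemma rep_eq: "finite A \<Longrightarrow> Poly_Mapping.keys f \<subseteq> A \<Longrightarrow> rep f \<xi> y = (\<Sum>w\<in>A. Poly_Mapping.lookup f w * wop w \<xi> y)"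
  unfolding rep_def by (rule sum.mono_neutral_left) (auto simp: in_keys_iff)

lemma rep_add: "rep (f + g) \<xi> = (\<lambda>y. rep f \<xi> y + rep g \<xi> y)"
proof
  fix y
  let ?A = "Poly_Mapping.keys f \<union> Poly_Mapping.keys g"
  have "finite ?A" "Poly_Mapping.keys (f + g) \<subseteq> ?A"
    using Poly_Mapping.keys_add[of f g] by auto
  then show "rep (f + g) \<xi> y = rep f \<xi> y + rep g \<xi> y"
    by (simp add: rep_eq[of ?A] lookup_add algebra_simps sum.distrib)
qed

lemma rep_single: "rep (Poly_Mapping.single w a) \<xi> = (\<lambda>y. a * wop w \<xi> y)"
  by (auto simp: rep_def fun_eq_iff)

lemma rep_linear: "rep f (\<lambda>y. \<xi> y + \<eta> y) = (\<lambda>y. rep f \<xi> y + rep f \<eta> y)" "rep f (\<lambda>y. a * \<xi> y) = (\<lambda>y. a * rep f \<xi> y)"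
  unfolding rep_def wop_linear
  by (simp_all add: fun_eq_iff distrib_left sum.distrib sum_distrib_left mult.left_commute)

lemma rep_mult: "rep (f * g) \<xi> = rep f (rep g \<xi>)"
proof (induction f rule: star_poly_induct)
  case (single w a)
  show ?case
    by (induction g rule: star_poly_induct)
       (simp_all add: mult_single rep_single distrib_left rep_add wop_linear mult.assoc)
qed (simp add: distrib_right rep_add)

lemma rep_uminus: "rep (- f) \<xi> = (\<lambda>y. - rep f \<xi> y)"
  by (auto simp: rep_def fun_eq_iff sum_negf)

lemma rep_diff: "rep (f - g) \<xi> = (\<lambda>y. rep f \<xi> y - rep g \<xi> y)"
  using rep_add[of f "- g"] by (simp add: rep_uminus)

lemma rep_0 [simp]: "rep 0 \<xi> = (\<lambda>_. 0)" "rep f (\<lambda>_. 0) = (\<lambda>_. 0)"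
  by (simp_all add: rep_def fun_eq_iff)

lemma rep_sum: "rep (sum F A) \<xi> = (\<lambda>y. \<Sum>a\<in>A. rep (F a) \<xi> y)"
  by (induction A rule: infinite_finite_induct) (simp_all add: rep_add)

lemma rep_gen: "rep (gen \<alpha>) \<xi> = op (Gen \<alpha>) \<xi>" "rep (poly_adj (gen \<alpha>)) \<xi> = op (Gen_adj \<alpha>) \<xi>"
  by (simp_all add: gen_def rep_single word_adj_def)

lemma rep_scale: "rep (poly_scale a f) \<xi> = (\<lambda>y. a * rep f \<xi> y)"
  by (simp add: poly_scale_def rep_mult rep_single)

lemma fsupp_rep: "fsupp \<xi> \<Longrightarrow> fsupp (rep f \<xi>)"
  unfolding rep_def[abs_def] by (intro fsupp_sum fsupp_scale fsupp_wop)

lemma rep_adj: "fsupp \<xi> \<Longrightarrow> ip (rep f \<xi>) \<eta> = ip \<xi> (rep (poly_adj f) \<eta>)"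
proof (induction f rule: star_poly_induct)
  case (single w a)
  then show ?case
    by (simp add: rep_single ip_scale_left ip_scale_right wop_adj)
next
  case (add f g)
  then show ?case
    by (simp add: rep_add ip_add_left ip_add_right poly_adj_add fsupp_rep)
qed

lemma nr_rep_bound: "fsupp \<xi> \<Longrightarrow> nr (rep f \<xi>) \<le> (\<Sum>w\<in>Poly_Mapping.keys f. cmod (Poly_Mapping.lookup f w)) * nr \<xi>"
proof -
  assume \<xi>: "fsupp \<xi>"
  have "nr (\<lambda>y. \<Sum>w\<in>A. Poly_Mapping.lookup f w * wop w \<xi> y) \<le> (\<Sum>w\<in>A. cmod (Poly_Mapping.lookup f w) * nr \<xi>)" for A
  proof (induction A rule: infinite_finite_induct)
    case (insert w A)
    have "nr (\<lambda>y. Poly_Mapping.lookup f w * wop w \<xi> y + (\<Sum>w\<in>A. Poly_Mapping.lookup f w * wop w \<xi> y))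
        \<le> nr (\<lambda>y. Poly_Mapping.lookup f w * wop w \<xi> y) + nr (\<lambda>y. \<Sum>w\<in>A. Poly_Mapping.lookup f w * wop w \<xi> y)"
      using \<xi> by (intro nr_triangle fsupp_scale fsupp_sum fsupp_wop)
    also have "\<dots> \<le> cmod (Poly_Mapping.lookup f w) * nr \<xi> + (\<Sum>w\<in>A. cmod (Poly_Mapping.lookup f w) * nr \<xi>)"
      unfolding nr_scale using \<xi> insert.IH by (intro add_mono mult_left_mono nr_wop) auto
    finally show ?case
      using insert by simp
  qed auto
  then show ?thesis
    unfolding rep_def[abs_def] by (simp add: sum_distrib_right)
qed

definition opn :: "'m star_poly \<Rightarrow> real" where
  "opn f = (SUP \<xi> \<in> {\<xi>. fsupp \<xi> \<and> nr \<xi> \<le> 1}. nr (rep f \<xi>))"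

lemma ball_ne: "{\<xi>. fsupp \<xi> \<and> nr \<xi> \<le> 1} \<noteq> {}"
  by (auto simp: fsupp_def intro!: exI[of _ "\<lambda>_. 0"])

lemma opn_upper: "fsupp \<xi> \<Longrightarrow> nr \<xi> \<le> 1 \<Longrightarrow> nr (rep f \<xi>) \<le> opn f"
  unfolding opn_def
proof (rule cSUP_upper)
  show "bdd_above ((\<lambda>\<xi>. nr (rep f \<xi>)) ` {\<xi>. fsupp \<xi> \<and> nr \<xi> \<le> 1})"
  proof (rule bdd_aboveI2)
    fix \<xi> :: "'b \<Rightarrow> complex" assume \<xi>: "\<xi> \<in> {\<xi>. fsupp \<xi> \<and> nr \<xi> \<le> 1}"
    have "(\<Sum>w\<in>Poly_Mapping.keys f. cmod (Poly_Mapping.lookup f w)) * nr \<xi>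
        \<le> (\<Sum>w\<in>Poly_Mapping.keys f. cmod (Poly_Mapping.lookup f w)) * 1"
      using \<xi> by (intro mult_left_mono sum_nonneg) auto
    then show "nr (rep f \<xi>) \<le> (\<Sum>w\<in>Poly_Mapping.keys f. cmod (Poly_Mapping.lookup f w))"
      using nr_rep_bound[of \<xi> f] \<xi> by simp
  qed
qed auto

lemma opn_least: "(\<And>\<xi>. fsupp \<xi> \<Longrightarrow> nr \<xi> \<le> 1 \<Longrightarrow> nr (rep f \<xi>) \<le> b) \<Longrightarrow> opn f \<le> b"
  unfolding opn_def using ball_ne by (intro cSUP_least) auto

lemma opn_nonneg [simp]: "0 \<le> opn f"
  using opn_upper[of "\<lambda>_. 0" f] by (simp add: fsupp_def)

lemma opn_bound:
  assumes \<xi>: "fsupp \<xi>"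
  shows "nr (rep f \<xi>) \<le> opn f * nr \<xi>"
proof (cases "nr \<xi> = 0")
  case True
  then show ?thesis
    using nr_eq_0[OF \<xi>] by simp
next
  case False
  then have pos: "nr \<xi> > 0"
    using nr_nonneg[of \<xi>] by linarith
  let ?a = "complex_of_real (1 / nr \<xi>)"
  have "nr (\<lambda>y. ?a * \<xi> y) \<le> 1"
    unfolding nr_scale using pos by (simp add: norm_divide)
  then have "nr (rep f (\<lambda>y. ?a * \<xi> y)) \<le> opn f"
    using \<xi> by (intro opn_upper fsupp_scale)
  then have "nr (rep f \<xi>) / nr \<xi> \<le> opn f"
    unfolding rep_linear nr_scale using pos by (simp add: norm_divide)
  then show ?thesis
    using pos by (simp add: divide_le_eq)
qed

lemma opn_add: "opn (f + g) \<le> opn f + opn g"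
proof (rule opn_least)
  fix \<xi> :: "'b \<Rightarrow> complex" assume \<xi>: "fsupp \<xi>" "nr \<xi> \<le> 1"
  have "nr (rep (f + g) \<xi>) \<le> nr (rep f \<xi>) + nr (rep g \<xi>)"
    unfolding rep_add using \<xi> by (intro nr_triangle fsupp_rep)
  then show "nr (rep (f + g) \<xi>) \<le> opn f + opn g"
    using opn_upper[OF \<xi>, of f] opn_upper[OF \<xi>, of g] by linarith
qed

lemma opn_scale: "opn (poly_scale a f) = cmod a * opn f"
proof -
  have le: "opn (poly_scale a f) \<le> cmod a * opn f" for a f
    by (rule opn_least) (simp add: rep_scale nr_scale mult_left_mono opn_upper)
  show ?thesis
  proof (cases "a = 0")
    case True
    then show ?thesis
      using le[of a f] opn_nonneg[of "poly_scale a f"] by (intro antisym) auto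
  next
    case False
    then have "opn f \<le> cmod (1 / a) * opn (poly_scale a f)"
      using le[of "1 / a" "poly_scale a f"] by (simp add: poly_scale_scale)
    then have "cmod a * opn f \<le> opn (poly_scale a f)"
      using False by (simp add: norm_divide field_simps)
    then show ?thesis
      using le[of a f] by simp
  qed
qed

lemma opn_mult: "opn (f * g) \<le> opn f * opn g"
proof (rule opn_least)
  fix \<xi> :: "'b \<Rightarrow> complex" assume \<xi>: "fsupp \<xi>" "nr \<xi> \<le> 1"
  have "nr (rep (f * g) \<xi>) \<le> opn f * nr (rep g \<xi>)"
    unfolding rep_mult using \<xi> by (intro opn_bound fsupp_rep)
  also have "\<dots> \<le> opn f * opn g"
    using opn_upper[OF \<xi>] by (intro mult_left_mono) auto
  finally show "nr (rep (f * g) \<xi>) \<le> opn f * opn g" .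
qed

text \<open>The square of the norm of \<open>rep f \<xi>\<close> is the inner product of \<xi> with
  \<open>rep (poly_adj f * f) \<xi>\<close>, and Cauchy-Schwarz bounds it. This works on finitely
  supported functions as it does on a Hilbert space.\<close>

lemma opn_cstar: "opn (poly_adj f * f) = (opn f)\<^sup>2"
proof -
  have ge: "(opn f)\<^sup>2 \<le> opn (poly_adj f * f)" for f
  proof -
    have "nr (rep f \<xi>) \<le> sqrt (opn (poly_adj f * f))" if \<xi>: "fsupp \<xi>" "nr \<xi> \<le> 1" for \<xi>
    proof -
      have "complex_of_real ((nr (rep f \<xi>))\<^sup>2) = ip \<xi> (rep (poly_adj f * f) \<xi>)"
        using \<xi> by (simp only: nr_square rep_adj rep_mult)
      then have "(nr (rep f \<xi>))\<^sup>2 = cmod (ip \<xi> (rep (poly_adj f * f) \<xi>))"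
        by (metis abs_of_nonneg norm_of_real zero_le_power2)
      also have "\<dots> \<le> nr \<xi> * nr (rep (poly_adj f * f) \<xi>)"
        using \<xi> by (intro cauchy_schwarz fsupp_rep)
      also have "\<dots> \<le> 1 * opn (poly_adj f * f)"
        using \<xi> opn_upper[OF \<xi>] by (intro mult_mono) auto
      finally show ?thesis
        by (intro real_le_rsqrt) simp
    qed
    then have "opn f \<le> sqrt (opn (poly_adj f * f))"
      by (rule opn_least)
    then have "(opn f)\<^sup>2 \<le> (sqrt (opn (poly_adj f * f)))\<^sup>2"
      by (intro power_mono) auto
    then show ?thesis by simp
  qed
  have le: "opn f \<le> opn (poly_adj f)" for f
  proof -
    have "opn f * opn f \<le> opn (poly_adj f) * opn f"
      using ge[of f] opn_mult[of "poly_adj f" f] by (simp add: power2_eq_square)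
    then show ?thesis
      using opn_nonneg[of f] opn_nonneg[of "poly_adj f"] by (cases "opn f = 0") auto
  qed
  have "opn (poly_adj f) = opn f"
    using le[of f] le[of "poly_adj f"] by simp
  then show ?thesis
    using ge[of f] opn_mult[of "poly_adj f" f] by (simp add: power2_eq_square)
qed

lemma opn_eq_0: "(\<And>\<xi>. rep f \<xi> = (\<lambda>_. 0)) \<Longrightarrow> opn f = 0"
  using opn_least[of f 0] opn_nonneg[of f] by simp

lemma opn_cstar_seminorm:
  assumes "\<And>f \<xi>. f \<in> ck_relations G \<Longrightarrow> rep f \<xi> = (\<lambda>_. 0)"
  shows "opn \<in> cstar_seminorms G"
  unfolding cstar_seminorms_def
  using assms opn_eq_0 opn_add opn_scale opn_mult opn_cstar by auto

end

section \<open>Boundary paths\<close>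

context k_graph
begin

definition pre :: "'m \<Rightarrow> 'm \<Rightarrow> bool" where
  "pre \<alpha> \<gamma> \<longleftrightarrow> \<alpha> \<in> M \<and> (\<exists>\<beta>\<in>M. s \<alpha> = r \<beta> \<and> \<gamma> = cmp G \<alpha> \<beta>)"

lemma preI: "\<alpha> \<in> M \<Longrightarrow> \<beta> \<in> M \<Longrightarrow> s \<alpha> = r \<beta> \<Longrightarrow> pre \<alpha> (cmp G \<alpha> \<beta>)"
  by (auto simp: pre_def)

lemma preD: "pre \<alpha> \<gamma> \<Longrightarrow> \<alpha> \<in> M \<and> \<gamma> \<in> M \<and> r \<alpha> = r \<gamma> \<and> d \<alpha> \<le> d \<gamma>"
  by (auto simp: pre_def cmp_closed rng_cmp deg_cmp vec_le_add)

lemma preE: "pre \<alpha> \<gamma> \<Longrightarrow> (\<And>\<beta>. \<beta> \<in> M \<Longrightarrow> s \<alpha> = r \<beta> \<Longrightarrow> \<gamma> = cmp G \<alpha> \<beta> \<Longrightarrow> s \<beta> = s \<gamma> \<Longrightarrow> thesis) \<Longrightarrow> thesis"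
  unfolding pre_def using src_cmp by metis

lemma pre_refl: "\<alpha> \<in> M \<Longrightarrow> pre \<alpha> \<alpha>"
  using preI[of \<alpha> "s \<alpha>"] by (simp add: src_closed rng_src cmp_src)

lemma pre_trans:
  assumes "pre \<alpha> \<beta>" "pre \<beta> \<gamma>"
  shows "pre \<alpha> \<gamma>"
proof -
  obtain \<kappa> where \<kappa>: "\<kappa> \<in> M" "s \<alpha> = r \<kappa>" "\<beta> = cmp G \<alpha> \<kappa>" "s \<kappa> = s \<beta>"
    using assms(1) by (rule preE)
  obtain \<eta> where \<eta>: "\<eta> \<in> M" "s \<beta> = r \<eta>" "\<gamma> = cmp G \<beta> \<eta>"
    using assms(2) by (rule preE)
  have \<alpha>: "\<alpha> \<in> M"
    using preD[OF assms(1)] by simp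
  have "\<gamma> = cmp G \<alpha> (cmp G \<kappa> \<eta>)"
    unfolding \<eta>(3) unfolding \<kappa>(3) using \<alpha> \<kappa> \<eta> by (intro cmp_assoc) simp_all
  then show ?thesis
    using preI[OF \<alpha>, of "cmp G \<kappa> \<eta>"] \<kappa>(1,2,4) \<eta>(1,2) by (simp add: cmp_closed rng_cmp)
qed

lemma pre_cmp:
  assumes "\<gamma> \<in> M" "s \<gamma> = r \<alpha>" "pre \<alpha> \<beta>"
  shows "pre (cmp G \<gamma> \<alpha>) (cmp G \<gamma> \<beta>)"
proof -
  obtain \<kappa> where \<kappa>: "\<kappa> \<in> M" "s \<alpha> = r \<kappa>" "\<beta> = cmp G \<alpha> \<kappa>"
    using assms(3) by (rule preE)
  have \<alpha>: "\<alpha> \<in> M"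
    using preD[OF assms(3)] by simp
  have "cmp G \<gamma> \<beta> = cmp G (cmp G \<gamma> \<alpha>) \<kappa>"
    unfolding \<kappa>(3) using assms(1,2) \<alpha> \<kappa>(1,2) by (intro cmp_assoc[symmetric])
  then show ?thesis
    using preI[of "cmp G \<gamma> \<alpha>" \<kappa>] assms(1,2) \<alpha> \<kappa>(1,2) by (simp add: cmp_closed src_cmp)
qed

lemma pre_cmp_cancel:
  assumes \<gamma>: "\<gamma> \<in> M" and \<alpha>: "\<alpha> \<in> M" "s \<gamma> = r \<alpha>" and \<beta>: "\<beta> \<in> M" "s \<gamma> = r \<beta>"
    and pre: "pre (cmp G \<gamma> \<alpha>) (cmp G \<gamma> \<beta>)"
  shows "pre \<alpha> \<beta>"
proof -
  obtain \<kappa> where \<kappa>: "\<kappa> \<in> M" "s (cmp G \<gamma> \<alpha>) = r \<kappa>" "cmp G \<gamma> \<beta> = cmp G (cmp G \<gamma> \<alpha>) \<kappa>"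
    using pre by (rule preE)
  have s: "s \<alpha> = r \<kappa>"
    using \<kappa>(2) \<gamma> \<alpha> by (simp add: src_cmp)
  have "cmp G (cmp G \<gamma> \<alpha>) \<kappa> = cmp G \<gamma> (cmp G \<alpha> \<kappa>)"
    using \<gamma> \<alpha> \<kappa>(1) s by (intro cmp_assoc)
  then have "\<beta> = cmp G \<alpha> \<kappa>"
    using factor_unique(2)[of \<gamma> \<beta> \<gamma> "cmp G \<alpha> \<kappa>"] \<gamma> \<alpha> \<beta> \<kappa>(1,3) s by (simp add: cmp_closed rng_cmp)
  then show ?thesis
    using preI[OF \<alpha>(1) \<kappa>(1) s] by simp
qed

lemma pre_deg_eq: "pre \<alpha> \<gamma> \<Longrightarrow> pre \<beta> \<gamma> \<Longrightarrow> d \<alpha> = d \<beta> \<Longrightarrow> \<alpha> = \<beta>"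
  unfolding pre_def using factor_unique(1) by metis

text \<open>If \<alpha> ended early in colour \<open>i\<close> while \<gamma> goes on, the rest of
  \<gamma> would provide an edge of colour \<open>i\<close> at the source of \<alpha>, against
  maximality. So initial segments in \<open>paths_le G n\<close> are unique.\<close>

lemma paths_le_pre_deg:
  assumes "\<alpha> \<in> paths_le G n" "pre \<alpha> \<gamma>"
  shows "d \<alpha> $ i = min (n $ i) (d \<gamma> $ i)"
proof (rule ccontr)
  assume ne: "d \<alpha> $ i \<noteq> min (n $ i) (d \<gamma> $ i)"
  obtain \<beta> where \<beta>: "\<beta> \<in> M" "s \<alpha> = r \<beta>" "\<gamma> = cmp G \<alpha> \<beta>"
    using assms(2) by (rule preE)
  have \<alpha>: "\<alpha> \<in> M" "d \<alpha> $ j \<le> n $ j" for j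
    using assms(1) by (simp_all add: paths_le_iff vec_le_iff)
  have d\<gamma>: "d \<gamma> $ i = d \<alpha> $ i + d \<beta> $ i"
    using \<alpha> \<beta> by (simp add: deg_cmp)
  then have "d \<alpha> $ i < n $ i" "d \<beta> $ i > 0"
    using ne \<alpha>(2)[of i] by auto
  then have "d \<alpha> + unit_deg i \<le> n" "edges_at (s \<alpha>) i \<noteq> {}"
    using \<alpha>(2) edges_at_path[OF \<beta>(1), of i] \<beta>(2) by (auto simp: vec_le_iff axis_nth_nat)
  then show False
    using assms(1) by (simp add: paths_le_iff)
qed

lemma paths_le_pre_unique:
  "\<alpha> \<in> paths_le G n \<Longrightarrow> \<beta> \<in> paths_le G n \<Longrightarrow> pre \<alpha> \<gamma> \<Longrightarrow> pre \<beta> \<gamma> \<Longrightarrow> \<alpha> = \<beta>"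
  using paths_le_pre_deg[of \<alpha> n \<gamma>] paths_le_pre_deg[of \<beta> n \<gamma>] by (intro pre_deg_eq) (simp_all add: vec_eq_iff)

lemma pre_mono:
  assumes "pre \<alpha> \<gamma>" "pre \<beta> \<gamma>" "d \<alpha> \<le> d \<beta>"
  shows "pre \<alpha> \<beta>"
proof -
  have \<beta>: "\<beta> \<in> M"
    using preD[OF assms(2)] by simp
  obtain \<alpha>' \<kappa> where *: "\<alpha>' \<in> M" "\<kappa> \<in> M" "d \<alpha>' = d \<alpha>" "d \<kappa> = d \<beta> - d \<alpha>" "s \<alpha>' = r \<kappa>" "\<beta> = cmp G \<alpha>' \<kappa>"
    "r \<alpha>' = r \<beta>" "s \<kappa> = s \<beta>"
    by (rule factorE[OF \<beta> assms(3)])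
  have "pre \<alpha>' \<beta>"
    using preI[OF *(1,2,5)] *(6) by simp
  moreover have "\<alpha>' = \<alpha>"
    using pre_trans[OF calculation assms(2)] assms(1) *(3) by (rule pre_deg_eq)
  ultimately show ?thesis by simp
qed

text \<open>
  A boundary path is encoded by its initial segments \<open>y n\<close> in \<open>\<Lambda>\<^sup>\<le>\<^sup>n\<close>; it may have finite degree in
  some colours, so \<open>y n\<close> need not have degree \<open>n\<close>.
\<close>

definition bdry :: "(nat ^ 'k \<Rightarrow> 'm) set" where
  "bdry = {y. (\<forall>n. y n \<in> paths_le G n) \<and> (\<forall>n m. n \<le> m \<longrightarrow> pre (y n) (y m))}"

lemma bdryD:
  assumes "y \<in> bdry"
  shows "y n \<in> paths_le G n" "n \<le> m \<Longrightarrow> pre (y n) (y m)" "y n \<in> M" "r (y n) = y 0"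
proof -
  show *: "y n \<in> paths_le G n" "n \<le> m \<Longrightarrow> pre (y n) (y m)" for n m
    using assms by (auto simp: bdry_def)
  then show "y n \<in> M"
    by (simp add: paths_le_iff)
  have "y 0 \<in> M" "d (y 0) = 0"
    using *(1)[of 0] by (auto simp: paths_le_iff vec_le_iff vec_eq_iff)
  moreover have "r (y 0) = r (y n)"
    using preD[OF *(2)[of 0 n]] by (simp add: vec_le_iff)
  ultimately show "r (y n) = y 0"
    using deg_0_rng by metis
qed

text \<open>
  Both values are arbitrary outside the domains \<open>y (d \<alpha>) = \<alpha>\<close> and \<open>z 0 = s \<alpha>\<close>. Inside them they are
  unique, and the segment in \<open>prepend\<close> exists by local convexity.
\<close>

definition unshift :: "'m \<Rightarrow> (nat ^ 'k \<Rightarrow> 'm) \<Rightarrow> nat ^ 'k \<Rightarrow> 'm" where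
  "unshift \<alpha> y n = (SOME \<beta>. \<beta> \<in> M \<and> s \<alpha> = r \<beta> \<and> y (d \<alpha> + n) = cmp G \<alpha> \<beta>)"

definition prepend :: "'m \<Rightarrow> (nat ^ 'k \<Rightarrow> 'm) \<Rightarrow> nat ^ 'k \<Rightarrow> 'm" where
  "prepend \<alpha> z n = (SOME \<beta>. \<beta> \<in> paths_le G n \<and> pre \<beta> (cmp G \<alpha> (z n)))"

lemma unshift:
  assumes y: "y \<in> bdry" "y (d \<alpha>) = \<alpha>"
  shows "unshift \<alpha> y n \<in> M \<and> s \<alpha> = r (unshift \<alpha> y n) \<and> y (d \<alpha> + n) = cmp G \<alpha> (unshift \<alpha> y n)"
  unfolding unshift_def
proof (rule someI_ex)
  have "pre \<alpha> (y (d \<alpha> + n))"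
    using bdryD(2)[OF y(1), of "d \<alpha>" "d \<alpha> + n"] y(2) by (simp add: vec_le_add)
  then show "\<exists>\<beta>. \<beta> \<in> M \<and> s \<alpha> = r \<beta> \<and> y (d \<alpha> + n) = cmp G \<alpha> \<beta>"
    unfolding pre_def by blast
qed

lemma unshift_eqI:
  assumes y: "y \<in> bdry" "y (d \<alpha>) = \<alpha>" and \<beta>: "\<beta> \<in> M" "s \<alpha> = r \<beta>" "y (d \<alpha> + n) = cmp G \<alpha> \<beta>"
  shows "unshift \<alpha> y n = \<beta>"
proof -
  have "\<alpha> \<in> M"
    using bdryD(3)[OF y(1), of "d \<alpha>"] y(2) by simp
  then show ?thesis
    using unshift[OF y, of n] \<beta> factor_unique(2)[of \<alpha> "unshift \<alpha> y n" \<alpha> \<beta>] by simp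
qed

lemma unshift_bdry:
  assumes y: "y \<in> bdry" "y (d \<alpha>) = \<alpha>"
  shows "unshift \<alpha> y \<in> bdry" "unshift \<alpha> y 0 = s \<alpha>"
proof -
  note u = unshift[OF y]
  have \<alpha>: "\<alpha> \<in> M"
    using bdryD(3)[OF y(1), of "d \<alpha>"] y(2) by simp
  have le: "unshift \<alpha> y n \<in> paths_le G n" for n
  proof -
    have "cmp G \<alpha> (unshift \<alpha> y n) \<in> paths_le G (d \<alpha> + n)"
      using bdryD(1)[OF y(1), of "d \<alpha> + n"] u[of n] by simp
    then show ?thesis
      using u[of n] \<alpha> by (auto simp: paths_le_iff deg_cmp src_cmp vec_le_iff add.assoc)
  qed
  then show "unshift \<alpha> y \<in> bdry"
    unfolding bdry_def
  proof (intro CollectI conjI allI impI)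
    fix n m :: "nat ^ 'k" assume nm: "n \<le> m"
    have "pre (y (d \<alpha> + n)) (y (d \<alpha> + m))"
      using nm by (intro bdryD(2)[OF y(1)]) (simp add: vec_le_iff)
    then have "pre (cmp G \<alpha> (unshift \<alpha> y n)) (cmp G \<alpha> (unshift \<alpha> y m))"
      using u by simp
    then show "pre (unshift \<alpha> y n) (unshift \<alpha> y m)"
      by (rule pre_cmp_cancel[OF \<alpha>, rotated -1]) (use u in blast)+
  qed
  then show "unshift \<alpha> y 0 = s \<alpha>"
    using u[of 0] bdryD(4)[of "unshift \<alpha> y" 0] by simp
qed

end

section \<open>Local convexity and the existence of boundary paths\<close>

locale lc_graph = finite_k_graph G for G :: "('m, 'k::finite) kgraph" +
  assumes lc: "locally_convex G"
begin

text \<open>Local convexity moves an edge of colour \<open>i\<close> past one edge of another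
  colour. Removing the first edge of \<beta>, whose colour differs from \<open>i\<close>, and
  repeating this moves it to the source.\<close>

lemma locally_convex_walk:
  "\<beta> \<in> M \<Longrightarrow> edges_at (r \<beta>) i \<noteq> {} \<Longrightarrow> d \<beta> $ i = 0 \<Longrightarrow> edges_at (s \<beta>) i \<noteq> {}"
proof (induction "\<Sum>j\<in>UNIV. d \<beta> $ j" arbitrary: \<beta> rule: less_induct)
  case less
  show ?case
  proof (cases "d \<beta> = 0")
    case True
    then show ?thesis
      using less.prems deg_0_rng[of \<beta>] deg_0_src[of \<beta>] by simp
  next
    case False
    then obtain j where j: "d \<beta> $ j > 0"
      by (auto simp: vec_eq_iff)
    then have ij: "i \<noteq> j"
      using less.prems by auto
    have "unit_deg j \<le> d \<beta>"
      using j by (auto simp: vec_le_iff axis_nth_nat)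
    then obtain g \<beta>' where g: "g \<in> M" "\<beta>' \<in> M" "d g = unit_deg j" "d \<beta>' = d \<beta> - unit_deg j" "s g = r \<beta>'"
      "\<beta> = cmp G g \<beta>'" "r g = r \<beta>" "s \<beta>' = s \<beta>"
      by (rule factorE[OF less.prems(1)])
    obtain f where f: "f \<in> M" "d f = unit_deg i" "r f = r \<beta>"
      using less.prems(2) edges_at_iff by blast
    have "edges_at (s g) i \<noteq> {}"
      using lc f(1,2) g(1,3) ij g(7) f(3) unfolding locally_convex_def edges_at_def
      by (auto simp: paths_of_deg_def)
    moreover have "(\<Sum>l\<in>UNIV. d \<beta>' $ l) < (\<Sum>l\<in>UNIV. d \<beta> $ l)"
    proof (rule sum_strict_mono_ex1)
      show "\<exists>l\<in>UNIV. d \<beta>' $ l < d \<beta> $ l"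
        using j by (intro bexI[of _ j]) (simp_all add: g(4) axis_nth_nat)
    qed (simp_all add: g(4))
    ultimately show ?thesis
      using less.hyps[of \<beta>'] g(2,4,5,8) less.prems(3) by simp
  qed
qed

text \<open>Cut \<nu> at the minimum of \<open>n\<close> and \<open>d \<nu>\<close>. If the piece
  could be prolonged within \<open>n\<close> in colour \<open>i\<close>, then \<nu> has used up this
  colour below \<open>n $ i\<close>, so the remainder of \<nu> has degree 0 there. Local convexity
  carries the edge along the remainder to the source of \<nu>, against maximality of \<nu>.\<close>

lemma paths_le_pre_exists:
  assumes \<nu>: "\<nu> \<in> paths_le G m" and nm: "n \<le> m"
  shows "\<exists>\<alpha>\<in>paths_le G n. pre \<alpha> \<nu>"
proof -
  have \<nu>M: "\<nu> \<in> M"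
    using \<nu> by (simp add: paths_le_iff)
  define k where "k = (\<chi> i. min (n $ i) (d \<nu> $ i))"
  have k: "k $ i = min (n $ i) (d \<nu> $ i)" for i
    by (simp add: k_def)
  have "k \<le> d \<nu>"
    by (simp add: vec_le_iff k)
  then obtain \<alpha> \<beta> where *: "\<alpha> \<in> M" "\<beta> \<in> M" "d \<alpha> = k" "d \<beta> = d \<nu> - k" "s \<alpha> = r \<beta>" "\<nu> = cmp G \<alpha> \<beta>" "r \<alpha> = r \<nu>" "s \<beta> = s \<nu>"
    by (rule factorE[OF \<nu>M])
  have "edges_at (s \<alpha>) i = {}" if i: "d \<alpha> + unit_deg i \<le> n" for i
  proof (rule ccontr)
    assume ne: "edges_at (s \<alpha>) i \<noteq> {}"
    have "k $ i < n $ i"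
      using i by (auto simp: *(3) vec_le_iff axis_nth_nat dest: spec[of _ i])
    then have ki: "k $ i = d \<nu> $ i" "d \<nu> $ i < n $ i"
      using k[of i] by auto
    have "edges_at (s \<nu>) i \<noteq> {}"
      using locally_convex_walk[OF *(2), of i] ne ki by (simp add: *(4,5,8))
    moreover have "d \<nu> + unit_deg i \<le> m"
      using \<nu> ki(2) nm unfolding paths_le_iff vec_le_iff
      by (auto simp: axis_nth_nat) (meson Suc_leI order_trans)
    ultimately show False
      using \<nu> by (simp add: paths_le_iff)
  qed
  then have "\<alpha> \<in> paths_le G n"
    using *(1) by (auto simp: paths_le_iff *(3) vec_le_iff k)
  then show ?thesis
    using preI[OF *(1,2,5)] *(6) by auto
qed

lemma prepend:
  assumes z: "z \<in> bdry" "z 0 = s \<alpha>" and \<alpha>: "\<alpha> \<in> M"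
  shows "prepend \<alpha> z n \<in> paths_le G n" "pre (prepend \<alpha> z n) (cmp G \<alpha> (z n))"
proof -
  have "cmp G \<alpha> (z n) \<in> paths_le G (d \<alpha> + n)"
    using bdryD[OF z(1), of n] z(2) by (intro paths_le_cmp[OF \<alpha>]) auto
  moreover have "n \<le> d \<alpha> + n"
    by (simp add: vec_le_iff)
  ultimately have "\<exists>\<beta>. \<beta> \<in> paths_le G n \<and> pre \<beta> (cmp G \<alpha> (z n))"
    using paths_le_pre_exists by blast
  from someI_ex[OF this] show "prepend \<alpha> z n \<in> paths_le G n" "pre (prepend \<alpha> z n) (cmp G \<alpha> (z n))"
    by (simp_all add: prepend_def)
qed

lemma prepend_unique:
  assumes z: "z \<in> bdry" "z 0 = s \<alpha>" and \<alpha>: "\<alpha> \<in> M"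
    and \<beta>: "\<beta> \<in> paths_le G n" "pre \<beta> (cmp G \<alpha> (z m))" "n \<le> m"
  shows "prepend \<alpha> z n = \<beta>"
proof (rule paths_le_pre_unique[OF prepend(1)[OF z \<alpha>] \<beta>(1) _ \<beta>(2)])
  have "pre (cmp G \<alpha> (z n)) (cmp G \<alpha> (z m))"
    using bdryD[OF z(1)] z(2) \<beta>(3) by (intro pre_cmp[OF \<alpha>]) auto
  then show "pre (prepend \<alpha> z n) (cmp G \<alpha> (z m))"
    using prepend(2)[OF z \<alpha>] pre_trans by blast
qed

lemma prepend_bdry:
  assumes z: "z \<in> bdry" "z 0 = s \<alpha>" and \<alpha>: "\<alpha> \<in> M"
  shows "prepend \<alpha> z \<in> bdry" "prepend \<alpha> z (d \<alpha>) = \<alpha>"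
    "prepend \<alpha> z (d \<alpha> + n) = cmp G \<alpha> (z n)" "unshift \<alpha> (prepend \<alpha> z) = z"
proof -
  note p = prepend[OF z \<alpha>]
  show bd: "prepend \<alpha> z \<in> bdry"
    unfolding bdry_def
  proof (intro CollectI conjI allI impI p)
    fix n m :: "nat ^ 'k" assume nm: "n \<le> m"
    obtain \<beta> where \<beta>: "\<beta> \<in> paths_le G n" "pre \<beta> (prepend \<alpha> z m)"
      using paths_le_pre_exists[OF p(1) nm] by blast
    then have "prepend \<alpha> z n = \<beta>"
      using p(2)[of m] nm by (intro prepend_unique[OF z \<alpha>]) (auto intro: pre_trans)
    then show "pre (prepend \<alpha> z n) (prepend \<alpha> z m)"
      using \<beta>(2) by simp
  qed
  have zM: "z n \<in> M" "s \<alpha> = r (z n)" for n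
    using bdryD[OF z(1)] z(2) by auto
  show d\<alpha>: "prepend \<alpha> z (d \<alpha>) = \<alpha>"
    by (rule prepend_unique[OF z \<alpha> paths_le_self[OF \<alpha>] preI[OF \<alpha> zM(1) zM(2)] order_refl])
  show shift: "prepend \<alpha> z (d \<alpha> + n) = cmp G \<alpha> (z n)" for n
  proof (rule prepend_unique[OF z \<alpha>])
    show "cmp G \<alpha> (z n) \<in> paths_le G (d \<alpha> + n)"
      using bdryD(1)[OF z(1)] zM by (intro paths_le_cmp \<alpha>)
    show "pre (cmp G \<alpha> (z n)) (cmp G \<alpha> (z (d \<alpha> + n)))"
      using zM by (intro pre_cmp \<alpha> bdryD(2)[OF z(1)]) (simp_all add: vec_le_iff)
  qed simp
  show "unshift \<alpha> (prepend \<alpha> z) = z"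
    using unshift_eqI[OF bd d\<alpha>] zM shift by blast
qed

lemma prepend_unshift:
  assumes y: "y \<in> bdry" "y (d \<alpha>) = \<alpha>"
  shows "prepend \<alpha> (unshift \<alpha> y) = y"
proof
  fix n
  have \<alpha>: "\<alpha> \<in> M"
    using bdryD(3)[OF y(1), of "d \<alpha>"] y(2) by simp
  have "pre (y n) (y (d \<alpha> + n))"
    by (intro bdryD(2)[OF y(1)]) (simp add: vec_le_iff)
  then show "prepend \<alpha> (unshift \<alpha> y) n = y n"
    using prepend_unique[OF unshift_bdry[OF y] \<alpha> bdryD(1)[OF y(1)], of n n] unshift[OF y, of n] by simp
qed

text \<open>Paths for the diagonal degrees \<open>c N\<close> are built by appending members of
  \<open>paths_le G (c 1)\<close>. Every degree \<open>n\<close> lies below the diagonal one with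
  index the sum of its entries; cutting there defines \<open>y n\<close>, and uniqueness of initial
  segments makes the cuts compatible.\<close>

lemma bdry_exists:
  assumes v: "v \<in> verts G"
  shows "\<exists>y\<in>bdry. y 0 = v"
proof -
  define c :: "nat \<Rightarrow> nat ^ 'k" where "c N = (\<chi> i. N)" for N
  have c: "c N $ i = N" for N i
    by (simp add: c_def)
  have step: "\<exists>\<nu>'. \<nu>' \<in> paths_le G (c (Suc N)) \<and> pre \<nu> \<nu>'" if \<nu>: "\<nu> \<in> paths_le G (c N)" for \<nu> N
  proof -
    have \<nu>M: "\<nu> \<in> M"
      using \<nu> by (simp add: paths_le_iff)
    obtain \<eta> where \<eta>: "\<eta> \<in> paths_le G (c 1)" "r \<eta> = s \<nu>"
      using paths_le_exists[OF src_verts[OF \<nu>M]] by blast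
    have \<eta>M: "\<eta> \<in> M" "d \<eta> $ i \<le> 1" for i
      using \<eta> by (auto simp: paths_le_iff vec_le_iff c)
    have "cmp G \<nu> \<eta> \<in> paths_le G (c (Suc N))"
      unfolding paths_le_iff
    proof (intro conjI allI impI)
      show "cmp G \<nu> \<eta> \<in> M"
        using \<nu>M \<eta>M \<eta> by (simp add: cmp_closed)
      have d: "d (cmp G \<nu> \<eta>) = d \<nu> + d \<eta>"
        using \<nu>M \<eta>M \<eta> by (simp add: deg_cmp)
      have d\<nu>: "d \<nu> $ i \<le> N" for i
        using \<nu> by (auto simp: paths_le_iff vec_le_iff c)
      show "d (cmp G \<nu> \<eta>) \<le> c (Suc N)"
        unfolding d vec_le_iff c using add_mono[OF d\<nu> \<eta>M(2)] by simp
      fix i assume i: "d (cmp G \<nu> \<eta>) + unit_deg i \<le> c (Suc N)"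
      show "edges_at (s (cmp G \<nu> \<eta>)) i = {}"
      proof (rule ccontr)
        assume "edges_at (s (cmp G \<nu> \<eta>)) i \<noteq> {}"
        then obtain f where f: "f \<in> M" "d f = unit_deg i" "r f = s \<eta>"
          using \<nu>M \<eta>M(1) \<eta>(2) by (auto simp: edges_at_iff src_cmp)
        have "cmp G \<eta> f \<in> M" "r (cmp G \<eta> f) = s \<nu>" "d (cmp G \<eta> f) $ i > 0"
          using f \<eta>M(1) \<eta>(2) by (simp_all add: cmp_closed rng_cmp deg_cmp)
        then have ne: "edges_at (s \<nu>) i \<noteq> {}"
          using edges_at_path by metis
        show False
        proof (cases "d \<eta> $ i = 0")
          case True
          then have "d \<eta> + unit_deg i \<le> c 1"
            using \<eta>M(2) by (auto simp: vec_le_iff axis_nth_nat c)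
          then have "edges_at (s \<eta>) i = {}"
            using \<eta>(1) unfolding paths_le_iff by blast
          moreover have "f \<in> edges_at (s \<eta>) i"
            using f by (simp add: edges_at_iff)
          ultimately show False
            by simp
        next
          case False
          have "d \<nu> $ i + d \<eta> $ i + 1 \<le> Suc N"
            using spec[OF i[unfolded vec_le_iff], of i] by (simp add: d c)
          then have "d \<nu> + unit_deg i \<le> c N"
            using False d\<nu> by (auto simp: vec_le_iff axis_nth_nat c)
          then show False
            using \<nu> ne by (simp add: paths_le_iff)
        qed
      qed
    qed
    then show ?thesis
      using preI[OF \<nu>M \<eta>M(1)] \<eta>(2) by auto
  qed
  obtain \<nu>0 where \<nu>0: "\<nu>0 \<in> paths_le G (c 0)" "r \<nu>0 = v"
    using paths_le_exists[OF v] by blast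
  have "\<exists>\<nu>. \<forall>N. \<nu> N \<in> paths_le G (c N) \<and> r (\<nu> N) = v \<and> pre (\<nu> N) (\<nu> (Suc N))"
  proof -
    have "\<exists>\<nu>. \<forall>N. (\<nu> N \<in> paths_le G (c N) \<and> r (\<nu> N) = v) \<and> pre (\<nu> N) (\<nu> (Suc N))"
    proof (rule dependent_nat_choice)
      show "\<exists>x. x \<in> paths_le G (c 0) \<and> r x = v"
        using \<nu>0 by blast
      show "\<exists>y. (y \<in> paths_le G (c (Suc N)) \<and> r y = v) \<and> pre x y"
        if "x \<in> paths_le G (c N) \<and> r x = v" for x N
        using step[of x N] that preD by metis
    qed
    then show ?thesis by simp
  qed
  then obtain \<nu> where \<nu>: "\<And>N. \<nu> N \<in> paths_le G (c N)" "\<And>N. r (\<nu> N) = v" "\<And>N. pre (\<nu> N) (\<nu> (Suc N))"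
    by blast
  have \<nu>_mono: "pre (\<nu> N) (\<nu> (N + k))" for N k
  proof (induction k)
    case 0
    then show ?case
      using \<nu>(1)[of N] by (simp add: pre_refl paths_le_iff)
  next
    case (Suc k)
    then show ?case
      using pre_trans[OF Suc \<nu>(3)] by simp
  qed
  define N where "N n = (\<Sum>i\<in>UNIV. n $ i)" for n :: "nat ^ 'k"
  have N: "n \<le> c (N n)" for n
    by (auto simp: vec_le_iff c N_def intro: member_le_sum)
  have "\<forall>n. \<exists>\<alpha>. \<alpha> \<in> paths_le G n \<and> pre \<alpha> (\<nu> (N n))"
    using paths_le_pre_exists[OF \<nu>(1) N] by blast
  then obtain y where y: "\<And>n. y n \<in> paths_le G n" "\<And>n. pre (y n) (\<nu> (N n))"
    by metis
  have pre_y: "pre (y n) (\<nu> (N n + k))" for n k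
    using pre_trans[OF y(2) \<nu>_mono] .
  have "pre (y n) (y m)" if nm: "n \<le> m" for n m
  proof -
    obtain \<alpha> where \<alpha>: "\<alpha> \<in> paths_le G n" "pre \<alpha> (y m)"
      using paths_le_pre_exists[OF y(1) nm] by blast
    have "pre \<alpha> (\<nu> (N n + N m))"
      using pre_trans[OF \<alpha>(2) pre_y[of m "N n"]] by (simp add: add.commute)
    then have "\<alpha> = y n"
      using paths_le_pre_unique[OF \<alpha>(1) y(1)] pre_y by blast
    then show ?thesis
      using \<alpha>(2) by simp
  qed
  then have "y \<in> bdry"
    using y(1) by (simp add: bdry_def)
  moreover have "y 0 = v"
    using bdryD(4)[OF \<open>y \<in> bdry\<close>, of 0] preD[OF y(2)[of 0]] \<nu>(2) by simp
  ultimately show ?thesis by blast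
qed

lemma bdry_extends: "\<alpha> \<in> M \<Longrightarrow> \<exists>y\<in>bdry. y (d \<alpha>) = \<alpha>"
  using bdry_exists[OF src_verts] prepend_bdry by metis

section \<open>The boundary path representations\<close>

text \<open>Operators pull functions back along \<open>bh\<close>. So \<open>Gen \<alpha>\<close>
  lives on the boundary paths that begin with \<alpha> and removes it; the point mass at a path
  starting at \<open>s \<alpha>\<close> then goes to a multiple of the point mass at its
  prolongation by \<alpha>.\<close>

definition bD :: "'m letter \<Rightarrow> (nat ^ 'k \<Rightarrow> 'm) set" where
  "bD l = (case l of Gen \<alpha> \<Rightarrow> {y \<in> bdry. \<alpha> \<in> M \<and> y (d \<alpha>) = \<alpha>} | Gen_adj \<alpha> \<Rightarrow> {z \<in> bdry. \<alpha> \<in> M \<and> z 0 = s \<alpha>})"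

definition bh :: "'m letter \<Rightarrow> (nat ^ 'k \<Rightarrow> 'm) \<Rightarrow> nat ^ 'k \<Rightarrow> 'm" where
  "bh l = (case l of Gen \<alpha> \<Rightarrow> unshift \<alpha> | Gen_adj \<alpha> \<Rightarrow> prepend \<alpha>)"

text \<open>The gauge action: degrees add under composition, so multiplying the operator of \<alpha>
  by this monomial in phases of modulus 1 respects all relations.\<close>

definition wt :: "('k \<Rightarrow> complex) \<Rightarrow> nat ^ 'k \<Rightarrow> complex" where
  "wt t n = (\<Prod>i\<in>UNIV. t i ^ (n $ i))"

definition bc :: "('k \<Rightarrow> complex) \<Rightarrow> 'm letter \<Rightarrow> complex" where
  "bc t l = (case l of Gen \<alpha> \<Rightarrow> wt t (d \<alpha>) | Gen_adj \<alpha> \<Rightarrow> cnj (wt t (d \<alpha>)))"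

lemma wt_add: "wt t (m + n) = wt t m * wt t n"
  by (simp add: wt_def power_add prod.distrib)

lemma wt_0 [simp]: "wt t 0 = 1"
  by (simp add: wt_def)

context
  fixes t :: "'k \<Rightarrow> complex"
  assumes t: "\<And>i. cmod (t i) = 1"
begin

lemma wt_norm: "cmod (wt t n) = 1"
  by (simp add: wt_def norm_power t flip: prod_norm)

lemma wt_unit: "cnj (wt t n) * wt t n = 1" "wt t n * cnj (wt t n) = 1"
  using complex_norm_square[of "wt t n"] by (simp_all add: wt_norm mult.commute)

interpretation pb: partial_bijections bD bh "bc t"
proof
  fix y l
  show "bh l y \<in> bD (letter_adj l)" "bh (letter_adj l) (bh l y) = y" if "y \<in> bD l"
    using that unshift_bdry prepend_bdry prepend_unshift
    by (cases l; auto simp: bD_def bh_def)+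
  show "bc t (letter_adj l) = cnj (bc t l)" "cmod (bc t l) = 1"
    by (cases l; simp add: bc_def wt_norm)+
qed

lemmas boundary_rep = pb.partial_bijections_axioms

lemma op_Gen: "pb.op (Gen \<alpha>) \<xi> y = (if y \<in> bdry \<and> \<alpha> \<in> M \<and> y (d \<alpha>) = \<alpha> then wt t (d \<alpha>) * \<xi> (unshift \<alpha> y) else 0)"
  by (simp add: pb.op_def bD_def bh_def bc_def)

lemma op_Gen_adj: "pb.op (Gen_adj \<alpha>) \<xi> z = (if z \<in> bdry \<and> \<alpha> \<in> M \<and> z 0 = s \<alpha> then cnj (wt t (d \<alpha>)) * \<xi> (prepend \<alpha> z) else 0)"
  by (simp add: pb.op_def bD_def bh_def bc_def)

lemma op_vert:
  assumes v: "v \<in> verts G"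
  shows "pb.op (Gen v) \<xi> y = (if y \<in> bdry \<and> y 0 = v then \<xi> y else 0)"
    "pb.op (Gen_adj v) \<xi> y = (if y \<in> bdry \<and> y 0 = v then \<xi> y else 0)"
proof -
  note v' = vertsD[OF v]
  have un: "unshift v y = y" if "y \<in> bdry" "y 0 = v" for y
  proof
    fix n
    show "unshift v y n = y n"
      using that v' bdryD(3,4)[OF that(1), of n] cmp_rng[of "y n"] by (intro unshift_eqI) auto
  qed
  then have pr: "prepend v y = y" if "y \<in> bdry" "y 0 = v" for y
    using that prepend_unshift[of y v] v' by simp
  show "pb.op (Gen v) \<xi> y = (if y \<in> bdry \<and> y 0 = v then \<xi> y else 0)"
    "pb.op (Gen_adj v) \<xi> y = (if y \<in> bdry \<and> y 0 = v then \<xi> y else 0)"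
    using un pr v' by (auto simp: op_Gen op_Gen_adj)
qed

lemma op_mult:
  assumes \<mu>: "\<mu> \<in> M" and \<nu>: "\<nu> \<in> M" "s \<mu> = r \<nu>"
  shows "pb.op (Gen \<mu>) (pb.op (Gen \<nu>) \<xi>) = pb.op (Gen (cmp G \<mu> \<nu>)) \<xi>"
proof
  fix y
  let ?\<gamma> = "cmp G \<mu> \<nu>"
  have \<gamma>: "?\<gamma> \<in> M" "d ?\<gamma> = d \<mu> + d \<nu>"
    using assms by (simp_all add: cmp_closed deg_cmp)
  show "pb.op (Gen \<mu>) (pb.op (Gen \<nu>) \<xi>) y = pb.op (Gen ?\<gamma>) \<xi> y"
  proof (cases "y \<in> bdry \<and> y (d ?\<gamma>) = ?\<gamma>")
    case True
    then have y: "y \<in> bdry" "y (d ?\<gamma>) = ?\<gamma>" by auto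
    have y\<mu>: "y (d \<mu>) = \<mu>"
    proof (rule paths_le_pre_unique)
      show "pre \<mu> ?\<gamma>"
        using assms by (intro preI)
      show "pre (y (d \<mu>)) ?\<gamma>"
        using bdryD(2)[OF y(1), of "d \<mu>" "d ?\<gamma>"] y(2) by (simp add: \<gamma> vec_le_add)
    qed (use paths_le_self[OF \<mu>] bdryD(1)[OF y(1)] in auto)
    have u: "unshift \<mu> y \<in> bdry" "unshift \<mu> y (d \<nu>) = \<nu>"
      using unshift_bdry[OF y(1) y\<mu>] unshift_eqI[OF y(1) y\<mu> \<nu>] y(2) \<gamma> by auto
    have "unshift \<nu> (unshift \<mu> y) = unshift ?\<gamma> y"
    proof
      fix n
      let ?\<beta> = "unshift ?\<gamma> y n"
      have \<beta>: "?\<beta> \<in> M" "s ?\<gamma> = r ?\<beta>" "y (d ?\<gamma> + n) = cmp G ?\<gamma> ?\<beta>"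
        using unshift[OF y, of n] by auto
      have s\<nu>: "s \<nu> = r ?\<beta>"
        using \<beta>(2) assms by (simp add: src_cmp)
      have "unshift \<mu> y (d \<nu> + n) = cmp G \<nu> ?\<beta>"
      proof (rule unshift_eqI[OF y(1) y\<mu>])
        show "y (d \<mu> + (d \<nu> + n)) = cmp G \<mu> (cmp G \<nu> ?\<beta>)"
          using \<beta>(3) cmp_assoc[OF \<mu> \<nu>(1) \<beta>(1) \<nu>(2) s\<nu>] by (simp add: \<gamma> add.assoc)
      qed (use \<nu> \<beta>(1) s\<nu> in \<open>simp_all add: cmp_closed rng_cmp\<close>)
      then show "unshift \<nu> (unshift \<mu> y) n = ?\<beta>"
        by (rule unshift_eqI[OF u \<beta>(1) s\<nu>])
    qed
    then show ?thesis
      using y y\<mu> u \<mu> \<nu>(1) \<gamma> by (simp add: op_Gen wt_add)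
  next
    case False
    have "\<not> (unshift \<mu> y \<in> bdry \<and> unshift \<mu> y (d \<nu>) = \<nu>)" if "y \<in> bdry" "y (d \<mu>) = \<mu>"
      using unshift[OF that, of "d \<nu>"] False that(1) \<gamma> by auto
    then show ?thesis
      using False by (auto simp: op_Gen)
  qed
qed

lemma op_range:
  assumes \<alpha>: "\<alpha> \<in> M"
  shows "pb.op (Gen \<alpha>) (pb.op (Gen_adj \<alpha>) \<xi>) y = (if y \<in> bdry \<and> y (d \<alpha>) = \<alpha> then \<xi> y else 0)"
  using \<alpha> unshift_bdry[of y \<alpha>] prepend_unshift[of y \<alpha>] wt_unit
  by (simp add: op_Gen op_Gen_adj mult.assoc[symmetric])

lemma op_source:
  assumes \<alpha>: "\<alpha> \<in> M"
  shows "pb.op (Gen_adj \<alpha>) (pb.op (Gen \<alpha>) \<xi>) = pb.op (Gen (s \<alpha>)) \<xi>"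
proof
  fix y
  show "pb.op (Gen_adj \<alpha>) (pb.op (Gen \<alpha>) \<xi>) y = pb.op (Gen (s \<alpha>)) \<xi> y"
    using \<alpha> prepend_bdry[of y \<alpha>] wt_unit op_vert(1)[OF src_verts[OF \<alpha>]]
    by (simp add: op_Gen[of \<alpha>] op_Gen_adj mult.assoc[symmetric])
qed

lemma rep_ck:
  assumes "f \<in> ck_relations G"
  shows "pb.rep f \<xi> = (\<lambda>_. 0)"
  using assms unfolding ck_relations_def
proof (elim UnE CollectE exE conjE)
  fix v n assume f: "f = gen v - (\<Sum>\<alpha>\<in>paths_to G v (paths_le G n). gen \<alpha> * poly_adj (gen \<alpha>))" and v: "v \<in> verts G"
  have "(\<Sum>\<alpha>\<in>paths_to G v (paths_le G n). pb.op (Gen \<alpha>) (pb.op (Gen_adj \<alpha>) \<xi>) y)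
      = (if y \<in> bdry \<and> y 0 = v then \<xi> y else 0)" for y
  proof -
    \<comment> \<open>The summand for \<alpha> is multiplication by the indicator of the paths
      beginning with \<alpha>. Among the members of \<open>paths_le G n\<close> only
      \<open>y n\<close> is an initial segment of \<open>y\<close>, so one term remains.\<close>
    have *: "pb.op (Gen \<alpha>) (pb.op (Gen_adj \<alpha>) \<xi>) y = (if \<alpha> = y n then if y \<in> bdry then \<xi> y else 0 else 0)"
      if "\<alpha> \<in> paths_to G v (paths_le G n)" for \<alpha>
    proof -
      have \<alpha>: "\<alpha> \<in> paths_le G n" "\<alpha> \<in> M" "d \<alpha> \<le> n"
        using that by (simp_all add: paths_to_def paths_le_iff)
      have "y (d \<alpha>) = \<alpha> \<longleftrightarrow> \<alpha> = y n" if y: "y \<in> bdry"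
      proof
        assume "y (d \<alpha>) = \<alpha>"
        then have "pre \<alpha> (y n)"
          using bdryD(2)[OF y \<alpha>(3)] by simp
        then show "\<alpha> = y n"
          using paths_le_pre_unique[OF \<alpha>(1) bdryD(1)[OF y]] pre_refl[OF bdryD(3)[OF y]] by blast
      next
        assume "\<alpha> = y n"
        then have "pre (y (d \<alpha>)) \<alpha>"
          using bdryD(2)[OF y \<alpha>(3)] by simp
        then show "y (d \<alpha>) = \<alpha>"
          using paths_le_pre_unique[OF bdryD(1)[OF y] paths_le_self[OF \<alpha>(2)]] pre_refl[OF \<alpha>(2)] by blast
      qed
      then show ?thesis
        using op_range[OF \<alpha>(2)] by auto
    qed
    have "(\<Sum>\<alpha>\<in>paths_to G v (paths_le G n). pb.op (Gen \<alpha>) (pb.op (Gen_adj \<alpha>) \<xi>) y)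
        = (\<Sum>\<alpha>\<in>paths_to G v (paths_le G n). if \<alpha> = y n then if y \<in> bdry then \<xi> y else 0 else 0)"
      by (intro sum.cong refl *)
    also have "\<dots> = (if y n \<in> paths_to G v (paths_le G n) then if y \<in> bdry then \<xi> y else 0 else 0)"
      using finite_paths_le[of n] by (subst sum.delta) (auto simp: paths_to_def)
    also have "\<dots> = (if y \<in> bdry \<and> y 0 = v then \<xi> y else 0)"
      using bdryD(1,4)[of y n] by (auto simp: paths_to_def)
    finally show ?thesis .
  qed
  then show "pb.rep f \<xi> = (\<lambda>_. 0)"
    by (simp add: f pb.rep_diff pb.rep_sum pb.rep_mult pb.rep_gen op_vert[OF v])
qed (auto simp: pb.rep_diff pb.rep_mult pb.rep_gen op_vert op_mult op_source fun_eq_iff)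

text \<open>The operator norm is one of the seminorms whose supremum is \<open>N\<close>. An element
  with \<open>N f = 0\<close> therefore acts as zero for every choice of phases, and small errors in
  \<open>N\<close> act as small operators.\<close>

lemma rep_le_univ: "f \<in> A0 \<Longrightarrow> fsupp \<xi> \<Longrightarrow> nr (pb.rep f \<xi>) \<le> N f * nr \<xi>"
  using pb.opn_bound[of \<xi> f] le_univ_seminorm[OF pb.opn_cstar_seminorm[OF rep_ck], of f]
  by (meson mult_right_mono nr_nonneg order_trans)

end

end

section \<open>Cycles with an entrance\<close>

text \<open>No completeness is needed: an approximate left inverse of \<open>W\<close> is bounded because \<open>W V = e\<close>.\<close>

lemma (in seminormed_algebra) full_isometry:
  assumes f: "full e" and c: "cor e V" "cor e W" "cor e P" and WV: "W * V = e" and WP: "W * P = 0"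
  shows "nn P = 0"
proof -
  define k where "k = nn V + 1"
  have k: "k > 0" "nn V \<le> k"
    using nn_nonneg[of V] by (simp_all add: k_def add_nonneg_pos)
  have ee: "e * e = e"
    using f by (simp add: full_def)
  \<comment> \<open>With this tolerance \<open>(W - z) * V\<close> has seminorm at most 1/8; the
    first estimate becomes \<open>nn y \<le> nn y / 8 + 3 * k / 2\<close> and yields the bound
    \<open>2 * k\<close>. In the second estimate the coefficients are 1/4 and 1/2, together below
    1.\<close>
  obtain z where z: "cor e z" "linv e z" "nn (W - z) < 1 / (8 * k)"
    using f c(2) k(1) unfolding full_def approx_def by (metis divide_pos_pos mult_pos_pos zero_less_numeral zero_less_one)
  obtain y where y: "cor e y" "nn (y * z - e) < 1/2"
    using linv_refine[OF ee z(1,2), of "1/2"] by auto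
  have "y = y * ((W - z) * V) + (V + (y * z - e) * V)"
    using corD[OF c(1)] corD[OF y(1)] by (simp add: algebra_simps WV)
  then have "nn y \<le> nn (y * ((W - z) * V)) + nn (V + (y * z - e) * V)"
    by (metis nn_add)
  also have "nn (y * ((W - z) * V)) \<le> nn y * (1 / (8 * k) * k)"
    using z(3) k by (intro nn_mult_le order_refl) auto
  also have "nn (V + (y * z - e) * V) \<le> nn V + nn ((y * z - e) * V)"
    by (rule nn_add)
  also have "nn ((y * z - e) * V) \<le> 1/2 * k"
    using y(2) k by (intro nn_mult_le) auto
  finally have ny: "nn y \<le> 2 * k"
    using k by simp
  have "P = y * ((z - W) * P) - (y * z - e) * P"
    using corD[OF c(3)] by (simp add: algebra_simps WP)
  then have "nn P \<le> nn (y * ((z - W) * P)) + nn ((y * z - e) * P)"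
    by (metis nn_diff)
  also have "nn (y * ((z - W) * P)) \<le> 2 * k * (1 / (8 * k) * nn P)"
    using ny z(3) nn_diff_commute[of W z] by (intro nn_mult_le) auto
  also have "nn ((y * z - e) * P) \<le> 1/2 * nn P"
    using y(2) by (intro nn_mult_le) auto
  finally have "nn P \<le> 3/4 * nn P"
    using k(1) by simp
  then show ?thesis
    using nn_nonneg[of P] by linarith
qed

section \<open>Powers of a cycle and its infinite path\<close>

context k_graph
begin

lemma cycle_vert: "is_cycle G \<alpha> \<Longrightarrow> r \<alpha> \<in> verts G \<and> \<alpha> \<in> M \<and> s \<alpha> = r \<alpha>"
  using rng_closed[of \<alpha>] deg_rng[of \<alpha>] by (simp add: is_cycle_def paths_of_deg_def)

lemma cpow_Suc:
  assumes w: "w \<in> verts G" and \<alpha>: "\<alpha> \<in> M" "r \<alpha> = w" "s \<alpha> = w"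
  shows "cpow w \<alpha> (Suc l) = cmp G (cpow w \<alpha> l) \<alpha>"
proof (induction l)
  case 0
  have "cmp G w \<alpha> = \<alpha>" "cmp G \<alpha> w = \<alpha>"
    using cmp_rng[OF \<alpha>(1)] cmp_src[OF \<alpha>(1)] by (simp_all only: \<alpha>)
  then show ?case by simp
next
  case (Suc l)
  have "cpow w \<alpha> (Suc (Suc l)) = cmp G \<alpha> (cmp G (cpow w \<alpha> l) \<alpha>)"
    using Suc by (simp only: cpow.simps)
  also have "\<dots> = cmp G (cmp G \<alpha> (cpow w \<alpha> l)) \<alpha>"
    using \<alpha> cpow_props[OF w \<alpha>, of l] by (intro cmp_assoc[symmetric]) simp_all
  finally show ?case by simp
qed

lemma cpow_pre:
  assumes w: "w \<in> verts G" and \<alpha>: "\<alpha> \<in> M" "r \<alpha> = w" "s \<alpha> = w" and le: "l \<le> l'"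
  shows "pre (cpow w \<alpha> l) (cpow w \<alpha> l')"
  using le
proof (induction l' rule: dec_induct)
  case base
  then show ?case
    using cpow_props[OF w \<alpha>, of l] by (simp add: pre_refl)
next
  case (step n)
  have "pre (cpow w \<alpha> n) (cmp G (cpow w \<alpha> n) \<alpha>)"
    using cpow_props[OF w \<alpha>, of n] \<alpha> by (intro preI) simp_all
  then show ?case
    using step.IH cpow_Suc[OF w \<alpha>, of n] pre_trans by simp
qed

lemma deg_le_cpow:
  assumes w: "w \<in> verts G" and \<alpha>: "\<alpha> \<in> M" "r \<alpha> = w" "s \<alpha> = w" and p: "\<And>i. d \<alpha> $ i = 0 \<Longrightarrow> p $ i = 0"
  shows "p \<le> d (cpow w \<alpha> (\<Sum>i\<in>UNIV. p $ i))"
proof -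
  have "p $ i \<le> (\<Sum>i\<in>UNIV. p $ i) * d \<alpha> $ i" for i
  proof (cases "d \<alpha> $ i = 0")
    case False
    have "p $ i \<le> (\<Sum>i\<in>UNIV. p $ i)"
      by (rule member_le_sum) auto
    then show ?thesis
      using False by (metis le_trans mult_le_mono2 mult_numeral_1_right numeral_1_eq_Suc_0 One_nat_def Suc_leI neq0_conv)
  qed (simp add: p)
  then show ?thesis
    using cpow_props[OF w \<alpha>] by (simp add: vec_le_iff)
qed

lemma deg_le_inf_iff: "deg_le p (deg_inf G \<alpha>) \<longleftrightarrow> (\<forall>i. d \<alpha> $ i = 0 \<longrightarrow> p $ i = 0)"
  by (auto simp: deg_le_def deg_inf_def zero_enat_def)

lemma cpow_segment:
  assumes w: "w \<in> verts G" and \<alpha>: "\<alpha> \<in> M" "r \<alpha> = w" "s \<alpha> = w" and p: "\<And>i. d \<alpha> $ i = 0 \<Longrightarrow> p $ i = 0"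
  shows "\<exists>\<gamma> l. d \<gamma> = p \<and> pre \<gamma> (cpow w \<alpha> l)"
proof -
  let ?A = "cpow w \<alpha> (\<Sum>i\<in>UNIV. p $ i)"
  have A: "?A \<in> M"
    using cpow_props[OF w \<alpha>] by simp
  obtain \<gamma> \<kappa> where "\<gamma> \<in> M" "\<kappa> \<in> M" "d \<gamma> = p" "d \<kappa> = d ?A - p" "s \<gamma> = r \<kappa>" "?A = cmp G \<gamma> \<kappa>" "r \<gamma> = r ?A" "s \<kappa> = s ?A"
    by (rule factorE[OF A deg_le_cpow[OF w \<alpha> p]])
  then show ?thesis
    using preI by metis
qed

text \<open>\<open>cycle_inf\<close> is a choice, so nothing is known about it without existence.
  The initial segments \<open>pf p\<close> are cut from powers of \<alpha>, and \<open>x p q\<close>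
  is what \<open>pf q\<close> adds to \<open>pf p\<close>.\<close>

lemma cycle_inf_path:
  assumes cyc: "is_cycle G \<alpha>"
  shows "\<exists>x. is_path G (deg_inf G \<alpha>) x \<and> (\<forall>n::nat. x (n *s d \<alpha>) (Suc n *s d \<alpha>) = \<alpha>)"
proof -
  define w where "w = r \<alpha>"
  have w: "w \<in> verts G" and \<alpha>: "\<alpha> \<in> M" "r \<alpha> = w" "s \<alpha> = w"
    using cycle_vert[OF cyc] by (simp_all add: w_def)
  note cp = cpow_props[OF w \<alpha>]
  define pf where "pf p = (SOME \<gamma>. d \<gamma> = p \<and> (\<exists>l. pre \<gamma> (cpow w \<alpha> l)))" for p
  have pf: "d (pf p) = p \<and> (\<exists>l. pre (pf p) (cpow w \<alpha> l))" if "deg_le p (deg_inf G \<alpha>)" for p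
  proof -
    have "\<exists>\<gamma>. d \<gamma> = p \<and> (\<exists>l. pre \<gamma> (cpow w \<alpha> l))"
      using cpow_segment[OF w \<alpha>, of p] that deg_le_inf_iff by blast
    then show ?thesis
      unfolding pf_def by (rule someI_ex)
  qed
  have common: "\<exists>l. pre \<beta> (cpow w \<alpha> l) \<and> pre \<gamma> (cpow w \<alpha> l)"
    if "pre \<beta> (cpow w \<alpha> l)" "pre \<gamma> (cpow w \<alpha> l')" for \<beta> \<gamma> l l'
    using that cpow_pre[OF w \<alpha>, of l "max l l'"] cpow_pre[OF w \<alpha>, of l' "max l l'"] pre_trans
    by (intro exI[of _ "max l l'"]) (metis max.cobounded1 max.cobounded2)
  have pf_eq: "pf p = \<gamma>" if "deg_le p (deg_inf G \<alpha>)" "d \<gamma> = p" "pre \<gamma> (cpow w \<alpha> l)" for p \<gamma> l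
    using pf[OF that(1)] common[OF _ that(3)] pre_deg_eq that(2) by metis
  have le: "deg_le p (deg_inf G \<alpha>)" if "p \<le> q" "deg_le q (deg_inf G \<alpha>)" for p q
    using that unfolding deg_le_inf_iff vec_le_iff by (metis le_zero_eq)
  have pf_pre: "pre (pf p) (pf q)" if "p \<le> q" "deg_le q (deg_inf G \<alpha>)" for p q
    using pf[OF that(2)] pf[OF le[OF that]] common pre_mono that(1) by metis
  define x where "x p q = (SOME \<beta>. \<beta> \<in> M \<and> s (pf p) = r \<beta> \<and> pf q = cmp G (pf p) \<beta>)" for p q
  have x: "x p q \<in> M \<and> s (pf p) = r (x p q) \<and> pf q = cmp G (pf p) (x p q)" if "p \<le> q" "deg_le q (deg_inf G \<alpha>)" for p q
  proof -
    have "\<exists>\<beta>. \<beta> \<in> M \<and> s (pf p) = r \<beta> \<and> pf q = cmp G (pf p) \<beta>"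
      using pf_pre[OF that] unfolding pre_def by blast
    then show ?thesis
      unfolding x_def by (rule someI_ex)
  qed
  have pfM: "pf p \<in> M" if "deg_le p (deg_inf G \<alpha>)" for p
    using pf[OF that] preD by blast
  have x_eq: "x p q = \<beta>" if "p \<le> q" "deg_le q (deg_inf G \<alpha>)" "\<beta> \<in> M" "s (pf p) = r \<beta>" "pf q = cmp G (pf p) \<beta>" for p q \<beta>
  proof -
    note p = pfM[OF le[OF that(1,2)]]
    have "x p q \<in> M" "s (pf p) = r (x p q)" "cmp G (pf p) (x p q) = cmp G (pf p) \<beta>"
      using x[OF that(1,2)] that(5) by metis+
    then show ?thesis
      using factor_unique(2)[OF p _ _ p that(3,4) _ refl] by blast
  qed
  have xx: "x p p = s (pf p)" if "deg_le p (deg_inf G \<alpha>)" for p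
    using pfM[OF that] that by (intro x_eq) (simp_all add: src_closed rng_src cmp_src)
  have "is_path G (deg_inf G \<alpha>) x"
    unfolding is_path_def
  proof (intro conjI allI impI; elim conjE)
    fix p q assume pq: "p \<le> q" "deg_le q (deg_inf G \<alpha>)"
    note p = le[OF pq] and X = x[OF pq]
    show "x p q \<in> M" "r (x p q) = x p p"
      using X xx[OF p] by simp_all
    have "q = p + d (x p q)"
      using pf[OF pq(2)] pf[OF p] deg_cmp[OF pfM[OF p], of "x p q"] X by simp
    then show "d (x p q) = q - p"
      by (simp add: vec_eq_iff)
    show "s (x p q) = x q q"
      using xx[OF pq(2)] src_cmp[OF pfM[OF p], of "x p q"] X by simp
  next
    fix p q u assume pqu: "p \<le> q" "q \<le> u" "deg_le u (deg_inf G \<alpha>)"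
    note q = le[OF pqu(2,3)]
    note X = x[OF pqu(1) q] and Y = x[OF pqu(2,3)] and p = pfM[OF le[OF pqu(1) q]]
    have sx: "s (x p q) = r (x q u)"
      using X Y src_cmp[OF p, of "x p q"] by simp
    show "x p u = cmp G (x p q) (x q u)"
    proof (rule x_eq)
      show "pf u = cmp G (pf p) (cmp G (x p q) (x q u))"
        using X Y cmp_assoc[OF p _ _ _ sx] by simp
    qed (use pqu X Y sx in \<open>simp_all add: cmp_closed rng_cmp order_trans[of p q u]\<close>)
  qed
  moreover have "x (n *s d \<alpha>) (Suc n *s d \<alpha>) = \<alpha>" for n
  proof -
    have dl: "deg_le (l *s d \<alpha>) (deg_inf G \<alpha>)" for l
      by (simp add: deg_le_inf_iff)
    have pfl: "pf (l *s d \<alpha>) = cpow w \<alpha> l" for l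
      using cp[of l] by (intro pf_eq[OF dl _ pre_refl]) simp_all
    show ?thesis
    proof (rule x_eq[OF _ dl])
      show "n *s d \<alpha> \<le> Suc n *s d \<alpha>"
        by (simp add: vec_le_iff)
      show "pf (Suc n *s d \<alpha>) = cmp G (pf (n *s d \<alpha>)) \<alpha>"
        unfolding pfl by (rule cpow_Suc[OF w \<alpha>])
    qed (use \<alpha> cp[of n] pfl[of n] in simp_all)
  qed
  ultimately show ?thesis by blast
qed

text \<open>Whatever path the choice returns, its segments from 0 to multiples of
  \<open>d \<alpha>\<close> are the powers of \<alpha>, so every initial segment is one of a
  power.\<close>

lemma cycle_inf_pre:
  assumes cyc: "is_cycle G \<alpha>" and p: "deg_le p (deg_inf G \<alpha>)"
  shows "\<exists>l. pre (cycle_inf G \<alpha> 0 p) (cpow (r \<alpha>) \<alpha> l) \<and> d (cycle_inf G \<alpha> 0 p) = p"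
proof -
  define w where "w = r \<alpha>"
  have w: "w \<in> verts G" and \<alpha>: "\<alpha> \<in> M" "r \<alpha> = w" "s \<alpha> = w"
    using cycle_vert[OF cyc] by (simp_all add: w_def)
  note cp = cpow_props[OF w \<alpha>]
  define x where "x = cycle_inf G \<alpha>"
  have path: "is_path G (deg_inf G \<alpha>) x" and step: "x (n *s d \<alpha>) (Suc n *s d \<alpha>) = \<alpha>" for n
    using someI_ex[OF cycle_inf_path[OF cyc]] by (simp_all add: x_def cycle_inf_def)
  have dl: "deg_le (l *s d \<alpha>) (deg_inf G \<alpha>)" for l
    by (simp add: deg_le_inf_iff)
  have mono: "n *s d \<alpha> \<le> Suc n *s d \<alpha>" "0 \<le> n *s d \<alpha>" for n
    by (simp_all add: vec_le_iff)
  have path1: "x p q \<in> M \<and> d (x p q) = q - p \<and> r (x p q) = x p p \<and> s (x p q) = x q q"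
    if "p \<le> q" "deg_le q (deg_inf G \<alpha>)" for p q
    using path that unfolding is_path_def by blast
  have path2: "x p u = cmp G (x p q) (x q u)" if "p \<le> q" "q \<le> u" "deg_le u (deg_inf G \<alpha>)" for p q u
    using path that unfolding is_path_def by blast
  have xl: "x 0 (l *s d \<alpha>) = cpow w \<alpha> l" for l
  proof (induction l)
    case 0
    have "r (x (0 *s d \<alpha>) (Suc 0 *s d \<alpha>)) = x (0 *s d \<alpha>) (0 *s d \<alpha>)"
      using path1[OF mono(1) dl] by blast
    then show ?case
      using step[of 0] \<alpha> by simp
  next
    case (Suc l)
    have "x 0 (Suc l *s d \<alpha>) = cmp G (x 0 (l *s d \<alpha>)) (x (l *s d \<alpha>) (Suc l *s d \<alpha>))"
      by (rule path2[OF mono(2,1) dl])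
    then show ?case
      using Suc step[of l] cpow_Suc[OF w \<alpha>, of l] by simp
  qed
  define l where "l = (\<Sum>i\<in>UNIV. p $ i)"
  have pl: "p \<le> l *s d \<alpha>"
    using deg_le_cpow[OF w \<alpha>, of p] p cp[of l] unfolding deg_le_inf_iff by (simp add: l_def)
  have p0: "0 \<le> p"
    by (simp add: vec_le_iff)
  have "pre (x 0 p) (x 0 (l *s d \<alpha>))"
    using path1[OF p0 p] path1[OF pl dl] path2[OF p0 pl dl] by (metis preI)
  then show ?thesis
    using xl[of l] path1[OF p0 p] by (auto simp: x_def w_def)
qed

end

context lc_graph
begin

text \<open>The functions live on a whole type, not just on boundary paths. Elements of
  \<open>A0\<close> have no constant term, and the outermost letter of a nonempty word cuts down to
  boundary paths.\<close>

lemma rep_outside_bdry: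
  assumes t: "\<And>i. cmod (t i) = 1" and f: "f \<in> A0" and y: "y \<notin> bdry"
  shows "partial_bijections.rep bD bh (bc t) f \<xi> y = 0"
proof -
  interpret pb: partial_bijections bD bh "bc t"
    by (rule boundary_rep[OF t])
  have "pb.wop w \<xi> y = 0" if "w \<in> Poly_Mapping.keys f" for w
  proof -
    have "letters w \<noteq> []"
      using that f by (auto simp: free_star_algebra_def word_eq_0_iff)
    then obtain l ls where "letters w = l # ls"
      by (cases "letters w") auto
    then show ?thesis
      using y by (cases l) (simp_all add: pb.wop_def pb.op_def bD_def)
  qed
  then show ?thesis
    by (simp add: pb.rep_def)
qed

text \<open>Choose a power \<beta> of the cycle that contains the segment \<sigma> of the infinite
  path with the degree of the entrance \<tau>. Then \<open>S \<beta> + (un - S w)\<close> is an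
  isometry with range defect \<open>P\<close>, which must be null. But a boundary path through
  \<tau> does not begin with \<beta>, as it would then begin with both \<tau> and \<sigma>, so
  \<open>P\<close> fixes the point mass there.\<close>

theorem full_imp_no_entrance:
  assumes full: "cs.full un" and cyc: "is_cycle G \<alpha>"
  shows "\<not> has_entrance G \<alpha>"
proof
  assume "has_entrance G \<alpha>"
  then obtain \<tau> where \<tau>: "\<tau> \<in> M" "r \<tau> = r \<alpha>" "deg_le (d \<tau>) (deg_inf G \<alpha>)" "\<tau> \<noteq> cycle_inf G \<alpha> 0 (d \<tau>)"
    by (auto simp: has_entrance_def paths_to_def)
  define w where "w = r \<alpha>"
  have w: "w \<in> verts G" and \<alpha>: "\<alpha> \<in> M" "r \<alpha> = w" "s \<alpha> = w"
    using cycle_vert[OF cyc] by (simp_all add: w_def)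
  define \<sigma> where "\<sigma> = cycle_inf G \<alpha> 0 (d \<tau>)"
  obtain l where l: "pre \<sigma> (cpow w \<alpha> l)" "d \<sigma> = d \<tau>"
    using cycle_inf_pre[OF cyc \<tau>(3)] by (auto simp: \<sigma>_def w_def)
  define \<beta> where "\<beta> = cpow w \<alpha> l"
  have \<beta>: "\<beta> \<in> M" "r \<beta> = w" "s \<beta> = w"
    using cpow_props[OF w \<alpha>, of l] by (simp_all add: \<beta>_def)
  have wM: "w \<in> M"
    using vertsD[OF w] by simp
  define P where "P = S w - S \<beta> * T \<beta>"
  have ST: "S w * S w = S w" "S w * S \<beta> = S \<beta>" "S \<beta> * S w = S \<beta>" "T \<beta> * S w = T \<beta>" "S w * T \<beta> = T \<beta>" "T \<beta> * S \<beta> = S w"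
    using vert_idem[OF w] S_rng[OF \<beta>(1)] S_src[OF \<beta>(1)] T_rng[OF \<beta>(1)] T_src[OF \<beta>(1)] T_S[OF \<beta>(1)] \<beta> by simp_all
  have unT: "un * T \<gamma> = T \<gamma>" "T \<gamma> * un = T \<gamma>" "S \<gamma> * un = S \<gamma>" for \<gamma>
    by (simp_all add: T_def S_def cls_hom(7)[symmetric] un_cls)
  have "nn P = 0"
  proof (rule cs.full_isometry[OF full])
    have T': "T \<beta> * (S \<beta> * F) = S w * F" for F
      using ST(6) by (simp add: mult.assoc[symmetric])
    show "cs.cor un (S \<beta> + (un - S w))" "cs.cor un (T \<beta> + (un - S w))" "cs.cor un P"
      by (simp_all add: cs.cor_def P_def algebra_simps unT un_un)
    show "(T \<beta> + (un - S w)) * (S \<beta> + (un - S w)) = un"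
      by (simp add: algebra_simps ST unT un_un)
    show "(T \<beta> + (un - S w)) * P = 0"
      by (simp add: P_def algebra_simps ST T') (simp add: mult.assoc[symmetric] ST unT)
  qed
  define f where "f = gen w - gen \<beta> * poly_adj (gen \<beta>)"
  have f: "f \<in> A0" "P = cls f"
    using wM \<beta> by (auto simp: f_def P_def S_def T_def cls_hom intro!: A0_closed gen_A0)
  have Nf: "N f = 0"
    using \<open>nn P = 0\<close> f by (simp add: cls_nn nrm1_A0)
  define t :: "'k \<Rightarrow> complex" where "t i = 1" for i
  have t: "cmod (t i) = 1" for i
    by (simp add: t_def)
  interpret pb: partial_bijections bD bh "bc t"
    by (rule boundary_rep[OF t])
  obtain y where y: "y \<in> bdry" "y (d \<tau>) = \<tau>"
    using bdry_extends[OF \<tau>(1)] by blast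
  have y0: "y 0 = w"
    using bdryD(4)[OF y(1), of "d \<tau>"] y(2) \<tau>(2) by (simp add: w_def)
  have "y (d \<beta>) \<noteq> \<beta>"
  proof
    assume *: "y (d \<beta>) = \<beta>"
    have "pre \<tau> \<beta>"
      using bdryD(2)[OF y(1), of "d \<tau>" "d \<beta>"] preD[OF l(1)] l(2) * y(2) by (simp add: \<beta>_def)
    then have "\<tau> = \<sigma>"
      using l by (intro pre_deg_eq[of \<tau> \<beta> \<sigma>]) (simp_all add: \<beta>_def)
    then show False
      using \<tau>(4) by (simp add: \<sigma>_def)
  qed
  define \<delta> where "\<delta> = (\<lambda>z. if z = y then 1 else 0 :: complex)"
  have fs: "fsupp \<delta>"
    by (simp add: fsupp_def \<delta>_def)
  have "pb.rep f \<delta> y = 1"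
    using op_vert(1)[OF t w] op_range[OF t \<beta>(1)] y(1) y0 \<open>y (d \<beta>) \<noteq> \<beta>\<close>
    by (simp add: f_def pb.rep_diff pb.rep_mult pb.rep_gen \<delta>_def)
  moreover have "nr (pb.rep f \<delta>) \<le> 0"
    using rep_le_univ[OF t f(1) fs] Nf by simp
  then have "pb.rep f \<delta> = (\<lambda>_. 0)"
    using nr_eq_0[OF pb.fsupp_rep[OF fs], of f] nr_nonneg[of "pb.rep f \<delta>"] by (simp add: antisym)
  ultimately show False
    by simp
qed

end

section \<open>Initial cycles with several colours\<close>

context finite_k_graph
begin

lemma full_A0:
  assumes "cs.full un" "x \<in> A0" "\<epsilon> > 0" "\<delta> > 0"
  shows "\<exists>z\<in>A0. \<exists>y\<in>A0. N (x - z) < \<epsilon> \<and> N (y * z - unit_sum) < \<delta>"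
proof -
  obtain z where z: "cs.cor un z" "cs.linv un z" "nn (cls x - z) < \<epsilon>"
    using assms cor_un[of x] unfolding cs.full_def cs.approx_def by blast
  obtain y where y: "cs.cor un y" "nn (y * z - un) < \<delta>"
    using cs.linv_refine[OF un_un z(1,2) assms(4)] by blast
  obtain z' y' where *: "z' \<in> A0" "z = cls z'" "y' \<in> A0" "y = cls y'"
    using cls_surj[OF z(1)] cls_surj[OF y(1)] by blast
  have "nn (cls x - z) = N (x - z')" "nn (y * z - un) = N (y' * z' - unit_sum)"
    using * assms(2) by (simp_all add: cls_unit_sum[symmetric] cls_hom(2,3)[symmetric] cls_nn nrm1_A0 A0_closed unit_sum_A0)
  then show ?thesis
    using * z y by auto
qed

end

text \<open>A scalar consequence of \<open>\<parallel>D \<eta> - \<delta>\<parallel> \<le> \<epsilon> \<parallel>\<eta>\<parallel> + \<epsilon>\<close> where \<open>D\<close> multiplies the coordinate \<open>x\<close> by \<open>\<zeta>\<close>.\<close>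

lemma coordinate_estimate:
  fixes \<eta> :: "'b \<Rightarrow> complex"
  assumes \<eta>: "fsupp \<eta>" and \<zeta>: "cmod \<zeta> \<le> 1"
    and le: "nr (\<lambda>y. if y = x then \<zeta> * \<eta> x - 1 else \<eta> y) \<le> 1/10 * nr \<eta> + 1/10"
  shows "\<eta> x \<noteq> 0 \<and> cmod (\<zeta> - 1 / \<eta> x) < 1"
proof -
  define \<kappa> where "\<kappa> = (\<lambda>y. if y = x then \<zeta> * \<eta> x - 1 else \<eta> y)"
  define E where "E = nr \<kappa>"
  define a where "a = \<eta> x"
  have f: "finite (insert x {y. \<eta> y \<noteq> 0})"
    using \<eta> by (simp add: fsupp_def)
  have f\<kappa>: "fsupp \<kappa>"
    unfolding fsupp_def by (rule finite_subset[OF _ f]) (auto simp: \<kappa>_def)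
  have \<kappa>x: "cmod (\<kappa> x) \<le> E"
  proof (cases "\<kappa> x = 0")
    case False
    have "cmod (\<kappa> x) \<le> L2_set (\<lambda>y. cmod (\<kappa> y)) {y. \<kappa> y \<noteq> 0}"
      using f\<kappa> False by (intro member_le_L2_set) (auto simp: fsupp_def)
    then show ?thesis
      by (simp add: E_def nr_def)
  qed (simp add: E_def)
  have "\<eta> = (\<lambda>y. \<kappa> y + (\<eta> x - \<kappa> x) * (if y = x then 1 else 0))"
    by (auto simp: \<kappa>_def)
  moreover have "fsupp (\<lambda>y. (\<eta> x - \<kappa> x) * (if y = x then 1 else 0))"
    unfolding fsupp_def by (rule finite_subset[of _ "{x}"]) auto
  ultimately have "nr \<eta> \<le> nr \<kappa> + nr (\<lambda>y. (\<eta> x - \<kappa> x) * (if y = x then 1 else 0))"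
    using nr_triangle[OF f\<kappa>] by metis
  also have "nr (\<lambda>y. (\<eta> x - \<kappa> x) * (if y = x then 1 else 0)) = cmod (\<eta> x - \<kappa> x)"
    unfolding nr_scale using nr_eq[of "{x}" "\<lambda>y. if y = x then 1 else 0"] by simp
  also have "cmod (\<eta> x - \<kappa> x) \<le> cmod a + E"
    using norm_triangle_ineq4[of "\<eta> x" "\<kappa> x"] \<kappa>x by (simp add: a_def)
  finally have "nr \<eta> \<le> cmod a + 2 * E"
    by (simp add: E_def)
  \<comment> \<open>The hypothesis reads \<open>E \<le> (nr \<eta> + 1) / 10\<close>, and
    \<open>nr \<eta> \<le> cmod a + 2 * E\<close>; this is solved for \<open>E\<close>.\<close>
  then have E: "E \<le> (cmod a + 1) / 8"
    using le unfolding \<kappa>_def[symmetric] E_def[symmetric] by simp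
  have \<zeta>a: "cmod (\<zeta> * a - 1) \<le> (cmod a + 1) / 8"
    using \<kappa>x E by (simp add: \<kappa>_def a_def)
  have a0: "a \<noteq> 0"
    using \<zeta>a by auto
  define g where "g = 1 / cmod a"
  have g: "g > 0" "cmod a * g = 1"
    using a0 by (simp_all add: g_def)
  have "\<zeta> - 1 / a = (\<zeta> * a - 1) / a"
    using a0 by (simp add: field_simps)
  then have "cmod (\<zeta> - 1 / a) = cmod (\<zeta> * a - 1) * g"
    by (simp add: norm_divide g_def)
  also have "\<dots> \<le> (cmod a + 1) / 8 * g"
    using \<zeta>a g by (intro mult_right_mono) auto
  also have "\<dots> = (1 + g) / 8"
    using g by (simp add: algebra_simps)
  finally have 1: "cmod (\<zeta> - 1 / a) \<le> (1 + g) / 8" .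
  have "g = cmod (1 / a)"
    by (simp add: g_def norm_divide)
  also have "\<dots> \<le> cmod \<zeta> + cmod (\<zeta> - 1 / a)"
    using norm_triangle_ineq4[of \<zeta> "\<zeta> - 1 / a"] by simp
  finally have "g \<le> cmod \<zeta> + cmod (\<zeta> - 1 / a)" .
  \<comment> \<open>The inequality bounds \<open>g\<close> by \<open>1 + (1 + g) / 8\<close>, hence
    by 9/7. The distance is then at most \<open>(1 + 9/7) / 8 = 2/7\<close>.\<close>
  moreover have "g \<le> 9 / 7" if "g \<le> b + e" "e \<le> (1 + g) / 8" "b \<le> 1" for b e
    using that by (simp add: field_simps)
  ultimately have "g \<le> 9 / 7"
    using 1 \<zeta> by blast
  moreover have "e < 1" if "e \<le> (1 + g) / 8" "g \<le> 9 / 7" for e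
    using that by (simp add: field_simps)
  ultimately have "cmod (\<zeta> - 1 / a) < 1"
    using 1 by blast
  then show ?thesis
    using a0 by (simp add: a_def)
qed

context lc_graph
begin

text \<open>Domains and maps do not depend on the phases, which enter a matrix coefficient only
  through finitely many products of the scalars \<open>bc\<close>.\<close>

lemma continuous_wop:
  fixes t :: "complex \<Rightarrow> 'k \<Rightarrow> complex"
  assumes t: "\<And>\<zeta> i. cmod (t \<zeta> i) = 1" and cont: "\<And>i. continuous_on A (\<lambda>\<zeta>. t \<zeta> i)"
  shows "continuous_on A (\<lambda>\<zeta>. partial_bijections.rep bD bh (bc (t \<zeta>)) f \<xi> y)"
proof -
  have bc: "continuous_on A (\<lambda>\<zeta>. bc (t \<zeta>) l)" for l
    by (cases l) (auto simp: bc_def wt_def intro!: continuous_intros cont)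
  have "continuous_on A (\<lambda>\<zeta>. partial_bijections.wop bD bh (bc (t \<zeta>)) (Word ls) \<xi> y)" for ls y
  proof (induction ls arbitrary: y)
    case Nil
    then show ?case
      by (simp add: partial_bijections.wop_def[OF boundary_rep[OF t]])
  next
    case (Cons l ls)
    show ?case
      unfolding partial_bijections.wop_Cons[OF boundary_rep[OF t]] partial_bijections.op_def[OF boundary_rep[OF t]]
      by (cases "y \<in> bD l") (auto intro!: continuous_intros bc Cons)
  qed
  from this[of "letters w" y for w] have "continuous_on A (\<lambda>\<zeta>. partial_bijections.wop bD bh (bc (t \<zeta>)) w \<xi> y)" for w
    by simp
  then show ?thesis
    unfolding partial_bijections.rep_def[OF boundary_rep[OF t]] by (intro continuous_intros)
qed

text \<open>
  If an initial cycle without entrance has two colours, there is a single boundary path \<open>x\<close> at its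
  vertex \<open>v\<close>, and for each of the two colours the corner at \<open>v\<close> contains an element acting on it by a power of
  the corresponding phase. With the real parts of these two elements the corner contains an
  element acting by an arbitrary point \<open>\<zeta>\<close> of the closed disc. Approximating it by a left invertible element
  would produce a nonvanishing continuous function close to \<open>\<zeta>\<close>, against Brouwer's theorem.
\<close>

theorem full_imp_one_colour:
  assumes full: "cs.full un" and ini: "is_initial_cycle G \<mu>"
  shows "num_colours G \<mu> \<le> 1"
proof (rule ccontr)
  assume "\<not> num_colours G \<mu> \<le> 1"
  define C where "C = {i. d \<mu> $ i > 0}"
  have "card C > 1"
    using \<open>\<not> num_colours G \<mu> \<le> 1\<close> by (simp add: num_colours_def C_def)
  then obtain i j where ij: "i \<in> C" "j \<in> C" "i \<noteq> j"
    by (metis card_1_singleton_iff card_eq_0_iff finite is_singletonI' is_singleton_altdef less_numeral_extra(4) not_one_less_zero One_nat_def)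
  define v where "v = r \<mu>"
  have \<mu>: "\<mu> \<in> M" "r \<mu> = v" "s \<mu> = v" and none: "\<And>k. k \<notin> C \<Longrightarrow> edges_at v k = {}"
    using ini unfolding is_initial_cycle_def v_def C_def edges_at_def by auto
  have v: "v \<in> verts G"
    using \<mu> rng_verts by metis
  have "is_cycle G \<mu>"
    using ij(1) \<mu> by (auto simp: is_cycle_def paths_of_deg_def C_def)
  then have ne: "\<not> has_entrance G \<mu>"
    by (rule full_imp_no_entrance[OF full])
  have supp: "d \<beta> $ k = 0" if "\<beta> \<in> M" "r \<beta> = v" "d \<mu> $ k = 0" for \<beta> k
    using edges_at_path[of \<beta> k] none[of k] that by (auto simp: C_def)
  have uniq: "\<beta> = \<gamma>" if "\<beta> \<in> M" "\<gamma> \<in> M" "r \<beta> = v" "r \<gamma> = v" "d \<beta> = d \<gamma>" for \<beta> \<gamma>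
    by (rule no_entrance_unique[OF ne that(1,2) _ _ that(5)]) (simp_all only: that \<mu> supp)
  have exist: "\<exists>\<beta>\<in>M. r \<beta> = v \<and> d \<beta> = p" if "\<And>k. d \<mu> $ k = 0 \<Longrightarrow> p $ k = 0" for p
    using cpow_segment[OF v \<mu> that] preD cpow_props[OF v \<mu>] by metis
  have emits: "edges_at (s \<beta>) k \<noteq> {}" if \<beta>: "\<beta> \<in> M" "r \<beta> = v" and k: "k \<in> C" for \<beta> k
  proof -
    obtain \<gamma> where \<gamma>: "\<gamma> \<in> M" "r \<gamma> = v" "d \<gamma> = d \<beta> + unit_deg k"
    proof -
      have "(d \<beta> + unit_deg k) $ l = 0" if "d \<mu> $ l = 0" for l
        using supp[OF \<beta> that] k that by (auto simp: C_def axis_nth_nat)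
      from exist[OF this] show ?thesis
        using that by blast
    qed
    have "d \<beta> \<le> d \<gamma>"
      by (simp add: \<gamma> vec_le_iff)
    then obtain \<beta>' \<kappa> where *: "\<beta>' \<in> M" "\<kappa> \<in> M" "d \<beta>' = d \<beta>" "d \<kappa> = d \<gamma> - d \<beta>" "s \<beta>' = r \<kappa>"
      "\<gamma> = cmp G \<beta>' \<kappa>" "r \<beta>' = r \<gamma>" "s \<kappa> = s \<gamma>"
      by (rule factorE[OF \<gamma>(1)])
    have "\<beta>' = \<beta>"
      by (rule uniq[OF *(1) \<beta>(1)]) (simp_all only: *(3,7) \<beta> \<gamma>(2))
    then show ?thesis
      using edges_at_path[OF *(2), of k] *(4,5) \<gamma>(3) by (simp add: axis_nth_nat)
  qed
  have path_deg: "d \<beta> $ k = (if k \<in> C then n $ k else 0)" if \<beta>: "\<beta> \<in> paths_le G n" "r \<beta> = v" for \<beta> n k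
  proof (cases "k \<in> C")
    case True
    have le: "d \<beta> $ l \<le> n $ l" for l
      using \<beta> by (simp add: paths_le_iff vec_le_iff)
    have "\<not> d \<beta> + unit_deg k \<le> n"
      using \<beta> emits[of \<beta> k] True by (auto simp: paths_le_iff)
    then obtain l where "\<not> d \<beta> $ l + unit_deg k $ l \<le> n $ l"
      by (auto simp: vec_le_iff)
    then have "l = k" "d \<beta> $ k = n $ k"
      using le[of l] le[of k] by (auto simp: axis_nth_nat split: if_splits)
    then show ?thesis using True by simp
  next
    case False
    then show ?thesis
      using supp[of \<beta> k] \<beta> by (simp add: C_def paths_le_iff)
  qed
  have bdry_uniq: "y = y'" if y: "y \<in> bdry" "y 0 = v" and y': "y' \<in> bdry" "y' 0 = v" for y y'
  proof
    fix n
    have r: "r (y n) = v" "r (y' n) = v"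
      using bdryD(4)[OF y(1)] bdryD(4)[OF y'(1)] y(2) y'(2) by simp_all
    have "d (y n) = d (y' n)"
      using path_deg[OF bdryD(1)[OF y(1)] r(1)] path_deg[OF bdryD(1)[OF y'(1)] r(2)] by (simp add: vec_eq_iff)
    then show "y n = y' n"
      by (rule uniq[OF bdryD(3)[OF y(1)] bdryD(3)[OF y'(1)] r])
  qed
  obtain x where x: "x \<in> bdry" "x 0 = v"
    using bdry_exists[OF v] by blast
  have through: "y = x" if "y \<in> bdry" "y (d \<beta>) = \<beta>" "r \<beta> = v" for y \<beta>
  proof (rule bdry_uniq[OF that(1) _ x])
    show "y 0 = v"
      using bdryD(4)[OF that(1), of "d \<beta>"] that(2,3) by simp
  qed
  have x_through: "x (d \<beta>) = \<beta>" if "\<beta> \<in> M" "r \<beta> = v" for \<beta>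
    using bdry_extends[OF that(1)] through that(2) by metis
  \<comment> \<open>Among the paths of colour \<open>k\<close> with range \<open>v\<close>, one for
    each length, two have the same source. The product \<open>S \<beta> * T \<gamma>\<close> lies in
    the corner at \<open>v\<close> and acts on the single boundary path by the phase of colour
    \<open>k\<close> to the power \<open>b - a\<close>.\<close>
  have loops: "\<exists>\<beta> \<gamma> a b. \<beta> \<in> M \<and> \<gamma> \<in> M \<and> r \<beta> = v \<and> r \<gamma> = v \<and> s \<beta> = s \<gamma> \<and> d \<beta> = axis k b \<and> d \<gamma> = axis k a \<and> a < b"
    if k: "k \<in> C" for k
  proof -
    have "\<exists>\<beta>. \<beta> \<in> M \<and> r \<beta> = v \<and> d \<beta> = axis k n" for n
    proof -
      have "axis k n $ l = 0" if "d \<mu> $ l = 0" for l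
        using that k by (auto simp: C_def axis_nth_nat)
      from exist[OF this] show ?thesis
        by blast
    qed
    then obtain \<beta> where \<beta>: "\<And>n. \<beta> n \<in> M \<and> r (\<beta> n) = v \<and> d (\<beta> n) = axis k n"
      by metis
    have "\<not> inj (\<lambda>n. s (\<beta> n))"
    proof
      assume "inj (\<lambda>n. s (\<beta> n))"
      moreover have "range (\<lambda>n. s (\<beta> n)) \<subseteq> verts G"
        using \<beta> src_verts by blast
      ultimately show False
        using finite_verts finite_subset finite_imageD infinite_UNIV_nat by metis
    qed
    then obtain a b where "a < b" "s (\<beta> a) = s (\<beta> b)"
      unfolding inj_on_def by (metis linorder_neqE_nat)
    then show ?thesis
      using \<beta> by metis
  qed
  obtain \<beta>i \<gamma>i ai bi where I: "\<beta>i \<in> M" "\<gamma>i \<in> M" "r \<beta>i = v" "r \<gamma>i = v" "s \<beta>i = s \<gamma>i"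
    "d \<beta>i = axis i bi" "d \<gamma>i = axis i ai" "ai < bi"
    using loops[OF ij(1)] by blast
  obtain \<beta>j \<gamma>j aj bj where J: "\<beta>j \<in> M" "\<gamma>j \<in> M" "r \<beta>j = v" "r \<gamma>j = v" "s \<beta>j = s \<gamma>j"
    "d \<beta>j = axis j bj" "d \<gamma>j = axis j aj" "aj < bj"
    using loops[OF ij(2)] by blast
  define mi mj where "mi = bi - ai" and "mj = bj - aj"
  have m: "mi > 0" "mj > 0" "bi = ai + mi" "bj = aj + mj"
    using I(8) J(8) by (simp_all add: mi_def mj_def)
  \<comment> \<open>Real part of one phase power plus the imaginary unit times the real part of
    another. The term \<open>unit_sum - gen v\<close> makes it act as the identity on boundary paths
    starting elsewhere.\<close>
  define As where "As = poly_scale (1/2) (gen \<beta>i * poly_adj (gen \<gamma>i) + gen \<gamma>i * poly_adj (gen \<beta>i))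
    + poly_scale (\<i>/2) (gen \<beta>j * poly_adj (gen \<gamma>j) + gen \<gamma>j * poly_adj (gen \<beta>j)) + (unit_sum - gen v)"
  have As: "As \<in> A0"
    unfolding As_def using I(1,2) J(1,2) vertsD[OF v] by (intro A0_closed gen_A0 unit_sum_A0) auto
  \<comment> \<open>The adjoint of \<open>As\<close> is approximated because \<open>y\<close>
    inverts \<open>z\<close> from the left: after taking adjoints \<open>z\<close> is close to
    \<open>As\<close> and the adjoint of \<open>y\<close> is nearly a right inverse. So
    \<open>As\<close> nearly maps \<eta> below to \<delta>.\<close>
  obtain z y where zy: "z \<in> A0" "y \<in> A0" "N (poly_adj As - z) < 1/10" "N (y * z - unit_sum) < 1/10"
    using full_A0[OF full free_adj[OF As], of "1/10" "1/10"] by auto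
  \<comment> \<open>The roots are chosen so that the power \<open>mi\<close> of the phase at
    \<open>i\<close> has real part \<open>Re \<zeta>\<close> and the power \<open>mj\<close> of the
    phase at \<open>j\<close> has real part \<open>Im \<zeta>\<close>; with \<open>arccos\<close>
    the choice is continuous in \<zeta>.\<close>
  define t :: "complex \<Rightarrow> 'k \<Rightarrow> complex" where
    "t \<zeta> k = (if k = i then cis (arccos (Re \<zeta>) / mi) else if k = j then cis (arccos (Im \<zeta>) / mj) else 1)" for \<zeta> k
  have t: "cmod (t \<zeta> k) = 1" for \<zeta> k
    by (simp add: t_def)
  define \<delta> where "\<delta> = (\<lambda>y. if y = x then 1 else 0 :: complex)"
  have fs\<delta>: "fsupp \<delta>" "nr \<delta> = 1"
    using nr_eq[of "{x}" \<delta>] by (auto simp: fsupp_def \<delta>_def)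
  define \<eta> where "\<eta> \<zeta> = partial_bijections.rep bD bh (bc (t \<zeta>)) (poly_adj y) \<delta>" for \<zeta>
  have main: "\<eta> \<zeta> x \<noteq> 0 \<and> cmod (\<zeta> - 1 / \<eta> \<zeta> x) < 1" if \<zeta>: "\<zeta> \<in> cball 0 1" for \<zeta>
  proof -
    interpret pb: partial_bijections bD bh "bc (t \<zeta>)"
      by (rule boundary_rep[OF t])
    have \<zeta>1: "cmod \<zeta> \<le> 1" "\<bar>Re \<zeta>\<bar> \<le> 1" "\<bar>Im \<zeta>\<bar> \<le> 1"
      using \<zeta> abs_Re_le_cmod[of \<zeta>] abs_Im_le_cmod[of \<zeta>] by simp_all
    have fs\<eta>: "fsupp (\<eta> \<zeta>)"
      unfolding \<eta>_def by (rule pb.fsupp_rep[OF fs\<delta>(1)])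
    have \<eta>0: "\<eta> \<zeta> q = 0" if "q \<notin> bdry" for q
      unfolding \<eta>_def by (rule rep_outside_bdry[OF t free_adj[OF zy(2)] that])
    have act: "pb.rep (gen \<beta> * poly_adj (gen \<gamma>)) \<xi> q = (if q = x then wt (t \<zeta>) (d \<beta>) * cnj (wt (t \<zeta>) (d \<gamma>)) * \<xi> x else 0)"
      if \<beta>\<gamma>: "\<beta> \<in> M" "\<gamma> \<in> M" "r \<beta> = v" "r \<gamma> = v" "s \<beta> = s \<gamma>" for \<beta> \<gamma> \<xi> q
    proof (cases "q = x")
      case True
      have u: "unshift \<beta> x \<in> bdry" "unshift \<beta> x 0 = s \<gamma>"
        using unshift_bdry[OF x(1) x_through[OF \<beta>\<gamma>(1,3)]] \<beta>\<gamma>(5) by simp_all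
      have "prepend \<gamma> (unshift \<beta> x) = x"
        using prepend_bdry(1,2)[OF u \<beta>\<gamma>(2)] \<beta>\<gamma>(4) by (intro through)
      then show ?thesis
        using True x(1) x_through[OF \<beta>\<gamma>(1,3)] u \<beta>\<gamma>(1,2)
        by (simp add: pb.rep_mult pb.rep_gen op_Gen[OF t] op_Gen_adj[OF t])
    next
      case False
      then show ?thesis
        using through[of q \<beta>] \<beta>\<gamma>(3) by (auto simp: pb.rep_mult pb.rep_gen op_Gen[OF t])
    qed
    have tn: "t \<zeta> k ^ n * cnj (t \<zeta> k ^ n) = 1" "cnj (t \<zeta> k ^ n) * t \<zeta> k ^ n = 1" for k n
      using complex_norm_square[of "t \<zeta> k ^ n"] by (simp_all add: norm_power t mult.commute)
    have wt_axis: "wt (t \<zeta>) (axis k n) = t \<zeta> k ^ n" for k n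
    proof -
      have "wt (t \<zeta>) (axis k n) = (\<Prod>l\<in>UNIV. if l = k then t \<zeta> k ^ n else 1)"
        unfolding wt_def by (intro prod.cong) (auto simp: axis_nth_nat)
      then show ?thesis by simp
    qed
    have wt1: "wt (t \<zeta>) (axis k (a + l)) * cnj (wt (t \<zeta>) (axis k a)) = t \<zeta> k ^ l"
      "wt (t \<zeta>) (axis k a) * cnj (wt (t \<zeta>) (axis k (a + l))) = cnj (t \<zeta> k ^ l)" for k a l
    proof -
      show "wt (t \<zeta>) (axis k (a + l)) * cnj (wt (t \<zeta>) (axis k a)) = t \<zeta> k ^ l"
        unfolding wt_axis power_add using tn(1)[of k a] by (simp add: mult.commute mult.left_commute)
      show "wt (t \<zeta>) (axis k a) * cnj (wt (t \<zeta>) (axis k (a + l))) = cnj (t \<zeta> k ^ l)"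
        unfolding wt_axis power_add using tn(1)[of k a] by (simp add: mult.assoc[symmetric])
    qed
    have ti: "t \<zeta> i ^ mi = cis (arccos (Re \<zeta>))"
      using m(1) by (simp add: t_def Complex.DeMoivre)
    have tj: "t \<zeta> j ^ mj = cis (arccos (Im \<zeta>))"
      using m(2) ij(3) by (simp add: t_def Complex.DeMoivre)
    have real: "cis (arccos a) + cnj (cis (arccos a)) = of_real (2 * a)" if "\<bar>a\<bar> \<le> 1" for a
      using that by (simp add: complex_eq_iff cos_arccos_abs)
    have repAs: "pb.rep As \<xi> q = (if q = x then \<zeta> * \<xi> x else if q \<in> bdry then \<xi> q else 0)" for \<xi> q
    proof -
      have "pb.rep unit_sum \<xi> q = (if q \<in> bdry then \<xi> q else 0)"
      proof -
        have "pb.rep unit_sum \<xi> q = (\<Sum>w\<in>verts G. if w = q 0 then if q \<in> bdry then \<xi> q else 0 else 0)"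
          unfolding unit_sum_def pb.rep_sum pb.rep_gen
          by (intro sum.cong refl) (auto simp: op_vert(1)[OF t])
        moreover have "q 0 \<in> verts G" if "q \<in> bdry"
          using bdryD(3,4)[OF that, of 0] rng_verts[of "q 0"] by simp
        ultimately show ?thesis
          using finite_verts by auto
      qed
      moreover have "pb.rep (gen v) \<xi> q = (if q = x then \<xi> x else 0)"
      proof -
        have "q \<in> bdry \<and> q 0 = v \<longleftrightarrow> q = x"
          using bdry_uniq[of q x] x by blast
        then show ?thesis
          unfolding pb.rep_gen op_vert(1)[OF t v] by (cases "q = x") (simp_all only: if_True if_False)
      qed
      moreover have "pb.rep (gen \<beta>i * poly_adj (gen \<gamma>i)) \<xi> q + pb.rep (gen \<gamma>i * poly_adj (gen \<beta>i)) \<xi> q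
          = (if q = x then of_real (2 * Re \<zeta>) * \<xi> x else 0)"
        using act[OF I(1,2,3,4,5)] act[OF I(2,1,4,3) I(5)[symmetric]] wt1[of i ai mi] real[OF \<zeta>1(2)]
        by (simp add: I(6,7) m(3) ti distrib_right[symmetric] del: cis_cnj)
      moreover have "pb.rep (gen \<beta>j * poly_adj (gen \<gamma>j)) \<xi> q + pb.rep (gen \<gamma>j * poly_adj (gen \<beta>j)) \<xi> q
          = (if q = x then of_real (2 * Im \<zeta>) * \<xi> x else 0)"
        using act[OF J(1,2,3,4,5)] act[OF J(2,1,4,3) J(5)[symmetric]] wt1[of j aj mj] real[OF \<zeta>1(3)]
        by (simp add: J(6,7) m(4) tj distrib_right[symmetric] del: cis_cnj)
      ultimately have "pb.rep As \<xi> q = (1/2) * (if q = x then of_real (2 * Re \<zeta>) * \<xi> x else 0)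
          + (\<i>/2) * (if q = x then of_real (2 * Im \<zeta>) * \<xi> x else 0)
          + ((if q \<in> bdry then \<xi> q else 0) - (if q = x then \<xi> x else 0))"
        by (simp only: As_def pb.rep_add pb.rep_scale pb.rep_diff)
      moreover have "(1/2) * (of_real (2 * Re \<zeta>) * \<xi> x) + (\<i>/2) * (of_real (2 * Im \<zeta>) * \<xi> x) = \<zeta> * \<xi> x"
        by (subst (3) complex_eq) (simp add: algebra_simps)
      ultimately show ?thesis
        using x(1) by simp
    qed
    let ?A = "poly_adj (poly_adj As - z)" and ?B = "poly_adj (y * z - unit_sum)"
    have AB: "?A \<in> A0" "?B \<in> A0" "N ?A < 1/10" "N ?B < 1/10"
      using zy As by (simp_all add: A0_closed unit_sum_A0 N_adj)
    have us: "pb.rep (poly_adj unit_sum) \<delta> = \<delta>"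
    proof
      fix q
      have "pb.rep (poly_adj unit_sum) \<delta> q = (\<Sum>w\<in>verts G. if w = v then \<delta> q else 0)"
        unfolding unit_sum_def poly_adj_sum pb.rep_sum pb.rep_gen
        by (intro sum.cong refl) (auto simp: op_vert(2)[OF t] \<delta>_def x)
      then show "pb.rep (poly_adj unit_sum) \<delta> q = \<delta> q"
        using finite_verts v by simp
    qed
    \<comment> \<open>The left side is \<open>As\<close> applied to \<eta>, minus \<delta>, as
      \<eta> vanishes off the boundary paths. It is the sum of the two errors, each controlled by
      \<open>N\<close>.\<close>
    have "(\<lambda>q. if q = x then \<zeta> * \<eta> \<zeta> x - 1 else \<eta> \<zeta> q) = (\<lambda>q. pb.rep ?A (\<eta> \<zeta>) q + pb.rep ?B \<delta> q)"
    proof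
      fix q
      have "pb.rep ?A (\<eta> \<zeta>) q + pb.rep ?B \<delta> q = pb.rep As (\<eta> \<zeta>) q - \<delta> q"
        by (simp add: poly_adj_diff poly_adj_mult pb.rep_diff pb.rep_mult us) (simp add: \<eta>_def)
      then show "(if q = x then \<zeta> * \<eta> \<zeta> x - 1 else \<eta> \<zeta> q) = pb.rep ?A (\<eta> \<zeta>) q + pb.rep ?B \<delta> q"
        using \<eta>0[of q] by (simp add: repAs \<delta>_def)
    qed
    then have "nr (\<lambda>q. if q = x then \<zeta> * \<eta> \<zeta> x - 1 else \<eta> \<zeta> q) \<le> nr (pb.rep ?A (\<eta> \<zeta>)) + nr (pb.rep ?B \<delta>)"
      using nr_triangle[OF pb.fsupp_rep[OF fs\<eta>] pb.fsupp_rep[OF fs\<delta>(1)]] by simp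
    also have "\<dots> \<le> N ?A * nr (\<eta> \<zeta>) + N ?B * 1"
      using rep_le_univ[of "t \<zeta>", OF t AB(1) fs\<eta>] rep_le_univ[of "t \<zeta>", OF t AB(2) fs\<delta>(1)] fs\<delta>(2) by simp
    also have "\<dots> \<le> 1/10 * nr (\<eta> \<zeta>) + 1/10"
      using AB(3,4) by (intro add_mono mult_right_mono) auto
    finally show ?thesis
      by (rule coordinate_estimate[OF fs\<eta> \<zeta>1(1)])
  qed
  have cont_t: "continuous_on (cball 0 1) (\<lambda>\<zeta>. t \<zeta> k)" for k
  proof -
    have "-1 \<le> Re \<zeta> \<and> Re \<zeta> \<le> 1 \<and> -1 \<le> Im \<zeta> \<and> Im \<zeta> \<le> 1" if "\<zeta> \<in> cball 0 1" for \<zeta> :: complex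
    proof -
      have "cmod \<zeta> \<le> 1"
        using that by simp
      then show ?thesis
        using abs_Re_le_cmod[of \<zeta>] abs_Im_le_cmod[of \<zeta>] by linarith
    qed
    then have "continuous_on (cball 0 1) (\<lambda>\<zeta>. cis (arccos (Re \<zeta>) / real n))"
      "continuous_on (cball 0 1) (\<lambda>\<zeta>. cis (arccos (Im \<zeta>) / real n))" for n
      unfolding divide_inverse by (auto intro!: continuous_intros)
    then show ?thesis
      by (cases "k = i"; cases "k = j") (simp_all add: t_def)
  qed
  have "continuous_on (cball 0 1) (\<lambda>\<zeta>. \<eta> \<zeta> x)"
    unfolding \<eta>_def using continuous_wop[OF t cont_t] .
  \<comment> \<open>This map sends the disc into itself, and a fixed point would require
    \<open>1 / \<eta> \<zeta> x = 0\<close>.\<close>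
  then have "continuous_on (cball 0 1) (\<lambda>\<zeta>. \<zeta> - 1 / \<eta> \<zeta> x)"
    using main by (intro continuous_intros) auto
  moreover have "(\<lambda>\<zeta>. \<zeta> - 1 / \<eta> \<zeta> x) \<in> cball 0 1 \<rightarrow> cball 0 1"
    using main by (auto simp: less_imp_le)
  ultimately obtain \<zeta> where "\<zeta> \<in> cball 0 1" "\<zeta> - 1 / \<eta> \<zeta> x = \<zeta>"
    using brouwer[of "cball 0 1 :: complex set" "\<lambda>\<zeta>. \<zeta> - 1 / \<eta> \<zeta> x"] by auto
  then show False
    using main by simp
qed

end

theorem corollary3p4:
  fixes \<Lambda> :: "('m, 'k::finite) kgraph"
  assumes "k_graph \<Lambda>"
    and "finite_kgraph \<Lambda>"
    and "locally_convex \<Lambda>"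
  shows "stable_rank (graph_cstar \<Lambda>) = 1 \<longleftrightarrow>
    \<not> (\<exists>\<alpha>. is_cycle \<Lambda> \<alpha> \<and> has_entrance \<Lambda> \<alpha>) \<and>
    \<not> (\<exists>\<mu>. is_initial_cycle \<Lambda> \<mu> \<and> num_colours \<Lambda> \<mu> > 1)"
proof -
  interpret k_graph \<Lambda>
    by fact
  interpret lc_graph \<Lambda>
    by unfold_locales (use assms in auto)
  show ?thesis
    unfolding stable_rank_1_iff_full
    using full_if_no_entrance full_imp_no_entrance full_imp_one_colour by (meson not_le)
qed

end
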